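(* Let $g$ be an admissible free holomorphic function with universal model ${\bf W}=(W_1,\ldots,W_n)$ such that $\mathcal D_{g^{-1}}$ is a radially pure domain and such that $g^{-1}=\sum_{\alpha\in\mathbb F_n^+}a_\alpha Z_\alpha$ has the property that the series $\sum_{k=0}^\infty\sum_{|\alpha|=k}a_\alpha W_\alpha W_\alpha^*$ converges in the operator norm. Let $\mathcal H$ be a Hilbert space and let $T=(T_1,\ldots,T_n)\in B(\mathcal H)^n$. Then $T\in\mathcal D_{g^{-1}}(\mathcal H)$ if and only if there is a Hilbert space $\mathcal D$ and a Cuntz type $*$-representation $\pi:C^*({\bf W})\to B(\mathcal K_\pi)$ on a separable Hilbert space $\mathcal K_\pi$ such that, up to identifying $\mathcal H$ with a subspace of $(F^2(H_n)\otimes\mathcal D)\oplus\mathcal K_\pi$ which is invariant under all the operators $(W_i^*\otimes I_{\mathcal D})\oplus\pi(W_i)^*$, $$T_i^*=\big[(W_i^*\otimes I_{\mathcal D})\oplus\pi(W_i)^*\big]\big|_{\mathcal H},\qquad i\in\{1,\ldots,n\}.$$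
   Context: Fix an integer $n\ge 1$ and an $n$-dimensional complex Hilbert space $H_n$ with orthonormal basis $e_1,\ldots,e_n$. The full Fock space is $F^2(H_n)=\bigoplus_{k\ge0}H_n^{\otimes k}$, $H_n^{\otimes 0}=\mathbb C1$; left creation operators: $S_i\varphi=e_i\otimes\varphi$. $\mathbb F_n^+$ is the unital free semigroup on generators $g_1,\ldots,g_n$ with identity $g_0$; $|\alpha|$ is the length of $\alpha$. For $\alpha=g_{i_1}\cdots g_{i_k}$ put $e_\alpha=e_{i_1}\otimes\cdots\otimes e_{i_k}$, $e_{g_0}=1$, and for operators or indeterminates $X_\alpha=X_{i_1}\cdots X_{i_k}$, $X_{g_0}=I$. A formal power series $g=1+\sum_{|\alpha|\ge1}b_\alpha Z_\alpha$ in noncommuting indeterminates is an admissible free holomorphic function if: (a) $b_\alpha>0$, $b_{g_0}=1$, $\sup_{\alpha}\frac{b_\alpha}{b_{g_i\alpha}}<\infty$ for each $i$; (b) $\limsup_{k}(\sum_{|\alpha|=k}b_\alpha^2)^{1/2k}<\infty$; (c) $\sup_{k}\|\sum_{p=0}^k\sum_{|\alpha|=p}a_\alpha W_\alpha W_\alpha^*\|<\infty$, where $g^{-1}=\sum_{\alpha}a_\alpha Z_\alpha$ ($a_{g_0}=1$) is the formal power series inverse and ${\bf W}=(W_1,\ldots,W_n)$, the universal model of $g$, is given by $W_i=S_iD_i$, $D_ie_\alpha=\sqrt{b_\alpha/b_{g_i\alpha}}\,e_\alpha$. $C^*({\bf W})$ is the $C^*$-algebra generated by $W_1,\ldots,W_n$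 and the identity. For a Hilbert space $\mathcal H$, $\mathcal D_{g^{-1}}(\mathcal H)$ is the set of $X=(X_1,\ldots,X_n)\in B(\mathcal H)^n$ such that $\Delta_{g^{-1}}(X,X^* ):=\sum_{p=0}^\infty\sum_{|\alpha|=p}a_\alpha X_\alpha X_\alpha^*$ converges in the weak operator topology (WOT) and is $\ge0$, and $\sum_{\alpha}b_\alpha X_\alpha\Delta_{g^{-1}}(X,X^* )X_\alpha^*\le I$ (WOT convergence); $X$ is pure if equality holds in the last relation. $\mathcal D_{g^{-1}}$ is a radially pure domain if for every Hilbert space $\mathcal H$ and every $X\in\mathcal D_{g^{-1}}(\mathcal H)$ there is $\delta\in(0,1)$ such that $rX=(rX_1,\ldots,rX_n)$ is a pure element of $\mathcal D_{g^{-1}}(\mathcal H)$ for every $r\in(\delta,1)$. A Cuntz type representation of $C^*({\bf W})$ is a unital $*$-representation $\pi$ such that $\Delta_{g^{-1}}(\pi({\bf W}),\pi({\bf W})^* )=0$, where $\pi({\bf W})=(\pi(W_1),\ldots,\pi(W_n))$. The Hilbert spaces $\mathcal D$ and $\mathcal K_\pi$ are allowed to be $\{0\}$.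
   Formalization: K_π is claimed to be separable only when H is separable (for nonseparable H, e.g. a unitary T with n=1 and g=1/(1-z), a separable K_π is impossible); D and K_π are sought among spaces of a type depending on that of H, which may be taken as large as desired. *)

theory Defs
  imports "HOL-Analysis.Analysis" "HOL-Algebra.Module"
begin

section \<open>Complex Hilbert spaces with explicit carriers\<close>

text \<open>
  The statement quantifies over Hilbert spaces inside formulas, so a Hilbert space is a structure
  with an explicit carrier, extending the modules of HOL-Algebra. As usual for modules there, the
  ring fields \<^term>\<open>mult\<close> and \<^term>\<open>one\<close> carry no meaning. The zero space is allowed.
\<close>

record 'a hilbert = "(complex, 'a) module" +
  cinner :: "'a \<Rightarrow> 'a \<Rightarrow> complex"

definition complex_ring :: "complex ring" where
  "complex_ring = \<lparr>carrier = UNIV, mult = (*), one = 1, zero = 0, add = (+)\<rparr>"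

definition hnorm :: "'a hilbert \<Rightarrow> 'a \<Rightarrow> real" where
  "hnorm H x = sqrt (Re (cinner H x x))"

locale hilbert_space = module complex_ring H for H :: "'a hilbert" (structure) +
  assumes cinner_add_left:
      "\<lbrakk>x \<in> carrier H; y \<in> carrier H; z \<in> carrier H\<rbrakk>
        \<Longrightarrow> cinner H (x \<oplus> y) z = cinner H x z + cinner H y z"
    and cinner_smult_left:
      "\<lbrakk>x \<in> carrier H; y \<in> carrier H\<rbrakk> \<Longrightarrow> cinner H (c \<odot> x) y = c * cinner H x y"
    and cinner_commute:
      "\<lbrakk>x \<in> carrier H; y \<in> carrier H\<rbrakk> \<Longrightarrow> cinner H x y = cnj (cinner H y x)"
    and cinner_pos:
      "\<lbrakk>x \<in> carrier H; x \<noteq> \<zero>\<rbrakk> \<Longrightarrow> 0 < Re (cinner H x x)"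
    and complete:
      "\<lbrakk>\<And>k :: nat. s k \<in> carrier H;
        \<forall>e>0. \<exists>N. \<forall>m\<ge>N. \<forall>k\<ge>N. hnorm H (s m \<ominus> s k) < e\<rbrakk>
        \<Longrightarrow> \<exists>l\<in>carrier H. (\<lambda>k. hnorm H (s k \<ominus> l)) \<longlonglongrightarrow> 0"

definition separable_hilbert :: "'a hilbert \<Rightarrow> bool" where
  "separable_hilbert H \<longleftrightarrow> (\<exists>S\<subseteq>carrier H. countable S \<and>
     (\<forall>x\<in>carrier H. \<forall>e>0. \<exists>s\<in>S. hnorm H (x \<ominus>\<^bsub>H\<^esub> s) < e))"

subsection \<open>Bounded operators\<close>

text \<open>
  Operators are extensional (\<^term>\<open>undefined\<close> outside the carrier), so that equality of operators
  is equality of functions.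
\<close>

definition bounded_ops :: "'a hilbert \<Rightarrow> 'b hilbert \<Rightarrow> ('a \<Rightarrow> 'b) set" where
  "bounded_ops H K = {A \<in> carrier H \<rightarrow>\<^sub>E carrier K.
     (\<forall>x\<in>carrier H. \<forall>y\<in>carrier H. A (x \<oplus>\<^bsub>H\<^esub> y) = A x \<oplus>\<^bsub>K\<^esub> A y) \<and>
     (\<forall>c. \<forall>x\<in>carrier H. A (c \<odot>\<^bsub>H\<^esub> x) = c \<odot>\<^bsub>K\<^esub> A x) \<and>
     (\<exists>M. \<forall>x\<in>carrier H. hnorm K (A x) \<le> M * hnorm H x)}"

definition isometries :: "'a hilbert \<Rightarrow> 'b hilbert \<Rightarrow> ('a \<Rightarrow> 'b) set" where
  "isometries H K = {V \<in> bounded_ops H K. \<forall>x\<in>carrier H. hnorm K (V x) = hnorm H x}"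

definition op_alg :: "'a hilbert \<Rightarrow> (complex, 'a \<Rightarrow> 'a) module" where
  "op_alg H =
     \<lparr>carrier = bounded_ops H H,
      mult = compose (carrier H),
      one = (\<lambda>x\<in>carrier H. x),
      zero = (\<lambda>x\<in>carrier H. \<zero>\<^bsub>H\<^esub>),
      add = (\<lambda>A B. \<lambda>x\<in>carrier H. A x \<oplus>\<^bsub>H\<^esub> B x),
      smult = (\<lambda>c A. \<lambda>x\<in>carrier H. c \<odot>\<^bsub>H\<^esub> A x)\<rparr>"

definition op_norm :: "'a hilbert \<Rightarrow> ('a \<Rightarrow> 'a) \<Rightarrow> real" where
  "op_norm H A = Sup {hnorm H (A x) |x. x \<in> carrier H \<and> hnorm H x \<le> 1}"

definition adj :: "'a hilbert \<Rightarrow> ('a \<Rightarrow> 'a) \<Rightarrow> ('a \<Rightarrow> 'a)" where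
  "adj H A = (THE B. B \<in> bounded_ops H H \<and>
     (\<forall>x\<in>carrier H. \<forall>y\<in>carrier H. cinner H (A x) y = cinner H x (B y)))"

definition op_le :: "'a hilbert \<Rightarrow> ('a \<Rightarrow> 'a) \<Rightarrow> ('a \<Rightarrow> 'a) \<Rightarrow> bool" where
  "op_le H A B \<longleftrightarrow> (\<forall>x\<in>carrier H. cinner H (B x) x - cinner H (A x) x \<in> \<real>\<^sub>\<ge>\<^sub>0)"

definition wot_tendsto :: "'a hilbert \<Rightarrow> (nat \<Rightarrow> 'a \<Rightarrow> 'a) \<Rightarrow> ('a \<Rightarrow> 'a) \<Rightarrow> bool" where
  "wot_tendsto H S L \<longleftrightarrow> L \<in> bounded_ops H H \<and>
     (\<forall>x\<in>carrier H. \<forall>y\<in>carrier H. (\<lambda>N. cinner H (S N x) y) \<longlonglongrightarrow> cinner H (L x) y)"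

definition norm_tendsto :: "'a hilbert \<Rightarrow> (nat \<Rightarrow> 'a \<Rightarrow> 'a) \<Rightarrow> ('a \<Rightarrow> 'a) \<Rightarrow> bool" where
  "norm_tendsto H S L \<longleftrightarrow> L \<in> bounded_ops H H \<and>
     (\<lambda>N. op_norm H (S N \<ominus>\<^bsub>op_alg H\<^esub> L)) \<longlonglongrightarrow> 0"

subsection \<open>Direct sums and tensor products\<close>

definition complex_space :: "complex hilbert" where
  "complex_space = \<lparr>carrier = UNIV, mult = (*), one = 1, zero = 0, add = (+),
     smult = (*), cinner = (\<lambda>x y. x * cnj y)\<rparr>"

text \<open>The Hilbert space direct sum of copies of \<open>D\<close>, one for each element of the type \<open>'i\<close>.\<close>

definition l2_sum :: "'d hilbert \<Rightarrow> ('i \<Rightarrow> 'd) hilbert" where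
  "l2_sum D =
     \<lparr>carrier = {f. (\<forall>i. f i \<in> carrier D) \<and> (\<lambda>i. (hnorm D (f i))\<^sup>2) summable_on UNIV},
      mult = undefined, one = undefined,
      zero = (\<lambda>i. \<zero>\<^bsub>D\<^esub>),
      add = (\<lambda>f g i. f i \<oplus>\<^bsub>D\<^esub> g i),
      smult = (\<lambda>c f i. c \<odot>\<^bsub>D\<^esub> f i),
      cinner = (\<lambda>f g. \<Sum>\<^sub>\<infinity>i. cinner D (f i) (g i))\<rparr>"

definition hdsum :: "'a hilbert \<Rightarrow> 'b hilbert \<Rightarrow> ('a \<times> 'b) hilbert" where
  "hdsum H K =
     \<lparr>carrier = carrier H \<times> carrier K,
      mult = undefined, one = undefined,
      zero = (\<zero>\<^bsub>H\<^esub>, \<zero>\<^bsub>K\<^esub>),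
      add = (\<lambda>(x, y) (x', y'). (x \<oplus>\<^bsub>H\<^esub> x', y \<oplus>\<^bsub>K\<^esub> y')),
      smult = (\<lambda>c (x, y). (c \<odot>\<^bsub>H\<^esub> x, c \<odot>\<^bsub>K\<^esub> y)),
      cinner = (\<lambda>(x, y) (x', y'). cinner H x x' + cinner K y y')\<rparr>"

definition op_dsum ::
  "'a hilbert \<Rightarrow> 'b hilbert \<Rightarrow> ('a \<Rightarrow> 'a) \<Rightarrow> ('b \<Rightarrow> 'b) \<Rightarrow> ('a \<times> 'b \<Rightarrow> 'a \<times> 'b)" where
  "op_dsum H K A B = (\<lambda>(x, y) \<in> carrier (hdsum H K). (A x, B y))"

text \<open>
  The free semigroup on \<open>n = CARD('n)\<close> generators is \<^typ>\<open>'n list\<close>, with \<open>g\<^sub>0 = []\<close>. The full Fock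
  space is realised on its orthonormal basis \<open>(e\<^sub>\<alpha>)\<close>: a vector \<open>\<Sum>\<^sub>\<alpha> c\<^sub>\<alpha> e\<^sub>\<alpha>\<close> is the function
  \<open>\<alpha> \<mapsto> c\<^sub>\<alpha>\<close>, and the \<open>k\<close>-th tensor power of \<open>H\<^sub>n\<close> consists of the functions supported on words of
  length \<open>k\<close>. Correspondingly the tensor product of the Fock space with \<open>D\<close> is
  \<^term>\<open>l2_sum D :: ('n list \<Rightarrow> 'd) hilbert\<close>, with the elementary tensors below.
\<close>

definition fock :: "('n::finite list \<Rightarrow> complex) hilbert" where
  "fock = l2_sum complex_space"

definition fock_tensor :: "'d hilbert \<Rightarrow> ('n::finite list \<Rightarrow> 'd) hilbert" where
  "fock_tensor D = l2_sum D"

definition elem_tensor :: "'d hilbert \<Rightarrow> ('n::finite list \<Rightarrow> complex) \<Rightarrow> 'd \<Rightarrow> ('n list \<Rightarrow> 'd)" where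
  "elem_tensor D f d = (\<lambda>\<alpha>. f \<alpha> \<odot>\<^bsub>D\<^esub> d)"

text \<open>The operator \<open>A \<otimes> I\<^sub>D\<close>.\<close>

definition ampliation ::
  "'d hilbert \<Rightarrow> (('n::finite list \<Rightarrow> complex) \<Rightarrow> ('n list \<Rightarrow> complex))
     \<Rightarrow> (('n list \<Rightarrow> 'd) \<Rightarrow> ('n list \<Rightarrow> 'd))" where
  "ampliation D A = (THE B. B \<in> bounded_ops (fock_tensor D) (fock_tensor D) \<and>
     (\<forall>f\<in>carrier fock. \<forall>d\<in>carrier D. B (elem_tensor D f d) = elem_tensor D (A f) d))"

section \<open>Admissible free holomorphic functions and the universal model\<close>

text \<open>
  A formal power series in noncommuting indeterminates is its coefficient function. The Cauchy
  product runs over all factorisations \<open>\<alpha> = \<beta>\<gamma>\<close>.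
\<close>

definition nc_mult :: "('n list \<Rightarrow> real) \<Rightarrow> ('n list \<Rightarrow> real) \<Rightarrow> ('n list \<Rightarrow> real)" where
  "nc_mult f g = (\<lambda>\<alpha>. \<Sum>k\<le>length \<alpha>. f (take k \<alpha>) * g (drop k \<alpha>))"

definition nc_one :: "'n list \<Rightarrow> real" where
  "nc_one = (\<lambda>\<alpha>. if \<alpha> = [] then 1 else 0)"

definition nc_inverse :: "('n list \<Rightarrow> real) \<Rightarrow> ('n list \<Rightarrow> real)" where
  "nc_inverse b = (THE a. nc_mult a b = nc_one \<and> nc_mult b a = nc_one)"

definition word_op :: "'a hilbert \<Rightarrow> ('n \<Rightarrow> 'a \<Rightarrow> 'a) \<Rightarrow> 'n list \<Rightarrow> ('a \<Rightarrow> 'a)" where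
  "word_op H X \<alpha> = foldr (\<lambda>i A. X i \<otimes>\<^bsub>op_alg H\<^esub> A) \<alpha> \<one>\<^bsub>op_alg H\<^esub>"

text \<open>\<open>word_sum H c X A N\<close> is the partial sum over \<open>|\<alpha>| \<le> N\<close> of \<open>c\<^sub>\<alpha> X\<^sub>\<alpha> A X\<^sub>\<alpha>\<^sup>*\<close>.\<close>

definition word_sum ::
  "'a hilbert \<Rightarrow> ('n::finite list \<Rightarrow> real) \<Rightarrow> ('n \<Rightarrow> 'a \<Rightarrow> 'a) \<Rightarrow> ('a \<Rightarrow> 'a) \<Rightarrow> nat \<Rightarrow> ('a \<Rightarrow> 'a)" where
  "word_sum H c X A N =
     (\<Oplus>\<^bsub>op_alg H\<^esub> \<alpha>\<in>{\<alpha>. length \<alpha> \<le> N}. complex_of_real (c \<alpha>) \<odot>\<^bsub>op_alg H\<^esub>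
        (word_op H X \<alpha> \<otimes>\<^bsub>op_alg H\<^esub> A \<otimes>\<^bsub>op_alg H\<^esub> adj H (word_op H X \<alpha>)))"

definition Delta_sum ::
  "('n::finite list \<Rightarrow> real) \<Rightarrow> 'a hilbert \<Rightarrow> ('n \<Rightarrow> 'a \<Rightarrow> 'a) \<Rightarrow> nat \<Rightarrow> ('a \<Rightarrow> 'a)" where
  "Delta_sum b H X = word_sum H (nc_inverse b) X \<one>\<^bsub>op_alg H\<^esub>"

definition creation :: "'n::finite \<Rightarrow> ('n list \<Rightarrow> complex) \<Rightarrow> ('n list \<Rightarrow> complex)" where
  "creation i = (\<lambda>f\<in>carrier fock. \<lambda>\<alpha>. case \<alpha> of [] \<Rightarrow> 0 | j # \<beta> \<Rightarrow> if j = i then f \<beta> else 0)"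

definition weight ::
  "('n::finite list \<Rightarrow> real) \<Rightarrow> 'n \<Rightarrow> ('n list \<Rightarrow> complex) \<Rightarrow> ('n list \<Rightarrow> complex)" where
  "weight b i = (\<lambda>f\<in>carrier fock. \<lambda>\<alpha>. complex_of_real (sqrt (b \<alpha> / b (i # \<alpha>))) * f \<alpha>)"

definition W :: "('n::finite list \<Rightarrow> real) \<Rightarrow> 'n \<Rightarrow> ('n list \<Rightarrow> complex) \<Rightarrow> ('n list \<Rightarrow> complex)" where
  "W b i = creation i \<otimes>\<^bsub>op_alg fock\<^esub> weight b i"

definition admissible :: "('n::finite list \<Rightarrow> real) \<Rightarrow> bool" where
  "admissible b \<longleftrightarrow>
     (\<forall>\<alpha>. b \<alpha> > 0) \<and> b [] = 1 \<and> (\<forall>i. bdd_above (range (\<lambda>\<alpha>. b \<alpha> / b (i # \<alpha>)))) \<and>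
     limsup (\<lambda>k. ereal ((\<Sum>\<alpha> | length \<alpha> = k. (b \<alpha>)\<^sup>2) powr (1 / (2 * real k)))) < \<infinity> \<and>
     bdd_above (range (\<lambda>k. op_norm fock (Delta_sum b fock (W b) k)))"

section \<open>Noncommutative domains\<close>

text \<open>
  \<open>domain_data b H X \<Delta> L\<close>: the defect series of \<open>X\<close> converges to \<open>\<Delta> \<ge> 0\<close> and the series of the
  \<open>b\<^sub>\<alpha> X\<^sub>\<alpha> \<Delta> X\<^sub>\<alpha>\<^sup>*\<close> converges to \<open>L\<close>. WOT limits are unique, so \<open>\<Delta>\<close> and \<open>L\<close> are determined by \<open>X\<close>.
\<close>

definition domain_data ::
  "('n::finite list \<Rightarrow> real) \<Rightarrow> 'a hilbert \<Rightarrow> ('n \<Rightarrow> 'a \<Rightarrow> 'a) \<Rightarrow> ('a \<Rightarrow> 'a) \<Rightarrow> ('a \<Rightarrow> 'a) \<Rightarrow> bool" where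
  "domain_data b H X \<Delta> L \<longleftrightarrow>
     (\<forall>i. X i \<in> bounded_ops H H) \<and>
     wot_tendsto H (Delta_sum b H X) \<Delta> \<and> op_le H \<zero>\<^bsub>op_alg H\<^esub> \<Delta> \<and>
     wot_tendsto H (word_sum H b X \<Delta>) L"

definition nc_domain :: "('n::finite list \<Rightarrow> real) \<Rightarrow> 'a hilbert \<Rightarrow> ('n \<Rightarrow> 'a \<Rightarrow> 'a) set" where
  "nc_domain b H = {X. \<exists>\<Delta> L. domain_data b H X \<Delta> L \<and> op_le H L \<one>\<^bsub>op_alg H\<^esub>}"

definition pure_tuple :: "('n::finite list \<Rightarrow> real) \<Rightarrow> 'a hilbert \<Rightarrow> ('n \<Rightarrow> 'a \<Rightarrow> 'a) \<Rightarrow> bool" where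
  "pure_tuple b H X \<longleftrightarrow> X \<in> nc_domain b H \<and> (\<exists>\<Delta>. domain_data b H X \<Delta> \<one>\<^bsub>op_alg H\<^esub>)"

text \<open>
  HOL cannot quantify over types inside a formula, so ``every Hilbert space'' means every Hilbert
  space whose carrier lies in the given type. For a type with at least continuum many elements
  (in particular, for any type that carries a nonzero Hilbert space) nothing is lost: such a type
  carries a copy of every separable Hilbert space, every \<open>X\<close> is a direct sum of tuples on separable
  spaces, and the radii \<open>\<delta>\<close> of the summands stay bounded away from 1, as one sees by applying the
  condition to the direct sum of any countable subfamily.
\<close>

definition radially_pure :: "'h itself \<Rightarrow> ('n::finite list \<Rightarrow> real) \<Rightarrow> bool" where
  "radially_pure U b \<longleftrightarrow>
     (\<forall>(H :: 'h hilbert). hilbert_space H \<longrightarrow>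
        (\<forall>X\<in>nc_domain b H. \<exists>\<delta>. 0 < \<delta> \<and> \<delta> < 1 \<and>
           (\<forall>r. \<delta> < r \<and> r < 1 \<longrightarrow> pure_tuple b H (\<lambda>i. complex_of_real r \<odot>\<^bsub>op_alg H\<^esub> X i))))"

section \<open>The algebra of the universal model and its representations\<close>

definition unital_cstar_subalgebra :: "'a hilbert \<Rightarrow> ('a \<Rightarrow> 'a) set \<Rightarrow> bool" where
  "unital_cstar_subalgebra H \<A> \<longleftrightarrow>
     \<A> \<subseteq> bounded_ops H H \<and> \<one>\<^bsub>op_alg H\<^esub> \<in> \<A> \<and>
     (\<forall>A\<in>\<A>. \<forall>B\<in>\<A>. A \<oplus>\<^bsub>op_alg H\<^esub> B \<in> \<A> \<and> A \<otimes>\<^bsub>op_alg H\<^esub> B \<in> \<A>) \<and>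
     (\<forall>c. \<forall>A\<in>\<A>. c \<odot>\<^bsub>op_alg H\<^esub> A \<in> \<A>) \<and>
     (\<forall>A\<in>\<A>. adj H A \<in> \<A>) \<and>
     (\<forall>S L. (\<forall>k. S k \<in> \<A>) \<and> norm_tendsto H S L \<longrightarrow> L \<in> \<A>)"

definition cstar_W :: "('n::finite list \<Rightarrow> real) \<Rightarrow> (('n list \<Rightarrow> complex) \<Rightarrow> ('n list \<Rightarrow> complex)) set" where
  "cstar_W b = \<Inter>{\<A>. unital_cstar_subalgebra fock \<A> \<and> range (W b) \<subseteq> \<A>}"

definition star_representation ::
  "'a hilbert \<Rightarrow> ('a \<Rightarrow> 'a) set \<Rightarrow> 'k hilbert \<Rightarrow> (('a \<Rightarrow> 'a) \<Rightarrow> ('k \<Rightarrow> 'k)) \<Rightarrow> bool" where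
  "star_representation H \<A> K \<pi> \<longleftrightarrow>
     (\<forall>A\<in>\<A>. \<pi> A \<in> bounded_ops K K) \<and>
     \<pi> \<one>\<^bsub>op_alg H\<^esub> = \<one>\<^bsub>op_alg K\<^esub> \<and>
     (\<forall>A\<in>\<A>. \<forall>B\<in>\<A>. \<pi> (A \<oplus>\<^bsub>op_alg H\<^esub> B) = \<pi> A \<oplus>\<^bsub>op_alg K\<^esub> \<pi> B) \<and>
     (\<forall>A\<in>\<A>. \<forall>B\<in>\<A>. \<pi> (A \<otimes>\<^bsub>op_alg H\<^esub> B) = \<pi> A \<otimes>\<^bsub>op_alg K\<^esub> \<pi> B) \<and>
     (\<forall>c. \<forall>A\<in>\<A>. \<pi> (c \<odot>\<^bsub>op_alg H\<^esub> A) = c \<odot>\<^bsub>op_alg K\<^esub> \<pi> A) \<and>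
     (\<forall>A\<in>\<A>. \<pi> (adj H A) = adj K (\<pi> A))"

definition cuntz_type ::
  "('n::finite list \<Rightarrow> real) \<Rightarrow> 'k hilbert
     \<Rightarrow> ((('n list \<Rightarrow> complex) \<Rightarrow> ('n list \<Rightarrow> complex)) \<Rightarrow> ('k \<Rightarrow> 'k)) \<Rightarrow> bool" where
  "cuntz_type b K \<pi> \<longleftrightarrow>
     star_representation fock (cstar_W b) K \<pi> \<and>
     wot_tendsto K (Delta_sum b K (\<lambda>i. \<pi> (W b i))) \<zero>\<^bsub>op_alg K\<^esub>"

text \<open>The operator \<open>(W\<^sub>i\<^sup>* \<otimes> I\<^sub>D) \<oplus> \<pi>(W\<^sub>i)\<^sup>*\<close>.\<close>

definition model_op ::
  "('n::finite list \<Rightarrow> real) \<Rightarrow> 'd hilbert \<Rightarrow> 'k hilbert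
     \<Rightarrow> ((('n list \<Rightarrow> complex) \<Rightarrow> ('n list \<Rightarrow> complex)) \<Rightarrow> ('k \<Rightarrow> 'k)) \<Rightarrow> 'n
     \<Rightarrow> (('n list \<Rightarrow> 'd) \<times> 'k \<Rightarrow> ('n list \<Rightarrow> 'd) \<times> 'k)" where
  "model_op b D K \<pi> i =
     op_dsum (fock_tensor D) K (ampliation D (adj fock (W b i))) (adj K (\<pi> (W b i)))"

text \<open>
  Existential quantifiers over Hilbert spaces also need a fixed carrier type. For \<open>T\<close> acting on a
  space with carrier in \<open>'h\<close>, the type \<^typ>\<open>nat \<Rightarrow> 'h\<close> is used: elements of the dilation
  space are limits of sequences of finite combinations, with coefficients in a countable set, of
  pairs from a countable set and the given space, so there is room for the spaces to be
  built; and since \<open>'h\<close> is arbitrary, no Hilbert space is excluded from the converse.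
\<close>

end

theory Submission
  imports Defs
begin

text \<open>
  If \<open>V h = (f, \<kappa>)\<close> intertwines \<open>T\<close> with the model, then the defect sums of \<open>T\<close> split into a form that
  is diagonal on Fock space, with eigenvalues that are bounded by condition (c) and tend to the
  indicator of the empty word, and a form that tends to 0 by the Cuntz condition. Hence the defect
  of \<open>T\<close> is \<open>\<langle>f [], f []\<rangle>\<close>, and its \<open>b\<close>-weighted sum is \<open>\<langle>f, f\<rangle> \<le> I\<close>.

  Conversely, a pure tuple \<open>rT\<close> has an isometric Poisson kernel \<open>V\<^sub>r\<close> into \<open>F\<^sup>2 \<otimes> H\<close>, and
  \<open>F\<^sub>r(C, h, k) = \<langle>(C \<otimes> I) V\<^sub>r h, V\<^sub>r k\<rangle>\<close> is a completely positive form with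
  \<open>F\<^sub>r(C W\<^sub>i\<^sup>*, h, k) = F\<^sub>r(C, r T\<^sub>i\<^sup>* h, k)\<close>. A cluster point as \<open>r \<rightarrow> 1\<close> is a form \<open>F\<close> with the same property
  for \<open>T\<close>. The projections \<open>Q\<^sub>N\<close> onto the words longer than \<open>N\<close> asymptotically commute with \<open>C\<^sup>*(W)\<close> under
  \<open>F\<close>, so a cluster point of \<open>F(Q\<^sub>N C, h, k)\<close> is a completely positive form \<open>F\<^sub>K\<close> on \<open>C\<^sup>*(W)\<close>. It kills
  the vacuum projection \<open>P\<^sub>0\<close>, the norm limit of the defect sums of \<open>W\<close>, so its Stinespring
  representation is of Cuntz type. The rest of \<open>F\<close> is recovered from \<open>F(P\<^sub>0, h, k)\<close>, whose Kolmogorov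
  space is \<open>D\<close>: the sum of \<open>b\<^sub>\<alpha> F(P\<^sub>0, T\<^sub>\<alpha>\<^sup>* h, T\<^sub>\<alpha>\<^sup>* k)\<close> over \<open>|\<alpha>| \<le> N\<close> is \<open>\<langle>h, k\<rangle> - F(Q\<^sub>N, h, k)\<close>.
\<close>

section \<open>Hilbert spaces and bounded operators\<close>

text \<open>Why \<open>Q_N\<close> asymptotically commutes with C*(W): each adjoint of
  \<open>W_i\<close> shortens words by one letter, so its commutator with \<open>Q_N\<close> is
  \<open>R_N\<close> times that adjoint, where \<open>R_N\<close> projects onto words of length
  exactly N. The \<open>R_N\<close> are mutually orthogonal, so the values of F at adj(A)
  \<open>R_N\<close> A on (h, h) are summable in N, hence tend to 0, and Cauchy-Schwarz removes the
  commutator from every matrix coefficient. Working with numerical forms instead of operator-valued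
  maps reduces cluster points to Tychonoff for discs, and replaces the square root of the defect by
  Gram numbers of the Poisson kernel. Norm convergence of the defect series puts \<open>P_0\<close>
  into C*(W); contractivity of representations then turns \<pi>(\<open>P_0\<close>) = 0 into the
  Cuntz condition. A second obstacle is the carrier type: the Stinespring space is completed from
  formal combinations of pairs (operator, vector), which is too large a type. As C*(W) is generated
  by countably many words in the \<open>W_i\<close> and their adjoints, each vector is a limit of
  finite sums of words applied to vectors of H, so a sequence in H encodes it. This also yields
  separability.\<close>

lemma complex_ring_simps [simp]:
  "carrier complex_ring = UNIV" "\<one>\<^bsub>complex_ring\<^esub> = 1" "\<zero>\<^bsub>complex_ring\<^esub> = 0"
  "x \<oplus>\<^bsub>complex_ring\<^esub> y = x + y" "x \<otimes>\<^bsub>complex_ring\<^esub> y = x * y"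
  by (simp_all add: complex_ring_def)

lemma cring_complex_ring: "cring complex_ring"
proof (rule cringI)
  show "abelian_group complex_ring"
  proof (rule abelian_groupI)
    show "\<exists>y\<in>carrier complex_ring. y \<oplus>\<^bsub>complex_ring\<^esub> x = \<zero>\<^bsub>complex_ring\<^esub>" for x
      by (auto intro: exI[of _ "- x"])
  qed (auto simp: algebra_simps)
  show "comm_monoid complex_ring"
    by (rule comm_monoidI) (auto simp: algebra_simps)
qed (auto simp: algebra_simps)

text \<open>Along c = -t cnj z the hypothesis is a real quadratic in t. The same discriminant
  argument serves both versions of Cauchy-Schwarz and the first-variation step of the Riesz
  theorem.\<close>

lemma discriminant_le:
  fixes p q :: real and z :: complex
  assumes q: "0 \<le> q" and pos: "\<And>c::complex. 0 \<le> p + 2 * Re (c * z) + (cmod c)\<^sup>2 * q"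
  shows "(cmod z)\<^sup>2 \<le> p * q"
proof -
  have *: "0 \<le> p - 2 * t * (cmod z)\<^sup>2 + t\<^sup>2 * (cmod z)\<^sup>2 * q" for t :: real
  proof -
    have "Re (- of_real t * cnj z * z) = - t * (cmod z)\<^sup>2"
      by (simp only: cmod_power2) (simp add: power2_eq_square algebra_simps)
    moreover have "(cmod (- of_real t * cnj z))\<^sup>2 = t\<^sup>2 * (cmod z)\<^sup>2"
      by (simp add: norm_mult power_mult_distrib)
    ultimately show ?thesis using pos[of "- of_real t * cnj z"] by simp
  qed
  show ?thesis
  proof (cases "q = 0")
    case True
    have "z = 0"
    proof (rule ccontr)
      assume "z \<noteq> 0"
      \<comment> \<open>For q = 0 the quadratic is affine in t, and this t gives it the value
        -1.\<close>
      then have "2 * ((p + 1) / (2 * (cmod z)\<^sup>2)) * (cmod z)\<^sup>2 = p + 1" by simp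
      then show False using *[of "(p + 1) / (2 * (cmod z)\<^sup>2)"] True by simp
    qed
    then show ?thesis using True by simp
  next
    case False
    then have "q > 0" using q by simp
    \<comment> \<open>The value t = 1/q minimises the quadratic.\<close>
    have "0 \<le> p - (cmod z)\<^sup>2 / q" using *[of "1 / q"] \<open>q > 0\<close>
      by (simp add: power2_eq_square)
    then show ?thesis using \<open>q > 0\<close> by (simp add: field_simps)
  qed
qed

text \<open>Differences are spelled \<open>x \<oplus> (-1) \<odot> y\<close>, because
  \<open>\<ominus>\<close> can be computed only after the group structure has been derived.
  Instances address the premises by number: 14 is Hermitian symmetry, 15 positivity, 16
  completeness.\<close>

lemma hilbert_spaceI:
  fixes H :: "'a hilbert" (structure)
  assumes zero: "\<zero> \<in> carrier H"
    and add: "\<And>x y. \<lbrakk>x \<in> carrier H; y \<in> carrier H\<rbrakk> \<Longrightarrow> x \<oplus> y \<in> carrier H"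
    and smult: "\<And>c x. x \<in> carrier H \<Longrightarrow> c \<odot> x \<in> carrier H"
    and assoc: "\<And>x y z. \<lbrakk>x \<in> carrier H; y \<in> carrier H; z \<in> carrier H\<rbrakk> \<Longrightarrow> (x \<oplus> y) \<oplus> z = x \<oplus> (y \<oplus> z)"
    and comm: "\<And>x y. \<lbrakk>x \<in> carrier H; y \<in> carrier H\<rbrakk> \<Longrightarrow> x \<oplus> y = y \<oplus> x"
    and l_zero: "\<And>x. x \<in> carrier H \<Longrightarrow> \<zero> \<oplus> x = x"
    and null: "\<And>x. x \<in> carrier H \<Longrightarrow> 0 \<odot> x = \<zero>"
    and one: "\<And>x. x \<in> carrier H \<Longrightarrow> 1 \<odot> x = x"
    and l_distr: "\<And>a b x. x \<in> carrier H \<Longrightarrow> (a + b) \<odot> x = a \<odot> x \<oplus> b \<odot> x"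
    and r_distr: "\<And>a x y. \<lbrakk>x \<in> carrier H; y \<in> carrier H\<rbrakk> \<Longrightarrow> a \<odot> (x \<oplus> y) = a \<odot> x \<oplus> a \<odot> y"
    and mult: "\<And>a b x. x \<in> carrier H \<Longrightarrow> (a * b) \<odot> x = a \<odot> (b \<odot> x)"
    and ip: "\<And>x y z. \<lbrakk>x \<in> carrier H; y \<in> carrier H; z \<in> carrier H\<rbrakk>
        \<Longrightarrow> cinner H (x \<oplus> y) z = cinner H x z + cinner H y z"
      "\<And>c x y. \<lbrakk>x \<in> carrier H; y \<in> carrier H\<rbrakk> \<Longrightarrow> cinner H (c \<odot> x) y = c * cinner H x y"
      "\<And>x y. \<lbrakk>x \<in> carrier H; y \<in> carrier H\<rbrakk> \<Longrightarrow> cinner H x y = cnj (cinner H y x)"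
      "\<And>x. \<lbrakk>x \<in> carrier H; x \<noteq> \<zero>\<rbrakk> \<Longrightarrow> 0 < Re (cinner H x x)"
    and complete: "\<And>s :: nat \<Rightarrow> 'a. \<lbrakk>\<And>k. s k \<in> carrier H;
        \<And>e. e > 0 \<Longrightarrow> \<exists>N. \<forall>m\<ge>N. \<forall>k\<ge>N. hnorm H (s m \<oplus> (-1) \<odot> s k) < e\<rbrakk>
        \<Longrightarrow> \<exists>l\<in>carrier H. (\<lambda>k. hnorm H (s k \<oplus> (-1) \<odot> l)) \<longlonglongrightarrow> 0"
  shows "hilbert_space H"
proof -
  have neg: "(-1) \<odot> x \<oplus> x = \<zero>" if "x \<in> carrier H" for x
    using l_distr[OF that, of "-1" 1] null[OF that] one[OF that] by simp
  have ag: "abelian_group H"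
  proof (rule abelian_groupI)
    show "\<exists>y\<in>carrier H. y \<oplus> x = \<zero>" if "x \<in> carrier H" for x
      using neg[OF that] smult[OF that] by blast
  qed (use zero add assoc comm l_zero in auto)
  interpret abelian_group H by fact
  have minus: "x \<ominus> y = x \<oplus> (-1) \<odot> y" if "x \<in> carrier H" "y \<in> carrier H" for x y
    using minus_equality[OF neg[OF that(2)] that(2) smult[OF that(2)]] by (simp add: a_minus_def)
  have "module complex_ring H"
    by (rule moduleI) (use cring_complex_ring ag smult l_distr r_distr mult one in auto)
  moreover have "hilbert_space_axioms H"
  proof (rule hilbert_space_axioms.intro)
    fix s :: "nat \<Rightarrow> 'a"
    assume s: "\<And>k. s k \<in> carrier H"
      and c: "\<forall>e>0. \<exists>N. \<forall>m\<ge>N. \<forall>k\<ge>N. hnorm H (s m \<ominus> s k) < e"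
    have "\<exists>l\<in>carrier H. (\<lambda>k. hnorm H (s k \<oplus> (-1) \<odot> l)) \<longlonglongrightarrow> 0"
      by (rule complete) (use s c minus in auto)
    then show "\<exists>l\<in>carrier H. (\<lambda>k. hnorm H (s k \<ominus> l)) \<longlonglongrightarrow> 0"
      using s minus by auto
  qed (rule ip; assumption)+
  ultimately show ?thesis by (rule hilbert_space.intro)
qed

section \<open>Inner product, norm and convergence in a Hilbert space\<close>

context hilbert_space
begin

lemma smult_in [simp, intro]: "x \<in> carrier H \<Longrightarrow> c \<odot> x \<in> carrier H"
  using smult_closed[of c x] by simp

lemma diff_in [simp, intro]: "\<lbrakk>x \<in> carrier H; y \<in> carrier H\<rbrakk> \<Longrightarrow> x \<ominus> y \<in> carrier H"
  by (simp add: a_minus_def)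

lemma ip_add_right:
  "\<lbrakk>x \<in> carrier H; y \<in> carrier H; z \<in> carrier H\<rbrakk> \<Longrightarrow> cinner H z (x \<oplus> y) = cinner H z x + cinner H z y"
  using cinner_commute[of z "x \<oplus> y"] cinner_commute[of z x] cinner_commute[of z y]
  by (simp add: cinner_add_left)

lemma ip_smult_right:
  "\<lbrakk>x \<in> carrier H; y \<in> carrier H\<rbrakk> \<Longrightarrow> cinner H x (c \<odot> y) = cnj c * cinner H x y"
  using cinner_commute[of x "c \<odot> y"] cinner_commute[of x y]
  by (simp add: cinner_smult_left)

lemma smult_zero_eq: "x \<in> carrier H \<Longrightarrow> 0 \<odot> x = \<zero>"
  using smult_l_null[of x] by simp

lemma ip_zero_left [simp]: "x \<in> carrier H \<Longrightarrow> cinner H \<zero> x = 0"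
  using cinner_smult_left[of x x 0] by (simp add: smult_zero_eq)

lemma ip_zero_right [simp]: "x \<in> carrier H \<Longrightarrow> cinner H x \<zero> = 0"
  using ip_smult_right[of x x 0] by (simp add: smult_zero_eq)

lemma minus_smult: "x \<in> carrier H \<Longrightarrow> \<ominus> x = (-1) \<odot> x"
proof -
  assume x: "x \<in> carrier H"
  have "((-1) + 1) \<odot> x = (-1) \<odot> x \<oplus> 1 \<odot> x"
    using smult_l_distr[of "-1" 1 x] x by (simp only: complex_ring_simps UNIV_I)
  then have "(-1) \<odot> x \<oplus> x = \<zero>"
    using smult_one[OF x] smult_zero_eq[OF x] by (simp only: complex_ring_simps add.left_inverse)
  then show ?thesis by (rule minus_equality[OF _ x smult_in[OF x]])
qed

lemma ip_diff_left:
  "\<lbrakk>x \<in> carrier H; y \<in> carrier H; z \<in> carrier H\<rbrakk> \<Longrightarrow> cinner H (x \<ominus> y) z = cinner H x z - cinner H y z"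
  by (simp add: a_minus_def minus_smult cinner_add_left cinner_smult_left)

lemma ip_diff_right:
  "\<lbrakk>x \<in> carrier H; y \<in> carrier H; z \<in> carrier H\<rbrakk> \<Longrightarrow> cinner H z (x \<ominus> y) = cinner H z x - cinner H z y"
  by (simp add: a_minus_def minus_smult ip_add_right ip_smult_right)

lemmas ip_simps = cinner_add_left ip_add_right cinner_smult_left ip_smult_right
  ip_diff_left ip_diff_right

lemma ip_self_Im: "x \<in> carrier H \<Longrightarrow> Im (cinner H x x) = 0"
  using arg_cong[OF cinner_commute[of x x], of Im] by simp

lemma ip_self_nonneg: "x \<in> carrier H \<Longrightarrow> 0 \<le> Re (cinner H x x)"
  using cinner_pos[of x] by (cases "x = \<zero>") auto

lemma hnorm_nonneg [simp]: "x \<in> carrier H \<Longrightarrow> 0 \<le> hnorm H x"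
  by (simp add: hnorm_def ip_self_nonneg)

lemma hnorm_sq: "x \<in> carrier H \<Longrightarrow> (hnorm H x)\<^sup>2 = Re (cinner H x x)"
  by (simp add: hnorm_def ip_self_nonneg)

lemma ip_self: "x \<in> carrier H \<Longrightarrow> cinner H x x = of_real ((hnorm H x)\<^sup>2)"
  by (simp add: hnorm_sq complex_eq_iff ip_self_Im)

lemma hnorm_zero [simp]: "hnorm H \<zero> = 0"
  by (simp add: hnorm_def)

lemma hnorm_eq_0: "x \<in> carrier H \<Longrightarrow> hnorm H x = 0 \<longleftrightarrow> x = \<zero>"
  using cinner_pos[of x] by (cases "x = \<zero>") (auto simp: hnorm_def)

lemma vec_eqI:
  assumes "x \<in> carrier H" "y \<in> carrier H" "\<And>z. z \<in> carrier H \<Longrightarrow> cinner H x z = cinner H y z"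
  shows "x = y"
proof -
  have "cinner H (x \<ominus> y) (x \<ominus> y) = 0"
    using assms by (simp add: ip_diff_left)
  then have "x \<ominus> y = \<zero>"
    using cinner_pos[of "x \<ominus> y"] assms by fastforce
  then have "x \<oplus> \<ominus> y = \<zero>" by (simp only: a_minus_def)
  then have "\<ominus> (\<ominus> y) = x" by (rule minus_equality) (use assms in auto)
  then show ?thesis using assms by simp
qed

lemma vec_eqI_diff:
  assumes "x \<in> carrier H" "y \<in> carrier H" "hnorm H (x \<ominus> y) = 0"
  shows "x = y"
proof (rule vec_eqI)
  fix z assume z: "z \<in> carrier H"
  have "x \<ominus> y = \<zero>" using assms hnorm_eq_0 by blast
  then have "cinner H (x \<ominus> y) z = 0" using z by simp
  then show "cinner H x z = cinner H y z" using assms z by (simp add: ip_diff_left)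
qed (use assms in auto)

lemma hnorm_smult: "x \<in> carrier H \<Longrightarrow> hnorm H (c \<odot> x) = cmod c * hnorm H x"
proof -
  assume x: "x \<in> carrier H"
  have "(hnorm H (c \<odot> x))\<^sup>2 = (cmod c * hnorm H x)\<^sup>2"
    using x by (simp add: hnorm_sq ip_simps power_mult_distrib ip_self_Im cmod_power2)
      (simp add: power2_eq_square algebra_simps)
  then show ?thesis using x by simp
qed

lemma norm_sq_add:
  "\<lbrakk>x \<in> carrier H; y \<in> carrier H\<rbrakk> \<Longrightarrow>
    (hnorm H (x \<oplus> y))\<^sup>2 = (hnorm H x)\<^sup>2 + 2 * Re (cinner H x y) + (hnorm H y)\<^sup>2"
  using cinner_commute[of y x] by (simp add: hnorm_sq ip_simps)

lemma norm_sq_diff: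
  "\<lbrakk>x \<in> carrier H; y \<in> carrier H\<rbrakk> \<Longrightarrow>
    (hnorm H (x \<ominus> y))\<^sup>2 = (hnorm H x)\<^sup>2 - 2 * Re (cinner H x y) + (hnorm H y)\<^sup>2"
  using cinner_commute[of y x] by (simp add: hnorm_sq ip_simps)

lemma Cauchy_Schwarz:
  assumes x: "x \<in> carrier H" and y: "y \<in> carrier H"
  shows "cmod (cinner H x y) \<le> hnorm H x * hnorm H y"
proof -
  have "(cmod (cinner H x y))\<^sup>2 \<le> (hnorm H x)\<^sup>2 * (hnorm H y)\<^sup>2"
  proof (rule discriminant_le)
    fix c :: complex
    have "0 \<le> (hnorm H (x \<oplus> cnj c \<odot> y))\<^sup>2" by simp
    also have "\<dots> = (hnorm H x)\<^sup>2 + 2 * Re (c * cinner H x y) + (cmod c)\<^sup>2 * (hnorm H y)\<^sup>2"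
      using x y by (subst norm_sq_add) (auto simp: ip_simps hnorm_smult power_mult_distrib)
    finally show "0 \<le> (hnorm H x)\<^sup>2 + 2 * Re (c * cinner H x y) + (cmod c)\<^sup>2 * (hnorm H y)\<^sup>2" .
  qed simp
  then have "(cmod (cinner H x y))\<^sup>2 \<le> (hnorm H x * hnorm H y)\<^sup>2"
    by (simp add: power_mult_distrib)
  then show ?thesis using x y by (auto intro: power2_le_imp_le)
qed

lemma hnorm_triangle:
  assumes x: "x \<in> carrier H" and y: "y \<in> carrier H"
  shows "hnorm H (x \<oplus> y) \<le> hnorm H x + hnorm H y"
proof -
  have "Re (cinner H x y) \<le> hnorm H x * hnorm H y"
    using Cauchy_Schwarz[OF x y] complex_Re_le_cmod order_trans by blast
  then have "(hnorm H (x \<oplus> y))\<^sup>2 \<le> (hnorm H x + hnorm H y)\<^sup>2"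
    using x y by (simp add: norm_sq_add power2_sum)
  then show ?thesis using x y by (auto intro: power2_le_imp_le)
qed

lemma diff_diff: "\<lbrakk>x \<in> carrier H; y \<in> carrier H; z \<in> carrier H\<rbrakk> \<Longrightarrow> (x \<ominus> y) \<oplus> (y \<ominus> z) = x \<ominus> z"
  by (rule vec_eqI) (auto simp: ip_simps)

lemma hnorm_diff_triangle:
  "\<lbrakk>x \<in> carrier H; y \<in> carrier H; z \<in> carrier H\<rbrakk> \<Longrightarrow>
    hnorm H (x \<ominus> z) \<le> hnorm H (x \<ominus> y) + hnorm H (y \<ominus> z)"
  using hnorm_triangle[of "x \<ominus> y" "y \<ominus> z"] by (simp add: diff_diff)

lemma hnorm_diff_commute: "\<lbrakk>x \<in> carrier H; y \<in> carrier H\<rbrakk> \<Longrightarrow> hnorm H (x \<ominus> y) = hnorm H (y \<ominus> x)"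
  using cinner_commute[of x y] by (simp add: hnorm_def ip_simps algebra_simps)

lemma hnorm_diff_ge: "\<lbrakk>x \<in> carrier H; y \<in> carrier H\<rbrakk> \<Longrightarrow> \<bar>hnorm H x - hnorm H y\<bar> \<le> hnorm H (x \<ominus> y)"
proof -
  have *: "hnorm H x \<le> hnorm H (x \<ominus> y) + hnorm H y" if "x \<in> carrier H" "y \<in> carrier H" for x y
  proof -
    have "(x \<ominus> y) \<oplus> y = x" by (rule vec_eqI) (use that in \<open>auto simp: ip_simps\<close>)
    then show ?thesis using hnorm_triangle[of "x \<ominus> y" y] that by simp
  qed
  assume "x \<in> carrier H" "y \<in> carrier H"
  then show ?thesis using *[of x y] *[of y x] by (simp add: hnorm_diff_commute)
qed

lemma ip_tendsto:
  assumes "\<And>k::nat. s k \<in> carrier H" "l \<in> carrier H" "(\<lambda>k. hnorm H (s k \<ominus> l)) \<longlonglongrightarrow> 0" "y \<in> carrier H"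
  shows "(\<lambda>k. cinner H (s k) y) \<longlonglongrightarrow> cinner H l y"
proof -
  have "(\<lambda>k. cinner H (s k) y - cinner H l y) \<longlonglongrightarrow> 0"
  proof (rule Lim_null_comparison)
    show "\<forall>\<^sub>F k in sequentially. norm (cinner H (s k) y - cinner H l y) \<le> hnorm H (s k \<ominus> l) * hnorm H y"
      using assms Cauchy_Schwarz by (simp flip: ip_diff_left)
    show "(\<lambda>k. hnorm H (s k \<ominus> l) * hnorm H y) \<longlonglongrightarrow> 0"
      using assms(3) tendsto_mult_left_zero by blast
  qed
  then show ?thesis by (rule LIM_zero_cancel)
qed

lemma hnorm_tendsto:
  assumes "\<And>k::nat. s k \<in> carrier H" "l \<in> carrier H" "(\<lambda>k. hnorm H (s k \<ominus> l)) \<longlonglongrightarrow> 0"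
  shows "(\<lambda>k. hnorm H (s k)) \<longlonglongrightarrow> hnorm H l"
proof -
  have "(\<lambda>k. hnorm H (s k) - hnorm H l) \<longlonglongrightarrow> 0"
    by (rule Lim_null_comparison[OF _ assms(3)]) (use assms hnorm_diff_ge in auto)
  then show ?thesis by (rule LIM_zero_cancel)
qed

lemma approx_eqI:
  assumes "x \<in> carrier H" "y \<in> carrier H" "\<And>e. e > 0 \<Longrightarrow> hnorm H (x \<ominus> y) < e"
  shows "x = y"
  using assms by (metis diff_in hnorm_nonneg less_irrefl not_less_iff_gr_or_eq order_le_less vec_eqI_diff)

lemma hnorm_le_if_ip:
  assumes "x \<in> carrier H" "0 \<le> M" "\<And>y. y \<in> carrier H \<Longrightarrow> cmod (cinner H x y) \<le> M * hnorm H y"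
  shows "hnorm H x \<le> M"
proof (cases "hnorm H x = 0")
  case False
  then have "hnorm H x > 0" using hnorm_nonneg[OF assms(1)] by linarith
  have "(hnorm H x)\<^sup>2 \<le> M * hnorm H x" using assms(3)[OF assms(1)] assms(1) by (simp add: ip_self norm_power)
  then show ?thesis using \<open>hnorm H x > 0\<close> by (simp add: power2_eq_square)
qed (use assms in simp)

end

text \<open>A bound as a predicate instead of the supremum \<open>op_norm\<close>: any valid M may
  be used, and nonnegativity is part of it so that bounds can be multiplied even on the zero
  space.\<close>

definition bounded_by :: "'a hilbert \<Rightarrow> ('a \<Rightarrow> 'a) \<Rightarrow> real \<Rightarrow> bool" where
  "bounded_by H A M \<longleftrightarrow> 0 \<le> M \<and> (\<forall>x\<in>carrier H. hnorm H (A x) \<le> M * hnorm H x)"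

lemma bounded_opsI:
  assumes "A \<in> carrier H \<rightarrow>\<^sub>E carrier K"
    and "\<And>x y. \<lbrakk>x \<in> carrier H; y \<in> carrier H\<rbrakk> \<Longrightarrow> A (x \<oplus>\<^bsub>H\<^esub> y) = A x \<oplus>\<^bsub>K\<^esub> A y"
    and "\<And>c x. x \<in> carrier H \<Longrightarrow> A (c \<odot>\<^bsub>H\<^esub> x) = c \<odot>\<^bsub>K\<^esub> A x"
    and "\<And>x. x \<in> carrier H \<Longrightarrow> hnorm K (A x) \<le> M * hnorm H x"
  shows "A \<in> bounded_ops H K"
  using assms unfolding bounded_ops_def by blast

lemma bounded_ops_PiE: "A \<in> bounded_ops H K \<Longrightarrow> A \<in> carrier H \<rightarrow>\<^sub>E carrier K"
  by (simp add: bounded_ops_def)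

lemma bounded_ops_in: "\<lbrakk>A \<in> bounded_ops H K; x \<in> carrier H\<rbrakk> \<Longrightarrow> A x \<in> carrier K"
  by (auto simp: bounded_ops_def)

lemma bounded_ops_add:
  "\<lbrakk>A \<in> bounded_ops H K; x \<in> carrier H; y \<in> carrier H\<rbrakk> \<Longrightarrow> A (x \<oplus>\<^bsub>H\<^esub> y) = A x \<oplus>\<^bsub>K\<^esub> A y"
  by (auto simp: bounded_ops_def)

lemma bounded_ops_smult:
  "\<lbrakk>A \<in> bounded_ops H K; x \<in> carrier H\<rbrakk> \<Longrightarrow> A (c \<odot>\<^bsub>H\<^esub> x) = c \<odot>\<^bsub>K\<^esub> A x"
  by (auto simp: bounded_ops_def)

lemma op_alg_simps [simp]:
  "carrier (op_alg H) = bounded_ops H H"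
  "mult (op_alg H) = compose (carrier H)"
  "one (op_alg H) = (\<lambda>x\<in>carrier H. x)"
  "zero (op_alg H) = (\<lambda>x\<in>carrier H. \<zero>\<^bsub>H\<^esub>)"
  "add (op_alg H) = (\<lambda>A B. \<lambda>x\<in>carrier H. A x \<oplus>\<^bsub>H\<^esub> B x)"
  "smult (op_alg H) = (\<lambda>c A. \<lambda>x\<in>carrier H. c \<odot>\<^bsub>H\<^esub> A x)"
  by (simp_all add: op_alg_def)

section \<open>Riesz representation, adjoints and the algebra of bounded operators\<close>

context hilbert_space
begin

abbreviation "ops \<equiv> bounded_ops H H"

lemma bounded_ops_bound:
  assumes "A \<in> ops" obtains M where "bounded_by H A M"
proof -
  obtain M where M: "\<And>x. x \<in> carrier H \<Longrightarrow> hnorm H (A x) \<le> M * hnorm H x"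
    using assms unfolding bounded_ops_def by blast
  have "bounded_by H A \<bar>M\<bar>" unfolding bounded_by_def
  proof (intro conjI ballI)
    fix x assume x: "x \<in> carrier H"
    have "M * hnorm H x \<le> \<bar>M\<bar> * hnorm H x" using x by (intro mult_right_mono) auto
    then show "hnorm H (A x) \<le> \<bar>M\<bar> * hnorm H x" using M[OF x] by linarith
  qed simp
  then show ?thesis by (rule that)
qed

lemma op_zero: "A \<in> ops \<Longrightarrow> A \<zero> = \<zero>"
  using bounded_ops_smult[of A H H \<zero> 0] bounded_ops_in[of A H H \<zero>] by (simp add: smult_zero_eq)

lemma diff_smult: "\<lbrakk>x \<in> carrier H; y \<in> carrier H\<rbrakk> \<Longrightarrow> x \<ominus> y = x \<oplus> (-1) \<odot> y"
  by (simp add: a_minus_def minus_smult)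

lemma op_diff: "\<lbrakk>A \<in> ops; x \<in> carrier H; y \<in> carrier H\<rbrakk> \<Longrightarrow> A (x \<ominus> y) = A x \<ominus> A y"
  by (simp add: diff_smult bounded_ops_add bounded_ops_smult bounded_ops_in)

lemma op_eqI:
  assumes "A \<in> ops" "B \<in> ops" "\<And>x. x \<in> carrier H \<Longrightarrow> A x = B x"
  shows "A = B"
  using assms(3) by (rule PiE_ext[OF bounded_ops_PiE[OF assms(1)] bounded_ops_PiE[OF assms(2)]])

lemma op_eqI_ip:
  assumes "A \<in> ops" "B \<in> ops"
    "\<And>x y. \<lbrakk>x \<in> carrier H; y \<in> carrier H\<rbrakk> \<Longrightarrow> cinner H (A x) y = cinner H (B x) y"
  shows "A = B"
  by (rule op_eqI[OF assms(1,2)], rule vec_eqI) (use assms bounded_ops_in in auto)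

text \<open>Variational proof without closed subspaces: the representing vector minimises J x =
  |x|^2 - 2 Re (\<phi> x).\<close>

lemma riesz:
  assumes add: "\<And>x y. \<lbrakk>x \<in> carrier H; y \<in> carrier H\<rbrakk> \<Longrightarrow> \<phi> (x \<oplus> y) = \<phi> x + \<phi> y"
    and smult: "\<And>c x. x \<in> carrier H \<Longrightarrow> \<phi> (c \<odot> x) = c * \<phi> x"
    and bound: "\<And>x. x \<in> carrier H \<Longrightarrow> cmod (\<phi> x) \<le> M * hnorm H x"
  obtains z where "z \<in> carrier H" "\<And>x. x \<in> carrier H \<Longrightarrow> \<phi> x = cinner H x z"
proof -
  define J where "J x = (hnorm H x)\<^sup>2 - 2 * Re (\<phi> x)" for x
  define m where "m = Inf (J ` carrier H)"
  have J_ge: "J x \<ge> - M\<^sup>2" if x: "x \<in> carrier H" for x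
  proof -
    have "Re (\<phi> x) \<le> M * hnorm H x" using bound[OF x] complex_Re_le_cmod order_trans by blast
    moreover have "0 \<le> (hnorm H x - M)\<^sup>2" by simp
    ultimately show ?thesis by (simp add: J_def power2_diff mult.commute)
  qed
  have m_le: "m \<le> J x" if "x \<in> carrier H" for x
    unfolding m_def by (rule cInf_lower) (use that J_ge in \<open>auto intro!: bdd_belowI[of _ "- M\<^sup>2"]\<close>)
  have "\<exists>x\<in>carrier H. J x < m + 1 / real (Suc n)" for n
  proof -
    have "Inf (J ` carrier H) < m + 1 / real (Suc n)" unfolding m_def by simp
    then show ?thesis using cInf_lessD[of "J ` carrier H"] by fastforce
  qed
  then obtain s where s: "\<And>n. s n \<in> carrier H" and Js: "\<And>n. J (s n) < m + 1 / real (Suc n)"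
    by metis
  \<comment> \<open>Parallelogram law: the linear part of J cancels against the midpoint, so |x -
    y|^2 = 2 J x + 2 J y - 4 J(midpoint), and the midpoint value is at least m. Minimising sequences
    are therefore Cauchy.\<close>
  have par: "(hnorm H (x \<ominus> y))\<^sup>2 \<le> 2 * (J x - m) + 2 * (J y - m)" if x: "x \<in> carrier H" and y: "y \<in> carrier H" for x y
  proof -
    let ?v = "(1/2) \<odot> (x \<oplus> y)"
    have "Re (\<phi> ?v) = (Re (\<phi> x) + Re (\<phi> y)) / 2" using x y by (simp add: add smult)
    moreover have "(hnorm H ?v)\<^sup>2 = ((hnorm H x)\<^sup>2 + 2 * Re (cinner H x y) + (hnorm H y)\<^sup>2) / 4"
      using x y by (simp add: hnorm_smult power_divide norm_sq_add norm_divide power_mult_distrib)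
    moreover have "m \<le> J ?v" using x y by (intro m_le) auto
    ultimately show ?thesis unfolding norm_sq_diff[OF x y] J_def by argo
  qed
  have "\<exists>l\<in>carrier H. (\<lambda>k. hnorm H (s k \<ominus> l)) \<longlonglongrightarrow> 0"
  proof (rule complete)
    show "\<forall>e>0. \<exists>N. \<forall>m\<ge>N. \<forall>k\<ge>N. hnorm H (s m \<ominus> s k) < e"
    proof (intro allI impI)
      fix e :: real assume "e > 0"
      then obtain N where N: "1 / real (Suc N) < e\<^sup>2 / 4"
        by (metis nat_approx_posE zero_less_divide_iff zero_less_numeral zero_less_power)
      have "hnorm H (s i \<ominus> s k) < e" if "i \<ge> N" "k \<ge> N" for i k
      proof -
        have *: "1 / real (Suc j) \<le> 1 / real (Suc N)" if "j \<ge> N" for j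
          using that by (simp add: frac_le)
        have "J (s j) - m < e\<^sup>2 / 4" if "j \<ge> N" for j
          using Js[of j] *[OF that] N by linarith
        from this[OF that(1)] this[OF that(2)] have "(hnorm H (s i \<ominus> s k))\<^sup>2 < e\<^sup>2"
          using par[OF s s, of i k] by argo
        then show ?thesis using \<open>e > 0\<close> by (auto intro: power2_less_imp_less)
      qed
      then show "\<exists>N. \<forall>m\<ge>N. \<forall>k\<ge>N. hnorm H (s m \<ominus> s k) < e" by blast
    qed
  qed (rule s)
  then obtain z where z: "z \<in> carrier H" and lim: "(\<lambda>k. hnorm H (s k \<ominus> z)) \<longlonglongrightarrow> 0" by blast
  have \<phi>diff: "\<phi> (x \<ominus> y) = \<phi> x - \<phi> y" if "x \<in> carrier H" "y \<in> carrier H" for x y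
    using that by (simp add: diff_smult add smult)
  have "(\<lambda>k. \<phi> (s k) - \<phi> z) \<longlonglongrightarrow> 0"
  proof (rule Lim_null_comparison)
    show "\<forall>\<^sub>F k in sequentially. norm (\<phi> (s k) - \<phi> z) \<le> M * hnorm H (s k \<ominus> z)"
      using bound s z by (simp flip: \<phi>diff)
    show "(\<lambda>k. M * hnorm H (s k \<ominus> z)) \<longlonglongrightarrow> 0" using lim tendsto_mult_right_zero by blast
  qed
  then have "(\<lambda>k. \<phi> (s k)) \<longlonglongrightarrow> \<phi> z" by (rule LIM_zero_cancel)
  then have "(\<lambda>k. J (s k)) \<longlonglongrightarrow> J z"
    unfolding J_def by (intro tendsto_intros hnorm_tendsto s z lim)
  moreover have "(\<lambda>k. m + 1 / real (Suc k)) \<longlonglongrightarrow> m + 0"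
    by (intro tendsto_intros LIMSEQ_Suc[OF lim_1_over_n])
  ultimately have "J z \<le> m + 0"
    by (rule LIMSEQ_le) (use Js less_imp_le in blast)
  then have Jz: "J z \<le> J x" if "x \<in> carrier H" for x using m_le[OF that] by simp
  have "\<phi> w = cinner H w z" if w: "w \<in> carrier H" for w
  proof -
    \<comment> \<open>First variation: comparing J at z and z + c w leaves a quadratic in c without
      constant term, so its linear coefficient must vanish.\<close>
    have "(cmod (cinner H w z - \<phi> w))\<^sup>2 \<le> 0 * (hnorm H w)\<^sup>2"
    proof (rule discriminant_le)
      fix c :: complex
      have "J z \<le> J (z \<oplus> c \<odot> w)" using z w by (intro Jz) auto
      moreover have "Re (cinner H z (c \<odot> w)) = Re (c * cinner H w z)"
        using cinner_commute[OF smult_in[OF w] z, of c] z w by (simp add: cinner_smult_left)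
      ultimately show "0 \<le> 0 + 2 * Re (c * (cinner H w z - \<phi> w)) + (cmod c)\<^sup>2 * (hnorm H w)\<^sup>2"
        using z w by (simp add: J_def norm_sq_add add smult hnorm_smult power_mult_distrib right_diff_distrib del: times_complex.sel)
    qed simp
    then show ?thesis by simp
  qed
  then show ?thesis using that z by blast
qed

text \<open>Riesz is applied in the second slot after conjugation. Adjoints, the defect and the
  weighted sum of a dilated tuple are all produced this way.\<close>

lemma sesquilinear_op:
  assumes add1: "\<And>x y z. \<lbrakk>x \<in> carrier H; y \<in> carrier H; z \<in> carrier H\<rbrakk> \<Longrightarrow> B (x \<oplus> y) z = B x z + B y z"
    and smult1: "\<And>c x z. \<lbrakk>x \<in> carrier H; z \<in> carrier H\<rbrakk> \<Longrightarrow> B (c \<odot> x) z = c * B x z"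
    and add2: "\<And>x y z. \<lbrakk>x \<in> carrier H; y \<in> carrier H; z \<in> carrier H\<rbrakk> \<Longrightarrow> B z (x \<oplus> y) = B z x + B z y"
    and smult2: "\<And>c x z. \<lbrakk>x \<in> carrier H; z \<in> carrier H\<rbrakk> \<Longrightarrow> B z (c \<odot> x) = cnj c * B z x"
    and bound: "0 \<le> M" "\<And>x y. \<lbrakk>x \<in> carrier H; y \<in> carrier H\<rbrakk> \<Longrightarrow> cmod (B x y) \<le> M * hnorm H x * hnorm H y"
  obtains A where "A \<in> ops" "bounded_by H A M"
    "\<And>x y. \<lbrakk>x \<in> carrier H; y \<in> carrier H\<rbrakk> \<Longrightarrow> cinner H (A x) y = B x y"
proof -
  have "\<exists>z\<in>carrier H. \<forall>y\<in>carrier H. cinner H z y = B x y" if x: "x \<in> carrier H" for x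
  proof -
    obtain z where z: "z \<in> carrier H" "\<And>y. y \<in> carrier H \<Longrightarrow> cnj (B x y) = cinner H y z"
      by (rule riesz[of "\<lambda>y. cnj (B x y)" "M * hnorm H x"]) (use x add2 smult2 bound in auto)
    have "cinner H z y = B x y" if "y \<in> carrier H" for y
      using cinner_commute[OF z(1) that] z(2)[OF that, symmetric] by simp
    then show ?thesis using z(1) by blast
  qed
  then obtain f where f: "\<And>x. x \<in> carrier H \<Longrightarrow> f x \<in> carrier H"
      "\<And>x y. \<lbrakk>x \<in> carrier H; y \<in> carrier H\<rbrakk> \<Longrightarrow> cinner H (f x) y = B x y"
    by metis
  define A where "A = (\<lambda>x\<in>carrier H. f x)"
  have A: "\<And>x. x \<in> carrier H \<Longrightarrow> A x \<in> carrier H"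
      "\<And>x y. \<lbrakk>x \<in> carrier H; y \<in> carrier H\<rbrakk> \<Longrightarrow> cinner H (A x) y = B x y"
    by (simp_all add: A_def f)
  have bd: "hnorm H (A x) \<le> M * hnorm H x" if "x \<in> carrier H" for x
    by (rule hnorm_le_if_ip) (use that A bound in auto)
  have "A \<in> ops"
  proof (rule bounded_opsI[where M=M])
    show "A \<in> carrier H \<rightarrow>\<^sub>E carrier H" using A(1) by (auto simp: A_def)
    show "A (x \<oplus> y) = A x \<oplus> A y" if "x \<in> carrier H" "y \<in> carrier H" for x y
      by (rule vec_eqI) (use that in \<open>auto simp: A add1 cinner_add_left\<close>)
    show "A (c \<odot> x) = c \<odot> A x" if "x \<in> carrier H" for c x
      by (rule vec_eqI) (use that in \<open>auto simp: A smult1 cinner_smult_left\<close>)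
  qed (use bd in auto)
  moreover have "bounded_by H A M" using bd bound by (simp add: bounded_by_def)
  ultimately show ?thesis using A that by blast
qed

lemma adj_unique:
  assumes "B \<in> ops" "C \<in> ops"
    "\<And>x y. \<lbrakk>x \<in> carrier H; y \<in> carrier H\<rbrakk> \<Longrightarrow> cinner H (A x) y = cinner H x (B y)"
    "\<And>x y. \<lbrakk>x \<in> carrier H; y \<in> carrier H\<rbrakk> \<Longrightarrow> cinner H (A x) y = cinner H x (C y)"
  shows "B = C"
proof (rule op_eqI_ip)
  fix x y assume xy: "x \<in> carrier H" "y \<in> carrier H"
  have "cinner H y (B x) = cinner H y (C x)" using assms(3,4)[OF xy(2,1)] by simp
  then show "cinner H (B x) y = cinner H (C x) y"
    using cinner_commute[OF bounded_ops_in[OF assms(1) xy(1)] xy(2)]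
      cinner_commute[OF bounded_ops_in[OF assms(2) xy(1)] xy(2)] by simp
qed (use assms in auto)

lemma adj_eqI:
  assumes "B \<in> ops" "\<And>x y. \<lbrakk>x \<in> carrier H; y \<in> carrier H\<rbrakk> \<Longrightarrow> cinner H (A x) y = cinner H x (B y)"
  shows "adj H A = B"
  unfolding adj_def
proof (rule the_equality)
  show "C = B" if "C \<in> ops \<and> (\<forall>x\<in>carrier H. \<forall>y\<in>carrier H. cinner H (A x) y = cinner H x (C y))" for C
    by (rule adj_unique[of C B A]) (use assms that in auto)
qed (use assms in auto)

text \<open>Representing the form (x, y) \<mapsto> <x, A y> gives the adjoint directly, with the
  same bound M, and justifies the description operator in \<open>adj\<close>.\<close>

lemma adj_exists:
  assumes A: "A \<in> ops" "bounded_by H A M"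
  shows "adj H A \<in> ops \<and> bounded_by H (adj H A) M \<and>
    (\<forall>x\<in>carrier H. \<forall>y\<in>carrier H. cinner H (A x) y = cinner H x (adj H A y))"
proof -
  have in_A: "\<And>x. x \<in> carrier H \<Longrightarrow> A x \<in> carrier H" using bounded_ops_in[OF A(1)] .
  obtain B where B: "B \<in> ops" "bounded_by H B M"
    "\<And>x y. \<lbrakk>x \<in> carrier H; y \<in> carrier H\<rbrakk> \<Longrightarrow> cinner H (B x) y = cinner H x (A y)"
  proof (rule sesquilinear_op[of "\<lambda>x y. cinner H x (A y)" M])
    show "cmod (cinner H x (A y)) \<le> M * hnorm H x * hnorm H y"
      if "x \<in> carrier H" "y \<in> carrier H" for x y
    proof -
      have "cmod (cinner H x (A y)) \<le> hnorm H x * hnorm H (A y)" by (rule Cauchy_Schwarz) (use that in_A in auto)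
      also have "\<dots> \<le> hnorm H x * (M * hnorm H y)"
        using A(2) that by (intro mult_left_mono) (auto simp: bounded_by_def)
      finally show ?thesis by (simp add: algebra_simps)
    qed
  qed (use A in \<open>auto simp: ip_simps in_A bounded_ops_add bounded_ops_smult bounded_by_def\<close>)
  have *: "cinner H (A x) y = cinner H x (B y)" if "x \<in> carrier H" "y \<in> carrier H" for x y
    using B(3)[OF that(2,1)] cinner_commute[OF in_A[OF that(1)] that(2)]
      cinner_commute[OF that(1) bounded_ops_in[OF B(1) that(2)]] by simp
  show ?thesis using adj_eqI[OF B(1) *] B * by simp
qed

lemma adj_in [simp, intro]: "A \<in> ops \<Longrightarrow> adj H A \<in> ops"
  by (metis adj_exists bounded_ops_bound)

lemma adj_ip:
  "\<lbrakk>A \<in> ops; x \<in> carrier H; y \<in> carrier H\<rbrakk> \<Longrightarrow> cinner H x (adj H A y) = cinner H (A x) y"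
  by (metis adj_exists bounded_ops_bound)

lemma adj_ip2:
  assumes "A \<in> ops" "x \<in> carrier H" "y \<in> carrier H"
  shows "cinner H (adj H A x) y = cinner H x (A y)"
  using cinner_commute[OF bounded_ops_in[OF adj_in[OF assms(1)] assms(2)] assms(3)]
    cinner_commute[OF assms(2) bounded_ops_in[OF assms(1,3)]] adj_ip[OF assms(1) assms(3,2)] by simp

lemma bounded_by_adj: "\<lbrakk>A \<in> ops; bounded_by H A M\<rbrakk> \<Longrightarrow> bounded_by H (adj H A) M"
  by (metis adj_exists)

lemma adj_adj [simp]: "A \<in> ops \<Longrightarrow> adj H (adj H A) = A"
  by (rule adj_eqI) (auto simp: adj_ip2)

lemma op_one_in [simp]: "(\<lambda>x\<in>carrier H. x) \<in> ops"
  by (rule bounded_opsI[where M=1]) auto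

lemma op_zero_in [simp]: "(\<lambda>x\<in>carrier H. \<zero>) \<in> ops"
  by (rule bounded_opsI[where M=0]) (auto simp: smult_r_null)

lemma bounded_by_compose:
  assumes B: "B \<in> ops" and M: "bounded_by H A M" "bounded_by H B M'"
  shows "bounded_by H (compose (carrier H) A B) (M * M')"
  unfolding bounded_by_def
proof (intro conjI ballI)
  fix x assume x: "x \<in> carrier H"
  have "hnorm H (A (B x)) \<le> M * hnorm H (B x)"
    using M bounded_ops_in[OF B x] by (simp add: bounded_by_def)
  also have "\<dots> \<le> M * (M' * hnorm H x)"
    using M x by (intro mult_left_mono) (auto simp: bounded_by_def)
  finally show "hnorm H (compose (carrier H) A B x) \<le> M * M' * hnorm H x"
    using x by (simp add: compose_eq mult.assoc)
qed (use M in \<open>auto simp: bounded_by_def\<close>)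

lemma op_compose_in [simp]:
  assumes "A \<in> ops" "B \<in> ops" shows "compose (carrier H) A B \<in> ops"
proof -
  obtain M M' where "bounded_by H A M" "bounded_by H B M'" using assms bounded_ops_bound by metis
  then have "bounded_by H (compose (carrier H) A B) (M * M')" using assms bounded_by_compose by blast
  then show ?thesis
    by (intro bounded_opsI[where M="M * M'"])
      (use assms in \<open>auto simp: bounded_by_def compose_eq bounded_ops_in bounded_ops_add bounded_ops_smult
         intro!: PiE_I simp: compose_def\<close>)
qed

lemma bounded_by_add:
  assumes "A \<in> ops" "B \<in> ops" "bounded_by H A M" "bounded_by H B M'"
  shows "bounded_by H (\<lambda>x\<in>carrier H. A x \<oplus> B x) (M + M')"
  unfolding bounded_by_def
proof (intro conjI ballI)
  fix x assume x: "x \<in> carrier H"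
  have "hnorm H (A x \<oplus> B x) \<le> hnorm H (A x) + hnorm H (B x)"
    by (rule hnorm_triangle) (simp_all add: x bounded_ops_in[OF assms(1)] bounded_ops_in[OF assms(2)])
  also have "\<dots> \<le> (M + M') * hnorm H x"
    using assms(3,4) x by (simp add: bounded_by_def distrib_right add_mono)
  finally show "hnorm H ((\<lambda>x\<in>carrier H. A x \<oplus> B x) x) \<le> (M + M') * hnorm H x" using x by simp
qed (use assms in \<open>auto simp: bounded_by_def\<close>)

lemma bounded_by_smult:
  "\<lbrakk>A \<in> ops; bounded_by H A M\<rbrakk> \<Longrightarrow> bounded_by H (\<lambda>x\<in>carrier H. c \<odot> A x) (cmod c * M)"
  by (simp add: bounded_by_def hnorm_smult bounded_ops_in mult.assoc mult_left_mono)

lemma op_add_in [simp]: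
  assumes "A \<in> ops" "B \<in> ops" shows "(\<lambda>x\<in>carrier H. A x \<oplus> B x) \<in> ops"
proof -
  obtain M M' where "bounded_by H A M" "bounded_by H B M'" using assms bounded_ops_bound by metis
  then have "bounded_by H (\<lambda>x\<in>carrier H. A x \<oplus> B x) (M + M')" using assms bounded_by_add by blast
  then show ?thesis
    by (intro bounded_opsI[where M="M + M'"])
      (use assms in \<open>auto simp: bounded_by_def bounded_ops_in bounded_ops_add bounded_ops_smult
         smult_r_distr a_ac\<close>)
qed

lemma op_smult_in [simp]:
  assumes "A \<in> ops" shows "(\<lambda>x\<in>carrier H. c \<odot> A x) \<in> ops"
proof -
  obtain M where "bounded_by H A M" using assms bounded_ops_bound by metis
  then have "bounded_by H (\<lambda>x\<in>carrier H. c \<odot> A x) (cmod c * M)" using assms bounded_by_smult by blast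
  then show ?thesis
    by (intro bounded_opsI[where M="cmod c * M"])
      (use assms in \<open>auto simp: bounded_by_def bounded_ops_in bounded_ops_add bounded_ops_smult
         smult_r_distr smult_assoc1[symmetric, simplified] mult.commute\<close>)
qed

lemma op_group: "abelian_group (op_alg H)"
proof (rule abelian_groupI)
  fix A assume "A \<in> carrier (op_alg H)"
  then have A: "A \<in> ops" by simp
  have "(\<lambda>x\<in>carrier H. (-1) \<odot> A x) \<oplus>\<^bsub>op_alg H\<^esub> A = \<zero>\<^bsub>op_alg H\<^esub>"
    using A bounded_ops_in[OF A] by (auto simp: restrict_def fun_eq_iff l_neg simp flip: minus_smult)
  then show "\<exists>B\<in>carrier (op_alg H). B \<oplus>\<^bsub>op_alg H\<^esub> A = \<zero>\<^bsub>op_alg H\<^esub>"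
    using A by (metis op_alg_simps(1) op_smult_in)
next
  fix A assume "A \<in> carrier (op_alg H)"
  then show "\<zero>\<^bsub>op_alg H\<^esub> \<oplus>\<^bsub>op_alg H\<^esub> A = A"
    using op_add_in[OF op_zero_in, of A] by (intro op_eqI) (auto simp: bounded_ops_in)
qed (auto simp: bounded_ops_in a_ac intro!: restrict_ext)

lemma op_minus_apply:
  assumes "A \<in> ops" "B \<in> ops" "x \<in> carrier H"
  shows "(A \<ominus>\<^bsub>op_alg H\<^esub> B) x = A x \<ominus> B x"
proof -
  interpret O: abelian_group "op_alg H" by (rule op_group)
  have "(\<lambda>x\<in>carrier H. (-1) \<odot> B x) \<oplus>\<^bsub>op_alg H\<^esub> B = \<zero>\<^bsub>op_alg H\<^esub>"
    using assms bounded_ops_in[OF assms(2)] by (auto simp: restrict_def fun_eq_iff l_neg simp flip: minus_smult)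
  then have "\<ominus>\<^bsub>op_alg H\<^esub> B = (\<lambda>x\<in>carrier H. (-1) \<odot> B x)"
    using assms by (intro O.minus_equality) auto
  then show ?thesis using assms by (simp add: a_minus_def minus_smult bounded_ops_in)
qed

lemma op_minus_in: "\<lbrakk>A \<in> ops; B \<in> ops\<rbrakk> \<Longrightarrow> A \<ominus>\<^bsub>op_alg H\<^esub> B \<in> ops"
  using abelian_group.minus_closed[OF op_group] by simp

lemma op_finsum_in:
  assumes "finite F" "\<And>a. a \<in> F \<Longrightarrow> f a \<in> ops"
  shows "(\<Oplus>\<^bsub>op_alg H\<^esub>a\<in>F. f a) \<in> ops"
  using abelian_monoid.finsum_closed[OF abelian_group.axioms(1)[OF op_group], of f F] assms
  by (auto simp: Pi_def)

lemma op_finsum_ip: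
  assumes "finite F" "\<And>a. a \<in> F \<Longrightarrow> f a \<in> ops" "x \<in> carrier H" "y \<in> carrier H"
  shows "cinner H ((\<Oplus>\<^bsub>op_alg H\<^esub>a\<in>F. f a) x) y = (\<Sum>a\<in>F. cinner H (f a x) y)"
proof -
  interpret O: abelian_monoid "op_alg H" using op_group by (rule abelian_group.axioms)
  show ?thesis using assms(1,2)
  proof (induction F)
    case empty
    then show ?case using assms by simp
  next
    case (insert a F)
    have "(\<Oplus>\<^bsub>op_alg H\<^esub>a\<in>insert a F. f a) = f a \<oplus>\<^bsub>op_alg H\<^esub> (\<Oplus>\<^bsub>op_alg H\<^esub>a\<in>F. f a)"
      by (rule O.finsum_insert) (use insert in auto)
    moreover have "f a x \<in> carrier H" "(\<Oplus>\<^bsub>op_alg H\<^esub>a\<in>F. f a) x \<in> carrier H"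
      using bounded_ops_in[OF op_finsum_in[OF insert.hyps(1)], of f] bounded_ops_in[of "f a" H H] insert.prems assms(3) by simp_all
    moreover have "cinner H ((\<Oplus>\<^bsub>op_alg H\<^esub>a\<in>F. f a) x) y = (\<Sum>a\<in>F. cinner H (f a x) y)"
      by (rule insert.IH) (use insert.prems in blast)
    ultimately show ?case using insert.hyps assms(3,4) by (simp add: cinner_add_left)
  qed
qed

text \<open>\<open>op_norm\<close> is a real supremum, so boundedness of its set has to be shown
  first; the estimate then follows by scaling into the unit ball.\<close>

lemma op_norm_bound:
  assumes A: "A \<in> ops" shows "bounded_by H A (op_norm H A)"
proof -
  obtain M where M: "bounded_by H A M" using bounded_ops_bound[OF A] .
  define S where "S = {hnorm H (A x) |x. x \<in> carrier H \<and> hnorm H x \<le> 1}"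
  have bdd: "bdd_above S"
  proof (rule bdd_aboveI)
    fix r assume "r \<in> S"
    then obtain x where x: "r = hnorm H (A x)" "x \<in> carrier H" "hnorm H x \<le> 1" by (auto simp: S_def)
    have "r \<le> M * hnorm H x" using M x by (simp add: bounded_by_def)
    also have "\<dots> \<le> M * 1" using M x by (intro mult_left_mono) (auto simp: bounded_by_def)
    finally show "r \<le> M * 1" .
  qed
  have up: "hnorm H (A x) \<le> op_norm H A" if "x \<in> carrier H" "hnorm H x \<le> 1" for x
    unfolding op_norm_def S_def[symmetric] by (rule cSup_upper[OF _ bdd]) (use that in \<open>auto simp: S_def\<close>)
  have nn: "0 \<le> op_norm H A" using up[of \<zero>] A by (simp add: op_zero)
  have "hnorm H (A x) \<le> op_norm H A * hnorm H x" if x: "x \<in> carrier H" for x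
  proof (cases "x = \<zero>")
    case True then show ?thesis using A by (simp add: op_zero)
  next
    case False
    then have pos: "hnorm H x > 0" using x hnorm_nonneg[OF x] hnorm_eq_0[OF x] by linarith
    let ?c = "complex_of_real (1 / hnorm H x)"
    have "hnorm H (A (?c \<odot> x)) \<le> op_norm H A"
      by (rule up) (use x pos in \<open>auto simp: hnorm_smult norm_divide\<close>)
    then show ?thesis using x pos A
      by (simp add: bounded_ops_smult hnorm_smult bounded_ops_in norm_divide field_simps)
  qed
  then show ?thesis using nn by (simp add: bounded_by_def)
qed

end

section \<open>Words in a tuple of operators and their adjoints\<close>

lemma word_op_simps [simp]:
  "word_op H X [] = (\<lambda>x\<in>carrier H. x)" "word_op H X (i # \<alpha>) = compose (carrier H) (X i) (word_op H X \<alpha>)"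
  by (simp_all add: word_op_def op_alg_def)

text \<open>This is the adjoint of \<open>X_\<alpha>\<close> applied to h: taking adjoints reverses
  the product, so the adjoint of the first letter acts first.\<close>

primrec wadj :: "'a hilbert \<Rightarrow> ('n \<Rightarrow> 'a \<Rightarrow> 'a) \<Rightarrow> 'n list \<Rightarrow> 'a \<Rightarrow> 'a" where
  "wadj H X [] h = h"
| "wadj H X (i # \<alpha>) h = wadj H X \<alpha> (adj H (X i) h)"

lemma finite_words [simp]: "finite {\<alpha> :: 'n::finite list. length \<alpha> \<le> N}" "finite {\<alpha> :: 'n list. length \<alpha> = N}"
  using finite_lists_length_le[of "UNIV :: 'n set" N] finite_lists_length_eq[of "UNIV :: 'n set" N] by simp_all

context hilbert_space
begin

lemma adj_app_in [simp, intro]: "\<lbrakk>A \<in> ops; x \<in> carrier H\<rbrakk> \<Longrightarrow> adj H A x \<in> carrier H"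
  using bounded_ops_in[OF adj_in] .

lemma adj_compose:
  assumes "A \<in> ops" "B \<in> ops"
  shows "adj H (compose (carrier H) A B) = compose (carrier H) (adj H B) (adj H A)"
  by (rule adj_eqI) (use assms in \<open>auto simp: compose_eq adj_ip bounded_ops_in\<close>)

lemma adj_one [simp]: "adj H (\<lambda>x\<in>carrier H. x) = (\<lambda>x\<in>carrier H. x)"
  by (rule adj_eqI) auto

lemma adj_smult:
  "A \<in> ops \<Longrightarrow> adj H (\<lambda>x\<in>carrier H. c \<odot> A x) = (\<lambda>x\<in>carrier H. cnj c \<odot> adj H A x)"
  by (rule adj_eqI) (auto simp: ip_simps adj_ip bounded_ops_in)

lemma adj_add:
  "\<lbrakk>A \<in> ops; B \<in> ops\<rbrakk> \<Longrightarrow> adj H (\<lambda>x\<in>carrier H. A x \<oplus> B x) = (\<lambda>x\<in>carrier H. adj H A x \<oplus> adj H B x)"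
  by (rule adj_eqI) (auto simp: ip_simps adj_ip bounded_ops_in)

lemma word_op_in:
  assumes "\<And>i. X i \<in> ops" shows "word_op H X \<alpha> \<in> ops"
proof (induction \<alpha>)
  case Nil
  show ?case by (simp only: word_op_simps op_one_in)
next
  case (Cons i \<alpha>)
  then show ?case by (simp add: assms)
qed

lemma wadj_in: "\<lbrakk>\<And>i. X i \<in> ops; h \<in> carrier H\<rbrakk> \<Longrightarrow> wadj H X \<alpha> h \<in> carrier H"
  by (induction \<alpha> arbitrary: h) (auto simp: bounded_ops_in[OF adj_in])

lemma adj_word_op:
  assumes X: "\<And>i. X i \<in> ops" shows "h \<in> carrier H \<Longrightarrow> adj H (word_op H X \<alpha>) h = wadj H X \<alpha> h"
proof (induction \<alpha> arbitrary: h)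
  case Nil
  then show ?case unfolding word_op_simps adj_one wadj.simps by simp
next
  case (Cons i \<alpha>)
  then show ?case
    using Cons by (simp add: adj_compose X word_op_in compose_eq)
qed

lemma wadj_add:
  "\<lbrakk>\<And>i. X i \<in> ops; h \<in> carrier H; k \<in> carrier H\<rbrakk> \<Longrightarrow> wadj H X \<alpha> (h \<oplus> k) = wadj H X \<alpha> h \<oplus> wadj H X \<alpha> k"
  by (induction \<alpha> arbitrary: h k) (auto simp: bounded_ops_in[OF adj_in] bounded_ops_add[OF adj_in])

lemma wadj_smult:
  "\<lbrakk>\<And>i. X i \<in> ops; h \<in> carrier H\<rbrakk> \<Longrightarrow> wadj H X \<alpha> (c \<odot> h) = c \<odot> wadj H X \<alpha> h"
  by (induction \<alpha> arbitrary: h) (auto simp: bounded_ops_in[OF adj_in] bounded_ops_smult[OF adj_in])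

lemma word_sum_in:
  fixes X :: "'n::finite \<Rightarrow> 'a \<Rightarrow> 'a"
  assumes "\<And>i. X i \<in> ops" "A \<in> ops"
  shows "word_sum H c X A N \<in> ops"
  unfolding word_sum_def by (rule op_finsum_in) (use assms in \<open>auto simp: word_op_in\<close>)

text \<open>Turns finite sums in the operator algebra into matrix coefficients; nearly all later
  arguments on defect sums use only this form.\<close>

lemma word_sum_ip:
  fixes X :: "'n::finite \<Rightarrow> 'a \<Rightarrow> 'a"
  assumes X: "\<And>i. X i \<in> ops" and A: "A \<in> ops" and h: "h \<in> carrier H" "k \<in> carrier H"
  shows "cinner H (word_sum H c X A N h) k =
    (\<Sum>\<alpha> | length \<alpha> \<le> N. of_real (c \<alpha>) * cinner H (A (wadj H X \<alpha> h)) (wadj H X \<alpha> k))"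
proof -
  note wo = word_op_in[of X, OF X]
  have "cinner H (word_sum H c X A N h) k = (\<Sum>\<alpha> | length \<alpha> \<le> N. cinner H ((of_real (c \<alpha>) \<odot>\<^bsub>op_alg H\<^esub>
        (word_op H X \<alpha> \<otimes>\<^bsub>op_alg H\<^esub> A \<otimes>\<^bsub>op_alg H\<^esub> adj H (word_op H X \<alpha>))) h) k)"
    unfolding word_sum_def by (rule op_finsum_ip) (use assms wo in auto)
  also have "\<dots> = (\<Sum>\<alpha> | length \<alpha> \<le> N. of_real (c \<alpha>) * cinner H (A (wadj H X \<alpha> h)) (wadj H X \<alpha> k))"
  proof (rule sum.cong[OF refl])
    fix \<alpha> :: "'n list"
    have "wadj H X \<alpha> h \<in> carrier H" using wadj_in[of X, OF X h(1)] .
    moreover from this have "A (wadj H X \<alpha> h) \<in> carrier H" using A bounded_ops_in by metis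
    moreover have "cinner H (word_op H X \<alpha> (A (wadj H X \<alpha> h))) k = cinner H (A (wadj H X \<alpha> h)) (wadj H X \<alpha> k)"
      using calculation adj_ip[OF wo[of \<alpha>], of "A (wadj H X \<alpha> h)" k] h by (simp add: adj_word_op X)
    ultimately show "cinner H ((of_real (c \<alpha>) \<odot>\<^bsub>op_alg H\<^esub>
        (word_op H X \<alpha> \<otimes>\<^bsub>op_alg H\<^esub> A \<otimes>\<^bsub>op_alg H\<^esub> adj H (word_op H X \<alpha>))) h) k =
        of_real (c \<alpha>) * cinner H (A (wadj H X \<alpha> h)) (wadj H X \<alpha> k)"
      using h A wo[of \<alpha>] by (simp add: compose_eq adj_word_op X bounded_ops_in cinner_smult_left)
  qed
  finally show ?thesis .
qed

lemma polarization:
  assumes "x \<in> carrier H" "y \<in> carrier H"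
  shows "4 * cinner H x y = of_real ((hnorm H (x \<oplus> y))\<^sup>2) - of_real ((hnorm H (x \<oplus> (-1) \<odot> y))\<^sup>2)
    + \<i> * of_real ((hnorm H (x \<oplus> \<i> \<odot> y))\<^sup>2) - \<i> * of_real ((hnorm H (x \<oplus> (-\<i>) \<odot> y))\<^sup>2)"
proof -
  have *: "of_real ((hnorm H (x \<oplus> c \<odot> y))\<^sup>2) = cinner H x x + cnj c * cinner H x y + c * cinner H y x + c * cnj c * cinner H y y" for c
    using assms by (simp add: ip_self[symmetric] ip_simps algebra_simps flip: of_real_power)
  have "of_real ((hnorm H (x \<oplus> y))\<^sup>2) = cinner H x x + cinner H x y + cinner H y x + cinner H y y"
    using *[of 1] smult_one[OF assms(2)] by simp
  then show ?thesis unfolding * by (simp add: algebra_simps)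
qed

end

text \<open>\<open>isometries\<close> only asks for preservation of norms; polarization recovers
  inner products.\<close>

lemma isometry_ip:
  assumes "hilbert_space H" "hilbert_space K" "V \<in> isometries H K" "x \<in> carrier H" "y \<in> carrier H"
  shows "cinner K (V x) (V y) = cinner H x y"
proof -
  interpret H: hilbert_space H by fact
  interpret K: hilbert_space K by fact
  have V: "V \<in> bounded_ops H K" "\<And>x. x \<in> carrier H \<Longrightarrow> hnorm K (V x) = hnorm H x"
    using assms(3) by (auto simp: isometries_def)
  have *: "hnorm K (V x \<oplus>\<^bsub>K\<^esub> c \<odot>\<^bsub>K\<^esub> V y) = hnorm H (x \<oplus>\<^bsub>H\<^esub> c \<odot>\<^bsub>H\<^esub> y)" for c
    using assms(4,5) V(2)[of "x \<oplus>\<^bsub>H\<^esub> c \<odot>\<^bsub>H\<^esub> y"] by (simp add: bounded_ops_add[OF V(1)] bounded_ops_smult[OF V(1)])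
  have "hnorm K (V x \<oplus>\<^bsub>K\<^esub> V y) = hnorm H (x \<oplus>\<^bsub>H\<^esub> y)"
    using assms(4,5) V(2)[of "x \<oplus>\<^bsub>H\<^esub> y"] by (simp add: bounded_ops_add[OF V(1)])
  then have "4 * cinner K (V x) (V y) = 4 * cinner H x y"
    using H.polarization[OF assms(4,5)] K.polarization[of "V x" "V y"] assms(4,5)
    by (simp add: * bounded_ops_in[OF V(1)])
  then show ?thesis by simp
qed

section \<open>The scalar space, l2 sums and direct sums\<close>

lemma hnorm_complex_space [simp]: "hnorm complex_space x = cmod x"
proof -
  have "Re (x * cnj x) = (cmod x)\<^sup>2" by (simp only: complex_norm_square[symmetric] Re_complex_of_real)
  then show ?thesis by (simp add: hnorm_def complex_space_def)
qed

lemma complex_space_simps [simp]: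
  "carrier complex_space = UNIV" "zero complex_space = 0" "add complex_space = (+)"
  "smult complex_space = (*)" "cinner complex_space = (\<lambda>x y. x * cnj y)"
  by (simp_all add: complex_space_def)

lemma hilbert_complex_space: "hilbert_space complex_space"
proof (rule hilbert_spaceI, goal_cases)
  case (15 x)
  have "Re (x * cnj x) = (cmod x)\<^sup>2" by (simp only: complex_norm_square[symmetric] Re_complex_of_real)
  then show ?case using 15 by simp
next
  case (16 s)
  have "Cauchy s" unfolding Cauchy_def dist_norm using 16(2) by simp
  then obtain l where "s \<longlonglongrightarrow> l" using Cauchy_convergent convergent_def by blast
  then have "(\<lambda>k. cmod (s k - l)) \<longlonglongrightarrow> 0" using tendsto_norm_zero LIM_zero by blast
  then show ?case by auto
qed (auto simp: algebra_simps)

lemma l2_sum_simps [simp]: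
  "zero (l2_sum D) = (\<lambda>i. \<zero>\<^bsub>D\<^esub>)" "add (l2_sum D) = (\<lambda>f g i. f i \<oplus>\<^bsub>D\<^esub> g i)"
  "smult (l2_sum D) = (\<lambda>c f i. c \<odot>\<^bsub>D\<^esub> f i)" "cinner (l2_sum D) = (\<lambda>f g. \<Sum>\<^sub>\<infinity>i. cinner D (f i) (g i))"
  by (simp_all add: l2_sum_def)

lemma l2_sum_carrier: "f \<in> carrier (l2_sum D) \<longleftrightarrow> (\<forall>i. f i \<in> carrier D) \<and> (\<lambda>i. (hnorm D (f i))\<^sup>2) summable_on UNIV"
  by (simp add: l2_sum_def)

lemma l2_sumD: "f \<in> carrier (l2_sum D) \<Longrightarrow> f i \<in> carrier D"
  by (simp add: l2_sum_def)

lemma sum_sq_le: "((a::real) + b)\<^sup>2 \<le> 2 * a\<^sup>2 + 2 * b\<^sup>2"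
  using sum_squares_bound[of a b] by (simp add: power2_sum)

context hilbert_space
begin

lemma l2_ip_abs_summable:
  assumes "f \<in> carrier (l2_sum H)" "g \<in> carrier (l2_sum H)"
  shows "(\<lambda>i. norm (cinner H (f i) (g i))) summable_on UNIV"
proof (rule summable_on_comparison_test)
  show "(\<lambda>i. (hnorm H (f i))\<^sup>2 + (hnorm H (g i))\<^sup>2) summable_on UNIV"
    using assms by (intro summable_on_add) (auto simp: l2_sum_carrier)
  show "norm (cinner H (f i) (g i)) \<le> (hnorm H (f i))\<^sup>2 + (hnorm H (g i))\<^sup>2" for i
    using Cauchy_Schwarz[OF l2_sumD[OF assms(1), of i] l2_sumD[OF assms(2), of i]]
      sum_squares_bound[of "hnorm H (f i)" "hnorm H (g i)"]
      mult_nonneg_nonneg[OF hnorm_nonneg[OF l2_sumD[OF assms(1), of i]] hnorm_nonneg[OF l2_sumD[OF assms(2), of i]]]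
    by linarith
qed simp

lemma l2_ip_summable:
  "\<lbrakk>f \<in> carrier (l2_sum H); g \<in> carrier (l2_sum H)\<rbrakk> \<Longrightarrow> (\<lambda>i. cinner H (f i) (g i)) summable_on UNIV"
  using abs_summable_summable[OF l2_ip_abs_summable] .

lemma hnorm_l2:
  assumes "f \<in> carrier (l2_sum H)"
  shows "hnorm (l2_sum H) f = sqrt (\<Sum>\<^sub>\<infinity>i. (hnorm H (f i))\<^sup>2)"
proof -
  have "Re (\<Sum>\<^sub>\<infinity>i. cinner H (f i) (f i)) = (\<Sum>\<^sub>\<infinity>i. Re (cinner H (f i) (f i)))"
    by (rule infsum_Re[symmetric]) (rule l2_ip_summable[OF assms assms])
  also have "\<dots> = (\<Sum>\<^sub>\<infinity>i. (hnorm H (f i))\<^sup>2)"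
    by (rule infsum_cong) (simp add: hnorm_sq l2_sumD[OF assms])
  finally show ?thesis by (simp add: hnorm_def)
qed

lemma hnorm_l2_ge:
  assumes "f \<in> carrier (l2_sum H)"
  shows "hnorm H (f i) \<le> hnorm (l2_sum H) f"
proof -
  have "(\<Sum>j\<in>{i}. (hnorm H (f j))\<^sup>2) \<le> (\<Sum>\<^sub>\<infinity>i. (hnorm H (f i))\<^sup>2)"
    by (rule finite_sum_le_infsum) (use assms in \<open>auto simp: l2_sum_carrier\<close>)
  then show ?thesis unfolding hnorm_l2[OF assms] by (simp add: real_le_rsqrt)
qed

lemma l2_add_in:
  assumes "f \<in> carrier (l2_sum H)" "g \<in> carrier (l2_sum H)"
  shows "(\<lambda>i. f i \<oplus> g i) \<in> carrier (l2_sum H)"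
  unfolding l2_sum_carrier
proof
  show "\<forall>i. f i \<oplus> g i \<in> carrier H" using l2_sumD[OF assms(1)] l2_sumD[OF assms(2)] by simp
  show "(\<lambda>i. (hnorm H (f i \<oplus> g i))\<^sup>2) summable_on UNIV"
  proof (rule summable_on_comparison_test)
    show "(\<lambda>i. 2 * (hnorm H (f i))\<^sup>2 + 2 * (hnorm H (g i))\<^sup>2) summable_on UNIV"
      using assms by (intro summable_on_add summable_on_cmult_right) (auto simp: l2_sum_carrier)
    show "(hnorm H (f i \<oplus> g i))\<^sup>2 \<le> 2 * (hnorm H (f i))\<^sup>2 + 2 * (hnorm H (g i))\<^sup>2" for i
      by (rule order_trans[OF power_mono[OF hnorm_triangle] sum_sq_le])
        (simp_all add: l2_sumD[OF assms(1)] l2_sumD[OF assms(2)])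
  qed simp
qed

lemma l2_smult_in:
  assumes "f \<in> carrier (l2_sum H)"
  shows "(\<lambda>i. c \<odot> f i) \<in> carrier (l2_sum H)"
  using assms by (auto simp: l2_sum_carrier hnorm_smult power_mult_distrib intro: summable_on_cmult_right)

text \<open>Coordinatewise limits exist by completeness of H. The Cauchy estimate passes to the
  limit on each finite index set with a bound independent of that set, which gives both square
  summability and convergence.\<close>

lemma l2_Cauchy_limit:
  fixes s :: "nat \<Rightarrow> 'i \<Rightarrow> 'a"
  assumes s: "\<And>k. s k \<in> carrier (l2_sum H)"
    and C: "\<And>e. e > 0 \<Longrightarrow> \<exists>N. \<forall>m\<ge>N. \<forall>k\<ge>N. hnorm (l2_sum H) (\<lambda>i. s m i \<oplus> (-1) \<odot> s k i) < e"
  shows "\<exists>l\<in>carrier (l2_sum H). (\<lambda>k. hnorm (l2_sum H) (\<lambda>i. s k i \<oplus> (-1) \<odot> l i)) \<longlonglongrightarrow> 0"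
proof -
  note sH = l2_sumD[OF s]
  have d: "(\<lambda>i. s m i \<ominus> s k i) \<in> carrier (l2_sum H)" for m k
    using l2_add_in[OF s l2_smult_in[OF s]] by (simp add: diff_smult sH)
  have C': "\<exists>N. \<forall>m\<ge>N. \<forall>k\<ge>N. hnorm (l2_sum H) (\<lambda>i. s m i \<ominus> s k i) < e" if "e > 0" for e
    using C[OF that] by (simp add: diff_smult sH)
  have "\<exists>l\<in>carrier H. (\<lambda>k. hnorm H (s k i \<ominus> l)) \<longlonglongrightarrow> 0" for i
  proof (rule complete[OF sH], intro allI impI)
    fix e :: real assume "e > 0"
    then obtain N where "\<forall>m\<ge>N. \<forall>k\<ge>N. hnorm (l2_sum H) (\<lambda>i. s m i \<ominus> s k i) < e" using C' by blast
    moreover have "hnorm H (s m i \<ominus> s k i) \<le> hnorm (l2_sum H) (\<lambda>i. s m i \<ominus> s k i)" for m k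
      using hnorm_l2_ge[OF d] .
    ultimately show "\<exists>N. \<forall>m\<ge>N. \<forall>k\<ge>N. hnorm H (s m i \<ominus> s k i) < e"
      using order_le_less_trans by blast
  qed
  then obtain l where lH: "\<And>i. l i \<in> carrier H" and lim: "\<And>i. (\<lambda>k. hnorm H (s k i \<ominus> l i)) \<longlonglongrightarrow> 0" by metis
  have fin: "(\<Sum>i\<in>F. (hnorm H (s m i \<ominus> l i))\<^sup>2) \<le> e\<^sup>2"
    if N: "\<And>k. k \<ge> N \<Longrightarrow> hnorm (l2_sum H) (\<lambda>i. s m i \<ominus> s k i) < e" and F: "finite F" and e: "e > 0" for m N e F
  proof (rule tendsto_upperbound)
    show "(\<lambda>k. \<Sum>i\<in>F. (hnorm H (s m i \<ominus> s k i))\<^sup>2) \<longlonglongrightarrow> (\<Sum>i\<in>F. (hnorm H (s m i \<ominus> l i))\<^sup>2)"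
    proof (intro tendsto_intros hnorm_tendsto)
      fix i
      have "hnorm H ((s m i \<ominus> s k i) \<ominus> (s m i \<ominus> l i)) = hnorm H (s k i \<ominus> l i)" for k
      proof -
        have "(s m i \<ominus> s k i) \<ominus> (s m i \<ominus> l i) = l i \<ominus> s k i"
          by (rule vec_eqI) (auto simp: sH lH ip_simps)
        then show ?thesis by (simp add: sH lH hnorm_diff_commute)
      qed
      then show "(\<lambda>k. hnorm H (s m i \<ominus> s k i \<ominus> (s m i \<ominus> l i))) \<longlonglongrightarrow> 0" using lim by simp
    qed (simp_all add: sH lH)
    have "(\<Sum>i\<in>F. (hnorm H (s m i \<ominus> s k i))\<^sup>2) \<le> e\<^sup>2" if "k \<ge> N" for k
    proof -
      have "(\<Sum>i\<in>F. (hnorm H (s m i \<ominus> s k i))\<^sup>2) \<le> (\<Sum>\<^sub>\<infinity>i. (hnorm H (s m i \<ominus> s k i))\<^sup>2)"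
        by (rule finite_sum_le_infsum) (use d F in \<open>auto simp: l2_sum_carrier\<close>)
      also have "\<dots> \<le> e\<^sup>2"
        using N[OF that] e unfolding hnorm_l2[OF d] by (simp add: real_sqrt_less_iff sqrt_le_D less_imp_le)
      finally show ?thesis .
    qed
    then show "\<forall>\<^sub>F k in sequentially. (\<Sum>i\<in>F. (hnorm H (s m i \<ominus> s k i))\<^sup>2) \<le> e\<^sup>2"
      using eventually_sequentially by blast
  qed simp
  have sl: "(\<lambda>i. s m i \<ominus> l i) \<in> carrier (l2_sum H) \<and> hnorm (l2_sum H) (\<lambda>i. s m i \<ominus> l i) \<le> e"
    if N: "\<And>k. k \<ge> N \<Longrightarrow> hnorm (l2_sum H) (\<lambda>i. s m i \<ominus> s k i) < e" and e: "e > 0" for m N e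
  proof -
    have sm: "(\<lambda>i. (hnorm H (s m i \<ominus> l i))\<^sup>2) summable_on UNIV"
      by (rule nonneg_bdd_above_summable_on) (use fin[OF N _ e] in \<open>auto intro!: bdd_aboveI[of _ "e\<^sup>2"]\<close>)
    then have c: "(\<lambda>i. s m i \<ominus> l i) \<in> carrier (l2_sum H)" by (simp add: l2_sum_carrier sH lH)
    have "(\<Sum>\<^sub>\<infinity>i. (hnorm H (s m i \<ominus> l i))\<^sup>2) \<le> e\<^sup>2"
      by (rule infsum_le_finite_sums[OF sm]) (use fin[OF N _ e] in auto)
    then show ?thesis unfolding hnorm_l2[OF c] using c e by (simp add: real_le_lsqrt)
  qed
  have tail: "\<exists>N. \<forall>m\<ge>N. (\<lambda>i. s m i \<ominus> l i) \<in> carrier (l2_sum H) \<and> hnorm (l2_sum H) (\<lambda>i. s m i \<ominus> l i) \<le> e"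
    if "e > 0" for e
  proof -
    obtain N where "\<forall>m\<ge>N. \<forall>k\<ge>N. hnorm (l2_sum H) (\<lambda>i. s m i \<ominus> s k i) < e" using C'[OF \<open>e > 0\<close>] by blast
    then show ?thesis using sl[OF _ \<open>e > 0\<close>] by meson
  qed
  \<comment> \<open>One term \<open>s N\<close> suffices: l is \<open>s N\<close> minus their square
    summable difference.\<close>
  obtain N where "(\<lambda>i. s N i \<ominus> l i) \<in> carrier (l2_sum H)" using tail[of 1] by auto
  then have "(\<lambda>i. s N i \<oplus> (-1) \<odot> (s N i \<ominus> l i)) \<in> carrier (l2_sum H)" using l2_add_in[OF s l2_smult_in] by simp
  moreover have "s N i \<oplus> (-1) \<odot> (s N i \<ominus> l i) = l i" for i
    by (rule vec_eqI) (auto simp: sH lH ip_simps)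
  ultimately have l: "l \<in> carrier (l2_sum H)" by simp
  have "(\<lambda>k. hnorm (l2_sum H) (\<lambda>i. s k i \<ominus> l i)) \<longlonglongrightarrow> 0"
  proof (rule LIMSEQ_I)
    fix r :: real assume "r > 0"
    then obtain N where N: "\<forall>m\<ge>N. (\<lambda>i. s m i \<ominus> l i) \<in> carrier (l2_sum H) \<and> hnorm (l2_sum H) (\<lambda>i. s m i \<ominus> l i) \<le> r/2"
      using tail[of "r/2"] by auto
    have "norm (hnorm (l2_sum H) (\<lambda>i. s m i \<ominus> l i) - 0) < r" if "m \<ge> N" for m
    proof -
      have "(\<lambda>i. s m i \<ominus> l i) \<in> carrier (l2_sum H)" and le: "hnorm (l2_sum H) (\<lambda>i. s m i \<ominus> l i) \<le> r/2"
        using N that by auto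
      then have "0 \<le> hnorm (l2_sum H) (\<lambda>i. s m i \<ominus> l i)" by (simp add: hnorm_l2 infsum_nonneg)
      then show ?thesis using le \<open>r > 0\<close> by simp
    qed
    then show "\<exists>no. \<forall>n\<ge>no. norm (hnorm (l2_sum H) (\<lambda>i. s n i \<ominus> l i) - 0) < r" by blast
  qed
  then show ?thesis using l by (auto simp: diff_smult sH lH)
qed

lemma hilbert_l2_sum: "hilbert_space (l2_sum H :: ('i \<Rightarrow> 'a) hilbert)"
proof (rule hilbert_spaceI, goal_cases)
  case 1 then show ?case by (simp add: l2_sum_carrier)
next
  case 2 then show ?case by (simp add: l2_add_in)
next
  case 3 then show ?case by (simp add: l2_smult_in)
next
  case 4 then show ?case by (simp add: l2_sumD a_assoc)
next
  case 5 then show ?case by (simp add: l2_sumD a_comm)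
next
  case 6 then show ?case by (simp add: l2_sumD)
next
  case 7 then show ?case by (simp add: l2_sumD smult_zero_eq)
next
  case (8 x) then show ?case using smult_one[OF l2_sumD[OF 8]] by simp
next
  case (9 a b x) then show ?case using smult_l_distr[of a b] by (simp add: l2_sumD)
next
  case 10 then show ?case by (simp add: l2_sumD smult_r_distr)
next
  case (11 a b x) then show ?case using smult_assoc1[of a b] by (simp add: l2_sumD)
next
  case (12 x y z) then show ?case by (simp add: cinner_add_left l2_sumD infsum_add[OF l2_ip_summable l2_ip_summable])
next
  case (13 c x y) then show ?case by (simp add: cinner_smult_left l2_sumD infsum_cmult_right[OF l2_ip_summable])
next
  case (14 x y)
  have "cnj (\<Sum>\<^sub>\<infinity>i. cinner H (y i) (x i)) = (\<Sum>\<^sub>\<infinity>i. cnj (cinner H (y i) (x i)))" by simp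
  also have "\<dots> = (\<Sum>\<^sub>\<infinity>i. cinner H (x i) (y i))"
    by (rule infsum_cong) (rule cinner_commute[symmetric, OF l2_sumD[OF 14(1)] l2_sumD[OF 14(2)]])
  finally show ?case by simp
next
  case (15 x)
  then obtain i where "x i \<noteq> \<zero>" by auto
  then have "0 < hnorm H (x i)" using l2_sumD[OF 15(1)] hnorm_nonneg hnorm_eq_0 by (metis order_le_less)
  then have "0 < hnorm (l2_sum H) x" using hnorm_l2_ge[OF 15(1)] by (rule less_le_trans)
  then show ?case by (simp add: hnorm_def)
next
  case (16 s) then show ?case using l2_Cauchy_limit[of s] by simp
qed

end

lemma hdsum_simps [simp]:
  "carrier (hdsum H K) = carrier H \<times> carrier K" "zero (hdsum H K) = (\<zero>\<^bsub>H\<^esub>, \<zero>\<^bsub>K\<^esub>)"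
  "add (hdsum H K) (x, y) (x', y') = (x \<oplus>\<^bsub>H\<^esub> x', y \<oplus>\<^bsub>K\<^esub> y')"
  "smult (hdsum H K) c (x, y) = (c \<odot>\<^bsub>H\<^esub> x, c \<odot>\<^bsub>K\<^esub> y)"
  "cinner (hdsum H K) (x, y) (x', y') = cinner H x x' + cinner K y y'"
  by (simp_all add: hdsum_def)

lemma hnorm_hdsum:
  assumes "hilbert_space H" "hilbert_space K" "x \<in> carrier H" "y \<in> carrier K"
  shows "hnorm (hdsum H K) (x, y) = sqrt ((hnorm H x)\<^sup>2 + (hnorm K y)\<^sup>2)"
  using assms hilbert_space.hnorm_sq[of H x] hilbert_space.hnorm_sq[of K y]
  by (simp add: hnorm_def[of "hdsum H K"])

lemma hilbert_hdsum:
  assumes "hilbert_space H" "hilbert_space K"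
  shows "hilbert_space (hdsum H K)"
proof -
  interpret H: hilbert_space H by fact
  interpret K: hilbert_space K by fact
  note hn = hnorm_hdsum[OF assms]
  show ?thesis
  proof (rule hilbert_spaceI, goal_cases)
    case (7 x) then show ?case by (cases x) (simp add: H.smult_zero_eq K.smult_zero_eq)
  next
    case (8 x) then show ?case using H.smult_one K.smult_one by (cases x) simp
  next
    case (9 a b x) then show ?case using H.smult_l_distr[of a b] K.smult_l_distr[of a b] by (cases x) simp
  next
    case (11 a b x) then show ?case using H.smult_assoc1[of a b] K.smult_assoc1[of a b] by (cases x) simp
  next
    case (14 x y) then show ?case
      using H.cinner_commute[of "fst x" "fst y"] K.cinner_commute[of "snd x" "snd y"] by (cases x; cases y) simp
  next
    case (15 x) then show ?case
      using H.cinner_pos[of "fst x"] K.cinner_pos[of "snd x"] H.ip_self_nonneg[of "fst x"] K.ip_self_nonneg[of "snd x"]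
      by (cases x) (auto intro: add_pos_nonneg add_nonneg_pos)
  next
    case (16 s)
    define a b where "a k = fst (s k)" and "b k = snd (s k)" for k
    have s: "s k = (a k, b k)" for k by (simp add: a_def b_def)
    have ab: "a k \<in> carrier H" "b k \<in> carrier K" for k using 16(1)[of k] by (auto simp: s)
    have sd: "hnorm (hdsum H K) (s m \<oplus>\<^bsub>hdsum H K\<^esub> (-1) \<odot>\<^bsub>hdsum H K\<^esub> s k) =
       sqrt ((hnorm H (a m \<ominus>\<^bsub>H\<^esub> a k))\<^sup>2 + (hnorm K (b m \<ominus>\<^bsub>K\<^esub> b k))\<^sup>2)" for m k
      by (simp add: s hn ab H.diff_smult K.diff_smult)
    have le: "hnorm H (a m \<ominus>\<^bsub>H\<^esub> a k) \<le> hnorm (hdsum H K) (s m \<oplus>\<^bsub>hdsum H K\<^esub> (-1) \<odot>\<^bsub>hdsum H K\<^esub> s k)"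
        "hnorm K (b m \<ominus>\<^bsub>K\<^esub> b k) \<le> hnorm (hdsum H K) (s m \<oplus>\<^bsub>hdsum H K\<^esub> (-1) \<odot>\<^bsub>hdsum H K\<^esub> s k)" for m k
      unfolding sd by (rule real_le_rsqrt; simp)+
    have "\<exists>l\<in>carrier H. (\<lambda>k. hnorm H (a k \<ominus>\<^bsub>H\<^esub> l)) \<longlonglongrightarrow> 0"
    proof (rule H.complete[OF ab(1)], intro allI impI)
      fix e :: real assume "e > 0"
      show "\<exists>N. \<forall>m\<ge>N. \<forall>k\<ge>N. hnorm H (a m \<ominus>\<^bsub>H\<^esub> a k) < e"
        using 16(2)[OF \<open>e > 0\<close>] order_le_less_trans[OF le(1), of _ _ e] by meson
    qed
    then obtain l where l: "l \<in> carrier H" "(\<lambda>k. hnorm H (a k \<ominus>\<^bsub>H\<^esub> l)) \<longlonglongrightarrow> 0" by blast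
    have "\<exists>l\<in>carrier K. (\<lambda>k. hnorm K (b k \<ominus>\<^bsub>K\<^esub> l)) \<longlonglongrightarrow> 0"
    proof (rule K.complete[OF ab(2)], intro allI impI)
      fix e :: real assume "e > 0"
      show "\<exists>N. \<forall>m\<ge>N. \<forall>k\<ge>N. hnorm K (b m \<ominus>\<^bsub>K\<^esub> b k) < e"
        using 16(2)[OF \<open>e > 0\<close>] order_le_less_trans[OF le(2), of _ _ e] by meson
    qed
    then obtain l' where l': "l' \<in> carrier K" "(\<lambda>k. hnorm K (b k \<ominus>\<^bsub>K\<^esub> l')) \<longlonglongrightarrow> 0" by blast
    have "(\<lambda>k. sqrt ((hnorm H (a k \<ominus>\<^bsub>H\<^esub> l))\<^sup>2 + (hnorm K (b k \<ominus>\<^bsub>K\<^esub> l'))\<^sup>2)) \<longlonglongrightarrow> sqrt (0\<^sup>2 + 0\<^sup>2)"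
      by (intro tendsto_intros l l')
    then show ?case using l(1) l'(1)
      by (intro bexI[of _ "(l, l')"]) (auto simp: s hn ab H.diff_smult K.diff_smult)
  qed (auto simp: H.a_ac K.a_ac H.smult_r_distr K.smult_r_distr H.ip_simps K.ip_simps algebra_simps)
qed

section \<open>Completion of a pre-inner product and positive definite kernels\<close>

text \<open>No vector space axioms are imposed on \<open>ad\<close> and \<open>sc\<close>; the
  intended instance is lists under append, where they fail. A point x enters only through the
  functional \<open>Q x\<close>, and there all identities hold.\<close>

locale pre_inner =
  fixes ad :: "'x \<Rightarrow> 'x \<Rightarrow> 'x" and sc :: "complex \<Rightarrow> 'x \<Rightarrow> 'x" and Q :: "'x \<Rightarrow> 'x \<Rightarrow> complex"
  assumes Q_ad: "Q (ad x y) z = Q x z + Q y z"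
    and Q_sc: "Q (sc c x) z = c * Q x z"
    and Q_comm: "Q x y = cnj (Q y x)"
    and Q_pos: "0 \<le> Re (Q x x)"
begin

lemma Q_ad_right: "Q z (ad x y) = Q z x + Q z y"
  using Q_comm[of z "ad x y"] Q_comm[of z x] Q_comm[of z y] by (simp add: Q_ad)

lemma Q_sc_right: "Q z (sc c x) = cnj c * Q z x"
  using Q_comm[of z "sc c x"] Q_comm[of z x] by (simp add: Q_sc)

definition nn :: "'x \<Rightarrow> real" where "nn x = sqrt (Re (Q x x))"

definition df :: "'x \<Rightarrow> 'x \<Rightarrow> 'x" where "df x y = ad x (sc (-1) y)"

lemma Q_df: "Q (df x y) z = Q x z - Q y z" "Q z (df x y) = Q z x - Q z y"
  by (simp_all add: df_def Q_ad Q_sc Q_ad_right Q_sc_right)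

lemmas Q_simps = Q_ad Q_sc Q_ad_right Q_sc_right Q_df

lemma nn_nonneg [simp]: "0 \<le> nn x"
  by (simp add: nn_def Q_pos)

lemma nn_sq: "(nn x)\<^sup>2 = Re (Q x x)"
  by (simp add: nn_def Q_pos)

lemma Q_self: "Q x x = of_real ((nn x)\<^sup>2)"
  using arg_cong[OF Q_comm[of x x], of Im] by (simp add: nn_sq complex_eq_iff)

lemma Q_Re_comm: "Re (Q y x) = Re (Q x y)"
  using Q_comm[of y x] by simp

lemma nn_sc: "nn (sc c x) = cmod c * nn x"
proof -
  have *: "Re (c * (cnj c * of_real t)) = (cmod c)\<^sup>2 * t" for t :: real
    unfolding cmod_power2 by (simp add: algebra_simps power2_eq_square)
  have "(nn (sc c x))\<^sup>2 = Re (c * (cnj c * Q x x))"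
    unfolding nn_sq Q_sc Q_sc_right by (simp only: mult.left_commute)
  also have "Q x x = of_real ((nn x)\<^sup>2)" by (rule Q_self)
  finally have "(nn (sc c x))\<^sup>2 = (cmod c * nn x)\<^sup>2" unfolding * by (simp add: power_mult_distrib)
  then show ?thesis by simp
qed

lemma nn_ad_sq: "(nn (ad x y))\<^sup>2 = (nn x)\<^sup>2 + 2 * Re (Q x y) + (nn y)\<^sup>2"
  using Q_Re_comm[of y x] by (simp add: nn_sq Q_simps)

lemma Q_CS: "cmod (Q x y) \<le> nn x * nn y"
proof -
  have "(cmod (Q x y))\<^sup>2 \<le> (nn x)\<^sup>2 * (nn y)\<^sup>2"
  proof (rule discriminant_le)
    fix c
    have "0 \<le> (nn (ad x (sc (cnj c) y)))\<^sup>2" by simp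
    also have "\<dots> = (nn x)\<^sup>2 + 2 * Re (c * Q x y) + (cmod c)\<^sup>2 * (nn y)\<^sup>2"
      by (subst nn_ad_sq) (simp add: nn_sc Q_simps power_mult_distrib)
    finally show "0 \<le> (nn x)\<^sup>2 + 2 * Re (c * Q x y) + (cmod c)\<^sup>2 * (nn y)\<^sup>2" .
  qed simp
  then have "(cmod (Q x y))\<^sup>2 \<le> (nn x * nn y)\<^sup>2" by (simp add: power_mult_distrib)
  then show ?thesis by (rule power2_le_imp_le) simp
qed

lemma nn_triangle: "nn (ad x y) \<le> nn x + nn y"
proof -
  have "Re (Q x y) \<le> nn x * nn y" using Q_CS[of x y] complex_Re_le_cmod order_trans by blast
  then have "(nn (ad x y))\<^sup>2 \<le> (nn x + nn y)\<^sup>2" by (simp add: nn_ad_sq power2_sum)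
  then show ?thesis by (rule power2_le_imp_le) simp
qed

lemma nn_df_triangle: "nn (df x z) \<le> nn (df x y) + nn (df y z)"
proof -
  have "nn (df x z) = nn (ad (df x y) (df y z))" by (simp add: nn_def Q_simps)
  then show ?thesis using nn_triangle by simp
qed

lemma nn_df_comm: "nn (df x y) = nn (df y x)"
  by (simp add: nn_def Q_simps)

lemma nn_le_df: "nn x \<le> nn (df x y) + nn y"
proof -
  have "nn x = nn (ad (df x y) y)" by (simp add: nn_def Q_simps)
  then show ?thesis using nn_triangle by simp
qed

text \<open>A point of the completion is the functional f = <x, .> itself, and s is a Cauchy
  sequence inducing it. Equivalent Cauchy sequences induce the same functional, so no quotient is
  formed.\<close>

definition approx :: "(nat \<Rightarrow> 'x) \<Rightarrow> ('x \<Rightarrow> complex) \<Rightarrow> bool" where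
  "approx s f \<longleftrightarrow> (\<forall>e>0. \<exists>N. \<forall>m\<ge>N. \<forall>n\<ge>N. nn (df (s m) (s n)) < e) \<and> (\<forall>y. (\<lambda>n. Q (s n) y) \<longlonglongrightarrow> f y)"

lemma approx_Cauchy: "\<lbrakk>approx s f; e > 0\<rbrakk> \<Longrightarrow> \<exists>N. \<forall>m\<ge>N. \<forall>n\<ge>N. nn (df (s m) (s n)) < e"
  by (simp add: approx_def)

lemma approx_lim: "approx s f \<Longrightarrow> (\<lambda>n. Q (s n) y) \<longlonglongrightarrow> f y"
  by (simp add: approx_def)

lemma approx_const: "approx (\<lambda>_. x) (Q x)"
proof -
  have "nn (df x x) = 0" by (simp add: nn_def Q_simps)
  then show ?thesis by (simp add: approx_def)
qed

lemma approx_ad: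
  assumes "approx s f" "approx t g"
  shows "approx (\<lambda>n. ad (s n) (t n)) (\<lambda>y. f y + g y)"
  unfolding approx_def
proof (intro conjI allI impI)
  fix e :: real assume "e > 0"
  then obtain N M where N: "\<forall>m\<ge>N. \<forall>n\<ge>N. nn (df (s m) (s n)) < e/2" and M: "\<forall>m\<ge>M. \<forall>n\<ge>M. nn (df (t m) (t n)) < e/2"
    using approx_Cauchy[OF assms(1), of "e/2"] approx_Cauchy[OF assms(2), of "e/2"] by auto
  have "nn (df (ad (s m) (t m)) (ad (s n) (t n))) < e" if "m \<ge> max N M" "n \<ge> max N M" for m n
  proof -
    have "nn (df (ad (s m) (t m)) (ad (s n) (t n))) = nn (ad (df (s m) (s n)) (df (t m) (t n)))"
      by (simp add: nn_def Q_simps)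
    also have "\<dots> \<le> nn (df (s m) (s n)) + nn (df (t m) (t n))" by (rule nn_triangle)
    also have "\<dots> < e/2 + e/2" using that N M by (intro add_strict_mono) auto
    finally show ?thesis by simp
  qed
  then show "\<exists>N. \<forall>m\<ge>N. \<forall>n\<ge>N. nn (df (ad (s m) (t m)) (ad (s n) (t n))) < e" by blast
qed (simp add: Q_simps tendsto_add approx_lim[OF assms(1)] approx_lim[OF assms(2)])

lemma approx_sc:
  assumes "approx s f" shows "approx (\<lambda>n. sc c (s n)) (\<lambda>y. c * f y)"
  unfolding approx_def
proof (intro conjI allI impI)
  fix e :: real assume "e > 0"
  then obtain N where N: "\<forall>m\<ge>N. \<forall>n\<ge>N. nn (df (s m) (s n)) < e / (cmod c + 1)"
    using approx_Cauchy[OF assms, of "e / (cmod c + 1)"] by (auto simp: add_nonneg_pos)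
  have "nn (df (sc c (s m)) (sc c (s n))) < e" if "m \<ge> N" "n \<ge> N" for m n
  proof -
    have "Q (df (sc c (s m)) (sc c (s n))) (df (sc c (s m)) (sc c (s n))) = Q (sc c (df (s m) (s n))) (sc c (df (s m) (s n)))"
      by (simp add: Q_simps algebra_simps)
    then have "nn (df (sc c (s m)) (sc c (s n))) = cmod c * nn (df (s m) (s n))"
      by (simp add: nn_sc[symmetric]) (simp add: nn_def)
    also have "\<dots> \<le> (cmod c + 1) * nn (df (s m) (s n))" by (simp add: mult_right_mono)
    also have "\<dots> < e" using N that
      by (simp add: pos_less_divide_eq add_nonneg_pos mult.commute[of "cmod c + 1"])
    finally show ?thesis .
  qed
  then show "\<exists>N. \<forall>m\<ge>N. \<forall>n\<ge>N. nn (df (sc c (s m)) (sc c (s n))) < e" by blast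
qed (simp add: Q_simps tendsto_mult_left approx_lim[OF assms])

lemma approx_df:
  assumes "approx s f" "approx t g"
  shows "approx (\<lambda>n. df (s n) (t n)) (\<lambda>y. f y - g y)"
  using approx_ad[OF assms(1) approx_sc[OF assms(2), of "-1"]] by (simp add: df_def)

lemma approx_bounded:
  assumes "approx s f" obtains B where "B > 0" "\<And>n. nn (s n) \<le> B"
proof -
  obtain N where N: "\<forall>m\<ge>N. \<forall>n\<ge>N. nn (df (s m) (s n)) < 1" using approx_Cauchy[OF assms, of 1] by auto
  define B where "B = (\<Sum>i\<le>N. nn (s i)) + 1"
  have *: "nn (s i) \<le> (\<Sum>i\<le>N. nn (s i))" if "i \<le> N" for i
    by (rule member_le_sum) (use that in auto)
  have "nn (s n) \<le> B" for n
  proof (cases "n \<le> N")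
    case True then show ?thesis using * by (simp add: B_def add.commute add_increasing)
  next
    case False
    then have "nn (df (s n) (s N)) < 1" using N by simp
    then show ?thesis using nn_le_df[of "s n" "s N"] *[of N] by (simp add: B_def)
  qed
  moreover have "B > 0" unfolding B_def by (simp add: add_nonneg_pos sum_nonneg)
  ultimately show ?thesis using that by blast
qed

text \<open>Shows that the limit of \<open>Q (s n) (t n)\<close> depends on s only through f, so the
  inner product of the completion does not depend on the chosen representatives.\<close>

lemma approx_Q_diff:
  assumes s: "approx s f" and t: "approx t g"
  shows "(\<lambda>n. Q (s n) (t n) - f (t n)) \<longlonglongrightarrow> 0"
proof (rule LIMSEQ_I)
  fix r :: real assume "r > 0"
  obtain B where B: "B > 0" "\<And>n. nn (t n) \<le> B" using approx_bounded[OF t] by metis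
  obtain N where N: "\<forall>m\<ge>N. \<forall>n\<ge>N. nn (df (s m) (s n)) < r / (2 * B)"
    using approx_Cauchy[OF s, of "r / (2 * B)"] \<open>r > 0\<close> B by auto
  have "norm (Q (s n) (t n) - f (t n) - 0) < r" if "n \<ge> N" for n
  proof -
    have "norm (Q (s n) (t n) - f (t n)) \<le> r / 2"
    proof (rule tendsto_upperbound)
      show "(\<lambda>m. norm (Q (s n) (t n) - Q (s m) (t n))) \<longlonglongrightarrow> norm (Q (s n) (t n) - f (t n))"
        by (intro tendsto_intros approx_lim[OF s])
      have "norm (Q (s n) (t n) - Q (s m) (t n)) \<le> r / 2" if "m \<ge> N" for m
      proof -
        have "norm (Q (s n) (t n) - Q (s m) (t n)) \<le> nn (df (s n) (s m)) * nn (t n)"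
          using Q_CS[of "df (s n) (s m)" "t n"] by (simp add: Q_simps)
        also have "\<dots> \<le> r / (2 * B) * B"
          using N that \<open>n \<ge> N\<close> B \<open>r > 0\<close> by (intro mult_mono) (auto intro: less_imp_le)
        finally show ?thesis using B by simp
      qed
      then show "\<forall>\<^sub>F m in sequentially. norm (Q (s n) (t n) - Q (s m) (t n)) \<le> r / 2"
        using eventually_sequentially by blast
    qed simp
    then show ?thesis using \<open>r > 0\<close> by simp
  qed
  then show "\<exists>no. \<forall>n\<ge>no. norm (Q (s n) (t n) - f (t n) - 0) < r" by blast
qed

lemma approx_convergent:
  assumes s: "approx s f" and t: "approx t g"
  shows "convergent (\<lambda>n. Q (s n) (t n))"
proof -
  obtain B where B: "B > 0" "\<And>n. nn (t n) \<le> B" using approx_bounded[OF t] by metis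
  obtain C where C: "C > 0" "\<And>n. nn (s n) \<le> C" using approx_bounded[OF s] by metis
  have "Cauchy (\<lambda>n. Q (s n) (t n))"
  proof (rule CauchyI)
    fix e :: real assume "e > 0"
    obtain N where N: "\<forall>m\<ge>N. \<forall>n\<ge>N. nn (df (s m) (s n)) < e / (2 * B)"
      using approx_Cauchy[OF s, of "e / (2 * B)"] \<open>e > 0\<close> B by auto
    obtain M where M: "\<forall>m\<ge>M. \<forall>n\<ge>M. nn (df (t m) (t n)) < e / (2 * C)"
      using approx_Cauchy[OF t, of "e / (2 * C)"] \<open>e > 0\<close> C by auto
    have "norm (Q (s m) (t m) - Q (s n) (t n)) < e" if mn: "m \<ge> max N M" "n \<ge> max N M" for m n
    proof -
      have "Q (s m) (t m) - Q (s n) (t n) = Q (df (s m) (s n)) (t m) + Q (s n) (df (t m) (t n))"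
        by (simp add: Q_simps)
      then have "norm (Q (s m) (t m) - Q (s n) (t n)) \<le> nn (df (s m) (s n)) * nn (t m) + nn (s n) * nn (df (t m) (t n))"
        using norm_triangle_ineq[of "Q (df (s m) (s n)) (t m)" "Q (s n) (df (t m) (t n))"]
          Q_CS[of "df (s m) (s n)" "t m"] Q_CS[of "s n" "df (t m) (t n)"] by simp
      also have "\<dots> \<le> nn (df (s m) (s n)) * B + C * nn (df (t m) (t n))"
        using B C by (intro add_mono mult_mono) auto
      also have "\<dots> < e / (2 * B) * B + C * (e / (2 * C))"
        using N M mn B C by (intro add_strict_mono mult_strict_right_mono mult_strict_left_mono) auto
      also have "\<dots> = e" using B C by simp
      finally show ?thesis .
    qed
    then show "\<exists>M. \<forall>m\<ge>M. \<forall>n\<ge>M. norm (Q (s m) (t m) - Q (s n) (t n)) < e" by blast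
  qed
  then show ?thesis by (rule Cauchy_convergent)
qed

lemma approx_unique_left:
  assumes "approx s f" "approx s' f" "approx t g"
  shows "lim (\<lambda>n. Q (s n) (t n)) = lim (\<lambda>n. Q (s' n) (t n))"
proof -
  have "(\<lambda>n. Q (s n) (t n)) \<longlonglongrightarrow> lim (\<lambda>n. Q (s' n) (t n))"
    using tendsto_add[OF tendsto_diff[OF approx_Q_diff[OF assms(1,3)] approx_Q_diff[OF assms(2,3)]]
      convergent_LIMSEQ_iff[THEN iffD1, OF approx_convergent[OF assms(2,3)]]] by simp
  then show ?thesis by (rule limI)
qed

definition rep :: "('x \<Rightarrow> complex) \<Rightarrow> nat \<Rightarrow> 'x" where "rep f = (SOME s. approx s f)"

definition completion :: "('x \<Rightarrow> complex) hilbert" where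
  "completion = \<lparr>carrier = {f. \<exists>s. approx s f}, mult = undefined, one = undefined,
     zero = (\<lambda>_. 0), add = (\<lambda>f g y. f y + g y), smult = (\<lambda>c f y. c * f y),
     cinner = (\<lambda>f g. lim (\<lambda>n. Q (rep f n) (rep g n)))\<rparr>"

lemma completion_simps [simp]:
  "carrier completion = {f. \<exists>s. approx s f}" "zero completion = (\<lambda>_. 0)"
  "add completion = (\<lambda>f g y. f y + g y)" "smult completion = (\<lambda>c f y. c * f y)"
  by (simp_all add: completion_def)

lemma rep: "approx s f \<Longrightarrow> approx (rep f) f"
  unfolding rep_def by (rule someI[of "\<lambda>s. approx s f"])

text \<open>The representatives fixed in \<open>completion\<close> are exchanged one slot at a time,
  with Hermitian symmetry carrying the left-slot result to the right slot.\<close>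

lemma ip_lim:
  assumes s: "approx s f" and t: "approx t g"
  shows "(\<lambda>n. Q (s n) (t n)) \<longlonglongrightarrow> cinner completion f g"
proof -
  have c: "(\<lambda>n. Q (s n) (t n)) \<longlonglongrightarrow> lim (\<lambda>n. Q (s n) (t n))"
    using approx_convergent[OF s t] by (simp add: convergent_LIMSEQ_iff)
  have sw: "lim (\<lambda>n. Q (u n) (w n)) = cnj (lim (\<lambda>n. Q (w n) (u n)))" if "approx u f'" "approx w g'" for u w f' g'
  proof (rule limI)
    have "(\<lambda>n. cnj (Q (w n) (u n))) \<longlonglongrightarrow> cnj (lim (\<lambda>n. Q (w n) (u n)))"
      using approx_convergent[OF that(2,1)] by (intro tendsto_cnj) (simp add: convergent_LIMSEQ_iff)
    then show "(\<lambda>n. Q (u n) (w n)) \<longlonglongrightarrow> cnj (lim (\<lambda>n. Q (w n) (u n)))" by (simp only: Q_comm[symmetric])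
  qed
  have "lim (\<lambda>n. Q (s n) (t n)) = lim (\<lambda>n. Q (rep f n) (t n))"
    by (rule approx_unique_left[OF s rep[OF s] t])
  also have "\<dots> = cnj (lim (\<lambda>n. Q (t n) (rep f n)))" by (rule sw[OF rep[OF s] t])
  also have "lim (\<lambda>n. Q (t n) (rep f n)) = lim (\<lambda>n. Q (rep g n) (rep f n))"
    by (rule approx_unique_left[OF t rep[OF t] rep[OF s]])
  also have "cnj \<dots> = lim (\<lambda>n. Q (rep f n) (rep g n))" by (rule sw[OF rep[OF s] rep[OF t], symmetric])
  finally show ?thesis using c by (simp add: completion_def)
qed

lemma ip_eqI: "\<lbrakk>approx s f; approx t g; (\<lambda>n. Q (s n) (t n)) \<longlonglongrightarrow> l\<rbrakk> \<Longrightarrow> cinner completion f g = l"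
  using ip_lim LIMSEQ_unique by blast

lemma hnorm_lim:
  assumes "approx s f" shows "(\<lambda>n. nn (s n)) \<longlonglongrightarrow> hnorm completion f"
  unfolding hnorm_def nn_def by (intro tendsto_intros ip_lim assms)

lemma hilbert_completion: "hilbert_space completion"
proof (rule hilbert_spaceI, goal_cases)
  case 1
  have "approx (\<lambda>_. sc 0 undefined) (\<lambda>y. 0 * Q undefined y)" by (intro approx_sc approx_const)
  then show ?case by auto
next
  case 2 then show ?case using approx_ad by fastforce
next
  case 3 then show ?case using approx_sc by fastforce
next
  case (12 x y z)
  then obtain s t u where a: "approx s x" "approx t y" "approx u z" by auto
  show ?case unfolding completion_simps
    by (rule ip_eqI[OF approx_ad[OF a(1,2)] a(3)]) (simp add: Q_simps tendsto_add ip_lim a)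
next
  case (13 c x y)
  then obtain s t where a: "approx s x" "approx t y" by auto
  show ?case unfolding completion_simps
    by (rule ip_eqI[OF approx_sc[OF a(1)] a(2)]) (simp add: Q_simps tendsto_mult_left ip_lim a)
next
  case (14 x y)
  then obtain s t where a: "approx s x" "approx t y" by auto
  have "(\<lambda>n. cnj (Q (t n) (s n))) \<longlonglongrightarrow> cnj (cinner completion y x)" by (intro tendsto_cnj ip_lim a)
  then have "(\<lambda>n. Q (s n) (t n)) \<longlonglongrightarrow> cnj (cinner completion y x)" by (simp flip: Q_comm)
  then show ?case by (rule ip_eqI[OF a])
next
  case (15 f)
  then obtain s where a: "approx s f" by auto
  have lim: "(\<lambda>n. nn (s n)) \<longlonglongrightarrow> hnorm completion f" by (rule hnorm_lim[OF a])
  have nonneg: "0 \<le> hnorm completion f" by (rule tendsto_lowerbound[OF lim]) auto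
  have "hnorm completion f \<noteq> 0"
  proof
    assume "hnorm completion f = 0"
    then have lim0: "(\<lambda>n. nn (s n)) \<longlonglongrightarrow> 0" using lim by simp
    \<comment> \<open>By Cauchy-Schwarz a vector of norm 0 is orthogonal to everything, so its
      functional vanishes.\<close>
    have "f y = 0" for y
    proof -
      have "(\<lambda>n. nn (s n) * nn y) \<longlonglongrightarrow> 0 * nn y" by (intro tendsto_intros lim0)
      then have "(\<lambda>n. Q (s n) y) \<longlonglongrightarrow> 0"
        using Q_CS by (intro Lim_null_comparison[of "\<lambda>n. Q (s n) y" "\<lambda>n. nn (s n) * nn y"]) auto
      then show ?thesis using approx_lim[OF a, of y] LIMSEQ_unique by blast
    qed
    then show False using 15(2) by auto
  qed
  then have "0 < hnorm completion f" using nonneg by simp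
  then show ?case by (simp add: hnorm_def)
next
  case (16 F)
  have "\<exists>s. approx s (F m)" for m using 16(1)[of m] by simp
  then obtain s where s: "\<And>m. approx (s m) (F m)" by metis
  have hn: "(\<lambda>j. nn (df (s m j) (s k j))) \<longlonglongrightarrow> hnorm completion (F m \<oplus>\<^bsub>completion\<^esub> (-1) \<odot>\<^bsub>completion\<^esub> F k)" for m k
    using hnorm_lim[OF approx_df[OF s s]] by simp
  have "\<exists>N. \<forall>i\<ge>N. \<forall>j\<ge>N. nn (df (s m i) (s m j)) < 1 / real (Suc m)" for m
    by (rule approx_Cauchy[OF s]) simp
  then obtain M where M: "\<And>m i j. \<lbrakk>i \<ge> M m; j \<ge> M m\<rbrakk> \<Longrightarrow> nn (df (s m i) (s m j)) < 1 / real (Suc m)" by metis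
  \<comment> \<open>Diagonal choice: \<open>x m\<close> lies within 1/(m+1) of all later terms
    representing \<open>F m\<close>, so x is Cauchy and represents the limit of F.\<close>
  define x where "x m = s m (M m)" for m
  have near: "nn (df (s m j) (x m)) < 1 / real (Suc m)" if "j \<ge> M m" for m j
    unfolding x_def using M[of m j "M m"] that by simp
  have xC: "\<exists>N. \<forall>m\<ge>N. \<forall>k\<ge>N. nn (df (x m) (x k)) < e" if "e > 0" for e
  proof -
    obtain N where N: "\<forall>m\<ge>N. \<forall>k\<ge>N. hnorm completion (F m \<oplus>\<^bsub>completion\<^esub> (-1) \<odot>\<^bsub>completion\<^esub> F k) < e/3"
      using 16(2)[of "e/3"] \<open>e > 0\<close> by auto
    obtain N' where N': "1 / real (Suc N') < e / 3"
      using \<open>e > 0\<close> by (metis nat_approx_posE zero_less_divide_iff zero_less_numeral)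
    have small: "1 / real (Suc m) < e / 3" if "m \<ge> N'" for m
      by (rule le_less_trans[OF _ N']) (use that in \<open>simp add: frac_le\<close>)
    have "nn (df (x m) (x k)) < e" if mk: "m \<ge> max N N'" "k \<ge> max N N'" for m k
    proof -
      have "\<forall>\<^sub>F j in sequentially. nn (df (s m j) (s k j)) < e / 3"
        using N mk by (intro order_tendstoD(2)[OF hn]) auto
      moreover have "\<forall>\<^sub>F j in sequentially. j \<ge> M m" "\<forall>\<^sub>F j in sequentially. j \<ge> M k"
        by (rule eventually_ge_at_top)+
      ultimately have "\<forall>\<^sub>F j in sequentially. nn (df (x m) (x k)) < e"
      proof eventually_elim
        case (elim j)
        have "nn (df (x m) (x k)) \<le> nn (df (x m) (s m j)) + (nn (df (s m j) (s k j)) + nn (df (s k j) (x k)))"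
          using nn_df_triangle[of "x m" "x k" "s m j"] nn_df_triangle[of "s m j" "x k" "s k j"] by simp
        then show ?case using near[OF elim(2)] near[OF elim(3)] small[of m] small[of k] mk elim(1)
            nn_df_comm[of "x m" "s m j"] by simp
      qed
      then show ?thesis by simp
    qed
    then show ?thesis by blast
  qed
  have "convergent (\<lambda>m. Q (x m) y)" for y
  proof (rule Cauchy_convergent, rule CauchyI)
    fix e :: real assume "e > 0"
    then obtain N where N: "\<forall>m\<ge>N. \<forall>k\<ge>N. nn (df (x m) (x k)) < e / (nn y + 1)"
      using xC[of "e / (nn y + 1)"] by (auto simp: add_nonneg_pos)
    have "norm (Q (x m) y - Q (x k) y) < e" if "m \<ge> N" "k \<ge> N" for m k
    proof -
      have "norm (Q (x m) y - Q (x k) y) \<le> nn (df (x m) (x k)) * nn y"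
        using Q_CS[of "df (x m) (x k)" y] by (simp add: Q_simps)
      also have "\<dots> \<le> nn (df (x m) (x k)) * (nn y + 1)" by (intro mult_left_mono) auto
      also have "\<dots> < e" using N that
      by (simp add: pos_less_divide_eq add_nonneg_pos mult.commute[of "cmod c + 1"])
      finally show ?thesis .
    qed
    then show "\<exists>M. \<forall>m\<ge>M. \<forall>n\<ge>M. norm (Q (x m) y - Q (x n) y) < e" by blast
  qed
  then have al: "approx x (\<lambda>y. lim (\<lambda>m. Q (x m) y))" (is "approx x ?l")
    using xC by (simp add: approx_def convergent_LIMSEQ_iff)
  have "(\<lambda>k. hnorm completion (F k \<oplus>\<^bsub>completion\<^esub> (-1) \<odot>\<^bsub>completion\<^esub> ?l)) \<longlonglongrightarrow> 0"
  proof (rule LIMSEQ_I)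
    fix r :: real assume "r > 0"
    obtain N where N: "\<forall>m\<ge>N. \<forall>k\<ge>N. nn (df (x m) (x k)) < r/4" using xC[of "r/4"] \<open>r > 0\<close> by auto
    obtain N' where N': "1 / real (Suc N') < r / 4"
      using \<open>r > 0\<close> by (metis nat_approx_posE zero_less_divide_iff zero_less_numeral)
    have small: "1 / real (Suc m) < r / 4" if "m \<ge> N'" for m
      by (rule le_less_trans[OF _ N']) (use that in \<open>simp add: frac_le\<close>)
    have "norm (hnorm completion (F k \<oplus>\<^bsub>completion\<^esub> (-1) \<odot>\<^bsub>completion\<^esub> ?l) - 0) < r" if k: "k \<ge> max N N'" for k
    proof -
      have lim: "(\<lambda>j. nn (df (s k j) (x j))) \<longlonglongrightarrow> hnorm completion (F k \<oplus>\<^bsub>completion\<^esub> (-1) \<odot>\<^bsub>completion\<^esub> ?l)"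
        using hnorm_lim[OF approx_df[OF s al]] by simp
      have "nn (df (s k j) (x j)) \<le> r/2" if "j \<ge> max N (M k)" for j
        using nn_df_triangle[of "s k j" "x j" "x k"] near[of k j] small[of k] that k N by fastforce
      then have "\<forall>\<^sub>F j in sequentially. nn (df (s k j) (x j)) \<le> r/2" using eventually_sequentially by blast
      then have "hnorm completion (F k \<oplus>\<^bsub>completion\<^esub> (-1) \<odot>\<^bsub>completion\<^esub> ?l) \<le> r/2"
        by (rule tendsto_upperbound[OF lim]) simp
      moreover have "0 \<le> hnorm completion (F k \<oplus>\<^bsub>completion\<^esub> (-1) \<odot>\<^bsub>completion\<^esub> ?l)"
        by (rule tendsto_lowerbound[OF lim]) auto
      ultimately show ?thesis using \<open>r > 0\<close> by simp
    qed
    then show "\<exists>no. \<forall>n\<ge>no. norm (hnorm completion (F n \<oplus>\<^bsub>completion\<^esub> (-1) \<odot>\<^bsub>completion\<^esub> ?l) - 0) < r" by blast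
  qed
  then show ?case using al by (intro bexI[of _ ?l]) auto
qed (auto simp: algebra_simps)

lemma completion_dense:
  assumes f: "f \<in> carrier completion" and e: "e > 0"
  shows "\<exists>x. hnorm completion (f \<ominus>\<^bsub>completion\<^esub> Q x) < e"
proof -
  interpret C: hilbert_space completion by (rule hilbert_completion)
  obtain s where s: "approx s f" using f by auto
  obtain N where N: "\<forall>m\<ge>N. \<forall>n\<ge>N. nn (df (s m) (s n)) < e/2" using approx_Cauchy[OF s, of "e/2"] e by auto
  have "(\<lambda>j. nn (df (s j) (s N))) \<longlonglongrightarrow> hnorm completion (\<lambda>y. f y - Q (s N) y)"
    using hnorm_lim[OF approx_df[OF s approx_const]] .
  moreover have "\<forall>\<^sub>F j in sequentially. nn (df (s j) (s N)) \<le> e/2"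
    using N less_imp_le[of _ "e/2"] unfolding eventually_sequentially by blast
  ultimately have "hnorm completion (\<lambda>y. f y - Q (s N) y) \<le> e/2"
    by (rule tendsto_upperbound) simp
  moreover have "f \<ominus>\<^bsub>completion\<^esub> Q (s N) = (\<lambda>y. f y - Q (s N) y)"
    using C.diff_smult[OF f, of "Q (s N)"] approx_const by auto
  ultimately show ?thesis using e by (intro exI[of _ "s N"]) simp
qed

lemma completion_Q:
  "Q x \<in> carrier completion" "cinner completion (Q x) (Q y) = Q x y"
  using approx_const ip_eqI[OF approx_const approx_const, of x y "Q x y"] by auto

end

section \<open>Positive definite kernels and their Kolmogorov spaces\<close>

definition kform :: "('s \<Rightarrow> 's \<Rightarrow> complex) \<Rightarrow> (complex \<times> 's) list \<Rightarrow> (complex \<times> 's) list \<Rightarrow> complex" where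
  "kform k xs ys = (\<Sum>p\<leftarrow>xs. \<Sum>q\<leftarrow>ys. fst p * cnj (fst q) * k (snd p) (snd q))"

definition scale :: "complex \<Rightarrow> (complex \<times> 's) list \<Rightarrow> (complex \<times> 's) list" where
  "scale c = map (\<lambda>p. (c * fst p, snd p))"

definition psd_kernel :: "('s \<Rightarrow> 's \<Rightarrow> complex) \<Rightarrow> bool" where
  "psd_kernel k \<longleftrightarrow> (\<forall>s t. k t s = cnj (k s t)) \<and> (\<forall>xs. 0 \<le> Re (kform k xs xs))"

primrec comb :: "'a hilbert \<Rightarrow> ('s \<Rightarrow> 'a) \<Rightarrow> (complex \<times> 's) list \<Rightarrow> 'a" where
  "comb K v [] = \<zero>\<^bsub>K\<^esub>"
| "comb K v (p # xs) = fst p \<odot>\<^bsub>K\<^esub> v (snd p) \<oplus>\<^bsub>K\<^esub> comb K v xs"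

text \<open>A minimal Kolmogorov decomposition: vectors with Gram matrix k whose finite combinations
  are dense. Density makes operators and vectors determined by their inner products with the
  \<open>v t\<close>.\<close>

definition realizes :: "'a hilbert \<Rightarrow> ('s \<Rightarrow> 'a) \<Rightarrow> ('s \<Rightarrow> 's \<Rightarrow> complex) \<Rightarrow> bool" where
  "realizes K v k \<longleftrightarrow> hilbert_space K \<and> (\<forall>s. v s \<in> carrier K) \<and> (\<forall>s t. cinner K (v s) (v t) = k s t) \<and>
     (\<forall>x\<in>carrier K. \<forall>e>0. \<exists>xs. hnorm K (x \<ominus>\<^bsub>K\<^esub> comb K v xs) < e)"

lemma kform_Nil [simp]: "kform k [] ys = 0" "kform k xs [] = 0"
  by (induction xs) (auto simp: kform_def)

lemma kform_Cons: "kform k (p # xs) ys = fst p * kform k [(1, snd p)] ys + kform k xs ys"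
  by (simp add: kform_def mult.assoc sum_list_const_mult)

lemma kform_append: "kform k (xs @ xs') ys = kform k xs ys + kform k xs' ys"
  by (simp add: kform_def)

lemma kform_scale: "kform k (scale c xs) ys = c * kform k xs ys"
  by (simp add: scale_def kform_def o_def mult.assoc sum_list_const_mult)

lemma kform_comm:
  assumes "\<And>s t. k t s = cnj (k s t)"
  shows "kform k xs ys = cnj (kform k ys xs)"
proof -
  have sg: "kform k [(1, s)] ys = cnj (kform k ys [(1, s)])" for s
    by (induction ys) (simp_all add: kform_def assms[of s])
  have sp: "kform k ys (p # xs) = cnj (fst p) * kform k ys [(1, snd p)] + kform k ys xs" for p xs
    by (induction ys) (simp_all add: kform_def algebra_simps)
  show ?thesis
  proof (induction xs)
    case (Cons p xs)
    show ?case by (subst kform_Cons, subst sp, subst sg, subst Cons.IH) simp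
  qed simp
qed

lemma psd_pre_inner: "psd_kernel k \<Longrightarrow> pre_inner (@) scale (kform k)"
  by unfold_locales (auto simp: psd_kernel_def kform_append kform_scale intro: kform_comm)

text \<open>Formal linear combinations, encoded as lists, carry the pre-inner product
  \<open>kform k\<close>; \<open>v s\<close> is the class of the one-term combination. The resulting
  carrier type is large and is reduced later.\<close>

lemma kernel_realization:
  fixes k :: "'s \<Rightarrow> 's \<Rightarrow> complex"
  assumes "psd_kernel k"
  shows "\<exists>(K :: ((complex \<times> 's) list \<Rightarrow> complex) hilbert) v. realizes K v k"
proof -
  interpret pre_inner "(@)" scale "kform k" using assms by (rule psd_pre_inner)
  interpret C: hilbert_space completion by (rule hilbert_completion)
  define v where "v s = kform k [(1, s)]" for s
  have cmb: "comb completion v xs = kform k xs" for xs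
  proof (induction xs)
    case (Cons p xs)
    then show ?case by (simp add: v_def fun_eq_iff) (metis kform_Cons)
  qed (simp add: fun_eq_iff)
  have "realizes completion v k" unfolding realizes_def cmb
  proof (intro conjI allI ballI impI)
    show "v s \<in> carrier completion" for s unfolding v_def by (rule completion_Q)
    show "cinner completion (v s) (v t) = k s t" for s t
      unfolding v_def completion_Q(2) by (simp add: kform_def)
  qed (rule hilbert_completion completion_dense; assumption?)+
  then show ?thesis by blast
qed

lemma (in hilbert_space) comb_in: "(\<And>s. v s \<in> carrier H) \<Longrightarrow> comb H v xs \<in> carrier H"
  by (induction xs) auto

lemma (in hilbert_space) comb_ip_left:
  assumes v: "\<And>s. v s \<in> carrier H" and y: "y \<in> carrier H"
  shows "cinner H (comb H v xs) y = (\<Sum>p\<leftarrow>xs. fst p * cinner H (v (snd p)) y)"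
  by (induction xs) (use assms in \<open>auto simp: comb_in cinner_add_left cinner_smult_left\<close>)

lemma (in hilbert_space) comb_ip:
  assumes v: "\<And>s. v s \<in> carrier H" and k: "\<And>s t. cinner H (v s) (v t) = k s t"
  shows "cinner H (comb H v xs) (comb H v ys) = kform k xs ys"
proof -
  have *: "cinner H (v s) (comb H v ys) = (\<Sum>q\<leftarrow>ys. cnj (fst q) * k s (snd q))" for s
    by (induction ys) (use v k in \<open>auto simp: comb_in ip_simps\<close>)
  show ?thesis
    by (subst comb_ip_left) (simp_all add: v comb_in * kform_def mult.assoc sum_list_const_mult)
qed

locale realization =
  fixes K :: "'a hilbert" and v :: "'s \<Rightarrow> 'a" and k :: "'s \<Rightarrow> 's \<Rightarrow> complex"
  assumes real: "realizes K v k"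
begin

sublocale K: hilbert_space K using real by (simp add: realizes_def)

lemma v_in [simp, intro]: "v s \<in> carrier K" using real by (simp add: realizes_def)
lemma gram: "cinner K (v s) (v t) = k s t" using real by (simp add: realizes_def)
lemma dense: "\<lbrakk>x \<in> carrier K; e > 0\<rbrakk> \<Longrightarrow> \<exists>xs. hnorm K (x \<ominus>\<^bsub>K\<^esub> comb K v xs) < e"
  using real by (simp add: realizes_def)
lemma comb_in [simp, intro]: "comb K v xs \<in> carrier K" by (rule K.comb_in) simp
lemma comb_ip: "cinner K (comb K v xs) (comb K v ys) = kform k xs ys" by (rule K.comb_ip) (simp_all add: gram)

lemma total_eqI:
  assumes x: "x \<in> carrier K" and y: "y \<in> carrier K" and eq: "\<And>t. cinner K x (v t) = cinner K y (v t)"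
  shows "x = y"
proof (rule K.vec_eqI_diff[OF x y])
  let ?z = "x \<ominus>\<^bsub>K\<^esub> y"
  have z: "?z \<in> carrier K" using x y by simp
  have 0: "cinner K ?z (comb K v xs) = 0" for xs
    by (induction xs) (use x y eq in \<open>auto simp: K.ip_simps\<close>)
  have "hnorm K ?z \<le> e" if "e > 0" for e
  proof -
    obtain xs where xs: "hnorm K (?z \<ominus>\<^bsub>K\<^esub> comb K v xs) < e" using dense[OF z \<open>e > 0\<close>] by blast
    have "cinner K ?z ?z = cinner K ?z (?z \<ominus>\<^bsub>K\<^esub> comb K v xs)" by (simp only: K.ip_diff_right[OF z comb_in z] 0 diff_zero)
    then have "(hnorm K ?z)\<^sup>2 = cmod (cinner K ?z (?z \<ominus>\<^bsub>K\<^esub> comb K v xs))"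
      using K.ip_self[OF z] by (metis abs_of_nonneg norm_of_real zero_le_power2)
    also have "\<dots> \<le> hnorm K ?z * hnorm K (?z \<ominus>\<^bsub>K\<^esub> comb K v xs)" by (rule K.Cauchy_Schwarz) (use z in auto)
    also have "\<dots> \<le> hnorm K ?z * e" using xs z by (intro mult_left_mono) (auto intro: less_imp_le)
    finally have "hnorm K ?z * hnorm K ?z \<le> hnorm K ?z * e" by (simp add: power2_eq_square)
    then show ?thesis using K.hnorm_nonneg[OF z] that by (cases "hnorm K ?z = 0") (auto simp: mult_le_cancel_left)
  qed
  then show "hnorm K ?z = 0" using K.hnorm_nonneg[OF z] by (metis dual_order.antisym field_le_epsilon add_0)
qed

text \<open>Continuous extension of v s \<mapsto> v (\<sigma> s). The image of x is the limit along
  approximating combinations, but it is pinned down by its inner products <x, v (\<tau> t)>; hence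
  linearity needs no inspection of the approximating sequences.\<close>

lemma kernel_op:
  assumes adj: "\<And>s t. k (\<sigma> s) t = k s (\<tau> t)" and M: "0 \<le> M"
    and bd: "\<And>xs. Re (kform k (map (apsnd \<sigma>) xs) (map (apsnd \<sigma>) xs)) \<le> M\<^sup>2 * Re (kform k xs xs)"
  obtains A where "A \<in> bounded_ops K K" "bounded_by K A M" "\<And>s. A (v s) = v (\<sigma> s)"
    "\<And>x t. x \<in> carrier K \<Longrightarrow> cinner K (A x) (v t) = cinner K x (v (\<tau> t))"
proof -
  let ?m = "\<lambda>xs. map (apsnd \<sigma>) xs"
  have ap: "kform k (?m xs) [(1, t)] = kform k xs [(1, \<tau> t)]" for xs t
    by (induction xs) (auto simp: kform_def adj)
  have cv: "cinner K (comb K v xs) (v t) = kform k xs [(1, t)]" for xs t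
    by (subst K.comb_ip_left) (simp_all add: kform_def gram )
  have nb: "hnorm K (comb K v (?m xs)) \<le> M * hnorm K (comb K v xs)" for xs
  proof -
    have "(hnorm K (comb K v (?m xs)))\<^sup>2 \<le> (M * hnorm K (comb K v xs))\<^sup>2"
      using bd[of xs] by (simp add: K.hnorm_sq comb_ip power_mult_distrib)
    then show ?thesis by (rule power2_le_imp_le) (use M in simp)
  qed
  have df: "comb K v xs \<ominus>\<^bsub>K\<^esub> comb K v ys = comb K v (xs @ scale (-1) ys)" for xs ys
  proof (rule K.vec_eqI)
    fix z assume z: "z \<in> carrier K"
    have "cinner K (comb K v (scale (-1) ys)) z = - cinner K (comb K v ys) z"
      by (induction ys) (use z in \<open>auto simp: scale_def K.ip_simps \<close>)
    moreover have "cinner K (comb K v (xs @ ws)) z = cinner K (comb K v xs) z + cinner K (comb K v ws) z" for ws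
      by (induction xs) (use z in \<open>auto simp: K.ip_simps\<close>)
    ultimately show "cinner K (comb K v xs \<ominus>\<^bsub>K\<^esub> comb K v ys) z = cinner K (comb K v (xs @ scale (-1) ys)) z"
      using z by (simp add: K.ip_diff_left)
  qed auto
  have msc: "?m (xs @ scale c ys) = ?m xs @ scale c (?m ys)" for xs ys c
    by (simp add: scale_def )
  have nd: "hnorm K (comb K v (?m xs) \<ominus>\<^bsub>K\<^esub> comb K v (?m ys)) \<le> M * hnorm K (comb K v xs \<ominus>\<^bsub>K\<^esub> comb K v ys)" for xs ys
    using nb[of "xs @ scale (-1) ys"] by (simp only: df msc)
  have ex: "\<exists>y\<in>carrier K. (\<forall>t. cinner K y (v t) = cinner K x (v (\<tau> t))) \<and> hnorm K y \<le> M * hnorm K x"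
    if x: "x \<in> carrier K" for x
  proof -
    have "\<exists>xs. hnorm K (x \<ominus>\<^bsub>K\<^esub> comb K v xs) < 1 / real (Suc n)" for n by (rule dense[OF x]) simp
    then obtain X where X: "\<And>n. hnorm K (x \<ominus>\<^bsub>K\<^esub> comb K v (X n)) < 1 / real (Suc n)" by metis
    have Xl: "(\<lambda>n. hnorm K (comb K v (X n) \<ominus>\<^bsub>K\<^esub> x)) \<longlonglongrightarrow> 0"
    proof (rule Lim_null_comparison)
      show "(\<lambda>n. 1 / real (Suc n)) \<longlonglongrightarrow> 0" by (rule LIMSEQ_Suc[OF lim_1_over_n])
      show "\<forall>\<^sub>F n in sequentially. norm (hnorm K (comb K v (X n) \<ominus>\<^bsub>K\<^esub> x)) \<le> 1 / real (Suc n)"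
        using X x by (intro always_eventually allI) (simp add: K.hnorm_diff_commute[of _ x] less_imp_le)
    qed
    have "\<exists>y\<in>carrier K. (\<lambda>n. hnorm K (comb K v (?m (X n)) \<ominus>\<^bsub>K\<^esub> y)) \<longlonglongrightarrow> 0"
    proof (rule K.complete[OF comb_in], intro allI impI)
      fix e :: real assume "e > 0"
      then have "\<forall>\<^sub>F n in sequentially. hnorm K (comb K v (X n) \<ominus>\<^bsub>K\<^esub> x) < e / (2 * (M + 1))"
        using M by (intro order_tendstoD(2)[OF Xl]) auto
      then obtain N where N: "\<And>n. n \<ge> N \<Longrightarrow> hnorm K (comb K v (X n) \<ominus>\<^bsub>K\<^esub> x) < e / (2 * (M + 1))"
        by (auto simp: eventually_sequentially)
      have "hnorm K (comb K v (?m (X m)) \<ominus>\<^bsub>K\<^esub> comb K v (?m (X n))) < e" if "m \<ge> N" "n \<ge> N" for m n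
      proof -
        have "hnorm K (comb K v (X m) \<ominus>\<^bsub>K\<^esub> comb K v (X n)) \<le> hnorm K (comb K v (X m) \<ominus>\<^bsub>K\<^esub> x) + hnorm K (x \<ominus>\<^bsub>K\<^esub> comb K v (X n))"
          by (rule K.hnorm_diff_triangle) (use x in auto)
        also have "\<dots> < e / (2 * (M + 1)) + e / (2 * (M + 1))"
          using N[OF that(1)] N[OF that(2)] x by (simp add: K.hnorm_diff_commute[of x])
        also have "\<dots> = e / (M + 1)"
        proof -
          have "e / (2 * q) + e / (2 * q) = e / q" for q :: real by simp
          then show ?thesis .
        qed
        finally have lt: "hnorm K (comb K v (X m) \<ominus>\<^bsub>K\<^esub> comb K v (X n)) < e / (M + 1)" .
        have "M * hnorm K (comb K v (X m) \<ominus>\<^bsub>K\<^esub> comb K v (X n)) \<le> (M + 1) * hnorm K (comb K v (X m) \<ominus>\<^bsub>K\<^esub> comb K v (X n))"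
          by (intro mult_right_mono) auto
        also have "\<dots> < e" using lt M by (simp add: pos_less_divide_eq mult.commute[of "M + 1"])
        finally show ?thesis using nd[of "X m" "X n"] by linarith
      qed
      then show "\<exists>N. \<forall>m\<ge>N. \<forall>k\<ge>N. hnorm K (comb K v (?m (X m)) \<ominus>\<^bsub>K\<^esub> comb K v (?m (X k))) < e" by blast
    qed
    then obtain y where y: "y \<in> carrier K" and yl: "(\<lambda>n. hnorm K (comb K v (?m (X n)) \<ominus>\<^bsub>K\<^esub> y)) \<longlonglongrightarrow> 0" by blast
    have "cinner K y (v t) = cinner K x (v (\<tau> t))" for t
    proof (rule LIMSEQ_unique)
      show "(\<lambda>n. cinner K (comb K v (?m (X n))) (v t)) \<longlonglongrightarrow> cinner K y (v t)"
        by (rule K.ip_tendsto[OF comb_in y yl v_in])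
      show "(\<lambda>n. cinner K (comb K v (?m (X n))) (v t)) \<longlonglongrightarrow> cinner K x (v (\<tau> t))"
        using K.ip_tendsto[OF comb_in x Xl v_in[of "\<tau> t"]] by (simp only: cv ap)
    qed
    moreover have "hnorm K y \<le> M * hnorm K x"
    proof (rule LIMSEQ_le)
      show "(\<lambda>n. hnorm K (comb K v (?m (X n)))) \<longlonglongrightarrow> hnorm K y" by (rule K.hnorm_tendsto[OF comb_in y yl])
      show "(\<lambda>n. M * hnorm K (comb K v (X n))) \<longlonglongrightarrow> M * hnorm K x"
        by (intro tendsto_intros K.hnorm_tendsto[OF comb_in x Xl])
    qed (use nb in blast)
    ultimately show ?thesis using y by blast
  qed
  then obtain f where f: "\<And>x. x \<in> carrier K \<Longrightarrow> f x \<in> carrier K"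
    "\<And>x t. x \<in> carrier K \<Longrightarrow> cinner K (f x) (v t) = cinner K x (v (\<tau> t))"
    "\<And>x. x \<in> carrier K \<Longrightarrow> hnorm K (f x) \<le> M * hnorm K x" by metis
  define A where "A = (\<lambda>x\<in>carrier K. f x)"
  have A1: "A (v s) = v (\<sigma> s)" for s
    by (rule total_eqI) (simp_all add: A_def f gram adj)
  have A2: "A \<in> bounded_ops K K"
  proof (rule bounded_opsI[where M=M])
    show "A \<in> carrier K \<rightarrow>\<^sub>E carrier K" using f(1) by (auto simp: A_def)
    show "A (x \<oplus>\<^bsub>K\<^esub> y) = A x \<oplus>\<^bsub>K\<^esub> A y" if "x \<in> carrier K" "y \<in> carrier K" for x y
      by (rule total_eqI) (use that f in \<open>auto simp: A_def K.cinner_add_left\<close>)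
    show "A (c \<odot>\<^bsub>K\<^esub> x) = c \<odot>\<^bsub>K\<^esub> A x" if "x \<in> carrier K" for c x
      by (rule total_eqI) (use that f in \<open>auto simp: A_def K.cinner_smult_left\<close>)
  qed (use f in \<open>auto simp: A_def\<close>)
  have A3: "bounded_by K A M" using M f(3) by (simp add: bounded_by_def A_def)
  show ?thesis using that[OF A2 A3 A1] f(2) by (simp add: A_def)
qed

end

section \<open>Change of carrier type, coding by sequences, and separability\<close>

definition transport :: "('a \<Rightarrow> 'b) \<Rightarrow> 'a hilbert \<Rightarrow> 'b hilbert" where
  "transport \<phi> K = (let \<psi> = inv_into (carrier K) \<phi> in
    \<lparr>carrier = \<phi> ` carrier K, mult = undefined, one = undefined, zero = \<phi> \<zero>\<^bsub>K\<^esub>,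
     add = (\<lambda>x y. \<phi> (\<psi> x \<oplus>\<^bsub>K\<^esub> \<psi> y)), smult = (\<lambda>c x. \<phi> (c \<odot>\<^bsub>K\<^esub> \<psi> x)), cinner = (\<lambda>x y. cinner K (\<psi> x) (\<psi> y))\<rparr>)"

lemma realizes_transport:
  assumes "realizes K v k" and inj: "inj_on \<phi> (carrier K)"
  shows "realizes (transport \<phi> K) (\<phi> \<circ> v) k"
proof -
  interpret realization K v k by unfold_locales fact
  let ?T = "transport \<phi> K" and ?\<psi> = "inv_into (carrier K) \<phi>"
  have \<psi>: "?\<psi> (\<phi> x) = x" if "x \<in> carrier K" for x using that inj by (rule inv_into_f_f[rotated])
  have simps: "carrier ?T = \<phi> ` carrier K" "\<zero>\<^bsub>?T\<^esub> = \<phi> \<zero>\<^bsub>K\<^esub>" "x \<oplus>\<^bsub>?T\<^esub> y = \<phi> (?\<psi> x \<oplus>\<^bsub>K\<^esub> ?\<psi> y)"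
    "c \<odot>\<^bsub>?T\<^esub> x = \<phi> (c \<odot>\<^bsub>K\<^esub> ?\<psi> x)" "cinner ?T x y = cinner K (?\<psi> x) (?\<psi> y)" "hnorm ?T x = hnorm K (?\<psi> x)" for x y c
    by (simp_all add: transport_def Let_def hnorm_def)
  have hT: "hilbert_space ?T"
  proof (rule hilbert_spaceI, unfold simps, goal_cases)
    case (8 x) then show ?case using K.smult_one by (auto simp: \<psi>)
  next
    case (9 a b x) then show ?case using K.smult_l_distr[of a b] by (auto simp: \<psi>)
  next
    case (11 a b x) then show ?case using K.smult_assoc1[of a b] by (auto simp: \<psi>)
  next
    case (14 x y) then show ?case by (auto simp: \<psi> intro: K.cinner_commute)
  next
    case (15 x) then show ?case by (auto simp: \<psi> intro: K.cinner_pos)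
  next
    case (16 s)
    then have s: "?\<psi> (s k) \<in> carrier K" for k by (auto simp: \<psi> dest!: spec[of _ k] meta_spec[of _ k])
    have "\<exists>l\<in>carrier K. (\<lambda>k. hnorm K (?\<psi> (s k) \<ominus>\<^bsub>K\<^esub> l)) \<longlonglongrightarrow> 0"
      by (rule K.complete) (use s 16(2) in \<open>auto simp: \<psi> K.diff_smult\<close>)
    then show ?case using s by (auto simp: \<psi> K.diff_smult)
  qed (auto simp: \<psi> K.a_ac K.smult_r_distr K.cinner_add_left K.cinner_smult_left K.smult_zero_eq)
  interpret T: hilbert_space ?T by fact
  have cb: "comb ?T (\<phi> \<circ> v) xs = \<phi> (comb K v xs)" for xs
    by (induction xs) (auto simp: simps \<psi>)
  have "\<exists>xs. hnorm ?T (\<phi> x \<ominus>\<^bsub>?T\<^esub> comb ?T (\<phi> \<circ> v) xs) < e" if x: "x \<in> carrier K" and e: "e > 0" for x e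
  proof -
    obtain xs where xs: "hnorm K (x \<ominus>\<^bsub>K\<^esub> comb K v xs) < e" using dense[OF x e] by blast
    have "\<phi> x \<ominus>\<^bsub>?T\<^esub> \<phi> (comb K v xs) = \<phi> x \<oplus>\<^bsub>?T\<^esub> (-1) \<odot>\<^bsub>?T\<^esub> \<phi> (comb K v xs)"
      by (rule T.diff_smult) (use x in \<open>auto simp: simps\<close>)
    also have "\<dots> = \<phi> (x \<ominus>\<^bsub>K\<^esub> comb K v xs)" using x by (simp add: simps \<psi> K.diff_smult)
    finally have "hnorm ?T (\<phi> x \<ominus>\<^bsub>?T\<^esub> comb ?T (\<phi> \<circ> v) xs) < e" using xs x by (simp add: cb simps(6) \<psi>)
    then show ?thesis ..
  qed
  then show ?thesis unfolding realizes_def using hT by (auto simp: simps \<psi> gram)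
qed

primrec fsum :: "'a hilbert \<Rightarrow> (nat \<Rightarrow> 'h \<Rightarrow> 'a) \<Rightarrow> (nat \<Rightarrow> 'h) \<Rightarrow> nat \<Rightarrow> 'a" where
  "fsum K u \<eta> 0 = \<zero>\<^bsub>K\<^esub>"
| "fsum K u \<eta> (Suc n) = fsum K u \<eta> n \<oplus>\<^bsub>K\<^esub> u n (\<eta> n)"

text \<open>\<open>u n\<close> are linear maps from \<open>H\<close> whose ranges jointly span a dense subspace of \<open>K\<close>; a point of
  \<open>K\<close> is then determined by a sequence of points of \<open>H\<close>.\<close>

locale spanned_by = K: hilbert_space K + H: hilbert_space H for K :: "'a hilbert" and H :: "'h hilbert" +
  fixes u :: "nat \<Rightarrow> 'h \<Rightarrow> 'a" and C :: "nat \<Rightarrow> real"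
  assumes u_in: "h \<in> carrier H \<Longrightarrow> u n h \<in> carrier K"
    and u_add: "\<lbrakk>h \<in> carrier H; h' \<in> carrier H\<rbrakk> \<Longrightarrow> u n (h \<oplus>\<^bsub>H\<^esub> h') = u n h \<oplus>\<^bsub>K\<^esub> u n h'"
    and u_smult: "h \<in> carrier H \<Longrightarrow> u n (c \<odot>\<^bsub>H\<^esub> h) = c \<odot>\<^bsub>K\<^esub> u n h"
    and u_bound: "0 \<le> C n" "h \<in> carrier H \<Longrightarrow> hnorm K (u n h) \<le> C n * hnorm H h"
begin

text \<open>Coefficients vanish from n on, so that the sum can be read off from the sequence without
  knowing its length.\<close>

definition approximable :: "'a \<Rightarrow> bool" where
  "approximable x \<longleftrightarrow> (\<forall>e>0. \<exists>n \<eta>. (\<forall>i. \<eta> i \<in> carrier H) \<and> (\<forall>i\<ge>n. \<eta> i = \<zero>\<^bsub>H\<^esub>) \<and> hnorm K (x \<ominus>\<^bsub>K\<^esub> fsum K u \<eta> n) < e)"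

lemma u_zero: "u n \<zero>\<^bsub>H\<^esub> = \<zero>\<^bsub>K\<^esub>"
  using u_smult[of "\<zero>\<^bsub>H\<^esub>" n 0] u_in[of "\<zero>\<^bsub>H\<^esub>" n] by (simp add: K.smult_zero_eq H.smult_zero_eq)

lemma fsum_in: "(\<And>i. \<eta> i \<in> carrier H) \<Longrightarrow> fsum K u \<eta> n \<in> carrier K"
  by (induction n) (auto simp: u_in)

lemma fsum_extend:
  assumes "\<And>i. \<eta> i \<in> carrier H" "\<And>i. i \<ge> n \<Longrightarrow> \<eta> i = \<zero>\<^bsub>H\<^esub>" "m \<ge> n"
  shows "fsum K u \<eta> m = fsum K u \<eta> n"
  using assms(3) by (induction rule: dec_induct) (simp_all add: assms(2) u_zero fsum_in assms(1))

lemma fsum_add: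
  assumes "\<And>i. \<eta> i \<in> carrier H" "\<And>i. \<eta>' i \<in> carrier H"
  shows "fsum K u (\<lambda>i. \<eta> i \<oplus>\<^bsub>H\<^esub> \<eta>' i) n = fsum K u \<eta> n \<oplus>\<^bsub>K\<^esub> fsum K u \<eta>' n"
  by (induction n) (simp_all add: assms u_add u_in fsum_in K.a_ac)

lemma fsum_smult:
  assumes "\<And>i. \<eta> i \<in> carrier H"
  shows "fsum K u (\<lambda>i. c \<odot>\<^bsub>H\<^esub> \<eta> i) n = c \<odot>\<^bsub>K\<^esub> fsum K u \<eta> n"
  by (induction n) (simp_all add: assms u_smult u_in fsum_in K.smult_r_distr)

text \<open>One sequence codes x: its m-th row under \<open>prod_encode\<close> holds the
  coefficients of a finite sum within 1/(m+1) of x. Two vectors with the same code share all these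
  sums and therefore coincide.\<close>

lemma approximable_embedding:
  assumes "\<And>x. x \<in> carrier K \<Longrightarrow> approximable x"
  shows "\<exists>\<phi> :: 'a \<Rightarrow> (nat \<Rightarrow> 'h). inj_on \<phi> (carrier K)"
proof -
  define R where "R \<eta> x \<longleftrightarrow> (\<forall>m. \<exists>n. (\<forall>i. \<eta> (prod_encode (m, i)) \<in> carrier H) \<and>
     (\<forall>i\<ge>n. \<eta> (prod_encode (m, i)) = \<zero>\<^bsub>H\<^esub>) \<and> hnorm K (x \<ominus>\<^bsub>K\<^esub> fsum K u (\<lambda>i. \<eta> (prod_encode (m, i))) n) < 1 / real (Suc m))" for \<eta> x
  have ex: "\<exists>\<eta>. R \<eta> x" if x: "x \<in> carrier K" for x
  proof -
    have "\<exists>n \<eta>. (\<forall>i. \<eta> i \<in> carrier H) \<and> (\<forall>i\<ge>n. \<eta> i = \<zero>\<^bsub>H\<^esub>) \<and> hnorm K (x \<ominus>\<^bsub>K\<^esub> fsum K u \<eta> n) < 1 / real (Suc m)" for m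
      using assms[OF x] unfolding approximable_def by (metis zero_less_divide_1_iff of_nat_0_less_iff zero_less_Suc)
    then obtain n \<eta> where "\<And>m. (\<forall>i. \<eta> m i \<in> carrier H) \<and> (\<forall>i\<ge>n m. \<eta> m i = \<zero>\<^bsub>H\<^esub>) \<and> hnorm K (x \<ominus>\<^bsub>K\<^esub> fsum K u (\<eta> m) (n m)) < 1 / real (Suc m)"
      by metis
    then have "R (\<lambda>j. \<eta> (fst (prod_decode j)) (snd (prod_decode j))) x" unfolding R_def by auto
    then show ?thesis by blast
  qed
  have un: "x = y" if x: "x \<in> carrier K" and y: "y \<in> carrier K" and Rx: "R \<eta> x" and Ry: "R \<eta> y" for \<eta> x y
  proof (rule K.approx_eqI[OF x y])
    fix e :: real assume "e > 0"
    then obtain m where m: "1 / real (Suc m) < e / 2" by (metis half_gt_zero nat_approx_posE)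
    define \<zeta> where "\<zeta> i = \<eta> (prod_encode (m, i))" for i
    obtain n where n: "\<And>i. \<zeta> i \<in> carrier H" "\<And>i. i \<ge> n \<Longrightarrow> \<zeta> i = \<zero>\<^bsub>H\<^esub>" "hnorm K (x \<ominus>\<^bsub>K\<^esub> fsum K u \<zeta> n) < 1 / real (Suc m)"
      using Rx unfolding R_def \<zeta>_def by blast
    obtain n' where n': "\<And>i. i \<ge> n' \<Longrightarrow> \<zeta> i = \<zero>\<^bsub>H\<^esub>" "hnorm K (y \<ominus>\<^bsub>K\<^esub> fsum K u \<zeta> n') < 1 / real (Suc m)"
      using Ry unfolding R_def \<zeta>_def by blast
    \<comment> \<open>The two vectors may have been approximated with different lengths for the same
      row; the zero tails make the sums equal.\<close>
    have eq: "fsum K u \<zeta> n' = fsum K u \<zeta> n"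
      using fsum_extend[of \<zeta> n "max n n'", OF n(1,2)] fsum_extend[of \<zeta> n' "max n n'", OF n(1) n'(1)] by simp
    note fi = fsum_in[of \<zeta> n, OF n(1)]
    have "hnorm K (x \<ominus>\<^bsub>K\<^esub> y) \<le> hnorm K (x \<ominus>\<^bsub>K\<^esub> fsum K u \<zeta> n) + hnorm K (fsum K u \<zeta> n \<ominus>\<^bsub>K\<^esub> y)"
      by (rule K.hnorm_diff_triangle[OF x fi y])
    then show "hnorm K (x \<ominus>\<^bsub>K\<^esub> y) < e" using n(3) n'(2) m K.hnorm_diff_commute[OF fi y] by (simp add: eq)
  qed
  have "inj_on (\<lambda>x. SOME \<eta>. R \<eta> x) (carrier K)"
    by (rule inj_onI) (metis (mono_tags, lifting) ex someI_ex un)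
  then show ?thesis by blast
qed

lemma fsum_diff_bound:
  assumes "\<And>i. \<eta> i \<in> carrier H" "\<And>i. \<eta>' i \<in> carrier H" "\<And>i. i < n \<Longrightarrow> hnorm H (\<eta> i \<ominus>\<^bsub>H\<^esub> \<eta>' i) \<le> d"
  shows "hnorm K (fsum K u \<eta> n \<ominus>\<^bsub>K\<^esub> fsum K u \<eta>' n) \<le> (\<Sum>i<n. C i) * d"
proof -
  have dif: "fsum K u \<eta> n \<ominus>\<^bsub>K\<^esub> fsum K u \<eta>' n = fsum K u (\<lambda>i. \<eta> i \<ominus>\<^bsub>H\<^esub> \<eta>' i) n"
    using fsum_add[of \<eta> "\<lambda>i. (-1) \<odot>\<^bsub>H\<^esub> \<eta>' i" n] fsum_smult[of \<eta>' "-1" n] assms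
    by (simp add: K.diff_smult H.diff_smult fsum_in)
  have "hnorm K (fsum K u (\<lambda>i. \<eta> i \<ominus>\<^bsub>H\<^esub> \<eta>' i) m) \<le> (\<Sum>i<m. C i) * d" if "m \<le> n" for m
    using that
  proof (induction m)
    case (Suc m)
    have "hnorm K (u m (\<eta> m \<ominus>\<^bsub>H\<^esub> \<eta>' m)) \<le> C m * hnorm H (\<eta> m \<ominus>\<^bsub>H\<^esub> \<eta>' m)" by (rule u_bound) (use assms in auto)
    also have "\<dots> \<le> C m * d" using assms(3)[of m] Suc.prems u_bound(1) by (intro mult_left_mono) auto
    finally show ?case
      using Suc K.hnorm_triangle[of "fsum K u (\<lambda>i. \<eta> i \<ominus>\<^bsub>H\<^esub> \<eta>' i) m" "u m (\<eta> m \<ominus>\<^bsub>H\<^esub> \<eta>' m)"] assms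
      by (simp add: fsum_in u_in distrib_right)
  qed simp
  then show ?thesis unfolding dif by simp
qed

lemma approximable_separable:
  assumes ap: "\<And>x. x \<in> carrier K \<Longrightarrow> approximable x" and "separable_hilbert H"
  shows "separable_hilbert K"
proof -
  obtain S where S: "S \<subseteq> carrier H" "countable S" "\<And>x e. \<lbrakk>x \<in> carrier H; e > 0\<rbrakk> \<Longrightarrow> \<exists>s\<in>S. hnorm H (x \<ominus>\<^bsub>H\<^esub> s) < e"
    using assms(2) unfolding separable_hilbert_def by blast
  define D where "D = (\<lambda>l. fsum K u (\<lambda>i. if i < length l then l ! i else \<zero>\<^bsub>H\<^esub>) (length l)) ` lists S"
  have lin: "(if i < length l then l ! i else \<zero>\<^bsub>H\<^esub>) \<in> carrier H" if "l \<in> lists S" for l i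
    using that S(1) by (auto simp: in_lists_conv_set)
  have "countable D" unfolding D_def using S(2) by (intro countable_image countable_lists)
  moreover have "D \<subseteq> carrier K" unfolding D_def by (rule image_subsetI) (rule fsum_in[OF lin])
  moreover have "\<exists>s\<in>D. hnorm K (x \<ominus>\<^bsub>K\<^esub> s) < e" if x: "x \<in> carrier K" and e: "e > 0" for x e
  proof -
    obtain n \<eta> where n0: "\<forall>i. \<eta> i \<in> carrier H" "hnorm K (x \<ominus>\<^bsub>K\<^esub> fsum K u \<eta> n) < e/2"
      using ap[OF x, unfolded approximable_def, rule_format, OF half_gt_zero[OF e]] by metis
    note n = n0(1)[rule_format] n0(2)
    \<comment> \<open>Coefficient errors below e/(2B) add up to at most e/2; the summand 1 keeps B
      positive.\<close>
    define B where "B = (\<Sum>i<n. C i) + 1"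
    have B: "B > 0" unfolding B_def using u_bound(1) by (simp add: add_nonneg_pos sum_nonneg)
    have "\<exists>s\<in>S. hnorm H (\<eta> i \<ominus>\<^bsub>H\<^esub> s) < e / (2 * B)" for i by (rule S(3)[OF n(1)]) (use e B in simp)
    then obtain s where s: "\<And>i. s i \<in> S" "\<And>i. hnorm H (\<eta> i \<ominus>\<^bsub>H\<^esub> s i) < e / (2 * B)" by metis
    let ?l = "map s [0..<n]" and ?z = "\<lambda>i. if i < length (map s [0..<n]) then map s [0..<n] ! i else \<zero>\<^bsub>H\<^esub>"
    have lS: "?l \<in> lists S" using s(1) by auto
    have zi: "\<And>i. ?z i \<in> carrier H" by (rule lin[OF lS])
    have "hnorm K (fsum K u \<eta> n \<ominus>\<^bsub>K\<^esub> fsum K u ?z n) \<le> (\<Sum>i<n. C i) * (e / (2 * B))"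
      by (rule fsum_diff_bound[OF n(1) zi]) (use s(2) in \<open>auto intro: less_imp_le\<close>)
    also have "\<dots> \<le> B * (e / (2 * B))" unfolding B_def using e B[unfolded B_def] by (intro mult_right_mono) auto
    also have "\<dots> = e / 2" using B by simp
    finally have le: "hnorm K (fsum K u \<eta> n \<ominus>\<^bsub>K\<^esub> fsum K u ?z n) \<le> e / 2" .
    have "hnorm K (x \<ominus>\<^bsub>K\<^esub> fsum K u ?z n) \<le> hnorm K (x \<ominus>\<^bsub>K\<^esub> fsum K u \<eta> n) + hnorm K (fsum K u \<eta> n \<ominus>\<^bsub>K\<^esub> fsum K u ?z n)"
      by (rule K.hnorm_diff_triangle[OF x]) (rule fsum_in, rule n zi)+
    then have "hnorm K (x \<ominus>\<^bsub>K\<^esub> fsum K u ?z (length ?l)) < e" using le n(2) by simp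
    then show ?thesis unfolding D_def using lS by blast
  qed
  ultimately show ?thesis unfolding separable_hilbert_def by blast
qed

end

section \<open>Completely positive forms and the Stinespring construction\<close>

text \<open>Norm closure is not demanded: the positivity arguments are algebraic and are applied
  both to all bounded operators and to C*(W).\<close>

definition star_alg :: "'a hilbert \<Rightarrow> ('a \<Rightarrow> 'a) set \<Rightarrow> bool" where
  "star_alg H \<A> \<longleftrightarrow> \<A> \<subseteq> bounded_ops H H \<and> \<one>\<^bsub>op_alg H\<^esub> \<in> \<A> \<and>
     (\<forall>A\<in>\<A>. \<forall>B\<in>\<A>. A \<oplus>\<^bsub>op_alg H\<^esub> B \<in> \<A> \<and> A \<otimes>\<^bsub>op_alg H\<^esub> B \<in> \<A>) \<and>
     (\<forall>c. \<forall>A\<in>\<A>. c \<odot>\<^bsub>op_alg H\<^esub> A \<in> \<A>) \<and> (\<forall>A\<in>\<A>. adj H A \<in> \<A>)"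

lemma unital_cstar_star_alg: "unital_cstar_subalgebra H \<A> \<Longrightarrow> star_alg H \<A>"
  unfolding unital_cstar_subalgebra_def star_alg_def by blast

text \<open>If t = a 0 / c exceeded L, iterating the hypothesis would give a n \<ge> c t^(2^n),
  which eventually outgrows K L^(2^n). The size of K is irrelevant, so a crude estimate becomes a
  sharp one.\<close>

lemma repeated_squaring_bound:
  fixes a :: "nat \<Rightarrow> real"
  assumes a: "0 \<le> c" "\<And>n. 0 \<le> a n" and sq: "\<And>n. (a n)\<^sup>2 \<le> c * a (Suc n)"
    and bd: "\<And>n. a n \<le> K * L ^ (2 ^ n)" and L: "0 \<le> L"
  shows "a 0 \<le> L * c"
proof (rule ccontr)
  assume "\<not> a 0 \<le> L * c"
  then have gt: "L * c < a 0" by simp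
  have c: "c > 0"
  proof (rule ccontr)
    assume "\<not> c > 0"
    then have "c = 0" using a(1) by simp
    then show False using sq[of 0] gt by simp
  qed
  define t where "t = a 0 / c"
  have t: "L < t" using gt c by (simp add: t_def field_simps)
  have ge: "c * t ^ (2 ^ n) \<le> a n" for n
  proof (induction n)
    case 0 show ?case using c by (simp add: t_def)
  next
    case (Suc n)
    have "(c * t ^ (2 ^ n))\<^sup>2 \<le> (a n)\<^sup>2" using Suc c t L by (intro power_mono) auto
    also have "\<dots> \<le> c * a (Suc n)" by (rule sq)
    finally have "c * (c * t ^ (2 ^ Suc n)) \<le> c * a (Suc n)"
      by (simp add: power2_eq_square power_add[symmetric] mult_2 algebra_simps)
    then show ?case using c by simp
  qed
  have K: "c * t ^ (2 ^ n) \<le> K * L ^ (2 ^ n)" for n using ge[of n] bd[of n] by linarith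
  have tp: "t ^ (2 ^ n) > 0" for n using t L by simp
  have Lp: "L > 0"
  proof (rule ccontr)
    assume "\<not> L > 0"
    then have "L = 0" using L by simp
    then have "c * t ^ (2 ^ 0) \<le> 0" using K[of 0] by simp
    then show False using tp[of 0] c by (simp add: mult_le_0_iff)
  qed
  obtain n where n: "K / c < (t / L) ^ n" using real_arch_pow[of "t / L" "K / c"] t Lp by auto
  have "(t / L) ^ n \<le> (t / L) ^ (2 ^ n)"
    using t Lp by (intro power_increasing) (auto intro: less_imp_le less_exp)
  also have "\<dots> \<le> K / c" using K[of n] c Lp by (simp add: power_divide field_simps)
  finally show False using n by simp
qed

text \<open>\<open>F C h k\<close> stands for \<open>\<langle>\<Theta>(C) h, k\<rangle>\<close> with a completely positive map \<open>\<Theta>\<close> from \<open>\<A>\<close> to \<open>B(H)\<close>.\<close>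

locale cp_form = B: hilbert_space B + H: hilbert_space H
  for B :: "'a hilbert" and H :: "'h hilbert" and \<A> :: "('a \<Rightarrow> 'a) set"
    and F :: "('a \<Rightarrow> 'a) \<Rightarrow> 'h \<Rightarrow> 'h \<Rightarrow> complex" +
  assumes alg: "star_alg B \<A>"
    and F_add: "\<lbrakk>C \<in> \<A>; C' \<in> \<A>; h \<in> carrier H; k \<in> carrier H\<rbrakk> \<Longrightarrow> F (C \<oplus>\<^bsub>op_alg B\<^esub> C') h k = F C h k + F C' h k"
    and F_smult: "\<lbrakk>C \<in> \<A>; h \<in> carrier H; k \<in> carrier H\<rbrakk> \<Longrightarrow> F (c \<odot>\<^bsub>op_alg B\<^esub> C) h k = c * F C h k"
    and F_add1: "\<lbrakk>C \<in> \<A>; h \<in> carrier H; h' \<in> carrier H; k \<in> carrier H\<rbrakk> \<Longrightarrow> F C (h \<oplus>\<^bsub>H\<^esub> h') k = F C h k + F C h' k"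
    and F_smult1: "\<lbrakk>C \<in> \<A>; h \<in> carrier H; k \<in> carrier H\<rbrakk> \<Longrightarrow> F C (c \<odot>\<^bsub>H\<^esub> h) k = c * F C h k"
    and F_herm: "\<lbrakk>C \<in> \<A>; h \<in> carrier H; k \<in> carrier H\<rbrakk> \<Longrightarrow> F (adj B C) k h = cnj (F C h k)"
    and F_cp: "set ps \<subseteq> \<A> \<times> carrier H \<Longrightarrow>
      0 \<le> Re (\<Sum>p\<leftarrow>ps. \<Sum>q\<leftarrow>ps. F (adj B (fst q) \<otimes>\<^bsub>op_alg B\<^esub> fst p) (snd p) (snd q))"
    and F_crude: "\<lbrakk>h \<in> carrier H; k \<in> carrier H\<rbrakk> \<Longrightarrow>
      \<exists>c\<ge>0. \<forall>C\<in>\<A>. \<forall>M. bounded_by B C M \<longrightarrow> cmod (F C h k) \<le> c * M"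
begin

abbreviation "S \<equiv> \<A> \<times> carrier H"

lemma A_ops: "A \<in> \<A> \<Longrightarrow> A \<in> bounded_ops B B" using alg unfolding star_alg_def by blast
lemma A_mult [simp]: "\<lbrakk>A \<in> \<A>; C \<in> \<A>\<rbrakk> \<Longrightarrow> compose (carrier B) A C \<in> \<A>" using alg unfolding star_alg_def by simp
lemma A_adj [simp]: "A \<in> \<A> \<Longrightarrow> adj B A \<in> \<A>" using alg unfolding star_alg_def by simp
lemma A_one [simp]: "(\<lambda>x\<in>carrier B. x) \<in> \<A>" using alg unfolding star_alg_def by simp
lemma A_add [simp]: "\<lbrakk>A \<in> \<A>; C \<in> \<A>\<rbrakk> \<Longrightarrow> (\<lambda>x\<in>carrier B. A x \<oplus>\<^bsub>B\<^esub> C x) \<in> \<A>" using alg unfolding star_alg_def by simp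
lemma A_smult [simp]: "A \<in> \<A> \<Longrightarrow> (\<lambda>x\<in>carrier B. c \<odot>\<^bsub>B\<^esub> A x) \<in> \<A>" using alg unfolding star_alg_def by simp

abbreviation mult_B (infixl "\<cdot>" 70) where "A \<cdot> C \<equiv> compose (carrier B) A C"

lemma mult_assoc: "\<lbrakk>A \<in> \<A>; C \<in> \<A>; D \<in> \<A>\<rbrakk> \<Longrightarrow> A \<cdot> C \<cdot> D = A \<cdot> (C \<cdot> D)"
  by (rule compose_assoc[symmetric, of _ _ "carrier B"]) (auto dest: A_ops intro: bounded_ops_in)

lemma mult_one [simp]: "A \<in> \<A> \<Longrightarrow> A \<cdot> (\<lambda>x\<in>carrier B. x) = A" "A \<in> \<A> \<Longrightarrow> (\<lambda>x\<in>carrier B. x) \<cdot> A = A"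
  by (rule B.op_eqI; auto dest: A_ops simp: compose_eq intro: bounded_ops_in)+

lemma adj_mult: "\<lbrakk>A \<in> \<A>; C \<in> \<A>\<rbrakk> \<Longrightarrow> adj B (A \<cdot> C) = adj B C \<cdot> adj B A"
  by (simp add: B.adj_compose A_ops)

lemma adj_adj [simp]: "A \<in> \<A> \<Longrightarrow> adj B (adj B A) = A"
  by (simp add: A_ops)

lemma add_mult:
  "\<lbrakk>A \<in> \<A>; C \<in> \<A>; D \<in> \<A>\<rbrakk> \<Longrightarrow> (A \<oplus>\<^bsub>op_alg B\<^esub> C) \<cdot> D = (A \<cdot> D) \<oplus>\<^bsub>op_alg B\<^esub> (C \<cdot> D)"
  "\<lbrakk>A \<in> \<A>; C \<in> \<A>; D \<in> \<A>\<rbrakk> \<Longrightarrow> D \<cdot> (A \<oplus>\<^bsub>op_alg B\<^esub> C) = (D \<cdot> A) \<oplus>\<^bsub>op_alg B\<^esub> (D \<cdot> C)"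
  by (rule B.op_eqI; simp add: A_ops compose_eq bounded_ops_in[OF A_ops] bounded_ops_add[OF A_ops])+

lemma smult_mult:
  "\<lbrakk>A \<in> \<A>; D \<in> \<A>\<rbrakk> \<Longrightarrow> (c \<odot>\<^bsub>op_alg B\<^esub> A) \<cdot> D = c \<odot>\<^bsub>op_alg B\<^esub> (A \<cdot> D)"
  "\<lbrakk>A \<in> \<A>; D \<in> \<A>\<rbrakk> \<Longrightarrow> D \<cdot> (c \<odot>\<^bsub>op_alg B\<^esub> A) = c \<odot>\<^bsub>op_alg B\<^esub> (D \<cdot> A)"
  by (rule B.op_eqI; simp add: A_ops compose_eq bounded_ops_in[OF A_ops] bounded_ops_smult[OF A_ops])+

lemma F_smult2:
  assumes "C \<in> \<A>" "h \<in> carrier H" "k \<in> carrier H" shows "F C h (c \<odot>\<^bsub>H\<^esub> k) = cnj c * F C h k"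
proof -
  have "F C h (c \<odot>\<^bsub>H\<^esub> k) = cnj (F (adj B C) (c \<odot>\<^bsub>H\<^esub> k) h)"
    using F_herm[of "adj B C" "c \<odot>\<^bsub>H\<^esub> k" h] assms by simp
  also have "\<dots> = cnj c * F C h k" using assms F_herm[of C h k] by (simp add: F_smult1)
  finally show ?thesis .
qed

text \<open>The Stinespring kernel, the Gram matrix of the symbols A \<otimes> h. It is set to 0 off
  \<open>S\<close> because kernels live on whole types.\<close>

definition kF :: "('a \<Rightarrow> 'a) \<times> 'h \<Rightarrow> ('a \<Rightarrow> 'a) \<times> 'h \<Rightarrow> complex" where
  "kF p q = (if p \<in> S \<and> q \<in> S then F (adj B (fst q) \<cdot> fst p) (snd p) (snd q) else 0)"

lemma kF_eq: "\<lbrakk>A \<in> \<A>; C \<in> \<A>; h \<in> carrier H; k \<in> carrier H\<rbrakk> \<Longrightarrow> kF (A, h) (C, k) = F (adj B C \<cdot> A) h k"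
  by (simp add: kF_def)

text \<open>Pairs outside \<open>S\<close> contribute nothing and are filtered out; scalars are
  absorbed into the vectors of H, after which the sum is an instance of complete positivity.\<close>

lemma psd_kF: "psd_kernel kF"
  unfolding psd_kernel_def
proof (intro conjI allI)
  fix p q
  have "F (adj B (fst p) \<cdot> fst q) (snd q) (snd p) = cnj (F (adj B (fst q) \<cdot> fst p) (snd p) (snd q))"
    if "p \<in> S" "q \<in> S"
  proof -
    have "adj B (adj B (fst q) \<cdot> fst p) = adj B (fst p) \<cdot> fst q" using that by (auto simp: adj_mult)
    then show ?thesis using that F_herm[of "adj B (fst q) \<cdot> fst p" "snd p" "snd q"] by auto
  qed
  then show "kF q p = cnj (kF p q)" by (simp add: kF_def)
next
  fix xs :: "(complex \<times> (('a \<Rightarrow> 'a) \<times> 'h)) list"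
  let ?g = "\<lambda>x. (fst (snd x), fst x \<odot>\<^bsub>H\<^esub> snd (snd x))"
  let ?in = "\<lambda>x. snd x \<in> S"
  have fil: "(\<Sum>x\<leftarrow>xs. if ?in x then f x else 0) = (\<Sum>x\<leftarrow>filter ?in xs. f x)" for f :: "_ \<Rightarrow> complex"
    by (induction xs) auto
  have "kform kF xs xs = (\<Sum>x\<leftarrow>xs. if ?in x then (\<Sum>y\<leftarrow>xs. if ?in y then fst x * cnj (fst y) * kF (snd x) (snd y) else 0) else 0)"
    unfolding kform_def by (intro arg_cong[where f=sum_list] map_cong refl) (auto simp: kF_def intro!: arg_cong[where f=sum_list] map_cong)
  also have "\<dots> = (\<Sum>x\<leftarrow>filter ?in xs. \<Sum>y\<leftarrow>filter ?in xs. fst x * cnj (fst y) * kF (snd x) (snd y))"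
    by (simp only: fil)
  also have "\<dots> = (\<Sum>x\<leftarrow>filter ?in xs. \<Sum>y\<leftarrow>filter ?in xs. F (adj B (fst (?g y)) \<otimes>\<^bsub>op_alg B\<^esub> fst (?g x)) (snd (?g x)) (snd (?g y)))"
    by (intro arg_cong[where f=sum_list] map_cong refl)
      (auto simp: kF_def F_smult1 F_smult2)
  also have "\<dots> = (\<Sum>p\<leftarrow>map ?g (filter ?in xs). \<Sum>q\<leftarrow>map ?g (filter ?in xs). F (adj B (fst q) \<otimes>\<^bsub>op_alg B\<^esub> fst p) (snd p) (snd q))"
    by (simp add: o_def)
  finally have eq: "kform kF xs xs = (\<Sum>p\<leftarrow>map ?g (filter ?in xs). \<Sum>q\<leftarrow>map ?g (filter ?in xs). F (adj B (fst q) \<otimes>\<^bsub>op_alg B\<^esub> fst p) (snd p) (snd q))" .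
  show "0 \<le> Re (kform kF xs xs)" unfolding eq by (rule F_cp) auto
qed

sublocale P: pre_inner "(@)" scale "kform kF" by (rule psd_pre_inner[OF psd_kF])

text \<open>Left multiplication on the symbols A \<otimes> h. Off \<open>S\<close>, where the kernel
  vanishes, any value would do.\<close>

definition act :: "('a \<Rightarrow> 'a) \<Rightarrow> ('a \<Rightarrow> 'a) \<times> 'h \<Rightarrow> ('a \<Rightarrow> 'a) \<times> 'h" where
  "act C p = (if p \<in> S then (C \<cdot> fst p, snd p) else p)"

abbreviation "acts C xs \<equiv> map (apsnd (act C)) xs"

lemma act_adj: "C \<in> \<A> \<Longrightarrow> kF (act C p) q = kF p (act (adj B C) q)"
  by (auto simp: kF_def act_def adj_mult mult_assoc)

lemma act_mult: "\<lbrakk>C \<in> \<A>; D \<in> \<A>\<rbrakk> \<Longrightarrow> act (C \<cdot> D) p = act C (act D p)"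
  by (auto simp: act_def mult_assoc)

lemma acts_mult: "\<lbrakk>C \<in> \<A>; D \<in> \<A>\<rbrakk> \<Longrightarrow> acts (C \<cdot> D) xs = acts C (acts D xs)"
  by (induction xs) (auto simp: act_mult)

lemma acts_adj: "C \<in> \<A> \<Longrightarrow> kform kF (acts C xs) ys = kform kF xs (acts (adj B C) ys)"
  by (simp add: kform_def o_def act_adj)

text \<open>Only linear growth in M matters here; the constant depends on the two lists and is
  removed by the repeated squaring.\<close>

lemma acts_crude: "\<exists>K\<ge>0. \<forall>C\<in>\<A>. \<forall>M. bounded_by B C M \<longrightarrow> cmod (kform kF (acts C xs) ys) \<le> K * M"
proof -
  have one: "\<exists>K\<ge>0. \<forall>C\<in>\<A>. \<forall>M. bounded_by B C M \<longrightarrow> cmod (kF (act C p) q) \<le> K * M" for p q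
  proof (cases "p \<in> S \<and> q \<in> S")
    case False
    then show ?thesis by (intro exI[of _ 0]) (auto simp: kF_def act_def)
  next
    case True
    then obtain A h D k where pq: "p = (A, h)" "q = (D, k)" "A \<in> \<A>" "D \<in> \<A>" "h \<in> carrier H" "k \<in> carrier H"
      by (metis SigmaE)
    obtain c where c: "c \<ge> 0" "\<And>C M. \<lbrakk>C \<in> \<A>; bounded_by B C M\<rbrakk> \<Longrightarrow> cmod (F C h k) \<le> c * M"
      using F_crude[OF pq(5,6)] by blast
    obtain a d where ad: "bounded_by B A a" "bounded_by B D d"
      using B.bounded_ops_bound[OF A_ops[OF pq(3)]] B.bounded_ops_bound[OF A_ops[OF pq(4)]] by metis
    have "cmod (kF (act C p) q) \<le> c * d * a * M" if C: "C \<in> \<A>" "bounded_by B C M" for C M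
    proof -
      have "bounded_by B (adj B D \<cdot> (C \<cdot> A)) (d * (M * a))"
        using C ad pq by (intro B.bounded_by_compose B.op_compose_in B.bounded_by_adj) (auto intro: A_ops)
      then have "cmod (F (adj B D \<cdot> (C \<cdot> A)) h k) \<le> c * (d * (M * a))" using c(2) C pq by simp
      then show ?thesis using pq C by (simp add: kF_def act_def algebra_simps)
    qed
    moreover have "0 \<le> c * d * a" using c ad by (simp add: bounded_by_def)
    ultimately show ?thesis by blast
  qed
  have two: "\<exists>K\<ge>0. \<forall>C\<in>\<A>. \<forall>M. bounded_by B C M \<longrightarrow> cmod (\<Sum>q\<leftarrow>ys. fst p * cnj (fst q) * kF (act C (snd p)) (snd q)) \<le> K * M" for p
  proof (induction ys)
    case (Cons q ys)
    obtain K where K: "K \<ge> 0" "\<forall>C\<in>\<A>. \<forall>M. bounded_by B C M \<longrightarrow> cmod (\<Sum>q\<leftarrow>ys. fst p * cnj (fst q) * kF (act C (snd p)) (snd q)) \<le> K * M"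
      using Cons by blast
    obtain K' where K': "K' \<ge> 0" "\<forall>C\<in>\<A>. \<forall>M. bounded_by B C M \<longrightarrow> cmod (kF (act C (snd p)) (snd q)) \<le> K' * M"
      using one by blast
    have "cmod (\<Sum>q\<leftarrow>q#ys. fst p * cnj (fst q) * kF (act C (snd p)) (snd q)) \<le> (cmod (fst p) * cmod (fst q) * K' + K) * M"
      if "C \<in> \<A>" "bounded_by B C M" for C M
    proof -
      have "cmod (fst p * cnj (fst q) * kF (act C (snd p)) (snd q)) \<le> cmod (fst p) * cmod (fst q) * (K' * M)"
        using K'(2) that by (simp add: norm_mult mult_left_mono)
      then have "cmod (\<Sum>q\<leftarrow>q#ys. fst p * cnj (fst q) * kF (act C (snd p)) (snd q)) \<le> cmod (fst p) * cmod (fst q) * (K' * M) + K * M"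
        using K(2) that by (auto intro!: order_trans[OF norm_triangle_ineq] add_mono)
      then show ?thesis by (simp add: algebra_simps)
    qed
    moreover have "0 \<le> cmod (fst p) * cmod (fst q) * K' + K" using K K' by simp
    ultimately show ?case by blast
  qed (auto intro!: exI[of _ 0])
  show ?thesis
  proof (induction xs)
    case (Cons p xs)
    obtain K where K: "K \<ge> 0" "\<forall>C\<in>\<A>. \<forall>M. bounded_by B C M \<longrightarrow> cmod (kform kF (acts C xs) ys) \<le> K * M"
      using Cons by blast
    obtain K' where K': "K' \<ge> 0" "\<forall>C\<in>\<A>. \<forall>M. bounded_by B C M \<longrightarrow> cmod (\<Sum>q\<leftarrow>ys. fst p * cnj (fst q) * kF (act C (snd p)) (snd q)) \<le> K' * M"
      using two[of p] by blast
    have "cmod (kform kF (acts C (p # xs)) ys) \<le> (K' + K) * M" if "C \<in> \<A>" "bounded_by B C M" for C M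
    proof -
      have eq: "kform kF (acts C (p # xs)) ys = (\<Sum>q\<leftarrow>ys. fst p * cnj (fst q) * kF (act C (snd p)) (snd q)) + kform kF (acts C xs) ys"
        by (simp add: kform_def)
      have "cmod (kform kF (acts C (p # xs)) ys) \<le> K' * M + K * M"
        unfolding eq by (rule norm_triangle_mono) (use K(2) K'(2) that in simp_all)
      then show ?thesis by (simp add: algebra_simps)
    qed
    moreover have "0 \<le> K' + K" using K K' by simp
    ultimately show ?case by blast
  next
    case Nil
    show ?case by (rule exI[of _ 0]) simp
  qed
qed

text \<open>No square roots are needed: with \<open>P = C\<^sup>* C\<close>, the Cauchy--Schwarz inequality gives
  \<open>\<langle>P x, x\<rangle>\<^sup>2 \<le> \<langle>P\<^sup>2 x, x\<rangle> \<langle>x, x\<rangle>\<close>, which is iterated against the crude bound.\<close>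

lemma acts_bound:
  assumes C: "C \<in> \<A>" "bounded_by B C M"
  shows "Re (kform kF (acts C xs) (acts C xs)) \<le> M\<^sup>2 * Re (kform kF xs xs)"
proof -
  \<comment> \<open>\<open>P n\<close> is the 2^n-th power of \<open>adj B C \<cdot> C\<close>:
    self-adjoint, with a bound that squares at each stage.\<close>
  define P where "P = rec_nat (adj B C \<cdot> C) (\<lambda>_ A. A \<cdot> A)"
  have P0: "P 0 = adj B C \<cdot> C" and PS: "P (Suc n) = P n \<cdot> P n" for n by (simp_all add: P_def)
  have PA: "P n \<in> \<A>" for n by (induction n) (simp_all add: P0 PS C)
  have Padj: "adj B (P n) = P n" for n by (induction n) (simp_all add: P0 PS C adj_mult PA)
  have Pb: "bounded_by B (P n) ((M\<^sup>2) ^ (2 ^ n))" for n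
  proof (induction n)
    case 0
    have "bounded_by B (P 0) (M * M)" unfolding P0
      using C by (intro B.bounded_by_compose B.bounded_by_adj) (auto intro: A_ops)
    then show ?case by (simp add: power2_eq_square)
  next
    case (Suc n)
    have "bounded_by B (P (Suc n)) ((M\<^sup>2) ^ (2 ^ n) * (M\<^sup>2) ^ (2 ^ n))" unfolding PS
      using Suc PA by (intro B.bounded_by_compose) (auto intro: A_ops)
    then show ?case by (simp add: power_add[symmetric] mult_2)
  qed
  obtain K where K: "\<And>D M. \<lbrakk>D \<in> \<A>; bounded_by B D M\<rbrakk> \<Longrightarrow> cmod (kform kF (acts D xs) xs) \<le> K * M"
    using acts_crude by blast
  have PP: "kform kF (acts (P (Suc n)) xs) xs = kform kF (acts (P n) xs) (acts (P n) xs)" for n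
    using acts_adj[OF PA, of n "acts (P n) xs" xs] by (simp add: PS acts_mult PA Padj)
  have CC: "kform kF (acts (P 0) xs) xs = kform kF (acts C xs) (acts C xs)"
    using acts_adj[of "adj B C" "acts C xs" xs] C by (simp add: P0 acts_mult)
  have nonneg: "0 \<le> Re (kform kF (acts (P n) xs) xs)" for n
    by (cases n) (simp_all only: PP CC P.Q_pos)
  have "Re (kform kF (acts (P 0) xs) xs) \<le> M\<^sup>2 * Re (kform kF xs xs)"
  proof (rule repeated_squaring_bound)
    fix n
    have "Re (kform kF (acts (P n) xs) xs) \<le> P.nn (acts (P n) xs) * P.nn xs"
      using P.Q_CS complex_Re_le_cmod order_trans by blast
    then have "(Re (kform kF (acts (P n) xs) xs))\<^sup>2 \<le> (P.nn (acts (P n) xs) * P.nn xs)\<^sup>2"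
      using nonneg by (intro power_mono) auto
    also have "\<dots> = Re (kform kF xs xs) * Re (kform kF (acts (P (Suc n)) xs) xs)"
      by (simp add: power_mult_distrib P.nn_sq PP)
    finally show "(Re (kform kF (acts (P n) xs) xs))\<^sup>2 \<le> Re (kform kF xs xs) * Re (kform kF (acts (P (Suc n)) xs) xs)" .
    show "Re (kform kF (acts (P n) xs) xs) \<le> K * (M\<^sup>2) ^ (2 ^ n)"
      using K[OF PA Pb, of n] complex_Re_le_cmod order_trans by blast
  qed (use nonneg P.Q_pos in auto)
  then show ?thesis by (simp only: CC)
qed

text \<open>Cauchy-Schwarz for the symbols C \<otimes> h and I \<otimes> k, with
  \<open>acts_bound\<close> removing C at the cost of M. Only the values of F at the identity
  remain.\<close>

lemma F_bound:
  assumes C: "C \<in> \<A>" "bounded_by B C M" and h: "h \<in> carrier H" "k \<in> carrier H"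
  shows "cmod (F C h k) \<le> M * sqrt (Re (F (\<lambda>x\<in>carrier B. x) h h)) * sqrt (Re (F (\<lambda>x\<in>carrier B. x) k k))"
proof -
  let ?I = "\<lambda>x\<in>carrier B. x"
  have I: "adj B ?I = ?I" by (rule B.adj_one)
  have nI: "P.nn [(1, (?I, k))] = sqrt (Re (F ?I k k))" if "k \<in> carrier H" for k
    using that by (simp add: P.nn_def kform_def kF_eq I)
  have "P.nn (acts C [(1, (?I, h))]) \<le> M * P.nn [(1, (?I, h))]"
  proof (rule power2_le_imp_le)
    show "(P.nn (acts C [(1, (?I, h))]))\<^sup>2 \<le> (M * P.nn [(1, (?I, h))])\<^sup>2"
      unfolding power_mult_distrib P.nn_sq by (rule acts_bound[OF C])
  qed (use C in \<open>simp add: bounded_by_def\<close>)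
  moreover have "F C h k = kform kF (acts C [(1, (?I, h))]) [(1, (?I, k))]"
    using C h by (simp add: kform_def act_def kF_eq I)
  ultimately show ?thesis
    using order_trans[OF P.Q_CS[of "acts C [(1, (?I, h))]" "[(1, (?I, k))]"] mult_right_mono[OF _ P.nn_nonneg]] h
    by (simp add: nI)
qed

end

section \<open>The Stinespring representation of a completely positive form\<close>

locale cp_realization = cp_form B H \<A> F + R: realization K v "cp_form.kF B H \<A> F"
  for B :: "'a hilbert" and H :: "'h hilbert" and \<A> F and K :: "'k hilbert" and v
begin

lemma v_zero: "p \<notin> S \<Longrightarrow> v p = \<zero>\<^bsub>K\<^esub>"
  by (rule R.total_eqI) (simp_all add: R.gram kF_def)

lemma v_add: "\<lbrakk>A \<in> \<A>; A' \<in> \<A>; h \<in> carrier H\<rbrakk> \<Longrightarrow> v (A \<oplus>\<^bsub>op_alg B\<^esub> A', h) = v (A, h) \<oplus>\<^bsub>K\<^esub> v (A', h)"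
  using add_mult(2)[of A A'] F_add
  by (intro R.total_eqI) (auto simp: R.gram kF_def R.K.cinner_add_left)

lemma v_smult: "\<lbrakk>A \<in> \<A>; h \<in> carrier H\<rbrakk> \<Longrightarrow> v (c \<odot>\<^bsub>op_alg B\<^esub> A, h) = c \<odot>\<^bsub>K\<^esub> v (A, h)"
  using smult_mult(2)[of A] F_smult
  by (intro R.total_eqI) (auto simp: R.gram kF_def R.K.cinner_smult_left)

lemma v_add1: "\<lbrakk>A \<in> \<A>; h \<in> carrier H; h' \<in> carrier H\<rbrakk> \<Longrightarrow> v (A, h \<oplus>\<^bsub>H\<^esub> h') = v (A, h) \<oplus>\<^bsub>K\<^esub> v (A, h')"
  by (rule R.total_eqI) (auto simp: R.gram kF_def R.K.cinner_add_left F_add1)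

lemma v_smult1: "\<lbrakk>A \<in> \<A>; h \<in> carrier H\<rbrakk> \<Longrightarrow> v (A, c \<odot>\<^bsub>H\<^esub> h) = c \<odot>\<^bsub>K\<^esub> v (A, h)"
  by (rule R.total_eqI) (auto simp: R.gram kF_def R.K.cinner_smult_left F_smult1)

text \<open>The operator sending A \<otimes> h to CA \<otimes> h, described by its matrix
  coefficients against the total family v, where uniqueness is immediate.\<close>

definition rep :: "('a \<Rightarrow> 'a) \<Rightarrow> ('k \<Rightarrow> 'k)" where
  "rep C = (THE A. A \<in> bounded_ops K K \<and>
     (\<forall>x\<in>carrier K. \<forall>t. cinner K (A x) (v t) = cinner K x (v (act (adj B C) t))))"

lemma op_eqI_total:
  assumes "A \<in> bounded_ops K K" "A' \<in> bounded_ops K K"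
    "\<And>x t. \<lbrakk>x \<in> carrier K; t \<in> S\<rbrakk> \<Longrightarrow> cinner K (A x) (v t) = cinner K (A' x) (v t)"
  shows "A = A'"
proof (rule R.K.op_eqI[OF assms(1,2)])
  fix x assume x: "x \<in> carrier K"
  show "A x = A' x"
  proof (rule R.total_eqI)
    fix t
    show "cinner K (A x) (v t) = cinner K (A' x) (v t)"
      using assms(3)[OF x, of t] v_zero[of t] bounded_ops_in[OF assms(1) x] bounded_ops_in[OF assms(2) x]
      by (cases "t \<in> S") auto
  qed (use bounded_ops_in[OF assms(1) x] bounded_ops_in[OF assms(2) x] in auto)
qed

lemma rep_props:
  assumes C: "C \<in> \<A>" "bounded_by B C M"
  shows "rep C \<in> bounded_ops K K" "bounded_by K (rep C) M" "rep C (v p) = v (act C p)"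
    "x \<in> carrier K \<Longrightarrow> cinner K (rep C x) (v t) = cinner K x (v (act (adj B C) t))"
proof -
  obtain A where A: "A \<in> bounded_ops K K" "bounded_by K A M" "\<And>s. A (v s) = v (act C s)"
    "\<And>x t. x \<in> carrier K \<Longrightarrow> cinner K (A x) (v t) = cinner K x (v (act (adj B C) t))"
    by (rule R.kernel_op[of "act C" "act (adj B C)" M]) (use C act_adj acts_bound in \<open>auto simp: bounded_by_def\<close>)
  have "rep C = A"
    unfolding rep_def
  proof (rule the_equality)
    show "A' = A" if "A' \<in> bounded_ops K K \<and> (\<forall>x\<in>carrier K. \<forall>t. cinner K (A' x) (v t) = cinner K x (v (act (adj B C) t)))" for A'
      by (rule op_eqI_total) (use that A in auto)
  qed (use A in auto)
  then show "rep C \<in> bounded_ops K K" "bounded_by K (rep C) M" "rep C (v p) = v (act C p)"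
    "x \<in> carrier K \<Longrightarrow> cinner K (rep C x) (v t) = cinner K x (v (act (adj B C) t))"
    using A by auto
qed

lemma rep_in: "C \<in> \<A> \<Longrightarrow> rep C \<in> bounded_ops K K"
  using B.bounded_ops_bound[OF A_ops] rep_props(1) by metis

lemma rep_v: "\<lbrakk>C \<in> \<A>; A \<in> \<A>; h \<in> carrier H\<rbrakk> \<Longrightarrow> rep C (v (A, h)) = v (C \<cdot> A, h)"
  using B.bounded_ops_bound[OF A_ops, of C] rep_props(3)[of C _ "(A, h)"] by (metis act_def fst_conv mem_Sigma_iff snd_conv)

lemma rep_ip: "\<lbrakk>C \<in> \<A>; D \<in> \<A>; h \<in> carrier H; x \<in> carrier K\<rbrakk> \<Longrightarrow>
    cinner K (rep C x) (v (D, h)) = cinner K x (v (adj B C \<cdot> D, h))"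
  using B.bounded_ops_bound[OF A_ops, of C] rep_props(4)[of C _ x "(D, h)"] by (metis act_def fst_conv mem_Sigma_iff snd_conv)

text \<open>Each identity is tested against the vectors \<open>v t\<close>: \<open>rep_ip\<close>
  moves the operators to the right, and only linearity of v in its operator slot and associativity
  are left to check.\<close>

lemma star_rep: "star_representation B \<A> K rep"
  unfolding star_representation_def
proof (intro conjI ballI allI)
  show "rep A \<in> bounded_ops K K" if "A \<in> \<A>" for A using rep_in[OF that] .
  have one: "(\<lambda>x\<in>carrier B. x) \<in> \<A>" by simp
  show "rep \<one>\<^bsub>op_alg B\<^esub> = \<one>\<^bsub>op_alg K\<^esub>"
  proof (rule op_eqI_total)
    fix x t assume x: "x \<in> carrier K" and t: "t \<in> S"
    show "cinner K (rep \<one>\<^bsub>op_alg B\<^esub> x) (v t) = cinner K (\<one>\<^bsub>op_alg K\<^esub> x) (v t)"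
      using x t rep_ip[OF one, of "fst t" "snd t" x] mult_one(2)[of "fst t"] by (auto simp: B.adj_one)
  qed (use rep_in[OF one] in auto)
next
  fix A C assume A: "A \<in> \<A>" and C: "C \<in> \<A>"
  have sum: "A \<oplus>\<^bsub>op_alg B\<^esub> C \<in> \<A>" using A C by simp
  have adj_sum: "adj B (A \<oplus>\<^bsub>op_alg B\<^esub> C) = adj B A \<oplus>\<^bsub>op_alg B\<^esub> adj B C"
    using B.adj_add[OF A_ops[OF A] A_ops[OF C]] by simp
  show "rep (A \<oplus>\<^bsub>op_alg B\<^esub> C) = rep A \<oplus>\<^bsub>op_alg K\<^esub> rep C"
  proof (rule op_eqI_total)
    fix x t assume x: "x \<in> carrier K" and t: "t \<in> S"
    then obtain D h where D: "t = (D, h)" "D \<in> \<A>" "h \<in> carrier H" by (metis SigmaE)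
    have "v (adj B (A \<oplus>\<^bsub>op_alg B\<^esub> C) \<cdot> D, h) = v (adj B A \<cdot> D, h) \<oplus>\<^bsub>K\<^esub> v (adj B C \<cdot> D, h)"
      using A C D by (simp only: adj_sum add_mult A_adj v_add A_mult)
    then have "cinner K (rep (A \<oplus>\<^bsub>op_alg B\<^esub> C) x) (v t) = cinner K (rep A x) (v t) + cinner K (rep C x) (v t)"
      using rep_ip[OF sum D(2,3) x] rep_ip[OF A D(2,3) x] rep_ip[OF C D(2,3) x] D(1) x
      by (simp add: R.K.ip_add_right)
    then show "cinner K (rep (A \<oplus>\<^bsub>op_alg B\<^esub> C) x) (v t) = cinner K ((rep A \<oplus>\<^bsub>op_alg K\<^esub> rep C) x) (v t)"
      using x bounded_ops_in[OF rep_in[OF A] x] bounded_ops_in[OF rep_in[OF C] x] by (simp add: R.K.cinner_add_left)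
  qed (use rep_in[OF A] rep_in[OF C] rep_in[OF sum] in auto)
  show "rep (A \<otimes>\<^bsub>op_alg B\<^esub> C) = rep A \<otimes>\<^bsub>op_alg K\<^esub> rep C"
  proof (rule op_eqI_total)
    fix x t assume x: "x \<in> carrier K" and t: "t \<in> S"
    then obtain D h where D: "t = (D, h)" "D \<in> \<A>" "h \<in> carrier H" by (metis SigmaE)
    show "cinner K (rep (A \<otimes>\<^bsub>op_alg B\<^esub> C) x) (v t) = cinner K ((rep A \<otimes>\<^bsub>op_alg K\<^esub> rep C) x) (v t)"
      using A C D x bounded_ops_in[OF rep_in[OF C] x] by (simp add: rep_ip compose_eq adj_mult mult_assoc)
  qed (use rep_in[OF A] rep_in[OF C] rep_in[of "A \<cdot> C"] A C in auto)
next
  fix c A assume A: "A \<in> \<A>"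
  have sm: "c \<odot>\<^bsub>op_alg B\<^esub> A \<in> \<A>" using A by simp
  have adj_sm: "adj B (c \<odot>\<^bsub>op_alg B\<^esub> A) = cnj c \<odot>\<^bsub>op_alg B\<^esub> adj B A"
    using B.adj_smult[OF A_ops[OF A]] by simp
  show "rep (c \<odot>\<^bsub>op_alg B\<^esub> A) = c \<odot>\<^bsub>op_alg K\<^esub> rep A"
  proof (rule op_eqI_total)
    fix x t assume x: "x \<in> carrier K" and t: "t \<in> S"
    then obtain D h where D: "t = (D, h)" "D \<in> \<A>" "h \<in> carrier H" by (metis SigmaE)
    have "v (adj B (c \<odot>\<^bsub>op_alg B\<^esub> A) \<cdot> D, h) = cnj c \<odot>\<^bsub>K\<^esub> v (adj B A \<cdot> D, h)"
      using A D by (simp only: adj_sm smult_mult A_adj v_smult A_mult)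
    then have "cinner K (rep (c \<odot>\<^bsub>op_alg B\<^esub> A) x) (v t) = c * cinner K (rep A x) (v t)"
      using rep_ip[OF sm D(2,3) x] rep_ip[OF A D(2,3) x] D(1) x by (simp add: R.K.ip_smult_right)
    then show "cinner K (rep (c \<odot>\<^bsub>op_alg B\<^esub> A) x) (v t) = cinner K ((c \<odot>\<^bsub>op_alg K\<^esub> rep A) x) (v t)"
      using x bounded_ops_in[OF rep_in[OF A] x] by (simp add: R.K.cinner_smult_left)
  qed (use rep_in[OF A] rep_in[OF sm] in auto)
next
  fix A assume A: "A \<in> \<A>"
  show "rep (adj B A) = adj K (rep A)"
  proof (rule op_eqI_total)
    fix x t assume x: "x \<in> carrier K" and t: "t \<in> S"
    then obtain D h where D: "t = (D, h)" "D \<in> \<A>" "h \<in> carrier H" by (metis SigmaE)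
    have "cinner K (rep (adj B A) x) (v t) = cinner K x (v (A \<cdot> D, h))"
      using A D x by (simp add: rep_ip)
    also have "\<dots> = cinner K x (rep A (v t))" using A D by (simp add: rep_v)
    also have "\<dots> = cinner K (adj K (rep A) x) (v t)" using R.K.adj_ip2[OF rep_in[OF A] x R.v_in] by simp
    finally show "cinner K (rep (adj B A) x) (v t) = cinner K (adj K (rep A) x) (v t)" .
  qed (use rep_in[OF A] rep_in[of "adj B A"] A R.K.adj_in in auto)
qed

end

section \<open>Limits of completely positive forms\<close>

text \<open>Tychonoff: the family stays in a product of closed discs, which is compact for pointwise
  convergence.\<close>

lemma bounded_family_cluster:
  fixes f :: "'i \<Rightarrow> 's \<Rightarrow> complex"
  assumes F: "F \<noteq> bot" and bd: "\<And>i s. cmod (f i s) \<le> M s"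
  obtains G l where "G \<le> F" "G \<noteq> bot" "\<And>s. ((\<lambda>i. f i s) \<longlongrightarrow> l s) G"
proof -
  define U where "U = PiE UNIV (\<lambda>s. cball (0::complex) (M s))"
  have "compactin (product_topology (\<lambda>s::'s. (euclidean :: complex topology)) UNIV) U"
    unfolding U_def compactin_PiE by simp
  then have "compact U" by (simp add: euclidean_product_topology)
  moreover have "filtermap f F \<noteq> bot" using F by (simp add: filtermap_bot_iff)
  moreover have "eventually (\<lambda>x. x \<in> U) (filtermap f F)"
    using bd by (simp add: U_def eventually_filtermap PiE_iff)
  ultimately obtain l where l: "inf (nhds l) (filtermap f F) \<noteq> bot" unfolding compact_filter by blast
  \<comment> \<open>Refining by the preimages of neighbourhoods of the cluster point turns
    clustering into convergence along G; clustering says exactly that G stays proper.\<close>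
  define G where "G = inf F (filtercomap f (nhds l))"
  have "G \<noteq> bot"
  proof
    assume "G = bot"
    then obtain P Q where P: "eventually P F" and Q: "eventually Q (filtercomap f (nhds l))" and PQ: "\<And>x. \<not> (P x \<and> Q x)"
      unfolding G_def trivial_limit_def[symmetric] by (auto simp: trivial_limit_def eventually_inf)
    from Q obtain N where N: "eventually N (nhds l)" "\<And>x. N (f x) \<Longrightarrow> Q x"
      by (auto simp: eventually_filtercomap)
    have "eventually (\<lambda>y. \<not> N y) (filtermap f F)"
      unfolding eventually_filtermap using P by eventually_elim (use N PQ in blast)
    then have "eventually (\<lambda>_. False) (inf (nhds l) (filtermap f F))"
      unfolding eventually_inf using N(1) by blast
    then show False using l by (simp add: trivial_limit_def)
  qed
  moreover have "(f \<longlongrightarrow> l) G" unfolding filterlim_iff_le_filtercomap G_def by simp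
  then have "((\<lambda>i. f i s) \<longlongrightarrow> l s) G" for s
    using continuous_on_tendsto_compose[OF continuous_on_product_coordinates[of s], of f l G] by simp
  ultimately show ?thesis using that[of G l] by (simp add: G_def)
qed

lemma tendsto_sum_list:
  fixes l :: "'b \<Rightarrow> complex"
  assumes "\<And>x. x \<in> set xs \<Longrightarrow> ((\<lambda>i. f i x) \<longlongrightarrow> l x) G"
  shows "((\<lambda>i. \<Sum>x\<leftarrow>xs. f i x) \<longlongrightarrow> (\<Sum>x\<leftarrow>xs. l x)) G"
  using assms by (induction xs) (auto intro!: tendsto_add)

text \<open>Linearity and bounds are required exactly, but Hermitian symmetry and positivity only
  asymptotically. Compressions by the tail projections are Hermitian and positive only up to
  commutators that vanish in the limit.\<close>

lemma cp_form_cluster: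
  fixes \<Phi> :: "'i \<Rightarrow> ('a \<Rightarrow> 'a) \<Rightarrow> 'h \<Rightarrow> 'h \<Rightarrow> complex"
  assumes B: "hilbert_space B" and H: "hilbert_space H" and alg: "star_alg B \<A>" and F0: "F0 \<noteq> bot"
    and add: "\<And>i C C' h k. \<lbrakk>C \<in> \<A>; C' \<in> \<A>; h \<in> carrier H; k \<in> carrier H\<rbrakk> \<Longrightarrow>
      \<Phi> i (C \<oplus>\<^bsub>op_alg B\<^esub> C') h k = \<Phi> i C h k + \<Phi> i C' h k"
    and smult: "\<And>i c C h k. \<lbrakk>C \<in> \<A>; h \<in> carrier H; k \<in> carrier H\<rbrakk> \<Longrightarrow>
      \<Phi> i (c \<odot>\<^bsub>op_alg B\<^esub> C) h k = c * \<Phi> i C h k"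
    and add1: "\<And>i C h h' k. \<lbrakk>C \<in> \<A>; h \<in> carrier H; h' \<in> carrier H; k \<in> carrier H\<rbrakk> \<Longrightarrow>
      \<Phi> i C (h \<oplus>\<^bsub>H\<^esub> h') k = \<Phi> i C h k + \<Phi> i C h' k"
    and smult1: "\<And>i c C h k. \<lbrakk>C \<in> \<A>; h \<in> carrier H; k \<in> carrier H\<rbrakk> \<Longrightarrow>
      \<Phi> i C (c \<odot>\<^bsub>H\<^esub> h) k = c * \<Phi> i C h k"
    and herm: "\<And>C h k. \<lbrakk>C \<in> \<A>; h \<in> carrier H; k \<in> carrier H\<rbrakk> \<Longrightarrow>
      ((\<lambda>i. \<Phi> i (adj B C) k h - cnj (\<Phi> i C h k)) \<longlongrightarrow> 0) F0"
    and cp: "\<And>ps. set ps \<subseteq> \<A> \<times> carrier H \<Longrightarrow> \<exists>\<psi>. (\<forall>i. 0 \<le> Re (\<psi> i)) \<and>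
      ((\<lambda>i. (\<Sum>p\<leftarrow>ps. \<Sum>q\<leftarrow>ps. \<Phi> i (adj B (fst q) \<otimes>\<^bsub>op_alg B\<^esub> fst p) (snd p) (snd q)) - \<psi> i) \<longlongrightarrow> 0) F0"
    and bd: "\<And>i C M h k. \<lbrakk>C \<in> \<A>; bounded_by B C M; h \<in> carrier H; k \<in> carrier H\<rbrakk> \<Longrightarrow>
      cmod (\<Phi> i C h k) \<le> M * hnorm H h * hnorm H k"
  obtains F G where "G \<le> F0" "G \<noteq> bot" "cp_form B H \<A> F"
    "\<And>C h k. \<lbrakk>C \<in> \<A>; h \<in> carrier H; k \<in> carrier H\<rbrakk> \<Longrightarrow> ((\<lambda>i. \<Phi> i C h k) \<longlongrightarrow> F C h k) G"
    "\<And>C M h k. \<lbrakk>C \<in> \<A>; bounded_by B C M; h \<in> carrier H; k \<in> carrier H\<rbrakk> \<Longrightarrow>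
      cmod (F C h k) \<le> M * hnorm H h * hnorm H k"
proof -
  interpret B: hilbert_space B by fact
  interpret H: hilbert_space H by fact
  have Aops: "A \<in> bounded_ops B B" if "A \<in> \<A>" for A using alg that unfolding star_alg_def by blast
  \<comment> \<open>Extension by 0 outside the carriers makes the index set of the product a whole
    type.\<close>
  define f where "f i s = (case s of (C, h, k) \<Rightarrow> if C \<in> \<A> \<and> h \<in> carrier H \<and> k \<in> carrier H then \<Phi> i C h k else 0)" for i s
  define M where "M s = (case s of (C, h, k) \<Rightarrow> if C \<in> \<A> \<and> h \<in> carrier H \<and> k \<in> carrier H then op_norm B C * hnorm H h * hnorm H k else 0)" for s
  have bdf: "cmod (f i s) \<le> M s" for i s
    using bd[OF _ B.op_norm_bound[OF Aops]] by (auto simp: f_def M_def split: prod.splits)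
  have "\<exists>G l. G \<le> F0 \<and> G \<noteq> bot \<and> (\<forall>s. ((\<lambda>i. f i s) \<longlongrightarrow> l s) G)"
    by (rule bounded_family_cluster[of F0 f M, OF F0 bdf]) blast
  then obtain G l where G: "G \<le> F0" "G \<noteq> bot" "\<And>s. ((\<lambda>i. f i s) \<longlongrightarrow> l s) G" by metis
  define F where "F C h k = l (C, h, k)" for C h k
  have lim: "((\<lambda>i. \<Phi> i C h k) \<longlongrightarrow> F C h k) G" if "C \<in> \<A>" "h \<in> carrier H" "k \<in> carrier H" for C h k
    using G(3)[of "(C, h, k)"] that by (simp add: f_def F_def)
  have A: "C \<oplus>\<^bsub>op_alg B\<^esub> C' \<in> \<A>" "adj B C' \<otimes>\<^bsub>op_alg B\<^esub> C \<in> \<A>" "c \<odot>\<^bsub>op_alg B\<^esub> C \<in> \<A>" "adj B C \<in> \<A>"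
    if "C \<in> \<A>" "C' \<in> \<A>" for C C' c
    using alg that unfolding star_alg_def by blast+
  have bF: "cmod (F C h k) \<le> M * hnorm H h * hnorm H k"
    if "C \<in> \<A>" "bounded_by B C M" "h \<in> carrier H" "k \<in> carrier H" for C M h k
    by (rule tendsto_upperbound[OF tendsto_norm[OF lim] _ G(2)]) (use that bd in auto)
  have "cp_form_axioms B H \<A> F"
  proof (rule cp_form_axioms.intro)
    show "F (C \<oplus>\<^bsub>op_alg B\<^esub> C') h k = F C h k + F C' h k"
      if "C \<in> \<A>" "C' \<in> \<A>" "h \<in> carrier H" "k \<in> carrier H" for C C' h k
      using tendsto_unique[OF G(2) lim[of "C \<oplus>\<^bsub>op_alg B\<^esub> C'" h k] tendsto_add[OF lim[of C h k] lim[of C' h k], folded add[OF that]]] that A by blast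
    show "F (c \<odot>\<^bsub>op_alg B\<^esub> C) h k = c * F C h k"
      if "C \<in> \<A>" "h \<in> carrier H" "k \<in> carrier H" for C h k c
      using tendsto_unique[OF G(2) lim[of "c \<odot>\<^bsub>op_alg B\<^esub> C" h k] tendsto_mult_left[OF lim[of C h k], of c, folded smult[OF that]]] that A by blast
    show "F C (h \<oplus>\<^bsub>H\<^esub> h') k = F C h k + F C h' k"
      if "C \<in> \<A>" "h \<in> carrier H" "h' \<in> carrier H" "k \<in> carrier H" for C h h' k
      using tendsto_unique[OF G(2) lim[of C "h \<oplus>\<^bsub>H\<^esub> h'" k] tendsto_add[OF lim[of C h k] lim[of C h' k], folded add1[OF that]]] that by blast
    show "F C (c \<odot>\<^bsub>H\<^esub> h) k = c * F C h k"
      if "C \<in> \<A>" "h \<in> carrier H" "k \<in> carrier H" for C h k c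
      using tendsto_unique[OF G(2) lim[of C "c \<odot>\<^bsub>H\<^esub> h" k] tendsto_mult_left[OF lim[of C h k], of c, folded smult1[OF that]]] that by blast
    show "F (adj B C) k h = cnj (F C h k)" if "C \<in> \<A>" "h \<in> carrier H" "k \<in> carrier H" for C h k
    proof -
      have "((\<lambda>i. \<Phi> i (adj B C) k h - cnj (\<Phi> i C h k)) \<longlongrightarrow> F (adj B C) k h - cnj (F C h k)) G"
        by (intro tendsto_intros lim) (use that A in auto)
      then have "F (adj B C) k h - cnj (F C h k) = 0"
        using tendsto_unique[OF G(2) _ tendsto_mono[OF G(1) herm[OF that]]] by blast
      then show ?thesis by simp
    qed
    show "0 \<le> Re (\<Sum>p\<leftarrow>ps. \<Sum>q\<leftarrow>ps. F (adj B (fst q) \<otimes>\<^bsub>op_alg B\<^esub> fst p) (snd p) (snd q))"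
      if ps: "set ps \<subseteq> \<A> \<times> carrier H" for ps
    proof -
      let ?s = "\<lambda>i. \<Sum>p\<leftarrow>ps. \<Sum>q\<leftarrow>ps. \<Phi> i (adj B (fst q) \<otimes>\<^bsub>op_alg B\<^esub> fst p) (snd p) (snd q)"
      obtain \<psi> where \<psi>: "\<And>i. 0 \<le> Re (\<psi> i)" "((\<lambda>i. ?s i - \<psi> i) \<longlongrightarrow> 0) F0" using cp[OF ps] by blast
      have "(?s \<longlongrightarrow> (\<Sum>p\<leftarrow>ps. \<Sum>q\<leftarrow>ps. F (adj B (fst q) \<otimes>\<^bsub>op_alg B\<^esub> fst p) (snd p) (snd q))) G"
      proof (intro tendsto_sum_list lim)
        fix p q assume "p \<in> set ps" "q \<in> set ps"
        then have "p \<in> \<A> \<times> carrier H" "q \<in> \<A> \<times> carrier H" using ps by blast+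
        then show "adj B (fst q) \<otimes>\<^bsub>op_alg B\<^esub> fst p \<in> \<A>" "snd p \<in> carrier H" "snd q \<in> carrier H"
          using A(2) by (auto simp del: op_alg_simps)
      qed
      from tendsto_diff[OF this tendsto_mono[OF G(1) \<psi>(2)]]
      have "(\<psi> \<longlongrightarrow> (\<Sum>p\<leftarrow>ps. \<Sum>q\<leftarrow>ps. F (adj B (fst q) \<otimes>\<^bsub>op_alg B\<^esub> fst p) (snd p) (snd q))) G" by simp
      then show ?thesis by (intro tendsto_lowerbound[OF tendsto_Re _ G(2)]) (use \<psi> in auto)
    qed
    show "\<exists>c\<ge>0. \<forall>C\<in>\<A>. \<forall>M. bounded_by B C M \<longrightarrow> cmod (F C h k) \<le> c * M"
      if "h \<in> carrier H" "k \<in> carrier H" for h k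
      using bF that by (intro exI[of _ "hnorm H h * hnorm H k"]) (auto simp: mult.commute mult.left_commute)
  qed (rule alg)
  then have "cp_form B H \<A> F" using B H by (simp add: cp_form_def)
  then show ?thesis using that[of G F] G lim bF by blast
qed

section \<open>The universal model\<close>

lemma nc_mult_assoc: "nc_mult (nc_mult f g) h = nc_mult f (nc_mult g h)"
proof
  fix \<alpha>
  have "nc_mult (nc_mult f g) h \<alpha> = (\<Sum>k\<le>length \<alpha>. \<Sum>j\<le>k. f (take j \<alpha>) * g (drop j (take k \<alpha>)) * h (drop k \<alpha>))"
    unfolding nc_mult_def by (intro sum.cong refl) (simp add: sum_distrib_right min_def)
  also have "\<dots> = (\<Sum>(k, j)\<in>(SIGMA k:{..length \<alpha>}. {..k}). f (take j \<alpha>) * g (drop j (take k \<alpha>)) * h (drop k \<alpha>))"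
    by (simp add: sum.Sigma)
  also have "\<dots> = (\<Sum>(j, i)\<in>(SIGMA j:{..length \<alpha>}. {..length \<alpha> - j}). f (take j \<alpha>) * g (take i (drop j \<alpha>)) * h (drop i (drop j \<alpha>)))"
    by (rule sum.reindex_bij_witness[of _ "\<lambda>(j, i). (i + j, j)" "\<lambda>(k, j). (j, k - j)"])
      (auto simp: drop_take add.commute)
  also have "\<dots> = (\<Sum>j\<le>length \<alpha>. \<Sum>i\<le>length \<alpha> - j. f (take j \<alpha>) * g (take i (drop j \<alpha>)) * h (drop i (drop j \<alpha>)))"
    by (simp add: sum.Sigma)
  also have "\<dots> = nc_mult f (nc_mult g h) \<alpha>"
    unfolding nc_mult_def by (intro sum.cong refl) (simp add: sum_distrib_left mult.assoc)
  finally show "nc_mult (nc_mult f g) h \<alpha> = nc_mult f (nc_mult g h) \<alpha>" .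
qed

lemma nc_mult_one [simp]: "nc_mult nc_one f = f" "nc_mult f nc_one = f"
proof -
  have "(\<Sum>k\<le>length \<alpha>. nc_one (take k \<alpha>) * f (drop k \<alpha>)) = (\<Sum>k\<in>{0}. nc_one (take k \<alpha>) * f (drop k \<alpha>))" for \<alpha>
    by (rule sum.mono_neutral_right) (auto simp: nc_one_def)
  moreover have "(\<Sum>k\<le>length \<alpha>. f (take k \<alpha>) * nc_one (drop k \<alpha>)) = (\<Sum>k\<in>{length \<alpha>}. f (take k \<alpha>) * nc_one (drop k \<alpha>))" for \<alpha>
    by (rule sum.mono_neutral_right) (auto simp: nc_one_def)
  ultimately show "nc_mult nc_one f = f" "nc_mult f nc_one = f" by (auto simp: nc_mult_def nc_one_def)
qed

function nc_linv :: "('n list \<Rightarrow> real) \<Rightarrow> 'n list \<Rightarrow> real" where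
  "nc_linv b \<alpha> = (if \<alpha> = [] then 1 else - (\<Sum>k<length \<alpha>. nc_linv b (take k \<alpha>) * b (drop k \<alpha>)))"
  by auto
termination by (relation "Wellfounded.measure (\<lambda>(b, \<alpha>). length \<alpha>)") auto

function nc_rinv :: "('n list \<Rightarrow> real) \<Rightarrow> 'n list \<Rightarrow> real" where
  "nc_rinv b \<alpha> = (if \<alpha> = [] then 1 else - (\<Sum>k\<in>{1..length \<alpha>}. b (take k \<alpha>) * nc_rinv b (drop k \<alpha>)))"
  by auto
termination by (relation "Wellfounded.measure (\<lambda>(b, \<alpha>). length \<alpha>)") auto

declare nc_linv.simps [simp del] nc_rinv.simps [simp del]

lemma nc_linv:
  fixes b :: "'n list \<Rightarrow> real"
  assumes "b [] = 1" shows "nc_mult (nc_linv b) b = nc_one"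
proof
  fix \<alpha> :: "'n list"
  have "(\<Sum>k\<le>length \<alpha>. nc_linv b (take k \<alpha>) * b (drop k \<alpha>)) = (\<Sum>k<length \<alpha>. nc_linv b (take k \<alpha>) * b (drop k \<alpha>)) + nc_linv b \<alpha>"
    using assms by (simp add: lessThan_Suc_atMost[symmetric])
  then show "nc_mult (nc_linv b) b \<alpha> = nc_one \<alpha>"
    by (simp add: nc_mult_def nc_one_def nc_linv.simps[of b \<alpha>])
qed

lemma nc_rinv:
  fixes b :: "'n list \<Rightarrow> real"
  assumes "b [] = 1" shows "nc_mult b (nc_rinv b) = nc_one"
proof
  fix \<alpha> :: "'n list"
  have "{..length \<alpha>} = insert 0 {1..length \<alpha>}" by auto
  then have "(\<Sum>k\<le>length \<alpha>. b (take k \<alpha>) * nc_rinv b (drop k \<alpha>)) = nc_rinv b \<alpha> + (\<Sum>k\<in>{1..length \<alpha>}. b (take k \<alpha>) * nc_rinv b (drop k \<alpha>))"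
    using assms by simp
  then show "nc_mult b (nc_rinv b) \<alpha> = nc_one \<alpha>"
    by (simp add: nc_mult_def nc_one_def nc_rinv.simps[of b \<alpha>])
qed

text \<open>The recursions on word length give a left and a right inverse; associativity identifies
  them with each other and with any two-sided inverse, so the description in
  \<open>nc_inverse\<close> is well defined.\<close>

lemma nc_inverse:
  assumes b: "b [] = 1" shows "nc_mult (nc_inverse b) b = nc_one"
proof -
  have eq: "nc_linv b = nc_rinv b"
    using nc_mult_assoc[of "nc_linv b" b "nc_rinv b"] nc_linv[of b, OF b] nc_rinv[of b, OF b] by simp
  have "nc_inverse b = nc_linv b" unfolding nc_inverse_def
  proof (rule the_equality)
    show "a = nc_linv b" if "nc_mult a b = nc_one \<and> nc_mult b a = nc_one" for a
      using nc_mult_assoc[of a b "nc_rinv b"] that nc_rinv[of b, OF b] eq by simp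
  qed (use nc_linv[of b, OF b] nc_rinv[of b, OF b] eq in simp)
  then show ?thesis using nc_linv[of b, OF b] by simp
qed

text \<open>Dominated convergence where each factor is eventually constant: past some N the two sums
  agree on a finite set carrying almost all of the mass of c.\<close>

lemma tendsto_infsum_dominated:
  fixes c :: "'i \<Rightarrow> complex" and d :: "nat \<Rightarrow> 'i \<Rightarrow> complex"
  assumes c: "(\<lambda>x. norm (c x)) summable_on UNIV" and B: "\<And>N x. norm (d N x) \<le> B" "\<And>x. norm (l x) \<le> B"
    and ev: "\<And>x. \<forall>\<^sub>F N in sequentially. d N x = l x"
  shows "(\<lambda>N. \<Sum>\<^sub>\<infinity>x. d N x * c x) \<longlonglongrightarrow> (\<Sum>\<^sub>\<infinity>x. l x * c x)"
proof (rule LIMSEQ_I)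
  fix r :: real assume "r > 0"
  have B0: "B \<ge> 0" using B(2) norm_ge_zero order_trans by blast
  have sm: "(\<lambda>x. norm (w x * c x)) summable_on X" if "\<And>x. norm (w x) \<le> D" for w D X
  proof (rule summable_on_comparison_test)
    show "(\<lambda>x. D * norm (c x)) summable_on X"
      by (intro summable_on_cmult_right summable_on_subset_banach[OF c]) auto
  qed (use that in \<open>auto simp: norm_mult intro: mult_right_mono\<close>)
  \<comment> \<open>The tail contributes at most 2Be, and (2B+1) 2e = r; the summand 1 covers B =
    0.\<close>
  define e where "e = r / (2 * (2 * B + 1))"
  have e: "e > 0" using \<open>r > 0\<close> B0 by (simp add: e_def)
  obtain X where X: "finite X" "dist (\<Sum>x\<in>X. norm (c x)) (\<Sum>\<^sub>\<infinity>x. norm (c x)) \<le> e"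
    using infsum_finite_approximation[OF c e] by auto
  have tl: "(\<Sum>\<^sub>\<infinity>x\<in>-X. norm (c x)) \<le> e"
  proof -
    have "(\<Sum>\<^sub>\<infinity>x\<in>X \<union> -X. norm (c x)) = (\<Sum>\<^sub>\<infinity>x\<in>X. norm (c x)) + (\<Sum>\<^sub>\<infinity>x\<in>-X. norm (c x))"
      by (rule infsum_Un_disjoint) (use X c in \<open>auto intro: summable_on_subset_banach[OF c]\<close>)
    then show ?thesis using X by (simp add: dist_real_def Compl_partition)
  qed
  have "\<forall>\<^sub>F N in sequentially. \<forall>x\<in>X. d N x = l x" using X(1) ev by (simp add: eventually_ball_finite_distrib)
  then obtain N0 where N0: "\<And>N x. \<lbrakk>N \<ge> N0; x \<in> X\<rbrakk> \<Longrightarrow> d N x = l x" by (auto simp: eventually_sequentially)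
  have "norm ((\<Sum>\<^sub>\<infinity>x. d N x * c x) - (\<Sum>\<^sub>\<infinity>x. l x * c x)) < r" if "N \<ge> N0" for N
  proof -
    have bd: "norm (d N x - l x) \<le> 2 * B" for x using norm_triangle_ineq4[of "d N x" "l x"] B(1)[of N x] B(2)[of x] by linarith
    have s1: "(\<lambda>x. d N x * c x) summable_on UNIV" "(\<lambda>x. l x * c x) summable_on UNIV"
      by (rule abs_summable_summable, rule sm, rule B)+
    have "(\<Sum>\<^sub>\<infinity>x. d N x * c x) - (\<Sum>\<^sub>\<infinity>x. l x * c x) = (\<Sum>\<^sub>\<infinity>x. (d N x - l x) * c x)"
      using infsum_add[OF s1(1) summable_on_uminus[THEN iffD2, OF s1(2)]] by (simp add: infsum_uminus left_diff_distrib)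
    also have "\<dots> = (\<Sum>\<^sub>\<infinity>x\<in>-X. (d N x - l x) * c x)"
      by (rule infsum_cong_neutral) (use N0 that in auto)
    finally have "norm ((\<Sum>\<^sub>\<infinity>x. d N x * c x) - (\<Sum>\<^sub>\<infinity>x. l x * c x)) \<le> (\<Sum>\<^sub>\<infinity>x\<in>-X. norm ((d N x - l x) * c x))"
      using norm_infsum_bound[OF sm[OF bd]] by simp
    also have "\<dots> \<le> (\<Sum>\<^sub>\<infinity>x\<in>-X. 2 * B * norm (c x))"
      by (rule infsum_mono[OF sm[OF bd] summable_on_cmult_right[OF summable_on_subset_banach[OF c]]])
        (auto simp: norm_mult intro: mult_right_mono bd)
    also have "\<dots> = 2 * B * (\<Sum>\<^sub>\<infinity>x\<in>-X. norm (c x))"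
      by (rule infsum_cmult_right) (auto intro: summable_on_subset_banach[OF c])
    also have "\<dots> \<le> 2 * B * e" using tl B0 by (intro mult_left_mono) auto
    also have "\<dots> < (2 * B + 1) * (2 * e)"
      using e mult_nonneg_nonneg[OF B0 less_imp_le[OF e]] by (simp add: algebra_simps)
    also have "\<dots> = r"
    proof -
      have *: "q * (2 * (r / (2 * q))) = r" if "q \<noteq> 0" for q :: real using that by simp
      show ?thesis unfolding e_def by (rule *) (use B0 in simp)
    qed
    finally show ?thesis .
  qed
  then show "\<exists>no. \<forall>n\<ge>no. norm ((\<Sum>\<^sub>\<infinity>x. d n x * c x) - (\<Sum>\<^sub>\<infinity>x. l x * c x)) < r" by blast
qed

lemma has_sum_finite_sum:
  fixes s :: "'i \<Rightarrow> complex"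
  assumes "finite I" "\<And>i. i \<in> I \<Longrightarrow> (f i has_sum s i) X"
  shows "((\<lambda>x. \<Sum>i\<in>I. f i x) has_sum (\<Sum>i\<in>I. s i)) X"
  using assms by (induction I rule: finite_induct) (auto intro!: has_sum_add)

text \<open>The adjoint of \<open>W_\<alpha>\<close> tensored with the identity, in closed form: the
  one-letter weights telescope to a single quotient.\<close>

definition bshift :: "('n list \<Rightarrow> real) \<Rightarrow> 'd hilbert \<Rightarrow> 'n list \<Rightarrow> ('n list \<Rightarrow> 'd) \<Rightarrow> ('n list \<Rightarrow> 'd)" where
  "bshift b D \<alpha> f = (\<lambda>\<gamma>. complex_of_real (sqrt (b \<gamma> / b (\<alpha> @ \<gamma>))) \<odot>\<^bsub>D\<^esub> f (\<alpha> @ \<gamma>))"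

text \<open>\<open>Bk b D i\<close> is the operator \<open>W\<^sub>i\<^sup>* \<otimes> I\<^sub>D\<close>.\<close>

definition Bk :: "('n::finite list \<Rightarrow> real) \<Rightarrow> 'd hilbert \<Rightarrow> 'n \<Rightarrow> ('n list \<Rightarrow> 'd) \<Rightarrow> ('n list \<Rightarrow> 'd)" where
  "Bk b D i = (\<lambda>f\<in>carrier (l2_sum D). bshift b D [i] f)"

definition basis :: "'i \<Rightarrow> 'i \<Rightarrow> complex" where
  "basis \<gamma> = (\<lambda>\<alpha>. if \<alpha> = \<gamma> then 1 else 0)"

definition single :: "'d hilbert \<Rightarrow> 'i \<Rightarrow> 'd \<Rightarrow> 'i \<Rightarrow> 'd" where
  "single D \<gamma> d = (\<lambda>\<alpha>. if \<alpha> = \<gamma> then d else \<zero>\<^bsub>D\<^esub>)"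

lemma (in hilbert_space) single_in:
  assumes "d \<in> carrier H" shows "single H \<gamma> d \<in> carrier (l2_sum H)"
proof -
  have "(\<lambda>\<alpha>. (hnorm H (single H \<gamma> d \<alpha>))\<^sup>2) summable_on UNIV"
    by (rule finite_nonzero_values_imp_summable_on) (rule finite_subset[of _ "{\<gamma>}"]; auto simp: single_def)
  then show ?thesis using assms by (simp add: l2_sum_carrier single_def)
qed

lemma (in hilbert_space) single_ip:
  assumes d: "d \<in> carrier H" and g: "g \<in> carrier (l2_sum H)"
  shows "cinner (l2_sum H) (single H \<gamma> d) g = cinner H d (g \<gamma>)"
proof -
  have "(\<Sum>\<^sub>\<infinity>\<alpha>. cinner H (single H \<gamma> d \<alpha>) (g \<alpha>)) = (\<Sum>\<^sub>\<infinity>\<alpha>\<in>{\<gamma>}. cinner H (single H \<gamma> d \<alpha>) (g \<alpha>))"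
    by (rule infsum_cong_neutral) (auto simp: single_def l2_sumD[OF g])
  then show ?thesis by (simp add: single_def)
qed

text \<open>Moving B to the other side makes the expansion a coordinate sum in the definition of the
  inner product, so no convergence of vectors has to be discussed.\<close>

lemma (in hilbert_space) l2_expand:
  fixes B :: "('i \<Rightarrow> 'a) \<Rightarrow> ('i \<Rightarrow> 'a)"
  assumes B: "B \<in> bounded_ops (l2_sum H) (l2_sum H)" and f: "f \<in> carrier (l2_sum H)" and g: "g \<in> carrier (l2_sum H)"
  shows "cinner (l2_sum H) (B f) g = (\<Sum>\<^sub>\<infinity>\<gamma>. cinner (l2_sum H) (B (single H \<gamma> (f \<gamma>))) g)"
proof -
  interpret L: hilbert_space "l2_sum H :: ('i \<Rightarrow> 'a) hilbert" by (rule hilbert_l2_sum)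
  have ag: "adj (l2_sum H) B g \<in> carrier (l2_sum H)" using B g by simp
  have "cinner (l2_sum H) (B f) g = cinner (l2_sum H) f (adj (l2_sum H) B g)" using L.adj_ip[OF B f g] by simp
  also have "\<dots> = (\<Sum>\<^sub>\<infinity>\<gamma>. cinner H (f \<gamma>) (adj (l2_sum H) B g \<gamma>))" by simp
  also have "\<dots> = (\<Sum>\<^sub>\<infinity>\<gamma>. cinner (l2_sum H) (B (single H \<gamma> (f \<gamma>))) g)"
  proof (rule infsum_cong)
    fix \<gamma>
    have "cinner H (f \<gamma>) (adj (l2_sum H) B g \<gamma>) = cinner (l2_sum H) (single H \<gamma> (f \<gamma>)) (adj (l2_sum H) B g)"
      by (rule single_ip[symmetric, OF l2_sumD[OF f] ag])
    also have "\<dots> = cinner (l2_sum H) (B (single H \<gamma> (f \<gamma>))) g"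
      by (rule L.adj_ip[OF B single_in[OF l2_sumD[OF f]] g])
    finally show "cinner H (f \<gamma>) (adj (l2_sum H) B g \<gamma>) = cinner (l2_sum H) (B (single H \<gamma> (f \<gamma>))) g" .
  qed
  finally show ?thesis .
qed

text \<open>A map with a bounded formal adjoint must be the adjoint of that operator, so its
  linearity and boundedness come for free.\<close>

lemma (in hilbert_space) ops_if_adjoint:
  assumes A: "A \<in> carrier H \<rightarrow>\<^sub>E carrier H" and C: "C \<in> ops"
    and ip: "\<And>x y. \<lbrakk>x \<in> carrier H; y \<in> carrier H\<rbrakk> \<Longrightarrow> cinner H (A x) y = cinner H x (C y)"
  shows "A \<in> ops" "adj H A = C"
proof -
  have "A = adj H C"
  proof (rule PiE_ext[OF A bounded_ops_PiE[OF adj_in[OF C]]])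
    fix x assume x: "x \<in> carrier H"
    show "A x = adj H C x"
      by (rule vec_eqI) (use A x C ip in \<open>auto simp: adj_ip2\<close>)
  qed
  then show "A \<in> ops" "adj H A = C" using C by simp_all
qed

lemma fock_simps [simp]:
  "zero fock = (\<lambda>_. 0)" "add fock = (\<lambda>f g i. f i + g i)"
  "smult fock = (\<lambda>c f i. c * f i)" "cinner fock = (\<lambda>f g. \<Sum>\<^sub>\<infinity>i. f i * cnj (g i))"
  by (simp_all add: fock_def)

lemma hilbert_fock: "hilbert_space fock"
  unfolding fock_def by (rule hilbert_space.hilbert_l2_sum[OF hilbert_complex_space])

lemma fock_carrier: "f \<in> carrier fock \<longleftrightarrow> (\<lambda>i. (cmod (f i))\<^sup>2) summable_on UNIV"
  by (simp add: fock_def l2_sum_carrier)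

lemma single_complex: "single complex_space \<gamma> 1 = basis \<gamma>"
  by (rule ext) (simp add: single_def basis_def)

lemma basis_in [simp]: "basis \<gamma> \<in> carrier fock"
  using hilbert_space.single_in[OF hilbert_complex_space, of 1 \<gamma>] by (simp add: fock_def single_complex)

lemma basis_ip: "g \<in> carrier fock \<Longrightarrow> cinner fock (basis \<gamma>) g = cnj (g \<gamma>)"
  using hilbert_space.single_ip[OF hilbert_complex_space, of 1 g \<gamma>]
  by (simp add: fock_def single_complex)

lemma hnorm_basis [simp]: "hnorm fock (basis \<gamma>) = 1"
  using basis_ip[of "basis \<gamma>" \<gamma>] by (simp only: hnorm_def basis_in) (simp add: basis_def)

section \<open>The universal model, its ampliations and its diagonal defect sums\<close>

locale admissible_series =
  fixes b :: "'n::finite list \<Rightarrow> real"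
  assumes adm: "admissible b"
begin

lemma b_pos [simp]: "b \<alpha> > 0" using adm by (simp add: admissible_def)
lemma b_nonneg [simp]: "b \<alpha> \<ge> 0" using b_pos[of \<alpha>] by linarith
lemma b_neq [simp]: "b \<alpha> \<noteq> 0" using b_pos[of \<alpha>] by linarith
lemma b_Nil [simp]: "b [] = 1" using adm by (simp add: admissible_def)

lemma weight_bound: obtains c where "c \<ge> 0" "\<And>\<alpha>. b \<alpha> / b (i # \<alpha>) \<le> c"
proof -
  have "bdd_above (range (\<lambda>\<alpha>. b \<alpha> / b (i # \<alpha>)))" using adm unfolding admissible_def by (elim conjE) (erule spec)
  then obtain c where c: "\<And>\<alpha>. b \<alpha> / b (i # \<alpha>) \<le> c" by (auto simp: bdd_above_def)
  moreover have "c \<ge> 0" using c[of "[]"] by (meson b_nonneg divide_nonneg_nonneg order_trans)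
  ultimately show ?thesis using that by blast
qed

lemma bshift_append:
  assumes "hilbert_space D" "\<And>\<gamma>. f \<gamma> \<in> carrier D"
  shows "bshift b D \<beta> (bshift b D \<alpha> f) = bshift b D (\<alpha> @ \<beta>) f"
proof
  fix \<gamma>
  interpret D: hilbert_space D by fact
  have "sqrt (b \<gamma> / b (\<beta> @ \<gamma>)) * sqrt (b (\<beta> @ \<gamma>) / b (\<alpha> @ \<beta> @ \<gamma>)) = sqrt (b \<gamma> / b (\<alpha> @ \<beta> @ \<gamma>))"
    by (simp add: real_sqrt_divide)
  then show "bshift b D \<beta> (bshift b D \<alpha> f) \<gamma> = bshift b D (\<alpha> @ \<beta>) f \<gamma>"
    using D.smult_assoc1[of "complex_of_real (sqrt (b \<gamma> / b (\<beta> @ \<gamma>)))" "complex_of_real (sqrt (b (\<beta> @ \<gamma>) / b (\<alpha> @ \<beta> @ \<gamma>)))" "f (\<alpha> @ \<beta> @ \<gamma>)"] assms(2)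
    by (simp add: bshift_def flip: of_real_mult)
qed

lemma Bk_in:
  assumes D: "hilbert_space D" shows "Bk b D i \<in> bounded_ops (l2_sum D) (l2_sum D)"
proof -
  interpret D: hilbert_space D by fact
  obtain c where c: "c \<ge> 0" "\<And>\<alpha>. b \<alpha> / b (i # \<alpha>) \<le> c" using weight_bound[of i] by metis
  have inj: "inj_on ((#) i) UNIV" by simp
  have le: "(hnorm D (bshift b D [i] f \<gamma>))\<^sup>2 \<le> c * (hnorm D (f (i # \<gamma>)))\<^sup>2" if "f \<in> carrier (l2_sum D)" for f \<gamma>
    using mult_right_mono[OF c(2)[of \<gamma>], of "(hnorm D (f (i # \<gamma>)))\<^sup>2"]
    by (simp add: bshift_def D.hnorm_smult l2_sumD[OF that] power_mult_distrib)
  have sm: "(\<lambda>\<gamma>. (hnorm D (f (i # \<gamma>)))\<^sup>2) summable_on UNIV" if "f \<in> carrier (l2_sum D)" for f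
    using summable_on_reindex[OF inj, of "\<lambda>\<gamma>. (hnorm D (f \<gamma>))\<^sup>2"] that
    by (auto simp: l2_sum_carrier o_def intro: summable_on_subset_banach)
  have in_l2: "bshift b D [i] f \<in> carrier (l2_sum D)" if f: "f \<in> carrier (l2_sum D)" for f
  proof -
    have "(\<lambda>\<gamma>. (hnorm D (bshift b D [i] f \<gamma>))\<^sup>2) summable_on UNIV"
      by (rule summable_on_comparison_test[OF summable_on_cmult_right[OF sm[OF f], of c]]) (use le[OF f] in auto)
    then show ?thesis using l2_sumD[OF f] by (simp add: l2_sum_carrier bshift_def)
  qed
  have bd: "hnorm (l2_sum D) (bshift b D [i] f) \<le> sqrt c * hnorm (l2_sum D) f" if f: "f \<in> carrier (l2_sum D)" for f
  proof -
    have "(\<Sum>\<^sub>\<infinity>\<gamma>. (hnorm D (bshift b D [i] f \<gamma>))\<^sup>2) \<le> (\<Sum>\<^sub>\<infinity>\<gamma>. c * (hnorm D (f (i # \<gamma>)))\<^sup>2)"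
      by (rule infsum_mono) (use in_l2[OF f] le[OF f] sm[OF f] in \<open>auto simp: l2_sum_carrier intro: summable_on_cmult_right\<close>)
    also have "\<dots> = c * (\<Sum>\<^sub>\<infinity>\<gamma>\<in>range ((#) i). (hnorm D (f \<gamma>))\<^sup>2)"
      by (simp add: infsum_cmult_right[OF sm[OF f]] infsum_reindex[OF inj] o_def)
    also have "\<dots> \<le> c * (\<Sum>\<^sub>\<infinity>\<gamma>. (hnorm D (f \<gamma>))\<^sup>2)"
      using c(1) f by (intro mult_left_mono infsum_mono2) (auto simp: l2_sum_carrier intro: summable_on_subset_banach)
    finally show ?thesis
      unfolding D.hnorm_l2[OF f] D.hnorm_l2[OF in_l2[OF f]] by (simp flip: real_sqrt_mult)
  qed
  show ?thesis
  proof (rule bounded_opsI[where M="sqrt c"])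
    show "Bk b D i \<in> carrier (l2_sum D) \<rightarrow>\<^sub>E carrier (l2_sum D)" using in_l2 by (auto simp: Bk_def)
    interpret L: hilbert_space "l2_sum D :: ('n list \<Rightarrow> _) hilbert" by (rule D.hilbert_l2_sum)
    show "Bk b D i (f \<oplus>\<^bsub>l2_sum D\<^esub> g) = Bk b D i f \<oplus>\<^bsub>l2_sum D\<^esub> Bk b D i g"
      if "f \<in> carrier (l2_sum D)" "g \<in> carrier (l2_sum D)" for f g
      using L.a_closed[OF that] that by (simp add: Bk_def bshift_def D.smult_r_distr l2_sumD)
    show "Bk b D i (c \<odot>\<^bsub>l2_sum D\<^esub> f) = c \<odot>\<^bsub>l2_sum D\<^esub> Bk b D i f"
      if "f \<in> carrier (l2_sum D)" for c f
      using L.smult_in[OF that, of c] that D.smult_assoc1[symmetric]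
      by (simp add: Bk_def bshift_def l2_sumD mult.commute)
  qed (use bd in \<open>simp add: Bk_def\<close>)
qed

lemma W_apply:
  assumes "f \<in> carrier fock" "(\<lambda>\<alpha>. complex_of_real (sqrt (b \<alpha> / b (i # \<alpha>))) * f \<alpha>) \<in> carrier fock"
  shows "W b i f = (\<lambda>\<alpha>. case \<alpha> of [] \<Rightarrow> 0 | j # \<beta> \<Rightarrow> if j = i then complex_of_real (sqrt (b \<beta> / b (i # \<beta>))) * f \<beta> else 0)"
  using assms by (simp add: W_def compose_eq creation_def weight_def)

text \<open>The explicit weighted backward shift is already known to be bounded; a direct
  computation shows that it is the formal adjoint of \<open>W b i\<close>, and
  \<open>ops_if_adjoint\<close> does the rest.\<close>

lemma W_props: "W b i \<in> bounded_ops fock fock" "adj fock (W b i) = Bk b complex_space i"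
proof -
  interpret F: hilbert_space "fock :: ('n list \<Rightarrow> complex) hilbert" by (rule hilbert_fock)
  obtain c where c: "c \<ge> 0" "\<And>\<alpha>. b \<alpha> / b (i # \<alpha>) \<le> c" using weight_bound[of i] by metis
  have inj: "inj_on ((#) i) UNIV" by simp
  let ?w = "\<lambda>\<alpha>. complex_of_real (sqrt (b \<alpha> / b (i # \<alpha>)))"
  have wf: "(\<lambda>\<alpha>. ?w \<alpha> * f \<alpha>) \<in> carrier fock" if "f \<in> carrier fock" for f
    unfolding fock_carrier
  proof (rule summable_on_comparison_test)
    show "(\<lambda>\<alpha>. c * (cmod (f \<alpha>))\<^sup>2) summable_on UNIV" using that by (intro summable_on_cmult_right) (simp add: fock_carrier)
    show "(cmod (?w \<alpha> * f \<alpha>))\<^sup>2 \<le> c * (cmod (f \<alpha>))\<^sup>2" for \<alpha>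
      using mult_right_mono[OF c(2)[of \<alpha>], of "(cmod (f \<alpha>))\<^sup>2"] by (simp add: norm_mult power_mult_distrib)
  qed simp
  have Wf: "W b i f \<in> carrier fock" if f: "f \<in> carrier fock" for f
  proof -
    have "(\<lambda>\<alpha>. (cmod (W b i f \<alpha>))\<^sup>2) summable_on range ((#) i)"
      using wf[OF f] by (simp add: summable_on_reindex[OF inj] o_def W_apply[OF f wf[OF f]] fock_carrier)
    then show ?thesis unfolding fock_carrier
      by (rule summable_on_cong_neutral[THEN iffD1, rotated -1])
        (auto simp: W_apply[OF f wf[OF f]] split: list.split)
  qed
  have ip: "cinner fock (W b i f) g = cinner fock f (Bk b complex_space i g)" if f: "f \<in> carrier fock" and g: "g \<in> carrier fock" for f g
  proof -
    have "(\<Sum>\<^sub>\<infinity>\<alpha>. W b i f \<alpha> * cnj (g \<alpha>)) = (\<Sum>\<^sub>\<infinity>\<alpha>\<in>range ((#) i). W b i f \<alpha> * cnj (g \<alpha>))"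
      by (rule infsum_cong_neutral) (auto simp: W_apply[OF f wf[OF f]] split: list.split)
    also have "\<dots> = (\<Sum>\<^sub>\<infinity>\<alpha>. f \<alpha> * cnj (?w \<alpha> * g (i # \<alpha>)))"
      by (simp add: infsum_reindex[OF inj] o_def W_apply[OF f wf[OF f]] mult_ac)
    finally show ?thesis using g by (simp add: Bk_def bshift_def fock_def)
  qed
  have "W b i \<in> carrier fock \<rightarrow>\<^sub>E carrier fock"
    using Wf by (auto simp: W_def compose_def)
  moreover have "Bk b complex_space i \<in> bounded_ops fock fock"
    unfolding fock_def by (rule Bk_in[OF hilbert_complex_space])
  ultimately show "W b i \<in> bounded_ops fock fock" "adj fock (W b i) = Bk b complex_space i"
    using F.ops_if_adjoint ip by blast+
qed

text \<open>For uniqueness, any competitor agrees on the one-coordinate vectors, which are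
  elementary tensors with basis vectors, and \<open>l2_expand\<close> recovers the operator from
  these.\<close>

lemma ampliation_adj_W:
  fixes D :: "'d hilbert"
  assumes D: "hilbert_space D"
  shows "ampliation D (adj fock (W b i)) = Bk b D i"
  unfolding ampliation_def fock_tensor_def W_props
proof (rule the_equality)
  interpret D: hilbert_space D by fact
  interpret L: hilbert_space "l2_sum D :: ('n list \<Rightarrow> _) hilbert" by (rule D.hilbert_l2_sum)
  have et: "elem_tensor D f d \<in> carrier (l2_sum D)" if "f \<in> carrier fock" "d \<in> carrier D" for f d
    using that by (auto simp: l2_sum_carrier elem_tensor_def D.hnorm_smult power_mult_distrib fock_carrier intro: summable_on_cmult_left)
  have "Bk b D i (elem_tensor D f d) = elem_tensor D (Bk b complex_space i f) d" if f: "f \<in> carrier fock" and d: "d \<in> carrier D" for f d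
    using et[OF f d] f d D.smult_assoc1[symmetric, OF _ _ d] by (simp add: Bk_def bshift_def elem_tensor_def fock_def)
  then show 1: "Bk b D i \<in> bounded_ops (l2_sum D) (l2_sum D) \<and>
    (\<forall>f\<in>carrier fock. \<forall>d\<in>carrier D. Bk b D i (elem_tensor D f d) = elem_tensor D (Bk b complex_space i f) d)"
    using Bk_in[OF D] by blast
  fix B assume B: "B \<in> bounded_ops (l2_sum D) (l2_sum D) \<and>
    (\<forall>f\<in>carrier fock. \<forall>d\<in>carrier D. B (elem_tensor D f d) = elem_tensor D (Bk b complex_space i f) d)"
  show "B = Bk b D i"
  proof (rule L.op_eqI_ip)
    fix f g :: "'n list \<Rightarrow> 'd"
    assume f: "f \<in> carrier (l2_sum D)" and g: "g \<in> carrier (l2_sum D)"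
    have "single D \<gamma> (f \<gamma>) = elem_tensor D (basis \<gamma>) (f \<gamma>)" for \<gamma>
      using D.smult_one[OF l2_sumD[OF f]] by (auto simp: fun_eq_iff single_def elem_tensor_def basis_def D.smult_zero_eq l2_sumD[OF f])
    then have "B (single D \<gamma> (f \<gamma>)) = Bk b D i (single D \<gamma> (f \<gamma>))" for \<gamma>
      using B 1 l2_sumD[OF f] by simp
    then show "cinner (l2_sum D) (B f) g = cinner (l2_sum D) (Bk b D i f) g"
      using D.l2_expand[of B, OF _ f g] D.l2_expand[of "Bk b D i", OF _ f g] B 1 by simp
  qed (use B 1 in auto)
qed

abbreviation "a \<equiv> nc_inverse b"

text \<open>The eigenvalue at \<open>e\<^sub>\<gamma>\<close> of the \<open>N\<close>-th defect sum of \<open>W\<close>.\<close>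

definition dN :: "nat \<Rightarrow> 'n list \<Rightarrow> real" where
  "dN N \<gamma> = (\<Sum>j | j \<le> N \<and> j \<le> length \<gamma>. a (take j \<gamma>) * b (drop j \<gamma>)) / b \<gamma>"

text \<open>Once N reaches the length of \<gamma> the truncation is the whole coefficient of a b =
  1.\<close>

lemma dN_eventually: "length \<gamma> \<le> N \<Longrightarrow> dN N \<gamma> = (if \<gamma> = [] then 1 else 0)"
proof -
  assume "length \<gamma> \<le> N"
  then have "{j. j \<le> N \<and> j \<le> length \<gamma>} = {..length \<gamma>}" by auto
  then have "dN N \<gamma> = nc_mult a b \<gamma> / b \<gamma>" by (simp add: dN_def nc_mult_def)
  then show ?thesis by (simp add: nc_inverse nc_one_def)
qed

text \<open>The term of \<alpha> sees only the words with prefix \<alpha>, each with weight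
  b(rest)/b(word). Collecting by the word \<gamma> turns the sum over \<alpha> into a sum over the
  prefix lengths of \<gamma>.\<close>

lemma Delta_diagonal:
  assumes D: "hilbert_space D" and f: "f \<in> carrier (l2_sum D)" and g: "g \<in> carrier (l2_sum D)"
  shows "(\<Sum>\<alpha> | length \<alpha> \<le> N. of_real (a \<alpha>) * cinner (l2_sum D) (bshift b D \<alpha> f) (bshift b D \<alpha> g)) =
    (\<Sum>\<^sub>\<infinity>\<gamma>. of_real (dN N \<gamma>) * cinner D (f \<gamma>) (g \<gamma>))"
proof -
  interpret D: hilbert_space D by fact
  let ?c = "\<lambda>\<gamma>. cinner D (f \<gamma>) (g \<gamma>)"
  let ?t = "\<lambda>\<alpha> \<gamma>. if take (length \<alpha>) \<gamma> = \<alpha> then of_real (b (drop (length \<alpha>) \<gamma>) / b \<gamma>) * ?c \<gamma> else 0"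
  have pre: "{\<gamma>. take (length \<alpha>) \<gamma> = \<alpha>} = range ((@) \<alpha>)" for \<alpha> :: "'n list"
    by (auto simp: image_iff) (metis append_take_drop_id)
  have inj: "inj_on ((@) \<alpha>) UNIV" for \<alpha> :: "'n list" by (simp add: inj_on_def)
  have cs: "?c summable_on UNIV" by (rule D.l2_ip_summable[OF f g])
  have ip: "cinner D (bshift b D \<alpha> f \<gamma>) (bshift b D \<alpha> g \<gamma>) = of_real (b \<gamma> / b (\<alpha> @ \<gamma>)) * ?c (\<alpha> @ \<gamma>)" for \<alpha> \<gamma>
  proof -
    have "cinner D (bshift b D \<alpha> f \<gamma>) (bshift b D \<alpha> g \<gamma>) = of_real (sqrt (b \<gamma> / b (\<alpha> @ \<gamma>)) * sqrt (b \<gamma> / b (\<alpha> @ \<gamma>))) * ?c (\<alpha> @ \<gamma>)"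
      unfolding bshift_def by (simp add: D.ip_simps l2_sumD[OF f] l2_sumD[OF g] flip: mult.assoc of_real_mult)
    then show ?thesis by simp
  qed
  have bs: "bshift b D \<alpha> f \<in> carrier (l2_sum D)" if f: "f \<in> carrier (l2_sum D)" for \<alpha> f
    using f
  proof (induction \<alpha> arbitrary: f)
    case Nil
    then show ?case using D.smult_one[OF l2_sumD[OF Nil]] by (simp add: bshift_def)
  next
    case (Cons i \<alpha>)
    have "Bk b D i f \<in> carrier (l2_sum D)" using bounded_ops_in[OF Bk_in[OF D] Cons.prems] .
    then have "bshift b D [i] f \<in> carrier (l2_sum D)" using Cons.prems by (simp add: Bk_def)
    from Cons.IH[OF this] show ?case using bshift_append[OF D l2_sumD[OF Cons.prems], where \<beta>=\<alpha> and \<alpha>="[i]"] by simp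
  qed
  have hs: "(?t \<alpha> has_sum cinner (l2_sum D) (bshift b D \<alpha> f) (bshift b D \<alpha> g)) UNIV" for \<alpha>
  proof -
    have "((\<lambda>\<gamma>. cinner D (bshift b D \<alpha> f \<gamma>) (bshift b D \<alpha> g \<gamma>)) has_sum cinner (l2_sum D) (bshift b D \<alpha> f) (bshift b D \<alpha> g)) UNIV"
      using has_sum_infsum[OF D.l2_ip_summable[OF bs[OF f, of \<alpha>] bs[OF g, of \<alpha>]]] by simp
    then have "((?t \<alpha> \<circ> (@) \<alpha>) has_sum cinner (l2_sum D) (bshift b D \<alpha> f) (bshift b D \<alpha> g)) UNIV"
      by (simp add: ip o_def)
    then have "(?t \<alpha> has_sum cinner (l2_sum D) (bshift b D \<alpha> f) (bshift b D \<alpha> g)) (range ((@) \<alpha>))"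
      by (subst has_sum_reindex[OF inj])
    then show ?thesis
      by (rule has_sum_cong_neutral[THEN iffD1, rotated -1]) (auto simp: pre[symmetric])
  qed
  have "((\<lambda>\<gamma>. \<Sum>\<alpha> | length \<alpha> \<le> N. of_real (a \<alpha>) * ?t \<alpha> \<gamma>) has_sum
     (\<Sum>\<alpha> | length \<alpha> \<le> N. of_real (a \<alpha>) * cinner (l2_sum D) (bshift b D \<alpha> f) (bshift b D \<alpha> g))) UNIV"
    by (rule has_sum_finite_sum) (simp, intro has_sum_cmult_right hs)
  moreover have "(\<Sum>\<alpha> | length \<alpha> \<le> N. of_real (a \<alpha>) * ?t \<alpha> \<gamma>) = of_real (dN N \<gamma>) * ?c \<gamma>" for \<gamma>
  proof -
    have "(\<Sum>\<alpha> | length \<alpha> \<le> N. of_real (a \<alpha>) * ?t \<alpha> \<gamma>) = (\<Sum>\<alpha> | length \<alpha> \<le> N \<and> take (length \<alpha>) \<gamma> = \<alpha>. of_real (a \<alpha>) * ?t \<alpha> \<gamma>)"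
      by (rule sum.mono_neutral_right) auto
    also have "\<dots> = (\<Sum>j | j \<le> N \<and> j \<le> length \<gamma>. of_real (a (take j \<gamma>) * b (drop j \<gamma>) / b \<gamma>) * ?c \<gamma>)"
      by (rule sum.reindex_bij_witness[of _ "\<lambda>j. take j \<gamma>" length]) (auto simp: min_def, metis length_take min.cobounded1)
    also have "\<dots> = of_real (dN N \<gamma>) * ?c \<gamma>" by (simp add: dN_def sum_distrib_right sum_divide_distrib)
    finally show ?thesis .
  qed
  ultimately show ?thesis by (simp add: infsumI)
qed

lemma wadj_bshift:
  assumes D: "hilbert_space D" and X: "\<And>i. adj (l2_sum D) (X i) = Bk b D i" and f: "f \<in> carrier (l2_sum D)"
  shows "wadj (l2_sum D) X \<alpha> f = bshift b D \<alpha> f"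
  using f
proof (induction \<alpha> arbitrary: f)
  case Nil
  interpret D: hilbert_space D by fact
  show ?case using D.smult_one[OF l2_sumD[OF Nil]] by (simp add: bshift_def)
next
  case (Cons i \<alpha>)
  have "Bk b D i f \<in> carrier (l2_sum D)" using bounded_ops_in[OF Bk_in[OF D] Cons.prems] .
  then show ?case using Cons.IH[of "Bk b D i f"] Cons.prems bshift_append[OF D l2_sumD[OF Cons.prems], where \<beta>=\<alpha> and \<alpha>="[i]"]
    by (simp add: X) (simp add: Bk_def)
qed

lemma Delta_sum_fock_ip:
  assumes f: "f \<in> carrier fock" and g: "g \<in> carrier fock"
  shows "cinner fock (Delta_sum b fock (W b) N f) g = (\<Sum>\<^sub>\<infinity>\<gamma>. of_real (dN N \<gamma>) * (f \<gamma> * cnj (g \<gamma>)))"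
proof -
  interpret F: hilbert_space "fock :: ('n list \<Rightarrow> complex) hilbert" by (rule hilbert_fock)
  have w: "wadj fock (W b) \<alpha> f = bshift b complex_space \<alpha> f" if "f \<in> carrier fock" for \<alpha> f
    unfolding fock_def by (rule wadj_bshift[OF hilbert_complex_space]) (use W_props that in \<open>auto simp: fock_def\<close>)
  have "cinner fock (Delta_sum b fock (W b) N f) g =
      (\<Sum>\<alpha> | length \<alpha> \<le> N. of_real (a \<alpha>) * cinner fock ((\<lambda>x\<in>carrier fock. x) (wadj fock (W b) \<alpha> f)) (wadj fock (W b) \<alpha> g))"
    unfolding Delta_sum_def op_alg_simps by (rule F.word_sum_ip) (use W_props f g in auto)
  also have "\<dots> = (\<Sum>\<alpha> | length \<alpha> \<le> N. of_real (a \<alpha>) * cinner fock (bshift b complex_space \<alpha> f) (bshift b complex_space \<alpha> g))"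
    using F.wadj_in[of "W b", OF W_props(1) f] by (simp only: restrict_apply if_True w[OF f] w[OF g])
  also have "\<dots> = (\<Sum>\<^sub>\<infinity>\<gamma>. of_real (dN N \<gamma>) * cinner complex_space (f \<gamma>) (g \<gamma>))"
    unfolding fock_def by (rule Delta_diagonal[OF hilbert_complex_space]) (use f g in \<open>auto simp: fock_def\<close>)
  finally show ?thesis by simp
qed

lemma Delta_sum_fock_in: "Delta_sum b fock (W b) N \<in> bounded_ops fock fock"
  unfolding Delta_sum_def by (rule hilbert_space.word_sum_in[OF hilbert_fock]) (use W_props hilbert_space.op_one_in[OF hilbert_fock] in auto)

text \<open>\<open>dN N \<gamma>\<close> is the matrix entry of the defect sum at the basis vector
  of \<gamma>, so condition (c) bounds it uniformly.\<close>

lemma dN_bounded: obtains B where "\<And>N \<gamma>. \<bar>dN N \<gamma>\<bar> \<le> B" "1 \<le> B"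
proof -
  interpret F: hilbert_space "fock :: ('n list \<Rightarrow> complex) hilbert" by (rule hilbert_fock)
  have "bdd_above (range (\<lambda>k. op_norm fock (Delta_sum b fock (W b) k)))" using adm by (simp add: admissible_def)
  then obtain B where B: "\<And>k. op_norm fock (Delta_sum b fock (W b) k) \<le> B" by (auto simp: bdd_above_def)
  \<comment> \<open>The maximum with 1 makes the same bound cover the limit, the indicator of the
    empty word.\<close>
  have "\<bar>dN N \<gamma>\<bar> \<le> max B 1" for N \<gamma>
  proof -
    have "(\<Sum>\<^sub>\<infinity>\<beta>. of_real (dN N \<beta>) * (basis \<gamma> \<beta> * cnj (basis \<gamma> \<beta>))) = (\<Sum>\<^sub>\<infinity>\<beta>\<in>{\<gamma>}. of_real (dN N \<beta>) * (basis \<gamma> \<beta> * cnj (basis \<gamma> \<beta>)))"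
      by (rule infsum_cong_neutral) (auto simp: basis_def)
    then have "cinner fock (Delta_sum b fock (W b) N (basis \<gamma>)) (basis \<gamma>) = of_real (dN N \<gamma>)"
      by (subst Delta_sum_fock_ip[OF basis_in basis_in]) (simp add: basis_def)
    then have "\<bar>dN N \<gamma>\<bar> \<le> hnorm fock (Delta_sum b fock (W b) N (basis \<gamma>)) * hnorm fock (basis \<gamma>)"
      using F.Cauchy_Schwarz[OF bounded_ops_in[OF Delta_sum_fock_in basis_in] basis_in, of N \<gamma> \<gamma>] by (metis norm_of_real)
    also have "\<dots> \<le> op_norm fock (Delta_sum b fock (W b) N)"
      using F.op_norm_bound[OF Delta_sum_fock_in, of N] basis_in[of \<gamma>] by (auto simp: bounded_by_def dest!: bspec[of _ _ "basis \<gamma>"])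
    finally show ?thesis using B[of N] by simp
  qed
  then show ?thesis using that[of "max B 1"] by simp
qed

lemma Delta_diagonal_limit:
  assumes D: "hilbert_space D" and f: "f \<in> carrier (l2_sum D)" and g: "g \<in> carrier (l2_sum D)"
  shows "(\<lambda>N. \<Sum>\<^sub>\<infinity>\<gamma>. of_real (dN N \<gamma>) * cinner D (f \<gamma>) (g \<gamma>)) \<longlonglongrightarrow> cinner D (f []) (g [])"
proof -
  interpret D: hilbert_space D by fact
  obtain B where B: "\<And>N \<gamma>. \<bar>dN N \<gamma>\<bar> \<le> B" "1 \<le> B" by (rule dN_bounded) blast
  let ?l = "\<lambda>\<gamma>. of_real (if \<gamma> = [] then 1 else 0) :: complex"
  have "(\<lambda>N. \<Sum>\<^sub>\<infinity>\<gamma>. of_real (dN N \<gamma>) * cinner D (f \<gamma>) (g \<gamma>)) \<longlonglongrightarrow> (\<Sum>\<^sub>\<infinity>\<gamma>. ?l \<gamma> * cinner D (f \<gamma>) (g \<gamma>))"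
  proof (rule tendsto_infsum_dominated[OF D.l2_ip_abs_summable[OF f g]])
    show "\<forall>\<^sub>F N in sequentially. of_real (dN N \<gamma>) = ?l \<gamma>" for \<gamma>
      using dN_eventually[of \<gamma>] by (auto simp: eventually_sequentially intro!: exI[of _ "length \<gamma>"])
  qed (use B in auto)
  moreover have "(\<Sum>\<^sub>\<infinity>\<gamma>. ?l \<gamma> * cinner D (f \<gamma>) (g \<gamma>)) = (\<Sum>\<^sub>\<infinity>\<gamma>\<in>{[]}. ?l \<gamma> * cinner D (f \<gamma>) (g \<gamma>))"
    by (rule infsum_cong_neutral) auto
  ultimately show ?thesis by simp
qed

end

section \<open>From a dilation back to the domain\<close>

lemma finite_words_filterlim:
  "filterlim (\<lambda>N. {\<alpha> :: 'n::finite list. length \<alpha> \<le> N}) (finite_subsets_at_top UNIV) sequentially"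
  unfolding filterlim_finite_subsets_at_top
proof (intro allI impI)
  fix X :: "'n list set" assume "finite X \<and> X \<subseteq> UNIV"
  then have "length \<alpha> \<le> Max (length ` X)" if "\<alpha> \<in> X" for \<alpha> using that by simp
  then have "X \<subseteq> {\<alpha>. length \<alpha> \<le> N}" if "N \<ge> Max (length ` X)" for N using that order_trans by blast
  then show "\<forall>\<^sub>F N in sequentially. finite {\<alpha> :: 'n list. length \<alpha> \<le> N} \<and> X \<subseteq> {\<alpha>. length \<alpha> \<le> N} \<and> {\<alpha> :: 'n list. length \<alpha> \<le> N} \<subseteq> UNIV"
    unfolding eventually_sequentially by auto
qed

text \<open>The sets of words of length at most N exhaust all finite sets of words, because the
  alphabet is finite; unordered sums over words may be computed along them.\<close>

lemma has_sum_words: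
  fixes f :: "'n::finite list \<Rightarrow> 'a :: {comm_monoid_add, topological_space}"
  assumes "(f has_sum s) UNIV"
  shows "(\<lambda>N. \<Sum>\<alpha> | length \<alpha> \<le> N. f \<alpha>) \<longlonglongrightarrow> s"
  using filterlim_compose[OF assms[unfolded has_sum_def] finite_words_filterlim] .

lemma (in hilbert_space) ip_self_nonneg_Reals: "x \<in> carrier H \<Longrightarrow> cinner H x x \<in> \<real>\<^sub>\<ge>\<^sub>0"
  by (simp only: ip_self nonneg_Reals_of_real_iff zero_le_power2)

context admissible_series
begin

lemma W_in_cstar: "W b i \<in> cstar_W b"
  unfolding cstar_W_def by auto

lemma bshift_Nil: "bshift b D \<alpha> f [] = complex_of_real (sqrt (1 / b \<alpha>)) \<odot>\<^bsub>D\<^esub> f \<alpha>"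
  by (simp add: bshift_def)

lemma domain_if_dilation:
  fixes D :: "'d hilbert" and K :: "'k hilbert" and T :: "'n \<Rightarrow> 'h \<Rightarrow> 'h"
  assumes H: "hilbert_space H" and D: "hilbert_space D" and K: "hilbert_space K"
    and T: "\<And>i. T i \<in> bounded_ops H H" and cuntz: "cuntz_type b K \<pi>"
    and V: "V \<in> isometries H (hdsum (fock_tensor D) K)"
    and inter: "\<And>i h. h \<in> carrier H \<Longrightarrow> V (adj H (T i) h) = model_op b D K \<pi> i (V h)"
  shows "T \<in> nc_domain b H"
proof -
  interpret H: hilbert_space H by fact
  interpret D: hilbert_space D by fact
  interpret K: hilbert_space K by fact
  interpret L: hilbert_space "l2_sum D :: ('n list \<Rightarrow> 'd) hilbert" by (rule D.hilbert_l2_sum)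
  let ?L = "l2_sum D :: ('n list \<Rightarrow> 'd) hilbert"
  have hE: "hilbert_space (hdsum ?L K)" by (rule hilbert_hdsum) unfold_locales
  have Vb: "V \<in> bounded_ops H (hdsum ?L K)" using V by (simp add: isometries_def fock_tensor_def)
  define f where "f h = fst (V h)" for h
  define \<kappa> where "\<kappa> h = snd (V h)" for h
  have Vf: "V h = (f h, \<kappa> h)" for h by (simp add: f_def \<kappa>_def)
  have fin: "f h \<in> carrier ?L" and kin: "\<kappa> h \<in> carrier K" if "h \<in> carrier H" for h
    using bounded_ops_in[OF Vb that] by (simp_all add: Vf)
  have fadd: "f (h \<oplus>\<^bsub>H\<^esub> k) = f h \<oplus>\<^bsub>?L\<^esub> f k" if "h \<in> carrier H" "k \<in> carrier H" for h k
    using bounded_ops_add[OF Vb that] by (simp add: Vf)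
  have fsm: "f (c \<odot>\<^bsub>H\<^esub> h) = c \<odot>\<^bsub>?L\<^esub> f h" if "h \<in> carrier H" for c h
    using bounded_ops_smult[OF Vb that] by (simp add: Vf)
  have ip: "cinner H h k = cinner ?L (f h) (f k) + cinner K (\<kappa> h) (\<kappa> k)" if "h \<in> carrier H" "k \<in> carrier H" for h k
    using isometry_ip[OF H hE _ that, of V] V by (simp add: Vf fock_tensor_def del: l2_sum_simps)
  have fle: "hnorm ?L (f h) \<le> hnorm H h" if h: "h \<in> carrier H" for h
  proof -
    have "Re (cinner ?L (f h) (f h)) \<le> Re (cinner H h h)"
      using ip[OF h h] K.ip_self_nonneg[OF kin[OF h]] by (simp del: l2_sum_simps)
    then show ?thesis by (simp add: hnorm_def del: l2_sum_simps)
  qed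
  define X where "X i = \<pi> (W b i)" for i
  have X: "X i \<in> bounded_ops K K" for i
    using cuntz W_in_cstar[of i] by (simp add: X_def cuntz_type_def star_representation_def)
  have mo: "f (adj H (T i) h) = Bk b D i (f h)" "\<kappa> (adj H (T i) h) = adj K (X i) (\<kappa> h)" if h: "h \<in> carrier H" for i h
    using inter[OF h, of i] fin[OF h] kin[OF h]
    by (simp_all add: Vf model_op_def op_dsum_def fock_tensor_def ampliation_adj_W[OF D] X_def)
  have fw: "f (wadj H T \<alpha> h) = bshift b D \<alpha> (f h)" if "h \<in> carrier H" for \<alpha> h
    using that
  proof (induction \<alpha> arbitrary: h)
    case Nil
    show ?case using D.smult_one[OF l2_sumD[OF fin[OF Nil]]] by (simp add: bshift_def)
  next
    case (Cons i \<alpha>)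
    have "f (wadj H T (i # \<alpha>) h) = bshift b D \<alpha> (Bk b D i (f h))"
      using Cons T by (simp add: mo)
    also have "\<dots> = bshift b D \<alpha> (bshift b D [i] (f h))" using fin[OF Cons.prems] by (simp add: Bk_def)
    also have "\<dots> = bshift b D (i # \<alpha>) (f h)"
      using bshift_append[OF D l2_sumD[OF fin[OF Cons.prems]], where \<beta>=\<alpha> and \<alpha>="[i]"] by simp
    finally show ?case .
  qed
  have kw: "\<kappa> (wadj H T \<alpha> h) = wadj K X \<alpha> (\<kappa> h)" if "h \<in> carrier H" for \<alpha> h
    using that by (induction \<alpha> arbitrary: h) (use T in \<open>simp_all add: mo\<close>)
  note Tw = H.wadj_in[of T, OF T]
  have one: "(\<lambda>x\<in>carrier H. x) \<in> bounded_ops H H" "(\<lambda>x\<in>carrier K. x) \<in> bounded_ops K K" by simp_all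
  have Dl: "(\<lambda>N. cinner H (Delta_sum b H T N h) k) \<longlonglongrightarrow> cinner D (f h []) (f k [])"
    if h: "h \<in> carrier H" and k: "k \<in> carrier H" for h k
  proof -
    \<comment> \<open>The isometry splits each summand into a Fock part and a part in K, and
      intertwining turns adjoint words of T into those of the model on either side.\<close>
    have "cinner H (Delta_sum b H T N h) k = (\<Sum>\<^sub>\<infinity>\<gamma>. of_real (dN N \<gamma>) * cinner D (f h \<gamma>) (f k \<gamma>)) + cinner K (Delta_sum b K X N (\<kappa> h)) (\<kappa> k)" for N
    proof -
      have "cinner H (Delta_sum b H T N h) k = (\<Sum>\<alpha> | length \<alpha> \<le> N. of_real (a \<alpha>) * cinner H ((\<lambda>x\<in>carrier H. x) (wadj H T \<alpha> h)) (wadj H T \<alpha> k))"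
        unfolding Delta_sum_def op_alg_simps by (rule H.word_sum_ip[of T, OF T one(1) h k])
      also have "\<dots> = (\<Sum>\<alpha> | length \<alpha> \<le> N. of_real (a \<alpha>) * (cinner ?L (bshift b D \<alpha> (f h)) (bshift b D \<alpha> (f k)) + cinner K (wadj K X \<alpha> (\<kappa> h)) (wadj K X \<alpha> (\<kappa> k))))"
        by (intro sum.cong refl) (simp add: Tw h k ip fw kw del: l2_sum_simps)
      also have "\<dots> = (\<Sum>\<alpha> | length \<alpha> \<le> N. of_real (a \<alpha>) * cinner ?L (bshift b D \<alpha> (f h)) (bshift b D \<alpha> (f k))) +
         (\<Sum>\<alpha> | length \<alpha> \<le> N. of_real (a \<alpha>) * cinner K ((\<lambda>x\<in>carrier K. x) (wadj K X \<alpha> (\<kappa> h))) (wadj K X \<alpha> (\<kappa> k)))"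
        using K.wadj_in[of X, OF X kin[OF h]] by (simp add: distrib_left sum.distrib del: l2_sum_simps)
      also have "(\<Sum>\<alpha> | length \<alpha> \<le> N. of_real (a \<alpha>) * cinner K ((\<lambda>x\<in>carrier K. x) (wadj K X \<alpha> (\<kappa> h))) (wadj K X \<alpha> (\<kappa> k))) = cinner K (Delta_sum b K X N (\<kappa> h)) (\<kappa> k)"
        unfolding Delta_sum_def op_alg_simps by (rule K.word_sum_ip[of X, OF X one(2) kin[OF h] kin[OF k], symmetric])
      finally show ?thesis by (simp only: Delta_diagonal[OF D fin[OF h] fin[OF k]])
    qed
    moreover have "(\<lambda>N. cinner K (Delta_sum b K X N (\<kappa> h)) (\<kappa> k)) \<longlonglongrightarrow> 0"
      using cuntz kin[OF h] kin[OF k] unfolding cuntz_type_def wot_tendsto_def X_def[symmetric] by auto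
    ultimately show ?thesis
      using tendsto_add[OF Delta_diagonal_limit[OF D fin[OF h] fin[OF k]], of "\<lambda>N. cinner K (Delta_sum b K X N (\<kappa> h)) (\<kappa> k)" 0] by simp
  qed
  have fD: "f h \<gamma> \<in> carrier D" if "h \<in> carrier H" for h \<gamma> using l2_sumD[OF fin[OF that]] .
  have fge: "hnorm D (f h \<gamma>) \<le> hnorm H h" if "h \<in> carrier H" for h \<gamma>
    using D.hnorm_l2_ge[OF fin[OF that], of \<gamma>] fle[OF that] by simp
  obtain \<Delta> where \<Delta>: "\<Delta> \<in> bounded_ops H H"
    "\<And>h k. \<lbrakk>h \<in> carrier H; k \<in> carrier H\<rbrakk> \<Longrightarrow> cinner H (\<Delta> h) k = cinner D (f h []) (f k [])"
  proof (rule H.sesquilinear_op[of "\<lambda>h k. cinner D (f h []) (f k [])" 1])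
    show "cmod (cinner D (f h []) (f k [])) \<le> 1 * hnorm H h * hnorm H k" if "h \<in> carrier H" "k \<in> carrier H" for h k
      using D.Cauchy_Schwarz[OF fD[OF that(1)] fD[OF that(2)], of "[]" "[]"]
        mult_mono[OF fge[OF that(1)] fge[OF that(2)], of "[]" "[]"] that fD by (simp add: order_trans)
  qed (auto simp: fadd fsm D.ip_simps fD)
  obtain L where L: "L \<in> bounded_ops H H"
    "\<And>h k. \<lbrakk>h \<in> carrier H; k \<in> carrier H\<rbrakk> \<Longrightarrow> cinner H (L h) k = cinner ?L (f h) (f k)"
  proof (rule H.sesquilinear_op[of "\<lambda>h k. cinner ?L (f h) (f k)" 1])
    show "cmod (cinner ?L (f h) (f k)) \<le> 1 * hnorm H h * hnorm H k" if "h \<in> carrier H" "k \<in> carrier H" for h k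
      using L.Cauchy_Schwarz[OF fin[OF that(1)] fin[OF that(2)]]
        mult_mono[OF fle[OF that(1)] fle[OF that(2)]] L.hnorm_nonneg[OF fin[OF that(2)]] that by (simp add: order_trans del: l2_sum_simps)
  qed (simp_all only: fadd fsm L.ip_simps fin zero_le_one)
  have Dl2: "(\<lambda>N. cinner H (word_sum H b T \<Delta> N h) k) \<longlonglongrightarrow> cinner H (L h) k"
    if h: "h \<in> carrier H" and k: "k \<in> carrier H" for h k
  proof -
    have "cinner H (word_sum H b T \<Delta> N h) k = (\<Sum>\<alpha> | length \<alpha> \<le> N. cinner D (f h \<alpha>) (f k \<alpha>))" for N
    proof -
      \<comment> \<open>The defect reads the coordinate at the empty word; shifting back by \<alpha>
        brings the coordinate at \<alpha> there with squared weight 1/b(\<alpha>), which the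
        coefficient cancels.\<close>
      have "of_real (b \<alpha>) * cinner H (\<Delta> (wadj H T \<alpha> h)) (wadj H T \<alpha> k) = cinner D (f h \<alpha>) (f k \<alpha>)" for \<alpha>
      proof -
        have "cinner H (\<Delta> (wadj H T \<alpha> h)) (wadj H T \<alpha> k) = of_real (sqrt (1 / b \<alpha>) * sqrt (1 / b \<alpha>)) * cinner D (f h \<alpha>) (f k \<alpha>)"
          unfolding \<Delta>(2)[OF Tw[OF h] Tw[OF k]] fw[OF h] fw[OF k] bshift_Nil
          by (simp add: D.ip_simps fD h k flip: mult.assoc of_real_mult)
        then show ?thesis by (simp flip: mult.assoc of_real_mult)
      qed
      then show ?thesis by (simp add: H.word_sum_ip[of T, OF T \<Delta>(1) h k])
    qed
    moreover have "((\<lambda>\<alpha>. cinner D (f h \<alpha>) (f k \<alpha>)) has_sum cinner ?L (f h) (f k)) UNIV"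
      using D.l2_ip_summable[OF fin[OF h] fin[OF k]] by simp
    ultimately show ?thesis using has_sum_words[of "\<lambda>\<alpha>. cinner D (f h \<alpha>) (f k \<alpha>)"] L(2)[OF h k] by (simp del: l2_sum_simps)
  qed
  have "domain_data b H T \<Delta> L"
    unfolding domain_data_def wot_tendsto_def op_le_def
    using T \<Delta> L Dl Dl2 D.ip_self_nonneg_Reals[OF fD] by (auto simp del: l2_sum_simps)
  moreover have "op_le H L \<one>\<^bsub>op_alg H\<^esub>"
    unfolding op_le_def using L(2) ip K.ip_self_nonneg_Reals[OF kin] by (auto simp del: l2_sum_simps)
  ultimately show ?thesis unfolding nc_domain_def by blast
qed

end

section \<open>The completely positive form of a domain element\<close>

declare fock_simps [simp del]

lemma (in cp_form) F_nonneg: "\<lbrakk>A \<in> \<A>; h \<in> carrier H\<rbrakk> \<Longrightarrow> 0 \<le> Re (F (adj B A \<cdot> A) h h)"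
  using F_cp[of "[(A, h)]"] by simp

lemma (in cp_form) F_CS:
  assumes "A \<in> \<A>" "C \<in> \<A>" "h \<in> carrier H" "k \<in> carrier H"
  shows "cmod (F (adj B C \<cdot> A) h k) \<le> sqrt (Re (F (adj B A \<cdot> A) h h)) * sqrt (Re (F (adj B C \<cdot> C) k k))"
  using P.Q_CS[of "[(1, (A, h))]" "[(1, (C, k))]"] assms by (simp add: P.nn_def kform_def kF_eq)

lemma (in hilbert_space) star_alg_ops: "star_alg H ops"
  unfolding star_alg_def by auto

text \<open>\<open>op_le\<close> only says that the quadratic form is real and nonnegative; testing
  it at x + y and x + i y yields Hermitian symmetry.\<close>

lemma (in hilbert_space) positive_hermitian:
  assumes D: "D \<in> ops" and pos: "op_le H \<zero>\<^bsub>op_alg H\<^esub> D" and x: "x \<in> carrier H" and y: "y \<in> carrier H"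
  shows "cinner H (D y) x = cnj (cinner H (D x) y)"
proof -
  have re: "Im (cinner H (D z) z) = 0" if "z \<in> carrier H" for z
    using pos that by (simp add: op_le_def complex_nonneg_Reals_iff)
  note Dx = bounded_ops_in[OF D x] and Dy = bounded_ops_in[OF D y]
  have "Im (cinner H (D (x \<oplus> y)) (x \<oplus> y)) = 0" by (rule re) (use x y in simp)
  then have 1: "Im (cinner H (D x) y) + Im (cinner H (D y) x) = 0"
    using re[OF x] re[OF y] x y Dx Dy by (simp add: bounded_ops_add[OF D] ip_simps)
  have "Im (cinner H (D (x \<oplus> \<i> \<odot> y)) (x \<oplus> \<i> \<odot> y)) = 0" by (rule re) (use x y in simp)
  then have 2: "Re (cinner H (D y) x) = Re (cinner H (D x) y)"
    using re[OF x] re[OF y] x y Dx Dy by (simp add: bounded_ops_add[OF D] bounded_ops_smult[OF D] ip_simps)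
  show ?thesis using 1 2 by (simp add: complex_eq_iff)
qed

lemma (in hilbert_space) positive_form_nonneg:
  "\<lbrakk>op_le H \<zero>\<^bsub>op_alg H\<^esub> D; x \<in> carrier H\<rbrakk> \<Longrightarrow> 0 \<le> Re (cinner H (D x) x)"
  by (simp add: op_le_def complex_nonneg_Reals_iff)

section \<open>Coordinate projections and the truncated Poisson kernel\<close>

lemma sum_words_top:
  fixes f :: "'n::finite list \<Rightarrow> complex"
  shows "(\<Sum>\<alpha> | length \<alpha> \<le> N \<and> length \<alpha> = N. f \<alpha>) = (\<Sum>\<alpha> | length \<alpha> \<le> N. f \<alpha>) - (\<Sum>\<alpha> | length \<alpha> < N. f \<alpha>)"
proof -
  have "{\<alpha> :: 'n list. length \<alpha> \<le> N} = {\<alpha>. length \<alpha> \<le> N \<and> length \<alpha> = N} \<union> {\<alpha>. length \<alpha> < N}" by auto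
  moreover have "finite {\<alpha> :: 'n list. length \<alpha> < N}" "finite {\<alpha> :: 'n list. length \<alpha> \<le> N \<and> length \<alpha> = N}"
    by (rule finite_subset[OF _ finite_words(1)[of N]]; auto)+
  moreover have "{\<alpha> :: 'n list. length \<alpha> \<le> N \<and> length \<alpha> = N} \<inter> {\<alpha>. length \<alpha> < N} = {}" by auto
  ultimately show ?thesis using sum.union_disjoint[of "{\<alpha> :: 'n list. length \<alpha> \<le> N \<and> length \<alpha> = N}" "{\<alpha>. length \<alpha> < N}" f] by simp
qed

definition dg :: "'n::finite list set \<Rightarrow> ('n list \<Rightarrow> complex) \<Rightarrow> ('n list \<Rightarrow> complex)" where
  "dg S = (\<lambda>f\<in>carrier fock. \<lambda>\<alpha>. if \<alpha> \<in> S then f \<alpha> else 0)"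

lemma dg_fock: "f \<in> carrier fock \<Longrightarrow> (\<lambda>\<alpha>. if \<alpha> \<in> S then f \<alpha> else 0) \<in> carrier fock"
  unfolding fock_carrier by (rule summable_on_comparison_test) auto

lemma dg_apply: "f \<in> carrier fock \<Longrightarrow> dg S f = (\<lambda>\<alpha>. if \<alpha> \<in> S then f \<alpha> else 0)"
  by (simp add: dg_def)

lemma dg_ip: "\<lbrakk>f \<in> carrier fock; g \<in> carrier fock\<rbrakk> \<Longrightarrow> cinner fock (dg S f) g = cinner fock f (dg S g)"
  by (auto simp: dg_apply fock_simps intro!: infsum_cong)

text \<open>The bound comes from idempotence: the square of the norm of Pf equals <Pf, f>, to which
  Cauchy-Schwarz applies.\<close>

lemma dg_props: "dg S \<in> bounded_ops fock fock" "bounded_by fock (dg S) 1" "adj fock (dg S) = dg S"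
proof -
  interpret F: hilbert_space fock by (rule hilbert_fock)
  interpret C: hilbert_space complex_space by (rule hilbert_complex_space)
  have in_f: "dg S f \<in> carrier fock" if "f \<in> carrier fock" for f using dg_fock[OF that] by (simp add: dg_apply[OF that])
  have bd: "hnorm fock (dg S f) \<le> 1 * hnorm fock f" if f: "f \<in> carrier fock" for f
  proof -
    have "(hnorm fock (dg S f))\<^sup>2 = Re (cinner fock (dg S f) f)"
      using dg_ip[OF in_f[OF f] f, of S] f dg_fock[OF f, of S]
      by (simp add: F.hnorm_sq[OF in_f[OF f]]) (simp add: dg_apply cong: if_cong)
    also have "\<dots> \<le> hnorm fock (dg S f) * hnorm fock f"
      using F.Cauchy_Schwarz[OF in_f[OF f] f] complex_Re_le_cmod order_trans by blast
    finally have "hnorm fock (dg S f) * hnorm fock (dg S f) \<le> hnorm fock (dg S f) * hnorm fock f"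
      by (simp add: power2_eq_square)
    then show ?thesis using F.hnorm_nonneg[OF in_f[OF f]] F.hnorm_nonneg[OF f]
      by (cases "hnorm fock (dg S f) = 0") (auto simp: mult_le_cancel_left)
  qed
  then show "bounded_by fock (dg S) 1" by (simp add: bounded_by_def)
  show 1: "dg S \<in> bounded_ops fock fock"
  proof (rule bounded_opsI[where M=1])
    show "dg S \<in> carrier fock \<rightarrow>\<^sub>E carrier fock" using in_f by (auto simp: dg_def)
    show "dg S (f \<oplus>\<^bsub>fock\<^esub> g) = dg S f \<oplus>\<^bsub>fock\<^esub> dg S g" if "f \<in> carrier fock" "g \<in> carrier fock" for f g
      using F.a_closed[OF that] that by (auto simp: dg_apply fock_simps)
    show "dg S (c \<odot>\<^bsub>fock\<^esub> f) = c \<odot>\<^bsub>fock\<^esub> dg S f" if "f \<in> carrier fock" for c f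
      using F.smult_in[OF that, of c] that by (auto simp: dg_apply fock_simps)
  qed (use bd in auto)
  show "adj fock (dg S) = dg S" by (rule F.adj_eqI[OF 1]) (rule dg_ip)
qed

lemma dg_compose:
  fixes S S' :: "'n::finite list set"
  shows "compose (carrier fock) (dg S) (dg S') = dg (S \<inter> S')"
proof (rule hilbert_space.op_eqI[OF hilbert_fock])
  fix f :: "'n list \<Rightarrow> complex"
  assume f: "f \<in> carrier fock"
  show "compose (carrier fock) (dg S) (dg S') f = dg (S \<inter> S') f"
    using f dg_fock[OF f, of S'] by (auto simp: compose_eq dg_apply)
qed (simp_all add: dg_props hilbert_space.op_compose_in[OF hilbert_fock])

lemma dg_Un: "S \<inter> S' = {} \<Longrightarrow> dg S \<oplus>\<^bsub>op_alg fock\<^esub> dg S' = dg (S \<union> S')"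
proof (rule hilbert_space.op_eqI[OF hilbert_fock])
  show "dg S \<oplus>\<^bsub>op_alg fock\<^esub> dg S' \<in> bounded_ops fock fock"
    using hilbert_space.op_add_in[OF hilbert_fock dg_props(1) dg_props(1)] by simp
qed (auto simp: dg_props dg_apply fock_simps fun_eq_iff)

lemma dg_UNIV: "dg UNIV = (\<lambda>f\<in>carrier fock. f)"
  by (simp add: dg_def)

lemma dg_basis: "dg S (basis \<gamma>) = (if \<gamma> \<in> S then basis \<gamma> else (\<lambda>_. 0))"
  by (simp add: dg_apply) (auto simp: basis_def)

lemma basis_ip_basis: "cinner fock (basis \<alpha>) (basis \<beta>) = (if \<alpha> = \<beta> then 1 else 0)"
  by (simp add: basis_ip) (simp add: basis_def)

text \<open>The Schur product of two Gram matrices is positive: expand the first factor along the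
  orthonormal basis.\<close>

lemma (in hilbert_space) gram_product_nonneg:
  assumes D: "D \<in> ops" and pos: "op_le H \<zero>\<^bsub>op_alg H\<^esub> D"
    and zs: "\<And>z. z \<in> set zs \<Longrightarrow> fst z \<in> carrier fock \<and> snd z \<in> carrier H"
  shows "0 \<le> Re (\<Sum>z\<leftarrow>zs. \<Sum>w\<leftarrow>zs. cinner fock (fst z) (fst w) * cinner H (D (snd z)) (snd w))"
proof -
  interpret C: hilbert_space complex_space by (rule hilbert_complex_space)
  \<comment> \<open>At a fixed coordinate \<gamma> the double sum is the quadratic form of D at the
    combination of the second components with coefficients taken from the first ones.\<close>
  define u where "u \<gamma> ws = foldr (\<lambda>z x. fst z \<gamma> \<odot> snd z \<oplus> x) ws \<zero>" for \<gamma> and ws :: "(('b list \<Rightarrow> complex) \<times> 'a) list"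
  have u_in: "u \<gamma> ws \<in> carrier H" if "set ws \<subseteq> set zs" for \<gamma> ws
    using that by (induction ws) (use zs in \<open>auto simp: u_def\<close>)
  have u1: "cinner H (D (u \<gamma> ws)) x = (\<Sum>z\<leftarrow>ws. fst z \<gamma> * cinner H (D (snd z)) x)" if "set ws \<subseteq> set zs" "x \<in> carrier H" for \<gamma> ws x
    using that(1)
  proof (induction ws)
    case (Cons z ws)
    then have "snd z \<in> carrier H" "u \<gamma> ws \<in> carrier H" using zs u_in by auto
    then show ?case using Cons that(2) bounded_ops_in[OF D]
      by (simp add: u_def bounded_ops_add[OF D] bounded_ops_smult[OF D] ip_simps)
  qed (use that D in \<open>simp add: u_def op_zero\<close>)
  have u2: "cinner H x (u \<gamma> ws) = (\<Sum>z\<leftarrow>ws. cnj (fst z \<gamma>) * cinner H x (snd z))" if "set ws \<subseteq> set zs" "x \<in> carrier H" for \<gamma> ws x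
    using that(1)
  proof (induction ws)
    case (Cons z ws)
    then have "snd z \<in> carrier H" "u \<gamma> ws \<in> carrier H" using zs u_in by auto
    then show ?case using Cons that(2) by (simp add: u_def ip_simps)
  qed (use that in \<open>simp add: u_def\<close>)
  have hs: "((\<lambda>\<gamma>. fst z \<gamma> * cnj (fst w \<gamma>)) has_sum cinner fock (fst z) (fst w)) UNIV" if "z \<in> set zs" "w \<in> set zs" for z w
    using has_sum_infsum[OF C.l2_ip_summable[of "fst z" "fst w"]] zs[OF that(1)] zs[OF that(2)] by (simp add: fock_def)
  have hsl: "((\<lambda>\<gamma>. \<Sum>x\<leftarrow>xs. g x \<gamma>) has_sum (\<Sum>x\<leftarrow>xs. s x)) UNIV" if "\<And>x. x \<in> set xs \<Longrightarrow> (g x has_sum s x) UNIV"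
    for g :: "(('b list \<Rightarrow> complex) \<times> 'a) \<Rightarrow> 'b list \<Rightarrow> complex" and s xs
    using that by (induction xs) (auto intro!: has_sum_add)
  have "((\<lambda>\<gamma>. \<Sum>z\<leftarrow>zs. \<Sum>w\<leftarrow>zs. fst z \<gamma> * cnj (fst w \<gamma>) * cinner H (D (snd z)) (snd w)) has_sum
     (\<Sum>z\<leftarrow>zs. \<Sum>w\<leftarrow>zs. cinner fock (fst z) (fst w) * cinner H (D (snd z)) (snd w))) UNIV"
    by (intro hsl has_sum_cmult_left hs)
  moreover have "(\<Sum>z\<leftarrow>zs. \<Sum>w\<leftarrow>zs. fst z \<gamma> * cnj (fst w \<gamma>) * cinner H (D (snd z)) (snd w)) = cinner H (D (u \<gamma> zs)) (u \<gamma> zs)" for \<gamma>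
  proof -
    have "cinner H (D (u \<gamma> zs)) (u \<gamma> zs) = (\<Sum>z\<leftarrow>zs. fst z \<gamma> * cinner H (D (snd z)) (u \<gamma> zs))"
      by (rule u1) (use u_in in auto)
    also have "\<dots> = (\<Sum>z\<leftarrow>zs. \<Sum>w\<leftarrow>zs. fst z \<gamma> * cnj (fst w \<gamma>) * cinner H (D (snd z)) (snd w))"
    proof (intro arg_cong[where f=sum_list] map_cong refl)
      fix z assume "z \<in> set zs"
      then have "cinner H (D (snd z)) (u \<gamma> zs) = (\<Sum>w\<leftarrow>zs. cnj (fst w \<gamma>) * cinner H (D (snd z)) (snd w))"
        by (intro u2) (use zs bounded_ops_in[OF D] in auto)
      then show "fst z \<gamma> * cinner H (D (snd z)) (u \<gamma> zs) = (\<Sum>w\<leftarrow>zs. fst z \<gamma> * cnj (fst w \<gamma>) * cinner H (D (snd z)) (snd w))"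
        by (simp add: mult.assoc sum_list_const_mult)
    qed
    finally show ?thesis by simp
  qed
  ultimately have "((\<lambda>\<gamma>. cinner H (D (u \<gamma> zs)) (u \<gamma> zs)) has_sum
     (\<Sum>z\<leftarrow>zs. \<Sum>w\<leftarrow>zs. cinner fock (fst z) (fst w) * cinner H (D (snd z)) (snd w))) UNIV" by simp
  then have "((\<lambda>\<gamma>. Re (cinner H (D (u \<gamma> zs)) (u \<gamma> zs))) has_sum
     Re (\<Sum>z\<leftarrow>zs. \<Sum>w\<leftarrow>zs. cinner fock (fst z) (fst w) * cinner H (D (snd z)) (snd w))) UNIV" by (rule has_sum_Re)
  then show ?thesis by (rule has_sum_nonneg) (use positive_form_nonneg[OF pos] u_in in auto)
qed

locale pure_data = admissible_series b + H: hilbert_space H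
  for b :: "'n::finite list \<Rightarrow> real" and H :: "'h hilbert" +
  fixes X :: "'n \<Rightarrow> 'h \<Rightarrow> 'h" and \<Delta> :: "'h \<Rightarrow> 'h"
  assumes X: "X i \<in> bounded_ops H H" and \<Delta>: "\<Delta> \<in> bounded_ops H H" and pos: "op_le H \<zero>\<^bsub>op_alg H\<^esub> \<Delta>"
    and pure: "\<lbrakk>h \<in> carrier H; k \<in> carrier H\<rbrakk> \<Longrightarrow> (\<lambda>N. cinner H (word_sum H b X \<Delta> N h) k) \<longlonglongrightarrow> cinner H h k"
begin

sublocale F: hilbert_space "fock :: ('n list \<Rightarrow> complex) hilbert" by (rule hilbert_fock)

text \<open>Up to the square root of \<Delta>, this is the coordinate at \<alpha> of the Poisson
  kernel of X. \<open>dy\<close> records inner products of such coordinates with \<Delta> itself, so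
  the root never has to be taken.\<close>

definition y :: "'n list \<Rightarrow> 'h \<Rightarrow> 'h" where
  "y \<alpha> h = complex_of_real (sqrt (b \<alpha>)) \<odot>\<^bsub>H\<^esub> wadj H X \<alpha> h"

lemma y_in [simp]: "h \<in> carrier H \<Longrightarrow> y \<alpha> h \<in> carrier H"
  by (simp add: y_def H.wadj_in[of X, OF X])

lemma y_add: "\<lbrakk>h \<in> carrier H; k \<in> carrier H\<rbrakk> \<Longrightarrow> y \<alpha> (h \<oplus>\<^bsub>H\<^esub> k) = y \<alpha> h \<oplus>\<^bsub>H\<^esub> y \<alpha> k"
  by (simp add: y_def H.wadj_in[of X, OF X] H.wadj_add[of X, OF X] H.smult_r_distr)

lemma y_smult: "h \<in> carrier H \<Longrightarrow> y \<alpha> (c \<odot>\<^bsub>H\<^esub> h) = c \<odot>\<^bsub>H\<^esub> y \<alpha> h"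
  using H.wadj_in[of X, OF X, of h \<alpha>] H.smult_assoc1[of _ _ "wadj H X \<alpha> h", symmetric]
  by (simp add: y_def H.wadj_smult[of X, OF X] mult.commute)

definition dy :: "'n list \<Rightarrow> 'n list \<Rightarrow> 'h \<Rightarrow> 'h \<Rightarrow> complex" where
  "dy \<alpha> \<beta> h k = cinner H (\<Delta> (y \<alpha> h)) (y \<beta> k)"

lemma dy_add: "\<lbrakk>h \<in> carrier H; h' \<in> carrier H; k \<in> carrier H\<rbrakk> \<Longrightarrow> dy \<alpha> \<beta> (h \<oplus>\<^bsub>H\<^esub> h') k = dy \<alpha> \<beta> h k + dy \<alpha> \<beta> h' k"
  by (simp add: dy_def y_add bounded_ops_add[OF \<Delta>] bounded_ops_in[OF \<Delta>] H.ip_simps)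

lemma dy_smult: "\<lbrakk>h \<in> carrier H; k \<in> carrier H\<rbrakk> \<Longrightarrow> dy \<alpha> \<beta> (c \<odot>\<^bsub>H\<^esub> h) k = c * dy \<alpha> \<beta> h k"
  by (simp add: dy_def y_smult bounded_ops_smult[OF \<Delta>] bounded_ops_in[OF \<Delta>] H.ip_simps)

lemma dy_herm: "\<lbrakk>h \<in> carrier H; k \<in> carrier H\<rbrakk> \<Longrightarrow> cnj (dy \<alpha> \<beta> h k) = dy \<beta> \<alpha> k h"
  using H.positive_hermitian[OF \<Delta> pos, of "y \<alpha> h" "y \<beta> k"] by (simp add: dy_def)

lemma dy_nonneg: "h \<in> carrier H \<Longrightarrow> 0 \<le> Re (dy \<alpha> \<alpha> h h)"
  using H.positive_form_nonneg[OF pos] by (simp add: dy_def)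

text \<open>The form <(C \<otimes> I) V h, V k> for the Poisson kernel V cut off to words of length
  at most N.\<close>

definition \<Phi> :: "nat \<Rightarrow> (('n list \<Rightarrow> complex) \<Rightarrow> ('n list \<Rightarrow> complex)) \<Rightarrow> 'h \<Rightarrow> 'h \<Rightarrow> complex" where
  "\<Phi> N C h k = (\<Sum>\<alpha> | length \<alpha> \<le> N. \<Sum>\<beta> | length \<beta> \<le> N. cinner fock (C (basis \<alpha>)) (basis \<beta>) * dy \<alpha> \<beta> h k)"

lemma \<Phi>_cp_form: "cp_form fock H F.ops (\<Phi> N)"
proof -
  note op_b = bounded_ops_in[where H=fock and K=fock, OF _ basis_in]
  have "cp_form_axioms fock H F.ops (\<Phi> N)"
  proof (rule cp_form_axioms.intro)
    show "star_alg fock F.ops" by (rule F.star_alg_ops)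
    show "\<Phi> N (C \<oplus>\<^bsub>op_alg fock\<^esub> C') h k = \<Phi> N C h k + \<Phi> N C' h k"
      if "C \<in> F.ops" "C' \<in> F.ops" for C C' h k
      using that by (simp add: \<Phi>_def F.cinner_add_left op_b distrib_right sum.distrib)
    show "\<Phi> N (c \<odot>\<^bsub>op_alg fock\<^esub> C) h k = c * \<Phi> N C h k" if "C \<in> F.ops" for C h k c
      using that by (simp add: \<Phi>_def F.cinner_smult_left op_b sum_distrib_left mult.assoc)
    show "\<Phi> N C (h \<oplus>\<^bsub>H\<^esub> h') k = \<Phi> N C h k + \<Phi> N C h' k"
      if "h \<in> carrier H" "h' \<in> carrier H" "k \<in> carrier H" for C h h' k
      using that by (simp add: \<Phi>_def dy_add distrib_left sum.distrib)
    show "\<Phi> N C (c \<odot>\<^bsub>H\<^esub> h) k = c * \<Phi> N C h k" if "h \<in> carrier H" "k \<in> carrier H" for C h k c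
      using that by (simp add: \<Phi>_def dy_smult sum_distrib_left mult_ac)
    show "\<Phi> N (adj fock C) k h = cnj (\<Phi> N C h k)" if C: "C \<in> F.ops" and h: "h \<in> carrier H" and k: "k \<in> carrier H" for C h k
    proof -
      have "cnj (cinner fock (C (basis \<alpha>)) (basis \<beta>)) = cinner fock (adj fock C (basis \<beta>)) (basis \<alpha>)" for \<alpha> \<beta>
        using F.cinner_commute[OF basis_in op_b[OF C], of \<beta> \<alpha>] F.adj_ip2[OF C basis_in basis_in, of \<beta> \<alpha>] by simp
      then have "cnj (\<Phi> N C h k) = (\<Sum>\<alpha> | length \<alpha> \<le> N. \<Sum>\<beta> | length \<beta> \<le> N. cinner fock (adj fock C (basis \<beta>)) (basis \<alpha>) * dy \<beta> \<alpha> k h)"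
        by (simp add: \<Phi>_def dy_herm h k)
      also have "\<dots> = \<Phi> N (adj fock C) k h" unfolding \<Phi>_def by (rule sum.swap)
      finally show ?thesis by simp
    qed
    show "\<exists>c\<ge>0. \<forall>C\<in>F.ops. \<forall>M. bounded_by fock C M \<longrightarrow> cmod (\<Phi> N C h k) \<le> c * M" for h k
    proof (intro exI conjI ballI allI impI)
      let ?c = "\<Sum>\<alpha> | length \<alpha> \<le> N. \<Sum>\<beta> | length \<beta> \<le> N. cmod (dy \<alpha> \<beta> h k)"
      show "0 \<le> ?c" by (intro sum_nonneg) auto
      fix C M assume C: "C \<in> F.ops" and M: "bounded_by fock C M"
      have "cmod (cinner fock (C (basis \<alpha>)) (basis \<beta>)) \<le> M" for \<alpha> \<beta>
        using F.Cauchy_Schwarz[OF op_b[OF C] basis_in, of \<alpha> \<beta>] M basis_in[of \<alpha>]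
        unfolding bounded_by_def by (metis hnorm_basis mult.right_neutral order_trans)
      then have "cmod (\<Phi> N C h k) \<le> (\<Sum>\<alpha> | length \<alpha> \<le> N. \<Sum>\<beta> | length \<beta> \<le> N. M * cmod (dy \<alpha> \<beta> h k))"
        unfolding \<Phi>_def by (intro sum_norm_le order_trans[OF norm_sum] sum_mono) (simp add: norm_mult mult_right_mono)
      then show "cmod (\<Phi> N C h k) \<le> ?c * M" by (simp add: sum_distrib_left mult.commute[of _ M])
    qed
    show "0 \<le> Re (\<Sum>p\<leftarrow>ps. \<Sum>q\<leftarrow>ps. \<Phi> N (adj fock (fst q) \<otimes>\<^bsub>op_alg fock\<^esub> fst p) (snd p) (snd q))"
      if ps: "set ps \<subseteq> F.ops \<times> carrier H" for ps
    proof -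
      obtain ws :: "'n list list" where ws: "set ws = {\<alpha>. length \<alpha> \<le> N}" "distinct ws"
        using finite_distinct_list[OF finite_words(1)] by blast
      \<comment> \<open>Running over all pairs (operator, vector) and all words at once makes the
        positivity sum a Schur product of two Gram matrices: images of basis vectors against the
        y-vectors.\<close>
      define zs where "zs = concat (map (\<lambda>p. map (\<lambda>\<alpha>. (fst p (basis \<alpha>), y \<alpha> (snd p))) ws) ps)"
      have P: "fst p \<in> F.ops" "snd p \<in> carrier H" if "p \<in> set ps" for p using ps that by auto
      have cc: "(\<Sum>z\<leftarrow>zs. f z) = (\<Sum>p\<leftarrow>ps. \<Sum>\<alpha>\<leftarrow>ws. f (fst p (basis \<alpha>), y \<alpha> (snd p)))" for f :: "_ \<Rightarrow> complex"
        unfolding zs_def by (induction ps) (simp_all add: o_def)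
      have sw: "(\<Sum>\<alpha>\<leftarrow>ws. \<Sum>q\<leftarrow>qs. f \<alpha> q) = (\<Sum>q\<leftarrow>qs. \<Sum>\<alpha>\<leftarrow>ws. f \<alpha> q)" for f :: "_ \<Rightarrow> _ \<Rightarrow> complex" and qs :: "((('n list \<Rightarrow> complex) \<Rightarrow> 'n list \<Rightarrow> complex) \<times> 'h) list"
        by (induction qs) (simp_all add: sum_list_addf)
      have S: "(\<Sum>\<alpha> | length \<alpha> \<le> N. f \<alpha>) = (\<Sum>\<alpha>\<leftarrow>ws. f \<alpha>)" for f :: "_ \<Rightarrow> complex"
        using sum.distinct_set_conv_list[OF ws(2), of f] ws(1) by simp
      have "(\<Sum>p\<leftarrow>ps. \<Sum>q\<leftarrow>ps. \<Phi> N (adj fock (fst q) \<otimes>\<^bsub>op_alg fock\<^esub> fst p) (snd p) (snd q)) =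
        (\<Sum>p\<leftarrow>ps. \<Sum>q\<leftarrow>ps. \<Sum>\<alpha>\<leftarrow>ws. \<Sum>\<beta>\<leftarrow>ws. cinner fock (fst p (basis \<alpha>)) (fst q (basis \<beta>)) * dy \<alpha> \<beta> (snd p) (snd q))"
      proof (intro arg_cong[where f=sum_list] map_cong refl)
        fix p q assume pq: "p \<in> set ps" "q \<in> set ps"
        have "cinner fock ((adj fock (fst q) \<otimes>\<^bsub>op_alg fock\<^esub> fst p) (basis \<alpha>)) (basis \<beta>) = cinner fock (fst p (basis \<alpha>)) (fst q (basis \<beta>))" for \<alpha> \<beta>
          using P[OF pq(1)] P[OF pq(2)] by (simp add: compose_eq F.adj_ip2 op_b)
        then show "\<Phi> N (adj fock (fst q) \<otimes>\<^bsub>op_alg fock\<^esub> fst p) (snd p) (snd q) =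
          (\<Sum>\<alpha>\<leftarrow>ws. \<Sum>\<beta>\<leftarrow>ws. cinner fock (fst p (basis \<alpha>)) (fst q (basis \<beta>)) * dy \<alpha> \<beta> (snd p) (snd q))"
          unfolding \<Phi>_def S by simp
      qed
      also have "\<dots> = (\<Sum>z\<leftarrow>zs. \<Sum>w\<leftarrow>zs. cinner fock (fst z) (fst w) * cinner H (\<Delta> (snd z)) (snd w))"
        unfolding cc by (simp add: sw dy_def)
      finally show ?thesis
      proof (simp only:, intro H.gram_product_nonneg[OF \<Delta> pos])
        fix z assume "z \<in> set zs"
        then obtain p \<alpha> where "p \<in> set ps" "z = (fst p (basis \<alpha>), y \<alpha> (snd p))" by (auto simp: zs_def)
        then show "fst z \<in> carrier fock \<and> snd z \<in> carrier H" using op_b[OF P(1), of p \<alpha>] P(2)[of p] by simp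
      qed
    qed
  qed
  then show ?thesis using H.hilbert_space_axioms F.hilbert_space_axioms by (simp add: cp_form_def)
qed

lemma \<Phi>_dg:
  "\<Phi> N (dg S) h k = (\<Sum>\<alpha> | length \<alpha> \<le> N \<and> \<alpha> \<in> S. dy \<alpha> \<alpha> h k)"
proof -
  have "(\<Sum>\<beta> | length \<beta> \<le> N. cinner fock (dg S (basis \<alpha>)) (basis \<beta>) * dy \<alpha> \<beta> h k) = (if \<alpha> \<in> S then dy \<alpha> \<alpha> h k else 0)"
    if "length \<alpha> \<le> N" for \<alpha>
  proof -
    have *: "cinner fock (dg S (basis \<alpha>)) (basis \<beta>) = (if \<beta> = \<alpha> \<and> \<alpha> \<in> S then 1 else 0)" for \<beta>
      using F.ip_zero_left[OF basis_in[of \<beta>]] by (auto simp: dg_basis basis_ip_basis fock_simps(1))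
    have "(\<Sum>\<beta> | length \<beta> \<le> N. cinner fock (dg S (basis \<alpha>)) (basis \<beta>) * dy \<alpha> \<beta> h k) =
       (\<Sum>\<beta>\<in>{\<alpha>}. cinner fock (dg S (basis \<alpha>)) (basis \<beta>) * dy \<alpha> \<beta> h k)"
      by (rule sum.mono_neutral_right) (use that in \<open>auto simp: *\<close>)
    then show ?thesis by (simp add: *)
  qed
  then have "\<Phi> N (dg S) h k = (\<Sum>\<alpha> | length \<alpha> \<le> N. if \<alpha> \<in> S then dy \<alpha> \<alpha> h k else 0)" unfolding \<Phi>_def by simp
  also have "\<dots> = (\<Sum>\<alpha> | length \<alpha> \<le> N \<and> \<alpha> \<in> S. dy \<alpha> \<alpha> h k)" by (simp add: sum.inter_filter[symmetric])
  finally show ?thesis .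
qed

lemma word_sum_dy:
  assumes "h \<in> carrier H" "k \<in> carrier H"
  shows "cinner H (word_sum H b X \<Delta> N h) k = (\<Sum>\<alpha> | length \<alpha> \<le> N. dy \<alpha> \<alpha> h k)"
proof -
  have "of_real (b \<alpha>) * cinner H (\<Delta> (wadj H X \<alpha> h)) (wadj H X \<alpha> k) = dy \<alpha> \<alpha> h k" for \<alpha>
  proof -
    have "dy \<alpha> \<alpha> h k = of_real (sqrt (b \<alpha>) * sqrt (b \<alpha>)) * cinner H (\<Delta> (wadj H X \<alpha> h)) (wadj H X \<alpha> k)"
      unfolding dy_def y_def using assms
      by (simp add: H.wadj_in[of X, OF X] bounded_ops_smult[OF \<Delta>] bounded_ops_in[OF \<Delta>] H.ip_simps flip: mult.assoc of_real_mult)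
    then show ?thesis by simp
  qed
  then show ?thesis by (simp add: H.word_sum_ip[of X, OF X \<Delta> assms])
qed

lemma \<Phi>_one: "\<Phi> N (\<lambda>f\<in>carrier fock. f) h k = (\<Sum>\<alpha> | length \<alpha> \<le> N. dy \<alpha> \<alpha> h k)"
  using \<Phi>_dg[of N UNIV] by (simp add: dg_UNIV)

text \<open>The values at the identity increase with N and converge by purity. Together with
  \<open>F_bound\<close> this bounds the forms uniformly in N.\<close>

lemma \<Phi>_one_le: "h \<in> carrier H \<Longrightarrow> Re (\<Phi> N (\<lambda>f\<in>carrier fock. f) h h) \<le> (hnorm H h)\<^sup>2"
proof -
  assume h: "h \<in> carrier H"
  have "incseq (\<lambda>N. Re (\<Phi> N (\<lambda>f\<in>carrier fock. f) h h))"
    unfolding \<Phi>_one Re_sum by (intro incseq_SucI sum_mono2) (auto simp: dy_nonneg h)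
  moreover have "(\<lambda>N. Re (\<Phi> N (\<lambda>f\<in>carrier fock. f) h h)) \<longlonglongrightarrow> Re (cinner H h h)"
    unfolding \<Phi>_one using tendsto_Re[OF pure[OF h h]] by (simp only: word_sum_dy[OF h h])
  ultimately show ?thesis using incseq_le H.hnorm_sq[OF h] by metis
qed

lemma \<Phi>_bound:
  assumes "C \<in> F.ops" "bounded_by fock C M" "h \<in> carrier H" "k \<in> carrier H"
  shows "cmod (\<Phi> N C h k) \<le> M * hnorm H h * hnorm H k"
proof -
  interpret cp_form fock H F.ops "\<Phi> N" by (rule \<Phi>_cp_form)
  have sq: "sqrt (Re (\<Phi> N (\<lambda>f\<in>carrier fock. f) h h)) \<le> hnorm H h" if "h \<in> carrier H" for h
    using \<Phi>_one_le[OF that, of N] that by (simp add: real_le_lsqrt)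
  have M: "M \<ge> 0" using assms(2) by (simp add: bounded_by_def)
  have "cmod (\<Phi> N C h k) \<le> M * sqrt (Re (\<Phi> N (\<lambda>f\<in>carrier fock. f) h h)) * sqrt (Re (\<Phi> N (\<lambda>f\<in>carrier fock. f) k k))"
    using F_bound[OF assms] .
  also have "\<dots> \<le> M * hnorm H h * hnorm H k"
    using sq[OF assms(3)] sq[OF assms(4)] M assms(3,4) F_nonneg[of "\<lambda>f\<in>carrier fock. f" k]
    by (intro mult_mono mult_left_mono) (auto simp: F.adj_one)
  finally show ?thesis .
qed

lemma Bk_basis:
  "Bk b complex_space i (basis \<alpha>) = (case \<alpha> of [] \<Rightarrow> (\<lambda>_. 0) | j # \<alpha>' \<Rightarrow>
     if j = i then complex_of_real (sqrt (b \<alpha>' / b (i # \<alpha>'))) \<odot>\<^bsub>fock\<^esub> basis \<alpha>' else (\<lambda>_. 0))"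
  using basis_in[of \<alpha>] by (auto simp: Bk_def fock_def[symmetric] bshift_def fock_simps basis_def fun_eq_iff split: list.split)

text \<open>The shift shortens words, so the left term covers only \<alpha> shorter than N. The
  discrepancy is the layer of length N, which Cauchy-Schwarz bounds by a difference of consecutive
  partial sums of a convergent series.\<close>

lemma \<Phi>_coinvariant:
  assumes C: "C \<in> F.ops" and h: "h \<in> carrier H" and k: "k \<in> carrier H"
  shows "(\<lambda>N. \<Phi> N (compose (carrier fock) C (Bk b complex_space i)) h k - \<Phi> N C (adj H (X i) h) k) \<longlonglongrightarrow> 0"
proof -
  let ?h = "adj H (X i) h"
  let ?R = "\<lambda>N. dg {\<alpha> :: 'n list. length \<alpha> = N}"
  have h': "?h \<in> carrier H" using X h by simp
  note op_b = bounded_ops_in[where H=fock and K=fock, OF _ basis_in]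
  obtain M where M: "bounded_by fock C M" using F.bounded_ops_bound[OF C] .
  have CC: "compose (carrier fock) C (adj fock C) \<in> F.ops" using C by simp
  have inj: "inj_on ((#) i) X" for X by simp
  \<comment> \<open>Only words starting with i survive. Removing that letter replaces the weight by
    that of the shorter word and passes the adjoint of \<open>X i\<close> on to h.\<close>
  have shift: "\<Phi> N (compose (carrier fock) C (Bk b complex_space i)) h k =
     (\<Sum>\<alpha> | length \<alpha> < N. \<Sum>\<beta> | length \<beta> \<le> N. cinner fock (C (basis \<alpha>)) (basis \<beta>) * dy \<alpha> \<beta> ?h k)" for N
  proof -
    let ?t = "\<lambda>\<alpha>. \<Sum>\<beta> | length \<beta> \<le> N. cinner fock (C (Bk b complex_space i (basis \<alpha>))) (basis \<beta>) * dy \<alpha> \<beta> h k"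
    have Cz: "C (\<lambda>_. 0) = (\<lambda>_. 0)" using F.op_zero[OF C] by (simp add: fock_simps)
    have z: "?t \<alpha> = 0" if "\<alpha> \<notin> range ((#) i)" for \<alpha>
      using that F.ip_zero_left[OF basis_in] by (cases \<alpha>) (auto simp: Bk_basis Cz fock_simps(1))
    have "\<Phi> N (compose (carrier fock) C (Bk b complex_space i)) h k = (\<Sum>\<alpha> | length \<alpha> \<le> N. ?t \<alpha>)"
      by (simp add: \<Phi>_def compose_eq)
    also have "\<dots> = (\<Sum>\<alpha>\<in>(#) i ` {\<alpha>. length \<alpha> < N}. ?t \<alpha>)"
    proof (rule sum.mono_neutral_right)
      show "\<forall>\<alpha>\<in>{\<alpha>. length \<alpha> \<le> N} - (#) i ` {\<alpha>. length \<alpha> < N}. ?t \<alpha> = 0"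
      proof
        fix \<alpha> assume "\<alpha> \<in> {\<alpha>. length \<alpha> \<le> N} - (#) i ` {\<alpha>. length \<alpha> < N}"
        then have "\<alpha> \<notin> range ((#) i)" by (auto simp: Suc_le_eq)
        then show "?t \<alpha> = 0" by (rule z)
      qed
    qed auto
    also have "\<dots> = (\<Sum>\<alpha> | length \<alpha> < N. ?t (i # \<alpha>))" by (simp add: sum.reindex o_def)
    also have "\<dots> = (\<Sum>\<alpha> | length \<alpha> < N. \<Sum>\<beta> | length \<beta> \<le> N. cinner fock (C (basis \<alpha>)) (basis \<beta>) * dy \<alpha> \<beta> ?h k)"
    proof (intro sum.cong refl)
      fix \<alpha> \<beta>
      have "sqrt (b \<alpha> / b (i # \<alpha>)) * sqrt (b (i # \<alpha>)) = sqrt (b \<alpha>)" by (simp add: real_sqrt_divide)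
      then have "complex_of_real (sqrt (b \<alpha> / b (i # \<alpha>))) * dy (i # \<alpha>) \<beta> h k = dy \<alpha> \<beta> ?h k"
        using H.wadj_in[of X, OF X h'] H.wadj_in[of X, OF X k] h k unfolding dy_def y_def wadj.simps
        by (simp add: bounded_ops_smult[OF \<Delta>] bounded_ops_in[OF \<Delta>] H.ip_simps flip: mult.assoc of_real_mult)
      then show "cinner fock (C (Bk b complex_space i (basis (i # \<alpha>)))) (basis \<beta>) * dy (i # \<alpha>) \<beta> h k =
          cinner fock (C (basis \<alpha>)) (basis \<beta>) * dy \<alpha> \<beta> ?h k"
        using op_b[OF C, of \<alpha>] by (simp add: Bk_basis bounded_ops_smult[OF C] F.cinner_smult_left mult_ac)
    qed
    finally show ?thesis .
  qed
  have diff: "\<Phi> N C ?h k - \<Phi> N (compose (carrier fock) C (Bk b complex_space i)) h k = \<Phi> N (compose (carrier fock) C (?R N)) ?h k" for N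
  proof -
    let ?t = "\<lambda>\<alpha>. \<Sum>\<beta> | length \<beta> \<le> N. cinner fock (C (basis \<alpha>)) (basis \<beta>) * dy \<alpha> \<beta> ?h k"
    have Cz: "C (\<lambda>_. 0) = (\<lambda>_. 0)" using F.op_zero[OF C] by (simp add: fock_simps)
    have "\<Phi> N (compose (carrier fock) C (?R N)) ?h k = (\<Sum>\<alpha> | length \<alpha> \<le> N. if length \<alpha> = N then ?t \<alpha> else 0)"
      unfolding \<Phi>_def using F.ip_zero_left[OF basis_in] by (intro sum.cong refl) (simp add: compose_eq dg_basis Cz fock_simps(1))
    also have "\<dots> = (\<Sum>\<alpha> | length \<alpha> \<le> N \<and> length \<alpha> = N. ?t \<alpha>)" by (simp add: sum.inter_filter[symmetric])
    also have "\<dots> = (\<Sum>\<alpha> | length \<alpha> \<le> N. ?t \<alpha>) - (\<Sum>\<alpha> | length \<alpha> < N. ?t \<alpha>)" by (rule sum_words_top)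
    finally show ?thesis unfolding shift by (simp add: \<Phi>_def)
  qed
  have "(\<lambda>N. \<Phi> N (compose (carrier fock) C (?R N)) ?h k) \<longlonglongrightarrow> 0"
  proof (rule Lim_null_comparison)
    let ?e = "\<lambda>N. Re (\<Phi> N (?R N) ?h ?h)"
    show "\<forall>\<^sub>F N in sequentially. norm (\<Phi> N (compose (carrier fock) C (?R N)) ?h k) \<le> sqrt (?e N) * (M * hnorm H k)"
    proof (intro always_eventually allI)
      fix N
      interpret cp_form fock H F.ops "\<Phi> N" by (rule \<Phi>_cp_form)
      have "cmod (\<Phi> N (compose (carrier fock) C (?R N)) ?h k) \<le> sqrt (?e N) * sqrt (Re (\<Phi> N (compose (carrier fock) C (adj fock C)) k k))"
        using F_CS[of "?R N" "adj fock C" ?h k] C h' k by (simp add: dg_props dg_compose)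
      also have "\<dots> \<le> sqrt (?e N) * (M * hnorm H k)"
      proof (rule mult_left_mono)
        have "bounded_by fock (compose (carrier fock) C (adj fock C)) (M * M)"
          using C M by (intro F.bounded_by_compose F.bounded_by_adj) auto
        then have "Re (\<Phi> N (compose (carrier fock) C (adj fock C)) k k) \<le> (M * hnorm H k)\<^sup>2"
          using \<Phi>_bound[OF CC, of "M * M" k k N] k complex_Re_le_cmod[of "\<Phi> N (compose (carrier fock) C (adj fock C)) k k"]
          by (simp add: power2_eq_square mult_ac)
        then show "sqrt (Re (\<Phi> N (compose (carrier fock) C (adj fock C)) k k)) \<le> M * hnorm H k"
          using M k by (intro real_le_lsqrt) (auto simp: bounded_by_def)
        show "0 \<le> sqrt (?e N)" using F_nonneg[of "?R N" ?h] h' by (simp add: dg_props dg_compose)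
      qed
      finally show "norm (\<Phi> N (compose (carrier fock) C (?R N)) ?h k) \<le> sqrt (?e N) * (M * hnorm H k)" .
    qed
    have "(\<lambda>N. \<Phi> N (?R N) ?h ?h) \<longlonglongrightarrow> 0"
    proof -
      have s: "(\<lambda>N. \<Sum>\<alpha> | length \<alpha> \<le> N. dy \<alpha> \<alpha> ?h ?h) \<longlonglongrightarrow> cinner H ?h ?h"
        using pure[OF h' h'] by (simp only: word_sum_dy[OF h' h'])
      \<comment> \<open>The layer value is the increment of the partial sums that converge to <?h,
        ?h> by purity.\<close>
      have "\<Phi> (Suc N) (?R (Suc N)) ?h ?h = (\<Sum>\<alpha> | length \<alpha> \<le> Suc N. dy \<alpha> \<alpha> ?h ?h) - (\<Sum>\<alpha> | length \<alpha> \<le> N. dy \<alpha> \<alpha> ?h ?h)" for N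
      proof -
        have "{\<alpha> :: 'n list. length \<alpha> < Suc N} = {\<alpha>. length \<alpha> \<le> N}" by auto
        then show ?thesis unfolding \<Phi>_dg using sum_words_top[of "\<lambda>\<alpha>. dy \<alpha> \<alpha> ?h ?h" "Suc N"] by simp
      qed
      then have "(\<lambda>N. \<Phi> (Suc N) (?R (Suc N)) ?h ?h) \<longlonglongrightarrow> 0"
        using tendsto_diff[OF LIMSEQ_Suc[OF s] s] by simp
      then show ?thesis by (rule LIMSEQ_imp_Suc)
    qed
    then have "?e \<longlonglongrightarrow> 0" using tendsto_Re by fastforce
    then show "(\<lambda>N. sqrt (?e N) * (M * hnorm H k)) \<longlonglongrightarrow> 0"
      using tendsto_mult_left_zero tendsto_real_sqrt by fastforce
  qed
  then have "(\<lambda>N. - \<Phi> N (compose (carrier fock) C (?R N)) ?h k) \<longlonglongrightarrow> 0" using tendsto_minus by fastforce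
  then show ?thesis by (simp add: diff[symmetric])
qed

end

text \<open>A unital completely positive form whose last clause encodes coinvariance. Its domain is
  all bounded operators on Fock space, so coordinate projections can be inserted without a
  membership check in C*(W).\<close>

definition dilation_form ::
  "('n::finite list \<Rightarrow> real) \<Rightarrow> 'h hilbert \<Rightarrow> ('n \<Rightarrow> 'h \<Rightarrow> 'h)
    \<Rightarrow> ((('n list \<Rightarrow> complex) \<Rightarrow> ('n list \<Rightarrow> complex)) \<Rightarrow> 'h \<Rightarrow> 'h \<Rightarrow> complex) \<Rightarrow> bool" where
  "dilation_form b H X F \<longleftrightarrow> cp_form fock H (bounded_ops fock fock) F \<and>
    (\<forall>C\<in>bounded_ops fock fock. \<forall>M. \<forall>h\<in>carrier H. \<forall>k\<in>carrier H. bounded_by fock C M \<longrightarrow>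
      cmod (F C h k) \<le> M * hnorm H h * hnorm H k) \<and>
    (\<forall>h\<in>carrier H. \<forall>k\<in>carrier H. F (\<lambda>f\<in>carrier fock. f) h k = cinner H h k) \<and>
    (\<forall>C\<in>bounded_ops fock fock. \<forall>i. \<forall>h\<in>carrier H. \<forall>k\<in>carrier H.
      F (compose (carrier fock) C (Bk b complex_space i)) h k = F C (adj H (X i) h) k)"

text \<open>The special case of exactly positive forms: the comparison function is the positivity
  sum itself.\<close>

lemma cp_form_cluster_cp:
  fixes \<Phi> :: "nat \<Rightarrow> ('a \<Rightarrow> 'a) \<Rightarrow> 'h \<Rightarrow> 'h \<Rightarrow> complex"
  assumes cp: "\<And>i. cp_form B H \<A> (\<Phi> i)"
    and bd: "\<forall>i. \<forall>C\<in>\<A>. \<forall>M. \<forall>h\<in>carrier H. \<forall>k\<in>carrier H. bounded_by B C M \<longrightarrow>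
      cmod (\<Phi> i C h k) \<le> M * hnorm H h * hnorm H k"
  shows "\<exists>F G. G \<le> sequentially \<and> G \<noteq> bot \<and> cp_form B H \<A> F \<and>
    (\<forall>C\<in>\<A>. \<forall>h\<in>carrier H. \<forall>k\<in>carrier H. ((\<lambda>i. \<Phi> i C h k) \<longlongrightarrow> F C h k) G) \<and>
    (\<forall>C\<in>\<A>. \<forall>M. \<forall>h\<in>carrier H. \<forall>k\<in>carrier H. bounded_by B C M \<longrightarrow>
      cmod (F C h k) \<le> M * hnorm H h * hnorm H k)"
proof (rule cp_form_cluster[of B H \<A> sequentially \<Phi>])
  have ax: "cp_form_axioms B H \<A> (\<Phi> i)" for i using cp[of i] by (simp add: cp_form_def)
  show "hilbert_space B" "hilbert_space H" using cp[of 0] by (simp_all add: cp_form_def)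
  show "star_alg B \<A>" using ax[of 0] unfolding cp_form_axioms_def by blast
  show "\<Phi> i (C \<oplus>\<^bsub>op_alg B\<^esub> C') h k = \<Phi> i C h k + \<Phi> i C' h k"
    if "C \<in> \<A>" "C' \<in> \<A>" "h \<in> carrier H" "k \<in> carrier H" for i C C' h k
    by (rule cp_form.F_add[OF cp that])
  show "\<Phi> i (c \<odot>\<^bsub>op_alg B\<^esub> C) h k = c * \<Phi> i C h k"
    if "C \<in> \<A>" "h \<in> carrier H" "k \<in> carrier H" for i c C h k
    by (rule cp_form.F_smult[OF cp that])
  show "\<Phi> i C (h \<oplus>\<^bsub>H\<^esub> h') k = \<Phi> i C h k + \<Phi> i C h' k"
    if "C \<in> \<A>" "h \<in> carrier H" "h' \<in> carrier H" "k \<in> carrier H" for i C h h' k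
    by (rule cp_form.F_add1[OF cp that])
  show "\<Phi> i C (c \<odot>\<^bsub>H\<^esub> h) k = c * \<Phi> i C h k"
    if "C \<in> \<A>" "h \<in> carrier H" "k \<in> carrier H" for i c C h k
    by (rule cp_form.F_smult1[OF cp that])
  show "((\<lambda>i. \<Phi> i (adj B C) k h - cnj (\<Phi> i C h k)) \<longlongrightarrow> 0) sequentially"
    if "C \<in> \<A>" "h \<in> carrier H" "k \<in> carrier H" for C h k
    by (simp add: cp_form.F_herm[OF cp that])
  show "\<exists>\<psi>. (\<forall>i. 0 \<le> Re (\<psi> i)) \<and>
      ((\<lambda>i. (\<Sum>p\<leftarrow>ps. \<Sum>q\<leftarrow>ps. \<Phi> i (adj B (fst q) \<otimes>\<^bsub>op_alg B\<^esub> fst p) (snd p) (snd q)) - \<psi> i) \<longlongrightarrow> 0) sequentially"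
    if "set ps \<subseteq> \<A> \<times> carrier H" for ps
    by (rule exI[of _ "\<lambda>i. \<Sum>p\<leftarrow>ps. \<Sum>q\<leftarrow>ps. \<Phi> i (adj B (fst q) \<otimes>\<^bsub>op_alg B\<^esub> fst p) (snd p) (snd q)"])
      (use cp_form.F_cp[OF cp that] in simp)
  show ?thesis
    if "G \<le> sequentially" "G \<noteq> bot" "cp_form B H \<A> F"
      "\<And>C h k. \<lbrakk>C \<in> \<A>; h \<in> carrier H; k \<in> carrier H\<rbrakk> \<Longrightarrow> ((\<lambda>i. \<Phi> i C h k) \<longlongrightarrow> F C h k) G"
      "\<And>C M h k. \<lbrakk>C \<in> \<A>; bounded_by B C M; h \<in> carrier H; k \<in> carrier H\<rbrakk> \<Longrightarrow>
        cmod (F C h k) \<le> M * hnorm H h * hnorm H k" for F G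
    by (rule exI[of _ F], rule exI[of _ G], intro conjI ballI allI impI) (rule that; assumption)+
qed (use bd in auto)

text \<open>Removing the cutoff N by a cluster point: purity supplies unitality and
  \<open>\<Phi>_coinvariant\<close> the exact coinvariance.\<close>

lemma (in pure_data) pure_dilation_form: "\<exists>F. dilation_form b H X F"
proof -
  have bdm: "\<forall>i. \<forall>C\<in>F.ops. \<forall>M. \<forall>h\<in>carrier H. \<forall>k\<in>carrier H. bounded_by fock C M \<longrightarrow>
      cmod (\<Phi> i C h k) \<le> M * hnorm H h * hnorm H k"
    using \<Phi>_bound by simp
  obtain F G where G: "G \<le> sequentially" "G \<noteq> bot" and F: "cp_form fock H F.ops F"
    and lim0: "\<forall>C\<in>F.ops. \<forall>h\<in>carrier H. \<forall>k\<in>carrier H. ((\<lambda>i. \<Phi> i C h k) \<longlongrightarrow> F C h k) G"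
    and bd: "\<forall>C\<in>F.ops. \<forall>M. \<forall>h\<in>carrier H. \<forall>k\<in>carrier H. bounded_by fock C M \<longrightarrow>
      cmod (F C h k) \<le> M * hnorm H h * hnorm H k"
    using cp_form_cluster_cp[of fock H F.ops \<Phi>, OF \<Phi>_cp_form bdm]
    by (elim exE conjE) (rule that, assumption+)
  note lim = lim0[rule_format]
  have unit: "F (\<lambda>f\<in>carrier fock. f) h k = cinner H h k" if "h \<in> carrier H" "k \<in> carrier H" for h k
  proof (rule tendsto_unique[OF G(2) lim])
    show "((\<lambda>i. \<Phi> i (\<lambda>f\<in>carrier fock. f) h k) \<longlongrightarrow> cinner H h k) G"
      using tendsto_mono[OF G(1) pure[OF that]] by (simp only: \<Phi>_one word_sum_dy[OF that])
  qed (use that in auto)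
  have co: "F (compose (carrier fock) C (Bk b complex_space i)) h k = F C (adj H (X i) h) k"
    if "C \<in> F.ops" "h \<in> carrier H" "k \<in> carrier H" for C i h k
  proof -
    have "Bk b complex_space i \<in> F.ops" using W_props[of i] F.adj_in by metis
    then have "((\<lambda>N. \<Phi> N (compose (carrier fock) C (Bk b complex_space i)) h k - \<Phi> N C (adj H (X i) h) k) \<longlongrightarrow>
      F (compose (carrier fock) C (Bk b complex_space i)) h k - F C (adj H (X i) h) k) G"
      using that X by (intro tendsto_diff lim) auto
    then have "F (compose (carrier fock) C (Bk b complex_space i)) h k - F C (adj H (X i) h) k = 0"
      using tendsto_unique[OF G(2) _ tendsto_mono[OF G(1) \<Phi>_coinvariant[OF that]]] by blast
    then show ?thesis by simp
  qed
  show ?thesis unfolding dilation_form_def using F bd unit co by blast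
qed

text \<open>T itself need not be pure, but rT is for r near 1. The forms of these tuples are
  uniformly bounded, and a cluster point as r tends to 1 inherits every clause.\<close>

lemma (in admissible_series) dilation_form_exists:
  fixes H :: "'h hilbert" and T :: "'n \<Rightarrow> 'h \<Rightarrow> 'h"
  assumes rp: "radially_pure TYPE('h) b" and H: "hilbert_space H" and T: "T \<in> nc_domain b H"
  shows "\<exists>F. dilation_form b H T F"
proof -
  interpret H: hilbert_space H by fact
  interpret F: hilbert_space "fock :: ('n list \<Rightarrow> complex) hilbert" by (rule hilbert_fock)
  have Tops: "T i \<in> bounded_ops H H" for i using T by (auto simp: nc_domain_def domain_data_def)
  obtain \<delta> where \<delta>: "0 < \<delta>" "\<delta> < 1" "\<And>r. \<lbrakk>\<delta> < r; r < 1\<rbrakk> \<Longrightarrow> pure_tuple b H (\<lambda>i. complex_of_real r \<odot>\<^bsub>op_alg H\<^esub> T i)"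
    using rp H T unfolding radially_pure_def by blast
  \<comment> \<open>The denominator starts at 2, which keeps \<open>r m\<close> strictly above
    \<delta>.\<close>
  define r where "r m = 1 - (1 - \<delta>) / real (m + 2)" for m :: nat
  have r: "\<delta> < r m" "r m < 1" for m
  proof -
    have "(1 - \<delta>) / real (m + 2) < (1 - \<delta>) / 1" using \<delta> by (intro divide_strict_left_mono) auto
    then show "\<delta> < r m" by (simp add: r_def)
    show "r m < 1" using \<delta> by (simp add: r_def)
  qed
  have rl: "r \<longlonglongrightarrow> 1"
  proof -
    have "(\<lambda>m. 1 - (1 - \<delta>) * (1 / real (m + 2))) \<longlonglongrightarrow> 1 - (1 - \<delta>) * 0"
      by (intro tendsto_intros LIMSEQ_ignore_initial_segment lim_1_over_n)
    then show ?thesis by (simp add: r_def[abs_def])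
  qed
  let ?X = "\<lambda>m i. complex_of_real (r m) \<odot>\<^bsub>op_alg H\<^esub> T i"
  have "\<exists>F. dilation_form b H (?X m) F" for m
  proof -
    obtain \<Delta> where \<Delta>: "domain_data b H (?X m) \<Delta> \<one>\<^bsub>op_alg H\<^esub>" using \<delta>(3)[OF r] unfolding pure_tuple_def by blast
    have "pure_data b H (?X m) \<Delta>"
      by unfold_locales (use \<Delta> in \<open>auto simp: domain_data_def wot_tendsto_def simp del: op_alg_simps(5,6)\<close>)
    then show ?thesis by (rule pure_data.pure_dilation_form)
  qed
  then obtain Fm where Fm: "\<And>m. dilation_form b H (?X m) (Fm m)" by metis
  have cpm: "cp_form fock H F.ops (Fm m)" for m using Fm[of m] by (simp add: dilation_form_def)
  have bdm: "\<forall>i. \<forall>C\<in>F.ops. \<forall>M. \<forall>h\<in>carrier H. \<forall>k\<in>carrier H. bounded_by fock C M \<longrightarrow>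
      cmod (Fm i C h k) \<le> M * hnorm H h * hnorm H k"
    using Fm by (simp add: dilation_form_def)
  obtain F G where G: "G \<le> sequentially" "G \<noteq> bot" and F: "cp_form fock H F.ops F"
    and lim0: "\<forall>C\<in>F.ops. \<forall>h\<in>carrier H. \<forall>k\<in>carrier H. ((\<lambda>i. Fm i C h k) \<longlongrightarrow> F C h k) G"
    and bd: "\<forall>C\<in>F.ops. \<forall>M. \<forall>h\<in>carrier H. \<forall>k\<in>carrier H. bounded_by fock C M \<longrightarrow>
      cmod (F C h k) \<le> M * hnorm H h * hnorm H k"
    using cp_form_cluster_cp[of fock H F.ops Fm, OF cpm bdm]
    by (elim exE conjE) (rule that, assumption+)
  note lim = lim0[rule_format]
  have unit: "F (\<lambda>f\<in>carrier fock. f) h k = cinner H h k" if "h \<in> carrier H" "k \<in> carrier H" for h k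
  proof (rule tendsto_unique[OF G(2) lim])
    show "((\<lambda>i. Fm i (\<lambda>f\<in>carrier fock. f) h k) \<longlongrightarrow> cinner H h k) G"
      using Fm that by (simp add: dilation_form_def)
  qed (use that in auto)
  have co: "F (compose (carrier fock) C (Bk b complex_space i)) h k = F C (adj H (T i) h) k"
    if C: "C \<in> F.ops" and h: "h \<in> carrier H" and k: "k \<in> carrier H" for C i h k
  proof (rule tendsto_unique[OF G(2) lim])
    have h': "adj H (T i) h \<in> carrier H" using Tops h by simp
    \<comment> \<open>Coinvariance holds for the scaled tuple, so the factor \<open>r m\<close>
      appears and tends to 1.\<close>
    have "Fm m (compose (carrier fock) C (Bk b complex_space i)) h k = of_real (r m) * Fm m C (adj H (T i) h) k" for m
    proof -
      have "adj H (?X m i) h = of_real (r m) \<odot>\<^bsub>H\<^esub> adj H (T i) h" using H.adj_smult[OF Tops, of "of_real (r m)" i] h by simp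
      then show ?thesis using Fm[of m] C h k cp_form.F_smult1[OF cpm C h' k] by (simp add: dilation_form_def del: op_alg_simps)
    qed
    moreover have "((\<lambda>m. of_real (r m) * Fm m C (adj H (T i) h) k) \<longlongrightarrow> of_real 1 * F C (adj H (T i) h) k) G"
      by (intro tendsto_mult tendsto_of_real tendsto_mono[OF G(1) rl] lim C h' k)
    ultimately show "((\<lambda>m. Fm m (compose (carrier fock) C (Bk b complex_space i)) h k) \<longlongrightarrow> F C (adj H (T i) h) k) G" by simp
    show "compose (carrier fock) C (Bk b complex_space i) \<in> F.ops" using W_props[of i] F.adj_in C by (metis F.op_compose_in)
  qed (use h k in auto)
  show ?thesis unfolding dilation_form_def using F bd unit co by blast
qed

lemma unital_cstar_ops:
  assumes "hilbert_space H" shows "unital_cstar_subalgebra H (bounded_ops H H)"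
proof -
  interpret hilbert_space H by fact
  show ?thesis unfolding unital_cstar_subalgebra_def norm_tendsto_def by auto
qed

lemma unital_cstar_Inter:
  assumes "\<And>\<A>. \<A> \<in> X \<Longrightarrow> unital_cstar_subalgebra H \<A>" "X \<noteq> {}"
  shows "unital_cstar_subalgebra H (\<Inter>X)"
proof -
  note u = assms(1)[unfolded unital_cstar_subalgebra_def]
  show ?thesis unfolding unital_cstar_subalgebra_def
  proof (intro conjI ballI allI impI InterI)
    show "\<Inter>X \<subseteq> bounded_ops H H" using u assms(2) by blast
  qed (use u in blast)+
qed

lemma (in admissible_series) unital_cstar_W: "unital_cstar_subalgebra fock (cstar_W b)"
proof -
  have "bounded_ops fock fock \<in> {\<A>. unital_cstar_subalgebra fock \<A> \<and> range (W b) \<subseteq> \<A>}"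
    using unital_cstar_ops[OF hilbert_fock] W_props by auto
  then show ?thesis unfolding cstar_W_def by (intro unital_cstar_Inter) auto
qed

text \<open>The induction principle for C*(W): a property that defines a unital C*-subalgebra and
  holds for the generators holds throughout.\<close>

lemma (in admissible_series) cstar_W_least:
  "\<lbrakk>unital_cstar_subalgebra fock \<A>; \<And>i. W b i \<in> \<A>\<rbrakk> \<Longrightarrow> cstar_W b \<subseteq> \<A>"
  unfolding cstar_W_def by blast

section \<open>Asymptotic commutation of the tail projections with C*(W)\<close>

locale dilation = admissible_series b + cp_form "fock :: ('n list \<Rightarrow> complex) hilbert" H "bounded_ops fock fock" F
  for b :: "'n::finite list \<Rightarrow> real" and H :: "'h hilbert" and F +
  fixes T :: "'n \<Rightarrow> 'h \<Rightarrow> 'h"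
  assumes T: "T i \<in> bounded_ops H H"
    and F_bd: "\<lbrakk>C \<in> bounded_ops fock fock; bounded_by fock C M; h \<in> carrier H; k \<in> carrier H\<rbrakk> \<Longrightarrow>
      cmod (F C h k) \<le> M * hnorm H h * hnorm H k"
    and F_one: "\<lbrakk>h \<in> carrier H; k \<in> carrier H\<rbrakk> \<Longrightarrow> F (\<lambda>f\<in>carrier fock. f) h k = cinner H h k"
    and F_co: "\<lbrakk>C \<in> bounded_ops fock fock; h \<in> carrier H; k \<in> carrier H\<rbrakk> \<Longrightarrow>
      F (compose (carrier fock) C (Bk b complex_space i)) h k = F C (adj H (T i) h) k"
begin

abbreviation mult_F (infixl "\<cdot>" 70) where "A \<cdot> C \<equiv> compose (carrier (fock :: ('n list \<Rightarrow> complex) hilbert)) A C"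
abbreviation "\<B> \<equiv> bounded_ops (fock :: ('n list \<Rightarrow> complex) hilbert) (fock :: ('n list \<Rightarrow> complex) hilbert)"
abbreviation "Bki i \<equiv> Bk b complex_space i"
abbreviation Qc :: "nat \<Rightarrow> ('n list \<Rightarrow> complex) \<Rightarrow> ('n list \<Rightarrow> complex)" where "Qc N \<equiv> dg {\<alpha>. N < length \<alpha>}"
abbreviation R :: "nat \<Rightarrow> ('n list \<Rightarrow> complex) \<Rightarrow> ('n list \<Rightarrow> complex)" where "R N \<equiv> dg {\<alpha>. length \<alpha> = N}"
abbreviation P0 :: "('n list \<Rightarrow> complex) \<Rightarrow> ('n list \<Rightarrow> complex)" where "P0 \<equiv> dg {[]}"

lemma Bki_in [simp]: "Bki i \<in> \<B>" using W_props[of i] B.adj_in by metis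
lemma W_in [simp]: "W b i \<in> \<B>" by (rule W_props)
lemma dg_in [simp]: "dg Z \<in> \<B>" by (rule dg_props)
lemma dg_adj [simp]: "adj fock (dg Z) = dg Z" by (rule dg_props)

text \<open>The layer projections \<open>R N\<close> are orthogonal, so their contributions to the
  positive form at A \<otimes> h are summable and tend to 0; Cauchy-Schwarz adds the factor
  Y.\<close>

lemma R_tendsto:
  assumes Y: "Y \<in> \<B>" and A: "A \<in> \<B>" and h: "h \<in> carrier H" and k: "k \<in> carrier H"
  shows "(\<lambda>N. F (Y \<cdot> (R N \<cdot> A)) h k) \<longlonglongrightarrow> 0"
proof -
  define s where "s N = Re (F (adj fock A \<cdot> (R N \<cdot> A)) h h)" for N
  obtain M where M: "bounded_by fock A M" using B.bounded_ops_bound[OF A] .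
  have sA: "adj fock (R N \<cdot> A) \<cdot> (R N \<cdot> A) = adj fock A \<cdot> (R N \<cdot> A)" for N
  proof -
    have "adj fock (R N \<cdot> A) \<cdot> (R N \<cdot> A) = adj fock A \<cdot> (R N \<cdot> R N \<cdot> A)" using A by (simp add: adj_mult mult_assoc)
    then show ?thesis by (simp add: dg_compose)
  qed
  have s0: "0 \<le> s N" for N using F_nonneg[of "R N \<cdot> A" h] A h by (simp only: s_def sA[symmetric]) simp
  \<comment> \<open>The layers below N add up to one projection, hence the partial sums obey a bound
    free of N.\<close>
  have part: "(\<Sum>n<N. s n) = Re (F (adj fock A \<cdot> (dg {\<alpha>. length \<alpha> < N} \<cdot> A)) h h)" for N
  proof (induction N)
    case 0
    have "F (0 \<odot>\<^bsub>op_alg fock\<^esub> (adj fock A \<cdot> (dg {} \<cdot> A))) h h = 0"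
      using F_smult[of "adj fock A \<cdot> (dg {} \<cdot> A)" h h 0] A h by simp
    moreover have "0 \<odot>\<^bsub>op_alg fock\<^esub> (adj fock A \<cdot> (dg {} \<cdot> A)) = adj fock A \<cdot> (dg {} \<cdot> A)"
    proof (rule B.op_eqI)
      fix f :: "'n list \<Rightarrow> complex" assume f: "f \<in> carrier fock"
      have "dg {} (A f) = \<zero>\<^bsub>fock\<^esub>" using bounded_ops_in[OF A f] by (simp add: dg_apply fock_simps)
      then show "(0 \<odot>\<^bsub>op_alg fock\<^esub> (adj fock A \<cdot> (dg {} \<cdot> A))) f = (adj fock A \<cdot> (dg {} \<cdot> A)) f"
        using f A B.op_zero[of "adj fock A"] by (simp add: compose_eq B.smult_zero_eq)
    qed (use A in auto)
    ultimately show ?case by simp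
  next
    case (Suc N)
    have "{\<alpha> :: 'n list. length \<alpha> < Suc N} = {\<alpha>. length \<alpha> < N} \<union> {\<alpha>. length \<alpha> = N}" by auto
    then have "dg {\<alpha>. length \<alpha> < Suc N} = dg {\<alpha> :: 'n list. length \<alpha> < N} \<oplus>\<^bsub>op_alg fock\<^esub> R N"
      by (simp only: dg_Un[symmetric] disjoint_iff) (subst dg_Un; auto)
    then have "adj fock A \<cdot> (dg {\<alpha>. length \<alpha> < Suc N} \<cdot> A) =
       (adj fock A \<cdot> (dg {\<alpha>. length \<alpha> < N} \<cdot> A)) \<oplus>\<^bsub>op_alg fock\<^esub> (adj fock A \<cdot> (R N \<cdot> A))"
      using A by (simp only: add_mult dg_in A_adj A_mult)
    then have "F (adj fock A \<cdot> (dg {\<alpha>. length \<alpha> < Suc N} \<cdot> A)) h h =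
       F (adj fock A \<cdot> (dg {\<alpha>. length \<alpha> < N} \<cdot> A)) h h + F (adj fock A \<cdot> (R N \<cdot> A)) h h"
      using A h by (simp only: F_add A_adj A_mult dg_in)
    then show ?case using Suc by (simp add: s_def)
  qed
  have "summable s"
  proof (rule summableI_nonneg_bounded[OF s0])
    fix N
    have "bounded_by fock (adj fock A \<cdot> (dg {\<alpha>. length \<alpha> < N} \<cdot> A)) (M * (1 * M))"
      using A M by (intro B.bounded_by_compose B.bounded_by_adj dg_props) auto
    then show "(\<Sum>n<N. s n) \<le> M * (1 * M) * hnorm H h * hnorm H h"
      unfolding part using F_bd[of "adj fock A \<cdot> (dg {\<alpha>. length \<alpha> < N} \<cdot> A)" _ h h] A h
        complex_Re_le_cmod[of "F (adj fock A \<cdot> (dg {\<alpha>. length \<alpha> < N} \<cdot> A)) h h"] by fastforce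
  qed
  then have "s \<longlonglongrightarrow> 0" by (rule summable_LIMSEQ_zero)
  then have lim: "(\<lambda>N. sqrt (s N) * sqrt (Re (F (Y \<cdot> adj fock Y) k k))) \<longlonglongrightarrow> 0"
    using tendsto_mult_left_zero[of "\<lambda>N. sqrt (s N)"] tendsto_real_sqrt[of s 0 sequentially] by simp
  show ?thesis
  proof (rule Lim_null_comparison[OF always_eventually lim], rule allI)
    fix N
    show "norm (F (Y \<cdot> (R N \<cdot> A)) h k) \<le> sqrt (s N) * sqrt (Re (F (Y \<cdot> adj fock Y) k k))"
      using F_CS[of "R N \<cdot> A" "adj fock Y" h k] Y A h k by (simp add: s_def sA)
  qed
qed

text \<open>The commutator is tested between arbitrary Y and A: this makes the class closed under
  products, where a neighbouring factor joins Y or A, and under adjoints, which exchange the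
  two.\<close>

definition comm :: "(('n list \<Rightarrow> complex) \<Rightarrow> ('n list \<Rightarrow> complex)) \<Rightarrow> bool" where
  "comm C \<longleftrightarrow> C \<in> \<B> \<and> (\<forall>Y\<in>\<B>. \<forall>A\<in>\<B>. \<forall>h\<in>carrier H. \<forall>k\<in>carrier H.
     (\<lambda>N. F (Y \<cdot> (Qc N \<cdot> (C \<cdot> A))) h k - F (Y \<cdot> (C \<cdot> (Qc N \<cdot> A))) h k) \<longlonglongrightarrow> 0)"

lemma commD: "\<lbrakk>comm C; Y \<in> \<B>; A \<in> \<B>; h \<in> carrier H; k \<in> carrier H\<rbrakk> \<Longrightarrow>
  (\<lambda>N. F (Y \<cdot> (Qc N \<cdot> (C \<cdot> A))) h k - F (Y \<cdot> (C \<cdot> (Qc N \<cdot> A))) h k) \<longlonglongrightarrow> 0"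
  unfolding comm_def by blast

lemma commI: "\<lbrakk>C \<in> \<B>; \<And>Y A h k. \<lbrakk>Y \<in> \<B>; A \<in> \<B>; h \<in> carrier H; k \<in> carrier H\<rbrakk> \<Longrightarrow>
  (\<lambda>N. F (Y \<cdot> (Qc N \<cdot> (C \<cdot> A))) h k - F (Y \<cdot> (C \<cdot> (Qc N \<cdot> A))) h k) \<longlonglongrightarrow> 0\<rbrakk> \<Longrightarrow> comm C"
  unfolding comm_def by blast

text \<open>The backward shift lowers length by one, so a word longer than N lands on length at
  least N: the tail projection is met again, plus one layer handled by
  \<open>R_tendsto\<close>.\<close>

lemma comm_Bki: "comm (Bki i)"
proof (rule commI)
  fix Y A h k assume a: "Y \<in> \<B>" "A \<in> \<B>" "h \<in> carrier H" "k \<in> carrier H"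
  have eq: "Bki i \<cdot> Qc N = (Qc N \<cdot> Bki i) \<oplus>\<^bsub>op_alg fock\<^esub> (R N \<cdot> Bki i)" for N
  proof (rule B.op_eqI)
    fix f :: "'n list \<Rightarrow> complex" assume f: "f \<in> carrier fock"
    have "Bki i f \<in> carrier fock" by (rule bounded_ops_in[OF Bki_in f])
    then show "(Bki i \<cdot> Qc N) f = ((Qc N \<cdot> Bki i) \<oplus>\<^bsub>op_alg fock\<^esub> (R N \<cdot> Bki i)) f"
      using f dg_fock[OF f, of "{\<alpha>. N < length \<alpha>}"]
      by (auto simp: compose_eq dg_apply Bk_def fock_def[symmetric] bshift_def fock_simps fun_eq_iff)
  qed auto
  have "F (Y \<cdot> (Bki i \<cdot> (Qc N \<cdot> A))) h k = F (Y \<cdot> (Qc N \<cdot> (Bki i \<cdot> A))) h k + F (Y \<cdot> (R N \<cdot> (Bki i \<cdot> A))) h k" for N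
  proof -
    have "Y \<cdot> (Bki i \<cdot> (Qc N \<cdot> A)) = Y \<cdot> (Bki i \<cdot> Qc N \<cdot> A)" using a by (simp add: mult_assoc)
    also have "\<dots> = (Y \<cdot> (Qc N \<cdot> Bki i \<cdot> A)) \<oplus>\<^bsub>op_alg fock\<^esub> (Y \<cdot> (R N \<cdot> Bki i \<cdot> A))"
      unfolding eq using a by (simp only: add_mult A_mult dg_in Bki_in)
    finally show ?thesis using a by (simp add: F_add mult_assoc del: op_alg_simps)
  qed
  then show "(\<lambda>N. F (Y \<cdot> (Qc N \<cdot> (Bki i \<cdot> A))) h k - F (Y \<cdot> (Bki i \<cdot> (Qc N \<cdot> A))) h k) \<longlonglongrightarrow> 0"
    using tendsto_minus[OF R_tendsto[of Y "Bki i \<cdot> A" h k]] a by simp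
qed simp

lemma comm_adj:
  assumes C: "comm C" shows "comm (adj fock C)"
proof (rule commI)
  have CB: "C \<in> \<B>" using C by (simp add: comm_def)
  then show "adj fock C \<in> \<B>" by simp
  fix Y A h k assume a: "Y \<in> \<B>" "A \<in> \<B>" "h \<in> carrier H" "k \<in> carrier H"
  have 1: "F (Y \<cdot> (Qc N \<cdot> (adj fock C \<cdot> A))) h k = cnj (F (adj fock A \<cdot> (C \<cdot> (Qc N \<cdot> adj fock Y))) k h)" for N
    using F_herm[of "adj fock A \<cdot> (C \<cdot> (Qc N \<cdot> adj fock Y))" k h] a CB by (simp add: adj_mult mult_assoc)
  have 2: "F (Y \<cdot> (adj fock C \<cdot> (Qc N \<cdot> A))) h k = cnj (F (adj fock A \<cdot> (Qc N \<cdot> (C \<cdot> adj fock Y))) k h)" for N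
    using F_herm[of "adj fock A \<cdot> (Qc N \<cdot> (C \<cdot> adj fock Y))" k h] a CB by (simp add: adj_mult mult_assoc)
  show "(\<lambda>N. F (Y \<cdot> (Qc N \<cdot> (adj fock C \<cdot> A))) h k - F (Y \<cdot> (adj fock C \<cdot> (Qc N \<cdot> A))) h k) \<longlonglongrightarrow> 0"
    unfolding 1 2
    using tendsto_cnj[OF tendsto_minus[OF commD[OF C, of "adj fock A" "adj fock Y" k h]]] a by simp
qed

lemma comm_W: "comm (W b i)"
  using comm_adj[OF comm_Bki[of i]] W_props(2)[of i] B.adj_adj[OF W_in[of i]] by simp

text \<open>Sums, scalars and products follow from the sandwiched form of \<open>comm\<close>. Norm
  limits work because \<open>F_bd\<close> controls the error uniformly in N, so a fixed member of
  the sequence can be chosen before N grows.\<close>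

lemma comm_cstar: "unital_cstar_subalgebra fock {C. comm C}"
  unfolding unital_cstar_subalgebra_def
proof (intro conjI allI impI ballI)
  show "{C. comm C} \<subseteq> \<B>" by (auto simp: comm_def)
  have "comm (\<lambda>f\<in>carrier fock. f)" by (rule commI) auto
  then show "\<one>\<^bsub>op_alg fock\<^esub> \<in> {C. comm C}" by simp
  fix A C assume "A \<in> {C. comm C}" "C \<in> {C. comm C}"
  then have AC: "comm A" "comm C" and b: "A \<in> \<B>" "C \<in> \<B>" by (auto simp: comm_def)
  have "comm (A \<oplus>\<^bsub>op_alg fock\<^esub> C)"
  proof (rule commI)
    fix Y D h k assume d: "Y \<in> \<B>" "D \<in> \<B>" "h \<in> carrier H" "k \<in> carrier H"
    have 1: "F (Y \<cdot> (Qc N \<cdot> ((A \<oplus>\<^bsub>op_alg fock\<^esub> C) \<cdot> D))) h k = F (Y \<cdot> (Qc N \<cdot> (A \<cdot> D))) h k + F (Y \<cdot> (Qc N \<cdot> (C \<cdot> D))) h k" for N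
      using d b by (simp only: add_mult F_add A_mult dg_in)
    have 2: "F (Y \<cdot> ((A \<oplus>\<^bsub>op_alg fock\<^esub> C) \<cdot> (Qc N \<cdot> D))) h k = F (Y \<cdot> (A \<cdot> (Qc N \<cdot> D))) h k + F (Y \<cdot> (C \<cdot> (Qc N \<cdot> D))) h k" for N
      using d b by (simp only: add_mult F_add A_mult dg_in)
    show "(\<lambda>N. F (Y \<cdot> (Qc N \<cdot> ((A \<oplus>\<^bsub>op_alg fock\<^esub> C) \<cdot> D))) h k - F (Y \<cdot> ((A \<oplus>\<^bsub>op_alg fock\<^esub> C) \<cdot> (Qc N \<cdot> D))) h k) \<longlonglongrightarrow> 0"
      unfolding 1 2 using tendsto_add[OF commD[OF AC(1) d] commD[OF AC(2) d]] by (simp add: algebra_simps)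
  qed (use b in simp)
  then show "A \<oplus>\<^bsub>op_alg fock\<^esub> C \<in> {C. comm C}" by blast
  have "comm (A \<cdot> C)"
  proof (rule commI)
    fix Y D h k assume d: "Y \<in> \<B>" "D \<in> \<B>" "h \<in> carrier H" "k \<in> carrier H"
    show "(\<lambda>N. F (Y \<cdot> (Qc N \<cdot> ((A \<cdot> C) \<cdot> D))) h k - F (Y \<cdot> ((A \<cdot> C) \<cdot> (Qc N \<cdot> D))) h k) \<longlonglongrightarrow> 0"
      using tendsto_add[OF commD[OF AC(1) d(1) _ d(3,4), of "C \<cdot> D"] commD[OF AC(2) _ d(2-4), of "Y \<cdot> A"]] d b
      by (simp add: mult_assoc)
  qed (use b in simp)
  then show "A \<otimes>\<^bsub>op_alg fock\<^esub> C \<in> {C. comm C}" by simp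
next
  fix c A assume "A \<in> {C. comm C}"
  then have A: "comm A" and b: "A \<in> \<B>" by (auto simp: comm_def)
  have "comm (c \<odot>\<^bsub>op_alg fock\<^esub> A)"
  proof (rule commI)
    fix Y D h k assume d: "Y \<in> \<B>" "D \<in> \<B>" "h \<in> carrier H" "k \<in> carrier H"
    have 1: "F (Y \<cdot> (Qc N \<cdot> ((c \<odot>\<^bsub>op_alg fock\<^esub> A) \<cdot> D))) h k = c * F (Y \<cdot> (Qc N \<cdot> (A \<cdot> D))) h k" for N
      using d b by (simp only: smult_mult F_smult A_mult dg_in)
    have 2: "F (Y \<cdot> ((c \<odot>\<^bsub>op_alg fock\<^esub> A) \<cdot> (Qc N \<cdot> D))) h k = c * F (Y \<cdot> (A \<cdot> (Qc N \<cdot> D))) h k" for N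
      using d b by (simp only: smult_mult F_smult A_mult dg_in)
    show "(\<lambda>N. F (Y \<cdot> (Qc N \<cdot> ((c \<odot>\<^bsub>op_alg fock\<^esub> A) \<cdot> D))) h k - F (Y \<cdot> ((c \<odot>\<^bsub>op_alg fock\<^esub> A) \<cdot> (Qc N \<cdot> D))) h k) \<longlonglongrightarrow> 0"
      unfolding 1 2 using tendsto_mult_left[OF commD[OF A d], of c] by (simp add: right_diff_distrib)
  qed (use b in simp)
  then show "c \<odot>\<^bsub>op_alg fock\<^esub> A \<in> {C. comm C}" by blast
next
  fix A assume "A \<in> {C. comm C}"
  then show "adj fock A \<in> {C. comm C}" using comm_adj by blast
next
  fix Sq L assume "(\<forall>j. Sq j \<in> {C. comm C}) \<and> norm_tendsto fock Sq L"
  then have Sq: "comm (Sq j)" and L: "L \<in> \<B>" and lim: "(\<lambda>j. op_norm fock (Sq j \<ominus>\<^bsub>op_alg fock\<^esub> L)) \<longlonglongrightarrow> 0" for j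
    by (auto simp: norm_tendsto_def)
  have SB: "Sq j \<in> \<B>" for j using Sq[of j] by (simp add: comm_def)
  define D where "D j = Sq j \<ominus>\<^bsub>op_alg fock\<^esub> L" for j
  have DB: "D j \<in> \<B>" for j unfolding D_def by (rule B.op_minus_in[OF SB L])
  have SD: "Sq j = L \<oplus>\<^bsub>op_alg fock\<^esub> D j" for j
  proof (rule B.op_eqI[OF SB])
    fix f :: "'n list \<Rightarrow> complex" assume f: "f \<in> carrier fock"
    have "Sq j f = L f \<oplus>\<^bsub>fock\<^esub> (Sq j f \<ominus>\<^bsub>fock\<^esub> L f)"
      by (rule B.vec_eqI) (use bounded_ops_in[OF SB f] bounded_ops_in[OF L f] in \<open>auto simp: B.ip_simps\<close>)
    then show "Sq j f = (L \<oplus>\<^bsub>op_alg fock\<^esub> D j) f" using f by (simp add: D_def B.op_minus_apply[OF SB L f] del: op_alg_simps(1-4))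
  qed (use L DB[of j] in simp)
  have "comm L"
  proof (rule commI[OF L])
    fix Y A h k assume d: "Y \<in> \<B>" "A \<in> \<B>" "h \<in> carrier H" "k \<in> carrier H"
    let ?g = "\<lambda>C N. F (Y \<cdot> (Qc N \<cdot> (C \<cdot> A))) h k - F (Y \<cdot> (C \<cdot> (Qc N \<cdot> A))) h k"
    obtain MY MA where M: "bounded_by fock Y MY" "bounded_by fock A MA" using B.bounded_ops_bound d(1,2) by metis
    \<comment> \<open>The factor 2 accounts for the two terms of the commutator.\<close>
    define c where "c = 2 * (MY * MA * hnorm H h * hnorm H k)"
    have c: "c \<ge> 0" using M d by (simp add: c_def bounded_by_def)
    have gS: "?g (Sq j) N = ?g L N + ?g (D j) N" for j N
    proof -
      have 1: "F (Y \<cdot> (Qc N \<cdot> (Sq j \<cdot> A))) h k = F (Y \<cdot> (Qc N \<cdot> (L \<cdot> A))) h k + F (Y \<cdot> (Qc N \<cdot> (D j \<cdot> A))) h k"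
        unfolding SD using d L DB by (simp only: add_mult F_add A_mult dg_in)
      have 2: "F (Y \<cdot> (Sq j \<cdot> (Qc N \<cdot> A))) h k = F (Y \<cdot> (L \<cdot> (Qc N \<cdot> A))) h k + F (Y \<cdot> (D j \<cdot> (Qc N \<cdot> A))) h k"
        unfolding SD using d L DB by (simp only: add_mult F_add A_mult dg_in)
      show ?thesis unfolding 1 2 by simp
    qed
    have gD: "cmod (?g (D j) N) \<le> c * op_norm fock (D j)" for j N
    proof -
      let ?n = "op_norm fock (D j)"
      have n: "bounded_by fock (D j) ?n" by (rule B.op_norm_bound[OF DB])
      have "bounded_by fock (Y \<cdot> (Qc N \<cdot> (D j \<cdot> A))) (MY * (1 * (?n * MA)))"
        "bounded_by fock (Y \<cdot> (D j \<cdot> (Qc N \<cdot> A))) (MY * (?n * (1 * MA)))"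
        using d M n DB by (intro B.bounded_by_compose dg_props; simp)+
      from F_bd[OF _ this(1) d(3,4)] F_bd[OF _ this(2) d(3,4)]
      have "cmod (F (Y \<cdot> (Qc N \<cdot> (D j \<cdot> A))) h k) \<le> c / 2 * ?n" "cmod (F (Y \<cdot> (D j \<cdot> (Qc N \<cdot> A))) h k) \<le> c / 2 * ?n"
        using d DB by (simp_all add: c_def mult_ac)
      then show ?thesis using norm_triangle_ineq4[of "F (Y \<cdot> (Qc N \<cdot> (D j \<cdot> A))) h k" "F (Y \<cdot> (D j \<cdot> (Qc N \<cdot> A))) h k"] by simp
    qed
    show "?g L \<longlonglongrightarrow> 0"
    proof (rule LIMSEQ_I)
      fix e :: real assume e: "e > 0"
      have "(\<lambda>j. c * op_norm fock (D j)) \<longlonglongrightarrow> 0" using tendsto_mult_right_zero[OF lim, of c] by (simp add: D_def)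
      then have "\<forall>\<^sub>F j in sequentially. c * op_norm fock (D j) < e / 2" by (rule order_tendstoD) (use e in simp)
      then obtain j where j: "c * op_norm fock (D j) < e / 2" by (auto simp: eventually_sequentially)
      obtain N0 where N0: "\<And>N. N \<ge> N0 \<Longrightarrow> norm (?g (Sq j) N - 0) < e / 2"
        using LIMSEQ_D[OF commD[OF Sq[of j] d], of "e / 2"] e by auto
      have "norm (?g L N - 0) < e" if "N \<ge> N0" for N
      proof -
        have "?g L N = ?g (Sq j) N - ?g (D j) N" by (simp only: gS) simp
        then have "norm (?g L N) \<le> norm (?g (Sq j) N) + norm (?g (D j) N)" by (metis norm_triangle_ineq4)
        then show ?thesis using N0[OF that] gD[of N j] j by simp
      qed
      then show "\<exists>no. \<forall>n\<ge>no. norm (?g L n - 0) < e" by blast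
    qed
  qed
  then show "L \<in> {C. comm C}" by blast
qed

lemma cstar_comm: "C \<in> cstar_W b \<Longrightarrow> comm C"
  using cstar_W_least[OF comm_cstar] comm_W by blast

end

section \<open>Approximable vectors form a closed subspace\<close>

context spanned_by
begin

lemma approximableD:
  assumes "approximable x" "e > 0"
  obtains n \<eta> where "\<And>i. \<eta> i \<in> carrier H" "\<And>i. i \<ge> n \<Longrightarrow> \<eta> i = \<zero>\<^bsub>H\<^esub>" "hnorm K (x \<ominus>\<^bsub>K\<^esub> fsum K u \<eta> n) < e"
  using assms unfolding approximable_def by metis

lemma approximableI:
  assumes "\<And>e. e > 0 \<Longrightarrow> \<exists>n \<eta>. (\<forall>i. \<eta> i \<in> carrier H) \<and> (\<forall>i\<ge>n. \<eta> i = \<zero>\<^bsub>H\<^esub>) \<and> hnorm K (x \<ominus>\<^bsub>K\<^esub> fsum K u \<eta> n) < e"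
  shows "approximable x"
  using assms unfolding approximable_def by simp

lemma approximable_fsum:
  assumes "\<And>i. \<eta> i \<in> carrier H" "\<And>i. i \<ge> n \<Longrightarrow> \<eta> i = \<zero>\<^bsub>H\<^esub>"
  shows "approximable (fsum K u \<eta> n)"
proof (rule approximableI)
  fix e :: real assume "e > 0"
  have "hnorm K (fsum K u \<eta> n \<ominus>\<^bsub>K\<^esub> fsum K u \<eta> n) = 0"
    using fsum_in[of \<eta> n, OF assms(1)] by (simp add: hnorm_def K.ip_simps)
  then show "\<exists>n' \<eta>'. (\<forall>i. \<eta>' i \<in> carrier H) \<and> (\<forall>i\<ge>n'. \<eta>' i = \<zero>\<^bsub>H\<^esub>) \<and> hnorm K (fsum K u \<eta> n \<ominus>\<^bsub>K\<^esub> fsum K u \<eta>' n') < e"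
    using assms \<open>e > 0\<close> by (intro exI[of _ n] exI[of _ \<eta>]) auto
qed

lemma approximable_u:
  assumes "h \<in> carrier H" shows "approximable (u n h)"
proof -
  let ?\<eta> = "\<lambda>i. if i = n then h else \<zero>\<^bsub>H\<^esub>"
  have "fsum K u ?\<eta> m = \<zero>\<^bsub>K\<^esub>" if "m \<le> n" for m using that by (induction m) (simp_all add: u_zero)
  then have "fsum K u ?\<eta> (Suc n) = u n h" using assms by (simp add: u_in)
  then show ?thesis using approximable_fsum[of ?\<eta> "Suc n"] assms by simp
qed

lemma approximable_closed:
  assumes x: "x \<in> carrier K" and ap: "\<And>e. e > 0 \<Longrightarrow> \<exists>y. y \<in> carrier K \<and> approximable y \<and> hnorm K (x \<ominus>\<^bsub>K\<^esub> y) < e"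
  shows "approximable x"
proof (rule approximableI)
  fix e :: real assume "e > 0"
  then obtain y where y: "y \<in> carrier K" "approximable y" "hnorm K (x \<ominus>\<^bsub>K\<^esub> y) < e / 2" using ap[of "e / 2"] by auto
  obtain n \<eta> where n: "\<And>i. \<eta> i \<in> carrier H" "\<And>i. i \<ge> n \<Longrightarrow> \<eta> i = \<zero>\<^bsub>H\<^esub>" "hnorm K (y \<ominus>\<^bsub>K\<^esub> fsum K u \<eta> n) < e / 2"
    by (rule approximableD[OF y(2) half_gt_zero[OF \<open>e > 0\<close>]]) metis
  have "hnorm K (x \<ominus>\<^bsub>K\<^esub> fsum K u \<eta> n) < e"
    using K.hnorm_diff_triangle[OF x y(1) fsum_in[of \<eta> n, OF n(1)]] y(3) n(3) by linarith
  then show "\<exists>n \<eta>. (\<forall>i. \<eta> i \<in> carrier H) \<and> (\<forall>i\<ge>n. \<eta> i = \<zero>\<^bsub>H\<^esub>) \<and> hnorm K (x \<ominus>\<^bsub>K\<^esub> fsum K u \<eta> n) < e"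
    using n by (intro exI[of _ n] exI[of _ \<eta>]) auto
qed

lemma approximable_add:
  assumes x: "x \<in> carrier K" "approximable x" and y: "y \<in> carrier K" "approximable y"
  shows "approximable (x \<oplus>\<^bsub>K\<^esub> y)"
proof (rule approximable_closed)
  fix e :: real assume "e > 0"
  obtain n \<eta> where n: "\<And>i. \<eta> i \<in> carrier H" "\<And>i. i \<ge> n \<Longrightarrow> \<eta> i = \<zero>\<^bsub>H\<^esub>" "hnorm K (x \<ominus>\<^bsub>K\<^esub> fsum K u \<eta> n) < e / 2"
    by (rule approximableD[OF x(2) half_gt_zero[OF \<open>e > 0\<close>]]) metis
  obtain n' \<eta>' where n': "\<And>i. \<eta>' i \<in> carrier H" "\<And>i. i \<ge> n' \<Longrightarrow> \<eta>' i = \<zero>\<^bsub>H\<^esub>" "hnorm K (y \<ominus>\<^bsub>K\<^esub> fsum K u \<eta>' n') < e / 2"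
    by (rule approximableD[OF y(2) half_gt_zero[OF \<open>e > 0\<close>]]) metis
  \<comment> \<open>The zero tails let both sums be extended to a common length and added
    termwise.\<close>
  let ?m = "max n n'" and ?\<zeta> = "\<lambda>i. \<eta> i \<oplus>\<^bsub>H\<^esub> \<eta>' i"
  have eq: "fsum K u ?\<zeta> ?m = fsum K u \<eta> n \<oplus>\<^bsub>K\<^esub> fsum K u \<eta>' n'"
    using fsum_add[of \<eta> \<eta>' ?m] fsum_extend[of \<eta> n ?m] fsum_extend[of \<eta>' n' ?m] n n' by simp
  have f: "fsum K u \<eta> n \<in> carrier K" "fsum K u \<eta>' n' \<in> carrier K" using n(1) n'(1) by (simp_all add: fsum_in)
  have "(x \<oplus>\<^bsub>K\<^esub> y) \<ominus>\<^bsub>K\<^esub> fsum K u ?\<zeta> ?m = (x \<ominus>\<^bsub>K\<^esub> fsum K u \<eta> n) \<oplus>\<^bsub>K\<^esub> (y \<ominus>\<^bsub>K\<^esub> fsum K u \<eta>' n')"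
    unfolding eq by (rule K.vec_eqI) (use x y f in \<open>auto simp: K.ip_simps\<close>)
  then have "hnorm K ((x \<oplus>\<^bsub>K\<^esub> y) \<ominus>\<^bsub>K\<^esub> fsum K u ?\<zeta> ?m) < e"
    using K.hnorm_triangle[of "x \<ominus>\<^bsub>K\<^esub> fsum K u \<eta> n" "y \<ominus>\<^bsub>K\<^esub> fsum K u \<eta>' n'"] x y f n(3) n'(3) by simp
  moreover have "approximable (fsum K u ?\<zeta> ?m)" by (rule approximable_fsum) (use n n' in auto)
  moreover have "fsum K u ?\<zeta> ?m \<in> carrier K" by (rule fsum_in) (use n n' in auto)
  ultimately show "\<exists>z. z \<in> carrier K \<and> approximable z \<and> hnorm K ((x \<oplus>\<^bsub>K\<^esub> y) \<ominus>\<^bsub>K\<^esub> z) < e" by blast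
qed (use x y in simp)

lemma approximable_smult:
  assumes x: "x \<in> carrier K" "approximable x" shows "approximable (c \<odot>\<^bsub>K\<^esub> x)"
proof (rule approximable_closed)
  fix e :: real assume "e > 0"
  then have e': "e / (cmod c + 1) > 0" by (simp add: add_nonneg_pos)
  obtain n \<eta> where n: "\<And>i. \<eta> i \<in> carrier H" "\<And>i. i \<ge> n \<Longrightarrow> \<eta> i = \<zero>\<^bsub>H\<^esub>" "hnorm K (x \<ominus>\<^bsub>K\<^esub> fsum K u \<eta> n) < e / (cmod c + 1)"
    by (rule approximableD[OF x(2) e']) metis
  let ?\<zeta> = "\<lambda>i. c \<odot>\<^bsub>H\<^esub> \<eta> i"
  have f: "fsum K u \<eta> n \<in> carrier K" using n(1) by (rule fsum_in)
  have "c \<odot>\<^bsub>K\<^esub> x \<ominus>\<^bsub>K\<^esub> fsum K u ?\<zeta> n = c \<odot>\<^bsub>K\<^esub> (x \<ominus>\<^bsub>K\<^esub> fsum K u \<eta> n)"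
    unfolding fsum_smult[of \<eta> c n, OF n(1)] by (rule K.vec_eqI) (use x f in \<open>auto simp: K.ip_simps right_diff_distrib\<close>)
  then have "hnorm K (c \<odot>\<^bsub>K\<^esub> x \<ominus>\<^bsub>K\<^esub> fsum K u ?\<zeta> n) = cmod c * hnorm K (x \<ominus>\<^bsub>K\<^esub> fsum K u \<eta> n)"
    using x f by (simp add: K.hnorm_smult)
  also have "\<dots> \<le> (cmod c + 1) * hnorm K (x \<ominus>\<^bsub>K\<^esub> fsum K u \<eta> n)" using x f by (intro mult_right_mono) auto
  also have "\<dots> < e" using n(3) by (simp add: pos_less_divide_eq add_nonneg_pos mult.commute[of "cmod c + 1"])
  finally have "hnorm K (c \<odot>\<^bsub>K\<^esub> x \<ominus>\<^bsub>K\<^esub> fsum K u ?\<zeta> n) < e" .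
  moreover have "approximable (fsum K u ?\<zeta> n)"
    by (rule approximable_fsum) (use n H.smult_r_null[of c] in auto)
  moreover have "fsum K u ?\<zeta> n \<in> carrier K" by (rule fsum_in) (use n in auto)
  ultimately show "\<exists>z. z \<in> carrier K \<and> approximable z \<and> hnorm K (c \<odot>\<^bsub>K\<^esub> x \<ominus>\<^bsub>K\<^esub> z) < e" by blast
qed (use x in simp)

lemma approximable_zero: "approximable \<zero>\<^bsub>K\<^esub>"
  using approximable_smult[OF u_in approximable_u, of "\<zero>\<^bsub>H\<^esub>" 0 0] by (simp add: u_zero)

text \<open>Reduces invariance under a bounded operator to its action on the spanning
  vectors.\<close>

lemma approximable_op:
  assumes Y: "Y \<in> bounded_ops K K" and g: "\<And>n h. h \<in> carrier H \<Longrightarrow> approximable (Y (u n h))"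
    and x: "x \<in> carrier K" "approximable x"
  shows "approximable (Y x)"
proof (rule approximable_closed)
  fix e :: real assume "e > 0"
  obtain M where M: "bounded_by K Y M" using K.bounded_ops_bound[OF Y] .
  have M0: "M \<ge> 0" using M by (simp add: bounded_by_def)
  then have e': "e / (M + 1) > 0" using \<open>e > 0\<close> by simp
  obtain n \<eta> where n: "\<And>i. \<eta> i \<in> carrier H" "hnorm K (x \<ominus>\<^bsub>K\<^esub> fsum K u \<eta> n) < e / (M + 1)"
    by (rule approximableD[OF x(2) e']) metis
  have f: "fsum K u \<eta> m \<in> carrier K" for m using n(1) by (rule fsum_in)
  have "approximable (Y (fsum K u \<eta> m))" for m
  proof (induction m)
    case 0 show ?case by (simp add: K.op_zero[OF Y] approximable_zero)
  next
    case (Suc m)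
    show ?case using f n(1) Suc g[OF n(1)]
      by (simp add: bounded_ops_add[OF Y] u_in approximable_add bounded_ops_in[OF Y])
  qed
  moreover have "hnorm K (Y x \<ominus>\<^bsub>K\<^esub> Y (fsum K u \<eta> n)) < e"
  proof -
    have "hnorm K (Y x \<ominus>\<^bsub>K\<^esub> Y (fsum K u \<eta> n)) = hnorm K (Y (x \<ominus>\<^bsub>K\<^esub> fsum K u \<eta> n))"
      by (simp add: K.op_diff[OF Y x(1) f])
    also have "\<dots> \<le> M * hnorm K (x \<ominus>\<^bsub>K\<^esub> fsum K u \<eta> n)" using M x(1) f by (simp add: bounded_by_def)
    also have "\<dots> \<le> (M + 1) * hnorm K (x \<ominus>\<^bsub>K\<^esub> fsum K u \<eta> n)" using x(1) f by (intro mult_right_mono) auto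
    also have "\<dots> < e" using n(2) M0 by (simp add: pos_less_divide_eq mult.commute[of "M + 1"])
    finally show ?thesis .
  qed
  ultimately show "\<exists>y. y \<in> carrier K \<and> approximable y \<and> hnorm K (Y x \<ominus>\<^bsub>K\<^esub> y) < e"
    using bounded_ops_in[OF Y f] by blast
qed (use bounded_ops_in[OF Y x(1)] in simp)

end

text \<open>Word sums are polynomials in the tuple and its adjoints, so a *-representation carries
  the defect sums of W to those of \<pi>(W).\<close>

lemma rep_word_sum:
  fixes X :: "'n::finite \<Rightarrow> 'a \<Rightarrow> 'a"
  assumes H: "hilbert_space H" and K: "hilbert_space K" and alg: "star_alg H \<A>" and \<pi>: "star_representation H \<A> K \<pi>"
    and X: "\<And>i. X i \<in> \<A>" and A: "A \<in> \<A>"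
  shows "word_sum H c X A N \<in> \<A>" "\<pi> (word_sum H c X A N) = word_sum K c (\<lambda>i. \<pi> (X i)) (\<pi> A) N"
proof -
  interpret H: hilbert_space H by fact
  interpret K: hilbert_space K by fact
  interpret OH: abelian_monoid "op_alg H" using H.op_group by (rule abelian_group.axioms)
  interpret OK: abelian_monoid "op_alg K" using K.op_group by (rule abelian_group.axioms)
  have Aops: "C \<in> bounded_ops H H" if "C \<in> \<A>" for C using alg that unfolding star_alg_def by blast
  have cl: "\<one>\<^bsub>op_alg H\<^esub> \<in> \<A>" "\<And>C D. \<lbrakk>C \<in> \<A>; D \<in> \<A>\<rbrakk> \<Longrightarrow> C \<oplus>\<^bsub>op_alg H\<^esub> D \<in> \<A>" "\<And>C D. \<lbrakk>C \<in> \<A>; D \<in> \<A>\<rbrakk> \<Longrightarrow> C \<otimes>\<^bsub>op_alg H\<^esub> D \<in> \<A>"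
    "\<And>a C. C \<in> \<A> \<Longrightarrow> a \<odot>\<^bsub>op_alg H\<^esub> C \<in> \<A>" "\<And>C. C \<in> \<A> \<Longrightarrow> adj H C \<in> \<A>"
    using alg unfolding star_alg_def by blast+
  have r: "\<And>C. C \<in> \<A> \<Longrightarrow> \<pi> C \<in> bounded_ops K K" "\<pi> \<one>\<^bsub>op_alg H\<^esub> = \<one>\<^bsub>op_alg K\<^esub>"
    "\<And>C D. \<lbrakk>C \<in> \<A>; D \<in> \<A>\<rbrakk> \<Longrightarrow> \<pi> (C \<oplus>\<^bsub>op_alg H\<^esub> D) = \<pi> C \<oplus>\<^bsub>op_alg K\<^esub> \<pi> D"
    "\<And>C D. \<lbrakk>C \<in> \<A>; D \<in> \<A>\<rbrakk> \<Longrightarrow> \<pi> (C \<otimes>\<^bsub>op_alg H\<^esub> D) = \<pi> C \<otimes>\<^bsub>op_alg K\<^esub> \<pi> D"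
    "\<And>a C. C \<in> \<A> \<Longrightarrow> \<pi> (a \<odot>\<^bsub>op_alg H\<^esub> C) = a \<odot>\<^bsub>op_alg K\<^esub> \<pi> C" "\<And>C. C \<in> \<A> \<Longrightarrow> \<pi> (adj H C) = adj K (\<pi> C)"
    using \<pi> unfolding star_representation_def by blast+
  have zero: "\<zero>\<^bsub>op_alg H\<^esub> = 0 \<odot>\<^bsub>op_alg H\<^esub> \<one>\<^bsub>op_alg H\<^esub>" "\<zero>\<^bsub>op_alg K\<^esub> = 0 \<odot>\<^bsub>op_alg K\<^esub> \<one>\<^bsub>op_alg K\<^esub>"
    by (auto simp: H.smult_zero_eq K.smult_zero_eq intro!: restrict_ext)
  have fs: "(\<Oplus>\<^bsub>op_alg H\<^esub>\<alpha>\<in>Z. f \<alpha>) \<in> \<A> \<and> \<pi> (\<Oplus>\<^bsub>op_alg H\<^esub>\<alpha>\<in>Z. f \<alpha>) = (\<Oplus>\<^bsub>op_alg K\<^esub>\<alpha>\<in>Z. \<pi> (f \<alpha>))"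
    if "finite Z" "\<And>\<alpha>. \<alpha> \<in> Z \<Longrightarrow> f \<alpha> \<in> \<A>" for Z :: "'n list set" and f
    using that
  proof (induction Z)
    case empty
    have "\<zero>\<^bsub>op_alg H\<^esub> \<in> \<A>" unfolding zero by (intro cl)
    moreover have "\<pi> \<zero>\<^bsub>op_alg H\<^esub> = \<zero>\<^bsub>op_alg K\<^esub>" unfolding zero by (simp only: r cl)
    ultimately show ?case by (simp del: op_alg_simps)
  next
    case (insert \<alpha> Z)
    have "(\<Oplus>\<^bsub>op_alg H\<^esub>\<alpha>\<in>insert \<alpha> Z. f \<alpha>) = f \<alpha> \<oplus>\<^bsub>op_alg H\<^esub> (\<Oplus>\<^bsub>op_alg H\<^esub>\<alpha>\<in>Z. f \<alpha>)"
      by (rule OH.finsum_insert) (use insert Aops in auto)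
    moreover have "(\<Oplus>\<^bsub>op_alg K\<^esub>\<alpha>\<in>insert \<alpha> Z. \<pi> (f \<alpha>)) = \<pi> (f \<alpha>) \<oplus>\<^bsub>op_alg K\<^esub> (\<Oplus>\<^bsub>op_alg K\<^esub>\<alpha>\<in>Z. \<pi> (f \<alpha>))"
      by (rule OK.finsum_insert) (use insert r in auto)
    moreover have "(\<Oplus>\<^bsub>op_alg H\<^esub>\<alpha>\<in>Z. f \<alpha>) \<in> \<A>" "\<pi> (\<Oplus>\<^bsub>op_alg H\<^esub>\<alpha>\<in>Z. f \<alpha>) = (\<Oplus>\<^bsub>op_alg K\<^esub>\<alpha>\<in>Z. \<pi> (f \<alpha>))" "f \<alpha> \<in> \<A>"
      using insert by auto
    ultimately show ?case using cl(2)[of "f \<alpha>"] r(3)[of "f \<alpha>"] by (simp del: op_alg_simps)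
  qed
  have wo: "word_op H X \<alpha> \<in> \<A> \<and> \<pi> (word_op H X \<alpha>) = word_op K (\<lambda>i. \<pi> (X i)) \<alpha>" for \<alpha>
  proof (induction \<alpha>)
    case Nil
    show ?case using cl(1) r(2) unfolding word_op_simps op_alg_simps by blast
  next
    case (Cons i \<alpha>)
    show ?case using cl(3)[OF X conjunct1[OF Cons], of i] r(4)[OF X conjunct1[OF Cons], of i] Cons
      unfolding word_op_simps op_alg_simps by simp
  qed
  have term_in: "of_real (c \<alpha>) \<odot>\<^bsub>op_alg H\<^esub> (word_op H X \<alpha> \<otimes>\<^bsub>op_alg H\<^esub> A \<otimes>\<^bsub>op_alg H\<^esub> adj H (word_op H X \<alpha>)) \<in> \<A>" for \<alpha>
    using wo[of \<alpha>] A by (intro cl) auto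
  have term_eq: "\<pi> (of_real (c \<alpha>) \<odot>\<^bsub>op_alg H\<^esub> (word_op H X \<alpha> \<otimes>\<^bsub>op_alg H\<^esub> A \<otimes>\<^bsub>op_alg H\<^esub> adj H (word_op H X \<alpha>))) =
     of_real (c \<alpha>) \<odot>\<^bsub>op_alg K\<^esub> (word_op K (\<lambda>i. \<pi> (X i)) \<alpha> \<otimes>\<^bsub>op_alg K\<^esub> \<pi> A \<otimes>\<^bsub>op_alg K\<^esub> adj K (word_op K (\<lambda>i. \<pi> (X i)) \<alpha>))" for \<alpha>
    using wo[of \<alpha>] A by (simp only: r cl)
  show "word_sum H c X A N \<in> \<A>" "\<pi> (word_sum H c X A N) = word_sum K c (\<lambda>i. \<pi> (X i)) (\<pi> A) N"
    unfolding word_sum_def using fs[OF finite_words(1)[of N] term_in] by (simp_all only: term_eq)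
qed

context admissible_series
begin

text \<open>The norm limit must agree with the weak one, and on matrix coefficients the eigenvalues
  tend to the indicator of the empty word. Membership follows since C*(W) is norm closed.\<close>

lemma dg_Nil_limit:
  assumes "norm_tendsto fock (Delta_sum b fock (W b)) L"
  shows "L = dg {[]}" "dg {[]} \<in> cstar_W b"
proof -
  interpret F: hilbert_space "fock :: ('n list \<Rightarrow> complex) hilbert" by (rule hilbert_fock)
  have L: "L \<in> bounded_ops fock fock" and lim: "(\<lambda>N. op_norm fock (Delta_sum b fock (W b) N \<ominus>\<^bsub>op_alg fock\<^esub> L)) \<longlonglongrightarrow> 0"
    using assms by (simp_all add: norm_tendsto_def)
  show "L = dg {[]}"
  proof (rule F.op_eqI_ip[OF L dg_props(1)])
    fix f g :: "'n list \<Rightarrow> complex" assume f: "f \<in> carrier fock" and g: "g \<in> carrier fock"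
    have "(\<lambda>N. cinner fock (Delta_sum b fock (W b) N f) g - cinner fock (L f) g) \<longlonglongrightarrow> 0"
    proof (rule Lim_null_comparison)
      show "(\<lambda>N. op_norm fock (Delta_sum b fock (W b) N \<ominus>\<^bsub>op_alg fock\<^esub> L) * (hnorm fock f * hnorm fock g)) \<longlonglongrightarrow> 0"
        using tendsto_mult_left_zero[OF lim] .
      show "\<forall>\<^sub>F N in sequentially. norm (cinner fock (Delta_sum b fock (W b) N f) g - cinner fock (L f) g) \<le>
         op_norm fock (Delta_sum b fock (W b) N \<ominus>\<^bsub>op_alg fock\<^esub> L) * (hnorm fock f * hnorm fock g)"
      proof (intro always_eventually allI)
        fix N
        let ?D = "Delta_sum b fock (W b) N \<ominus>\<^bsub>op_alg fock\<^esub> L"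
        have D: "?D \<in> bounded_ops fock fock" by (rule F.op_minus_in[OF Delta_sum_fock_in L])
        have "cinner fock (Delta_sum b fock (W b) N f) g - cinner fock (L f) g = cinner fock (?D f) g"
          using bounded_ops_in[OF Delta_sum_fock_in f] bounded_ops_in[OF L f] g
          by (simp add: F.op_minus_apply[OF Delta_sum_fock_in L f] F.ip_diff_left)
        then have "norm (cinner fock (Delta_sum b fock (W b) N f) g - cinner fock (L f) g) \<le> hnorm fock (?D f) * hnorm fock g"
          using F.Cauchy_Schwarz[OF bounded_ops_in[OF D f] g] by simp
        also have "\<dots> \<le> op_norm fock ?D * hnorm fock f * hnorm fock g"
          using F.op_norm_bound[OF D] f g by (intro mult_right_mono) (auto simp: bounded_by_def)
        finally show "norm (cinner fock (Delta_sum b fock (W b) N f) g - cinner fock (L f) g) \<le>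
          op_norm fock ?D * (hnorm fock f * hnorm fock g)" by (simp add: mult.assoc)
      qed
    qed
    then have 1: "(\<lambda>N. cinner fock (Delta_sum b fock (W b) N f) g) \<longlonglongrightarrow> cinner fock (L f) g" by (rule LIM_zero_cancel)
    have "(\<lambda>N. \<Sum>\<^sub>\<infinity>\<gamma>. of_real (dN N \<gamma>) * cinner complex_space (f \<gamma>) (g \<gamma>)) \<longlonglongrightarrow> cinner complex_space (f []) (g [])"
      by (rule Delta_diagonal_limit[OF hilbert_complex_space]) (use f g in \<open>simp_all add: fock_def\<close>)
    then have 2: "(\<lambda>N. cinner fock (Delta_sum b fock (W b) N f) g) \<longlonglongrightarrow> f [] * cnj (g [])"
      by (simp add: Delta_sum_fock_ip[OF f g])
    have "cinner fock (dg {[]} f) g = (\<Sum>\<^sub>\<infinity>\<gamma>\<in>{[]}. f \<gamma> * cnj (g \<gamma>))"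
      unfolding dg_apply[OF f] fock_simps by (rule infsum_cong_neutral) auto
    then show "cinner fock (L f) g = cinner fock (dg {[]} f) g" using LIMSEQ_unique[OF 1 2] by simp
  qed
  have "Delta_sum b fock (W b) N \<in> cstar_W b" for N
    unfolding Delta_sum_def op_alg_simps
  \<comment> \<open>The identity representation serves only to obtain membership of the word
    sums.\<close>
  proof (rule rep_word_sum(1)[OF hilbert_fock hilbert_fock unital_cstar_star_alg[OF unital_cstar_W], where \<pi>="\<lambda>C. C"])
    show "star_representation fock (cstar_W b) fock (\<lambda>C. C)"
      using unital_cstar_W by (auto simp: star_representation_def unital_cstar_subalgebra_def)
    show "(\<lambda>x\<in>carrier fock. x) \<in> cstar_W b" using unital_cstar_W by (simp add: unital_cstar_subalgebra_def)
  qed (rule W_in_cstar)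
  then have "L \<in> cstar_W b" using unital_cstar_W assms unfolding unital_cstar_subalgebra_def by blast
  then show "dg {[]} \<in> cstar_W b" using \<open>L = dg {[]}\<close> by simp
qed

end

section \<open>The diagonal of the dilation form and its Cuntz part\<close>

context dilation
begin

lemma cstar_B: "C \<in> cstar_W b \<Longrightarrow> C \<in> \<B>"
  using unital_cstar_W unfolding unital_cstar_subalgebra_def by blast

text \<open>The mirror image of coinvariance, obtained by Hermitian symmetry.\<close>

lemma F_left: "\<lbrakk>C \<in> \<B>; h \<in> carrier H; k \<in> carrier H\<rbrakk> \<Longrightarrow> F (W b i \<cdot> C) h k = F C h (adj H (T i) k)"
  using F_herm[of "adj fock C \<cdot> Bki i" k h] F_co[of "adj fock C" k h i] F_herm[of C h "adj H (T i) k"] T[of i]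
  by (simp add: adj_mult W_props(2)[symmetric])

lemma F_dg_empty: "\<lbrakk>Y \<in> \<B>; A \<in> \<B>; h \<in> carrier H; k \<in> carrier H\<rbrakk> \<Longrightarrow> F (Y \<cdot> (dg {} \<cdot> A)) h k = 0"
proof -
  assume a: "Y \<in> \<B>" "A \<in> \<B>" "h \<in> carrier H" "k \<in> carrier H"
  have "dg {} = 0 \<odot>\<^bsub>op_alg fock\<^esub> (dg {} :: ('n list \<Rightarrow> complex) \<Rightarrow> _)"
    by (auto simp: dg_def fock_simps intro!: restrict_ext)
  then have "F (Y \<cdot> (dg {} \<cdot> A)) h k = F (Y \<cdot> ((0 \<odot>\<^bsub>op_alg fock\<^esub> dg {}) \<cdot> A)) h k" by simp
  also have "\<dots> = 0 * F (Y \<cdot> (dg {} \<cdot> A)) h k" using a by (simp only: smult_mult F_smult A_mult dg_in)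
  finally show ?thesis by simp
qed

text \<open>Conjugating a rank-one coordinate projection by \<open>W b i\<close> prepends a letter;
  the squared weight is the scalar that appears.\<close>

lemma dg_shift: "W b i \<cdot> (dg {\<alpha>} \<cdot> Bki i) = of_real (b \<alpha> / b (i # \<alpha>)) \<odot>\<^bsub>op_alg fock\<^esub> dg {i # \<alpha>}"
proof (rule B.op_eqI_ip)
  show "of_real (b \<alpha> / b (i # \<alpha>)) \<odot>\<^bsub>op_alg fock\<^esub> dg {i # \<alpha>} \<in> \<B>" using A_smult[OF dg_in] by simp
  fix f g :: "'n list \<Rightarrow> complex" assume f: "f \<in> carrier fock" and g: "g \<in> carrier fock"
  have Bf: "Bki i f \<in> carrier fock" "Bki i g \<in> carrier fock" using bounded_ops_in[OF Bki_in] f g by blast+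
  have sgl: "cinner fock (dg {\<beta>} x) y = x \<beta> * cnj (y \<beta>)" if "x \<in> carrier fock" for x y and \<beta> :: "'n list"
  proof -
    have "cinner fock (dg {\<beta>} x) y = (\<Sum>\<^sub>\<infinity>\<gamma>\<in>{\<beta>}. x \<gamma> * cnj (y \<gamma>))"
      unfolding dg_apply[OF that] fock_simps by (rule infsum_cong_neutral) auto
    then show ?thesis by simp
  qed
  have "cinner fock ((W b i \<cdot> (dg {\<alpha>} \<cdot> Bki i)) f) g = cinner fock (dg {\<alpha>} (Bki i f)) (Bki i g)"
    using B.adj_ip[OF W_in bounded_ops_in[OF dg_in Bf(1)] g] f by (simp add: compose_eq W_props(2))
  also have "\<dots> = Bki i f \<alpha> * cnj (Bki i g \<alpha>)" by (rule sgl[OF Bf(1)])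
  also have "\<dots> = of_real (sqrt (b \<alpha> / b (i # \<alpha>)) * sqrt (b \<alpha> / b (i # \<alpha>))) * (f (i # \<alpha>) * cnj (g (i # \<alpha>)))"
    using f g unfolding of_real_mult by (simp add: Bk_def bshift_def fock_def)
  also have "\<dots> = of_real (b \<alpha> / b (i # \<alpha>)) * cinner fock (dg {i # \<alpha>} f) g" by (simp add: sgl[OF f])
  also have "\<dots> = cinner fock ((of_real (b \<alpha> / b (i # \<alpha>)) \<odot>\<^bsub>op_alg fock\<^esub> dg {i # \<alpha>}) f) g"
    using f g bounded_ops_in[OF dg_in f] by (simp add: B.cinner_smult_left)
  finally show "cinner fock ((W b i \<cdot> (dg {\<alpha>} \<cdot> Bki i)) f) g = cinner fock ((of_real (b \<alpha> / b (i # \<alpha>)) \<odot>\<^bsub>op_alg fock\<^esub> dg {i # \<alpha>}) f) g" .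
qed simp

text \<open>Induction on the word: \<open>dg_shift\<close> removes the first letter, and
  coinvariance on both sides converts it into adjoints of T acting on h and k. The weight quotients
  telescope to b(\<alpha>).\<close>

lemma F_dg: "\<lbrakk>h \<in> carrier H; k \<in> carrier H\<rbrakk> \<Longrightarrow> F (dg {\<alpha>}) h k = of_real (b \<alpha>) * F P0 (wadj H T \<alpha> h) (wadj H T \<alpha> k)"
proof (induction \<alpha> arbitrary: h k)
  case Nil then show ?case by simp
next
  case (Cons i \<alpha>)
  have T': "adj H (T i) h \<in> carrier H" "adj H (T i) k \<in> carrier H" using T Cons.prems by simp_all
  have "of_real (b \<alpha> / b (i # \<alpha>)) * F (dg {i # \<alpha>}) h k = F (W b i \<cdot> (dg {\<alpha>} \<cdot> Bki i)) h k"
    unfolding dg_shift using Cons.prems by (simp only: F_smult dg_in)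
  also have "\<dots> = F (dg {\<alpha>}) (adj H (T i) h) (adj H (T i) k)"
    using Cons.prems T' by (simp add: F_left F_co)
  also have "\<dots> = of_real (b \<alpha>) * F P0 (wadj H T (i # \<alpha>) h) (wadj H T (i # \<alpha>) k)"
    using Cons.IH[OF T'] by simp
  finally show ?case using b_neq[of \<alpha>] b_neq[of "i # \<alpha>"] by (simp add: field_simps)
qed

lemma F_dg_sum: "\<lbrakk>finite Z; h \<in> carrier H; k \<in> carrier H\<rbrakk> \<Longrightarrow> F (dg Z) h k = (\<Sum>\<alpha>\<in>Z. F (dg {\<alpha>}) h k)"
proof (induction Z rule: finite_induct)
  case empty
  have "(\<lambda>f\<in>carrier fock. f) \<cdot> (dg {} \<cdot> (\<lambda>f\<in>carrier fock. f)) = (dg {} :: ('n list \<Rightarrow> complex) \<Rightarrow> _)" by simp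
  then show ?case using F_dg_empty[of "\<lambda>f\<in>carrier fock. f" "\<lambda>f\<in>carrier fock. f" h k] empty by simp
next
  case (insert \<alpha> Z)
  have "dg (insert \<alpha> Z) = dg {\<alpha>} \<oplus>\<^bsub>op_alg fock\<^esub> dg Z" using dg_Un[of "{\<alpha>}" Z] insert.hyps by simp
  then show ?case using insert by (simp add: F_add del: op_alg_simps)
qed

text \<open>The identity is the projection onto words of length at most N plus \<open>Qc N\<close>;
  the first part is a finite sum of the coordinate projections evaluated by
  \<open>F_dg\<close>.\<close>

lemma F_words:
  assumes "h \<in> carrier H" "k \<in> carrier H"
  shows "(\<Sum>\<alpha> | length \<alpha> \<le> N. of_real (b \<alpha>) * F P0 (wadj H T \<alpha> h) (wadj H T \<alpha> k)) = cinner H h k - F (Qc N) h k"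
proof -
  have "dg {\<alpha> :: 'n list. length \<alpha> \<le> N} \<oplus>\<^bsub>op_alg fock\<^esub> Qc N = dg UNIV" by (subst dg_Un) (auto intro!: arg_cong[where f=dg])
  then have "F (dg {\<alpha>. length \<alpha> \<le> N}) h k + F (Qc N) h k = F (\<lambda>f\<in>carrier fock. f) h k"
    using F_add[of "dg {\<alpha>. length \<alpha> \<le> N}" "Qc N" h k] assms by (simp add: dg_UNIV del: op_alg_simps)
  then show ?thesis using F_dg_sum[OF finite_words(1) assms, of N] F_dg[OF assms] F_one[OF assms] by (simp add: algebra_simps)
qed

text \<open>Cutting off by \<open>Qc N\<close> keeps what lies at infinity. Linearity and bounds
  survive exactly; Hermitian symmetry and positivity hold up to commutators of \<open>Qc N\<close>
  with elements of C*(W), which vanish by \<open>cstar_comm\<close>.\<close>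

lemma cuntz_form_exists:
  "\<exists>FK G. G \<le> sequentially \<and> G \<noteq> bot \<and> cp_form fock H (cstar_W b) FK \<and>
    (\<forall>C\<in>cstar_W b. \<forall>h\<in>carrier H. \<forall>k\<in>carrier H. ((\<lambda>N. F (Qc N \<cdot> C) h k) \<longlongrightarrow> FK C h k) G) \<and>
    (\<forall>C\<in>cstar_W b. \<forall>M. \<forall>h\<in>carrier H. \<forall>k\<in>carrier H. bounded_by fock C M \<longrightarrow>
      cmod (FK C h k) \<le> M * hnorm H h * hnorm H k)"
proof (rule cp_form_cluster[of fock H "cstar_W b" sequentially "\<lambda>N C h k. F (Qc N \<cdot> C) h k"])
  show alg: "star_alg fock (cstar_W b)" by (rule unital_cstar_star_alg[OF unital_cstar_W])
  have cl: "A \<otimes>\<^bsub>op_alg fock\<^esub> C \<in> cstar_W b" "adj fock A \<in> cstar_W b" if "A \<in> cstar_W b" "C \<in> cstar_W b" for A C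
    using alg that unfolding star_alg_def by blast+
  show "F (Qc N \<cdot> (C \<oplus>\<^bsub>op_alg fock\<^esub> C')) h k = F (Qc N \<cdot> C) h k + F (Qc N \<cdot> C') h k"
    if "C \<in> cstar_W b" "C' \<in> cstar_W b" "h \<in> carrier H" "k \<in> carrier H" for N C C' h k
    using that by (simp only: add_mult F_add A_mult dg_in cstar_B)
  show "F (Qc N \<cdot> (c \<odot>\<^bsub>op_alg fock\<^esub> C)) h k = c * F (Qc N \<cdot> C) h k"
    if "C \<in> cstar_W b" "h \<in> carrier H" "k \<in> carrier H" for N c C h k
    using that by (simp only: smult_mult F_smult A_mult dg_in cstar_B)
  show "F (Qc N \<cdot> C) (h \<oplus>\<^bsub>H\<^esub> h') k = F (Qc N \<cdot> C) h k + F (Qc N \<cdot> C) h' k"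
    if "C \<in> cstar_W b" "h \<in> carrier H" "h' \<in> carrier H" "k \<in> carrier H" for N C h h' k
    using that by (simp only: F_add1 A_mult dg_in cstar_B)
  show "F (Qc N \<cdot> C) (c \<odot>\<^bsub>H\<^esub> h) k = c * F (Qc N \<cdot> C) h k"
    if "C \<in> cstar_W b" "h \<in> carrier H" "k \<in> carrier H" for N c C h k
    using that by (simp only: F_smult1 A_mult dg_in cstar_B)
  show "(\<lambda>N. F (Qc N \<cdot> adj fock C) k h - cnj (F (Qc N \<cdot> C) h k)) \<longlonglongrightarrow> 0"
    if C: "C \<in> cstar_W b" and h: "h \<in> carrier H" and k: "k \<in> carrier H" for C h k
  proof -
    have CB: "C \<in> \<B>" by (rule cstar_B[OF C])
    have "cnj (F (Qc N \<cdot> C) h k) = F (adj fock C \<cdot> Qc N) k h" for N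
      using F_herm[of "Qc N \<cdot> C" h k] CB h k by (simp add: adj_mult)
    moreover have "comm (adj fock C)" by (rule comm_adj[OF cstar_comm[OF C]])
    ultimately show ?thesis
      using commD[of "adj fock C" "\<lambda>f\<in>carrier fock. f" "\<lambda>f\<in>carrier fock. f" k h] CB h k by simp
  qed
  show "\<exists>\<psi>. (\<forall>i. 0 \<le> Re (\<psi> i)) \<and>
      (\<lambda>i. (\<Sum>p\<leftarrow>ps. \<Sum>q\<leftarrow>ps. F (Qc i \<cdot> (adj fock (fst q) \<otimes>\<^bsub>op_alg fock\<^esub> fst p)) (snd p) (snd q)) - \<psi> i) \<longlonglongrightarrow> 0"
    if ps: "set ps \<subseteq> cstar_W b \<times> carrier H" for ps
  proof (intro exI conjI allI)
    let ?p = "\<lambda>N. map (\<lambda>p. (Qc N \<cdot> fst p, snd p)) ps"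
    \<comment> \<open>The exactly positive comparison: inserting \<open>Qc N\<close> into each
      operator leaves one projection in the middle by idempotence, and moving it to the front costs
      a commutator.\<close>
    let ?\<psi> = "\<lambda>N. \<Sum>p\<leftarrow>?p N. \<Sum>q\<leftarrow>?p N. F (adj fock (fst q) \<otimes>\<^bsub>op_alg fock\<^esub> fst p) (snd p) (snd q)"
    have P: "fst p \<in> \<B>" "comm (fst p)" "snd p \<in> carrier H" if "p \<in> set ps" for p
      using ps that cstar_B cstar_comm by auto
    show "0 \<le> Re (?\<psi> N)" for N by (rule F_cp) (use P in auto)
    have eq: "?\<psi> N = (\<Sum>p\<leftarrow>ps. \<Sum>q\<leftarrow>ps. F (adj fock (fst q) \<cdot> (Qc N \<cdot> fst p)) (snd p) (snd q))" for N
    proof -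
      have "adj fock (Qc N \<cdot> fst q) \<cdot> (Qc N \<cdot> fst p) = adj fock (fst q) \<cdot> (Qc N \<cdot> fst p)" if "p \<in> set ps" "q \<in> set ps" for p q
      proof -
        have "adj fock (Qc N \<cdot> fst q) \<cdot> (Qc N \<cdot> fst p) = adj fock (fst q) \<cdot> (Qc N \<cdot> Qc N \<cdot> fst p)"
          using P[OF that(1)] P[OF that(2)] by (simp add: adj_mult mult_assoc)
        then show ?thesis by (simp add: dg_compose)
      qed
      then show ?thesis by (simp add: o_def cong: map_cong)
    qed
    have dsl: "(\<Sum>p\<leftarrow>xs. f p) - (\<Sum>p\<leftarrow>xs. g p) = (\<Sum>p\<leftarrow>xs. f p - g p)" for f g :: "_ \<Rightarrow> complex" and xs :: "((('n list \<Rightarrow> complex) \<Rightarrow> 'n list \<Rightarrow> complex) \<times> 'h) list"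
      by (induction xs) auto
    have "(\<lambda>N. \<Sum>p\<leftarrow>ps. \<Sum>q\<leftarrow>ps. F (Qc N \<cdot> (adj fock (fst q) \<cdot> fst p)) (snd p) (snd q) - F (adj fock (fst q) \<cdot> (Qc N \<cdot> fst p)) (snd p) (snd q))
       \<longlonglongrightarrow> (\<Sum>p\<leftarrow>ps. \<Sum>q\<leftarrow>ps. 0)"
    proof (intro tendsto_sum_list)
      fix p q assume pq: "p \<in> set ps" "q \<in> set ps"
      show "(\<lambda>N. F (Qc N \<cdot> (adj fock (fst q) \<cdot> fst p)) (snd p) (snd q) - F (adj fock (fst q) \<cdot> (Qc N \<cdot> fst p)) (snd p) (snd q)) \<longlonglongrightarrow> 0"
        using commD[OF comm_adj[OF P(2)[OF pq(2)]], of "\<lambda>f\<in>carrier fock. f" "fst p" "snd p" "snd q"] P[OF pq(1)] P[OF pq(2)] by simp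
    qed
    then show "(\<lambda>N. (\<Sum>p\<leftarrow>ps. \<Sum>q\<leftarrow>ps. F (Qc N \<cdot> (adj fock (fst q) \<otimes>\<^bsub>op_alg fock\<^esub> fst p)) (snd p) (snd q)) - ?\<psi> N) \<longlonglongrightarrow> 0"
      unfolding eq unfolding dsl op_alg_simps by simp
  qed
  show "cmod (F (Qc N \<cdot> C) h k) \<le> M * hnorm H h * hnorm H k"
    if "C \<in> cstar_W b" "bounded_by fock C M" "h \<in> carrier H" "k \<in> carrier H" for N C M h k
    using F_bd[of "Qc N \<cdot> C" "1 * M" h k] B.bounded_by_compose[OF cstar_B[OF that(1)] dg_props(2) that(2)] that cstar_B by simp
  show ?thesis
    if "G \<le> sequentially" "G \<noteq> bot" "cp_form fock H (cstar_W b) FK"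
      "\<And>C h k. \<lbrakk>C \<in> cstar_W b; h \<in> carrier H; k \<in> carrier H\<rbrakk> \<Longrightarrow> ((\<lambda>N. F (Qc N \<cdot> C) h k) \<longlongrightarrow> FK C h k) G"
      "\<And>C M h k. \<lbrakk>C \<in> cstar_W b; bounded_by fock C M; h \<in> carrier H; k \<in> carrier H\<rbrakk> \<Longrightarrow>
        cmod (FK C h k) \<le> M * hnorm H h * hnorm H k" for FK G
    by (rule exI[of _ FK], rule exI[of _ G], intro conjI ballI allI impI) (rule that; assumption)+
qed (use B.hilbert_space_axioms H.hilbert_space_axioms in auto)

end

section \<open>Countably generated representations\<close>

lemma (in realization) approximable_all:
  assumes "spanned_by K H u C" "\<And>s. spanned_by.approximable K H u (v s)" "x \<in> carrier K"
  shows "spanned_by.approximable K H u x"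
proof -
  interpret sp: spanned_by K H u C by fact
  have "sp.approximable (comb K v xs)" for xs
    by (induction xs) (simp_all add: sp.approximable_zero sp.approximable_add sp.approximable_smult assms(2))
  then show ?thesis
    using dense[OF assms(3)] comb_in by (intro sp.approximable_closed[OF assms(3)]) blast
qed

text \<open>Replaces the carrier type of the completion by sequences in H, using only that countably
  many linear maps from H span densely.\<close>

lemma (in realization) realizes_functions:
  fixes H :: "'h hilbert"
  assumes "spanned_by K H u C" "\<And>s. spanned_by.approximable K H u (v s)"
  shows "\<exists>(K' :: (nat \<Rightarrow> 'h) hilbert) v'. realizes K' v' k"
proof -
  obtain \<phi> :: "'a \<Rightarrow> nat \<Rightarrow> 'h" where "inj_on \<phi> (carrier K)"
    using spanned_by.approximable_embedding[OF assms(1) approximable_all[OF assms]] by blast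
  then show ?thesis using realizes_transport[OF real] by blast
qed

lemma (in cp_realization) rep_alg:
  "rep (\<lambda>x\<in>carrier B. x) = (\<lambda>x\<in>carrier K. x)"
  "\<lbrakk>C \<in> \<A>; D \<in> \<A>\<rbrakk> \<Longrightarrow> rep (C \<oplus>\<^bsub>op_alg B\<^esub> D) = rep C \<oplus>\<^bsub>op_alg K\<^esub> rep D"
  "\<lbrakk>C \<in> \<A>; D \<in> \<A>\<rbrakk> \<Longrightarrow> rep (C \<otimes>\<^bsub>op_alg B\<^esub> D) = rep C \<otimes>\<^bsub>op_alg K\<^esub> rep D"
  "C \<in> \<A> \<Longrightarrow> rep (a \<odot>\<^bsub>op_alg B\<^esub> C) = a \<odot>\<^bsub>op_alg K\<^esub> rep C"
  "C \<in> \<A> \<Longrightarrow> rep (adj B C) = adj K (rep C)"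
proof -
  have "rep \<one>\<^bsub>op_alg B\<^esub> = \<one>\<^bsub>op_alg K\<^esub>" using star_rep unfolding star_representation_def by blast
  then show "rep (\<lambda>x\<in>carrier B. x) = (\<lambda>x\<in>carrier K. x)" by (simp only: op_alg_simps)
qed (use star_rep in \<open>unfold star_representation_def, blast+\<close>)

locale cstar_realization = cp_realization B H \<A> F K v
  for B :: "'a hilbert" and H :: "'h hilbert" and \<A> and F and K :: "'k hilbert" and v +
  fixes X :: "'n::finite \<Rightarrow> 'a \<Rightarrow> 'a"
  assumes cstar: "unital_cstar_subalgebra B \<A>" and X_in [simp]: "X i \<in> \<A>"
    and least: "\<And>\<C>. \<lbrakk>unital_cstar_subalgebra B \<C>; \<And>i. X i \<in> \<C>\<rbrakk> \<Longrightarrow> \<A> \<subseteq> \<C>"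
    and F_le: "\<lbrakk>C \<in> \<A>; bounded_by B C M; h \<in> carrier H\<rbrakk> \<Longrightarrow> cmod (F C h h) \<le> M * hnorm H h * hnorm H h"
begin

text \<open>The flag of a letter selects the generator or its adjoint. There are countably many such
  words, so they can be enumerated by natural numbers.\<close>

primrec opw :: "('n \<times> bool) list \<Rightarrow> 'a \<Rightarrow> 'a" where
  "opw [] = (\<lambda>x\<in>carrier B. x)"
| "opw (p # w) = (if snd p then X (fst p) else adj B (X (fst p))) \<cdot> opw w"

lemma opw_in [simp]: "opw w \<in> \<A>"
proof (induction w)
  case Nil
  show ?case unfolding opw.simps by (rule A_one)
next
  case (Cons p w)
  then show ?case unfolding opw.simps by simp
qed

abbreviation "wd n \<equiv> from_nat_into (UNIV :: ('n \<times> bool) list set) n"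
abbreviation "u n h \<equiv> v (opw (wd n), h)"

lemma ex_wd: "\<exists>n. wd n = w"
proof -
  have "countable (lists (UNIV :: ('n \<times> bool) set))" by (intro countable_lists countable_finite) simp
  then have "countable (UNIV :: ('n \<times> bool) list set)" by simp
  then show ?thesis using from_nat_into_surj[of UNIV w] by simp
qed

lemma hnorm_v:
  assumes A: "A \<in> \<A>" "bounded_by B A M" and h: "h \<in> carrier H"
  shows "hnorm K (v (A, h)) \<le> M * hnorm H h"
proof -
  have "bounded_by B (adj B A \<cdot> A) (M * M)"
    using A by (intro B.bounded_by_compose B.bounded_by_adj A_ops)
  then have "cmod (F (adj B A \<cdot> A) h h) \<le> M * M * hnorm H h * hnorm H h"
    using A h by (intro F_le) auto
  then have "Re (F (adj B A \<cdot> A) h h) \<le> (M * hnorm H h)\<^sup>2"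
    using complex_Re_le_cmod[of "F (adj B A \<cdot> A) h h"] by (simp add: power2_eq_square mult.assoc mult.left_commute)
  then have "(hnorm K (v (A, h)))\<^sup>2 \<le> (M * hnorm H h)\<^sup>2"
    using A h by (simp add: R.K.hnorm_sq R.gram kF_eq)
  then show ?thesis by (rule power2_le_imp_le) (use A(2) h in \<open>simp add: bounded_by_def\<close>)
qed

sublocale sp: spanned_by K H "\<lambda>n h. u n h" "\<lambda>n. op_norm B (opw (wd n))"
proof unfold_locales
  show "0 \<le> op_norm B (opw (wd n))" for n
    using B.op_norm_bound[OF A_ops[OF opw_in[of "wd n"]]] by (simp add: bounded_by_def)
  show "hnorm K (u n h) \<le> op_norm B (opw (wd n)) * hnorm H h" if "h \<in> carrier H" for n h
    using hnorm_v[OF opw_in B.op_norm_bound[OF A_ops[OF opw_in]] that] .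
qed (simp_all add: v_add1 v_smult1)

text \<open>Contractivity of the representation on differences, which carries norm limits in the
  algebra over to K. The adjoint version is needed because the closure argument treats an operator
  and its adjoint together.\<close>

lemma rep_diff_bound:
  assumes C: "C \<in> \<A>" "D \<in> \<A>" and x: "x \<in> carrier K"
  shows "hnorm K (rep C x \<ominus>\<^bsub>K\<^esub> rep D x) \<le> op_norm B (C \<ominus>\<^bsub>op_alg B\<^esub> D) * hnorm K x"
    "hnorm K (rep (adj B C) x \<ominus>\<^bsub>K\<^esub> rep (adj B D) x) \<le> op_norm B (C \<ominus>\<^bsub>op_alg B\<^esub> D) * hnorm K x"
proof -
  let ?E = "C \<ominus>\<^bsub>op_alg B\<^esub> D"
  have mD: "(-1) \<odot>\<^bsub>op_alg B\<^esub> D \<in> \<A>" using C by simp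
  have E: "?E = C \<oplus>\<^bsub>op_alg B\<^esub> ((-1) \<odot>\<^bsub>op_alg B\<^esub> D)"
  proof (rule B.op_eqI)
    show "?E \<in> bounded_ops B B" by (rule B.op_minus_in[OF C[THEN A_ops]])
    show "C \<oplus>\<^bsub>op_alg B\<^esub> ((-1) \<odot>\<^bsub>op_alg B\<^esub> D) \<in> bounded_ops B B"
      unfolding op_alg_simps by (rule A_ops[OF A_add[OF C(1) mD[unfolded op_alg_simps]]])
  qed (simp add: B.op_minus_apply[OF C[THEN A_ops]] B.diff_smult bounded_ops_in[OF A_ops[OF C(1)]] bounded_ops_in[OF A_ops[OF C(2)]])
  have EA: "?E \<in> \<A>" unfolding E op_alg_simps by (rule A_add[OF C(1) mD[unfolded op_alg_simps]])
  have b: "bounded_by B ?E (op_norm B ?E)" by (rule B.op_norm_bound[OF A_ops[OF EA]])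
  have r: "rep C \<in> bounded_ops K K" "rep D \<in> bounded_ops K K" "rep ?E \<in> bounded_ops K K" by (simp_all only: rep_in C EA)
  have rE: "rep ?E = rep C \<oplus>\<^bsub>op_alg K\<^esub> ((-1) \<odot>\<^bsub>op_alg K\<^esub> rep D)"
    unfolding E by (simp only: rep_alg C mD)
  have pt: "rep ?E z = rep C z \<ominus>\<^bsub>K\<^esub> rep D z" if "z \<in> carrier K" for z
    unfolding rE using that r by (simp add: R.K.diff_smult bounded_ops_in)
  note pt[OF x]
  moreover have "hnorm K (rep ?E x) \<le> op_norm B ?E * hnorm K x"
    using rep_props(2)[OF EA b] x by (simp add: bounded_by_def)
  ultimately show "hnorm K (rep C x \<ominus>\<^bsub>K\<^esub> rep D x) \<le> op_norm B ?E * hnorm K x" by simp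
  have "adj K (rep ?E) x = adj K (rep C) x \<ominus>\<^bsub>K\<^esub> adj K (rep D) x"
    by (rule R.K.vec_eqI) (use x r in \<open>simp_all add: R.K.adj_app_in R.K.ip_diff_left R.K.ip_diff_right R.K.adj_ip2 pt bounded_ops_in\<close>)
  moreover have "hnorm K (adj K (rep ?E) x) \<le> op_norm B ?E * hnorm K x"
    using R.K.bounded_by_adj[OF r(3) rep_props(2)[OF EA b]] x by (simp add: bounded_by_def)
  moreover have "rep (adj B C) = adj K (rep C)" "rep (adj B D) = adj K (rep D)"
    by (simp_all only: rep_alg C)
  ultimately show "hnorm K (rep (adj B C) x \<ominus>\<^bsub>K\<^esub> rep (adj B D) x) \<le> op_norm B ?E * hnorm K x" by simp
qed

text \<open>The operators whose representatives and adjoints preserve the approximable vectors form a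
  unital C*-subalgebra that contains the generators.\<close>

lemma approximable_rep:
  assumes "C \<in> \<A>" "x \<in> carrier K" "sp.approximable x" shows "sp.approximable (rep C x)"
proof -
  define \<C> where "\<C> = {C \<in> \<A>. \<forall>x\<in>carrier K. sp.approximable x \<longrightarrow> sp.approximable (rep C x) \<and> sp.approximable (rep (adj B C) x)}"
  have A: "C \<in> \<A>" "\<lbrakk>x \<in> carrier K; sp.approximable x\<rbrakk> \<Longrightarrow> sp.approximable (rep C x)"
    "\<lbrakk>x \<in> carrier K; sp.approximable x\<rbrakk> \<Longrightarrow> sp.approximable (rep (adj B C) x)" if "C \<in> \<C>" for C x
    using that by (auto simp: \<C>_def)
  have I: "C \<in> \<C>" if "C \<in> \<A>" "\<And>x. \<lbrakk>x \<in> carrier K; sp.approximable x\<rbrakk> \<Longrightarrow> sp.approximable (rep C x)"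
    "\<And>x. \<lbrakk>x \<in> carrier K; sp.approximable x\<rbrakk> \<Longrightarrow> sp.approximable (rep (adj B C) x)" for C
    using that by (simp add: \<C>_def)
  note r = rep_alg
  have ad: "\<And>C D. \<lbrakk>C \<in> \<A>; D \<in> \<A>\<rbrakk> \<Longrightarrow> adj B (C \<oplus>\<^bsub>op_alg B\<^esub> D) = adj B C \<oplus>\<^bsub>op_alg B\<^esub> adj B D"
    "\<And>a C. C \<in> \<A> \<Longrightarrow> adj B (a \<odot>\<^bsub>op_alg B\<^esub> C) = cnj a \<odot>\<^bsub>op_alg B\<^esub> adj B C"
    by (simp_all add: B.adj_add B.adj_smult A_ops)
  note rin = bounded_ops_in[OF rep_in]
  have "unital_cstar_subalgebra B \<C>"
    unfolding unital_cstar_subalgebra_def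
  proof (intro conjI ballI allI impI)
    show "\<C> \<subseteq> bounded_ops B B" using A(1) A_ops by blast
    show "\<one>\<^bsub>op_alg B\<^esub> \<in> \<C>" by (rule I) (simp_all add: r(1))
    fix C D c assume C: "C \<in> \<C>" 
    show "adj B C \<in> \<C>" using A[OF C] by (intro I) simp_all
    show "c \<odot>\<^bsub>op_alg B\<^esub> C \<in> \<C>"
    proof (rule I)
      fix x assume x: "x \<in> carrier K" "sp.approximable x"
      show "sp.approximable (rep (c \<odot>\<^bsub>op_alg B\<^esub> C) x)"
        unfolding r(4)[OF A(1)[OF C]] using A[OF C] x rin by (simp add: sp.approximable_smult)
      show "sp.approximable (rep (adj B (c \<odot>\<^bsub>op_alg B\<^esub> C)) x)"
        unfolding ad(2)[OF A(1)[OF C]] r(4)[OF A_adj[OF A(1)[OF C]]] using A[OF C] x rin by (simp add: sp.approximable_smult)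
    qed (use A[OF C] in simp)
  next
    fix C D assume C: "C \<in> \<C>" and D: "D \<in> \<C>"
    show "C \<oplus>\<^bsub>op_alg B\<^esub> D \<in> \<C>"
    proof (rule I)
      fix x assume x: "x \<in> carrier K" "sp.approximable x"
      show "sp.approximable (rep (C \<oplus>\<^bsub>op_alg B\<^esub> D) x)"
        unfolding r(2)[OF A(1)[OF C] A(1)[OF D]] using A[OF C] A[OF D] x rin by (simp add: sp.approximable_add)
      show "sp.approximable (rep (adj B (C \<oplus>\<^bsub>op_alg B\<^esub> D)) x)"
        unfolding ad(1)[OF A(1)[OF C] A(1)[OF D]] r(2)[OF A_adj[OF A(1)[OF C]] A_adj[OF A(1)[OF D]]]
        using A[OF C] A[OF D] x rin by (simp add: sp.approximable_add)
    qed (use A[OF C] A[OF D] in simp)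
    show "C \<otimes>\<^bsub>op_alg B\<^esub> D \<in> \<C>"
    proof (rule I)
      fix x assume x: "x \<in> carrier K" "sp.approximable x"
      show "sp.approximable (rep (C \<otimes>\<^bsub>op_alg B\<^esub> D) x)"
        unfolding r(3)[OF A(1)[OF C] A(1)[OF D]] using A[OF C] A[OF D] x rin by (simp add: compose_eq)
      have "adj B (C \<otimes>\<^bsub>op_alg B\<^esub> D) = adj B D \<otimes>\<^bsub>op_alg B\<^esub> adj B C" using A(1)[OF C] A(1)[OF D] by (simp add: adj_mult)
      then show "sp.approximable (rep (adj B (C \<otimes>\<^bsub>op_alg B\<^esub> D)) x)"
        using r(3)[OF A_adj[OF A(1)[OF D]] A_adj[OF A(1)[OF C]]] A[OF C] A[OF D] x rin by (simp add: compose_eq)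
    qed (use A[OF C] A[OF D] in simp)
  next
    fix s L assume s: "(\<forall>k. s k \<in> \<C>) \<and> norm_tendsto B s L"
    then have sk: "s k \<in> \<C>" for k by blast
    have "L \<in> \<A>" using cstar s A(1) unfolding unital_cstar_subalgebra_def by blast
    have lim: "(\<lambda>k. op_norm B (s k \<ominus>\<^bsub>op_alg B\<^esub> L)) \<longlonglongrightarrow> 0" using s by (simp add: norm_tendsto_def)
    have small: "\<exists>k. op_norm B (s k \<ominus>\<^bsub>op_alg B\<^esub> L) * hnorm K x < e" if "e > 0" for e x
    proof -
      have "(\<lambda>k. op_norm B (s k \<ominus>\<^bsub>op_alg B\<^esub> L) * hnorm K x) \<longlonglongrightarrow> 0" using tendsto_mult_left_zero[OF lim] .
      then have "\<forall>\<^sub>F k in sequentially. op_norm B (s k \<ominus>\<^bsub>op_alg B\<^esub> L) * hnorm K x < e" using order_tendstoD(2) that by blast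
      then show ?thesis by (rule eventually_happens'[OF sequentially_bot])
    qed
    show "L \<in> \<C>"
    proof (rule I[OF \<open>L \<in> \<A>\<close>])
      fix x assume x: "x \<in> carrier K" "sp.approximable x"
      show "sp.approximable (rep L x)"
      proof (rule sp.approximable_closed)
        fix e :: real assume "e > 0"
        then obtain k where "op_norm B (s k \<ominus>\<^bsub>op_alg B\<^esub> L) * hnorm K x < e" using small by blast
        then have "hnorm K (rep L x \<ominus>\<^bsub>K\<^esub> rep (s k) x) < e"
          using rep_diff_bound(1)[OF A(1)[OF sk] \<open>L \<in> \<A>\<close> x(1), of k] R.K.hnorm_diff_commute[OF rin[OF \<open>L \<in> \<A>\<close> x(1)] rin[OF A(1)[OF sk] x(1)], of k] by simp
        then show "\<exists>y. y \<in> carrier K \<and> sp.approximable y \<and> hnorm K (rep L x \<ominus>\<^bsub>K\<^esub> y) < e"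
          using rin[OF A(1)[OF sk] x(1), of k] A(2)[OF sk x, of k] by blast
      qed (rule rin[OF \<open>L \<in> \<A>\<close> x(1)])
      note L' = A_adj[OF \<open>L \<in> \<A>\<close>] and s' = A_adj[OF A(1)[OF sk]]
      show "sp.approximable (rep (adj B L) x)"
      proof (rule sp.approximable_closed)
        fix e :: real assume "e > 0"
        then obtain k where "op_norm B (s k \<ominus>\<^bsub>op_alg B\<^esub> L) * hnorm K x < e" using small by blast
        then have "hnorm K (rep (adj B L) x \<ominus>\<^bsub>K\<^esub> rep (adj B (s k)) x) < e"
          using rep_diff_bound(2)[OF A(1)[OF sk] \<open>L \<in> \<A>\<close> x(1), of k] R.K.hnorm_diff_commute[OF rin[OF L' x(1)] rin[OF s' x(1)], of k] by simp
        then show "\<exists>y. y \<in> carrier K \<and> sp.approximable y \<and> hnorm K (rep (adj B L) x \<ominus>\<^bsub>K\<^esub> y) < e"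
          using rin[OF s' x(1), of k] A(3)[OF sk x, of k] by blast
      qed (rule rin[OF L' x(1)])
    qed
  qed
  moreover have "X i \<in> \<C>" for i
  proof (rule I)
    fix x assume x: "x \<in> carrier K" "sp.approximable x"
    have g: "sp.approximable (rep (if e then X i else adj B (X i)) (u n h))" if h: "h \<in> carrier H" for n h e
    proof -
      obtain m where m: "wd m = (i, e) # wd n" using ex_wd by blast
      have "rep (if e then X i else adj B (X i)) (u n h) = u m h"
        unfolding m using h by (simp add: rep_v)
      then show ?thesis using sp.approximable_u[OF h, of m] by simp
    qed
    show "sp.approximable (rep (X i) x)"
      by (rule sp.approximable_op[OF rep_in[OF X_in] g[of _ True, unfolded if_True] x])
    show "sp.approximable (rep (adj B (X i)) x)"
      by (rule sp.approximable_op[OF rep_in[OF A_adj[OF X_in]] g[of _ False, unfolded if_False] x])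
  qed simp
  ultimately have "\<A> \<subseteq> \<C>" by (rule least)
  then show ?thesis using A(2) assms by blast
qed

text \<open>A \<otimes> h is A applied to I \<otimes> h, and I \<otimes> h is the spanning vector of
  the empty word.\<close>

lemma approximable_v: "sp.approximable (v p)"
proof (cases "p \<in> S")
  case True
  then obtain C h where p: "p = (C, h)" "C \<in> \<A>" "h \<in> carrier H" by (metis SigmaE)
  obtain m where m: "wd m = []" using ex_wd by blast
  have "v p = rep C (u m h)" unfolding m using p by (simp add: rep_v)
  then show ?thesis using approximable_rep[OF p(2) _ sp.approximable_u[OF p(3), of m]] by simp
qed (simp add: v_zero sp.approximable_zero)

lemma realizes_kF: "\<exists>(K' :: (nat \<Rightarrow> 'h) hilbert) v'. realizes K' v' kF"
  by (rule R.realizes_functions[OF sp.spanned_by_axioms approximable_v])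

lemma separable: "separable_hilbert H \<Longrightarrow> separable_hilbert K"
  by (rule sp.approximable_separable[OF R.approximable_all[OF sp.spanned_by_axioms approximable_v]])

end

section \<open>The Cuntz part and the dilation\<close>

locale cuntz_form = dilation b H F T + FK: cp_form fock H "cstar_W b" FK
  for b :: "'n::finite list \<Rightarrow> real" and H :: "'h hilbert" and F T FK +
  fixes G :: "nat filter"
  assumes G_le: "G \<le> sequentially" and G_bot: "G \<noteq> bot"
    and FK_lim: "\<lbrakk>C \<in> cstar_W b; h \<in> carrier H; k \<in> carrier H\<rbrakk> \<Longrightarrow> ((\<lambda>N. F (Qc N \<cdot> C) h k) \<longlongrightarrow> FK C h k) G"
    and FK_bd: "\<lbrakk>C \<in> cstar_W b; bounded_by fock C M; h \<in> carrier H; k \<in> carrier H\<rbrakk> \<Longrightarrow>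
      cmod (FK C h k) \<le> M * hnorm H h * hnorm H k"
    and Delta_lim: "norm_tendsto fock (Delta_sum b fock (W b)) P0"
begin

lemma P0_cstar [simp]: "P0 \<in> cstar_W b" using dg_Nil_limit(2)[OF Delta_lim] .

lemma Bki_cstar [simp]: "Bki i \<in> cstar_W b"
  using FK.A_adj[OF W_in_cstar[of i]] W_props(2)[of i] by simp

lemma one_cstar: "(\<lambda>f\<in>carrier fock. f) \<in> cstar_W b" by (rule FK.A_one)

lemma FK_co: "\<lbrakk>C \<in> cstar_W b; h \<in> carrier H; k \<in> carrier H\<rbrakk> \<Longrightarrow> FK (C \<cdot> Bki i) h k = FK C (adj H (T i) h) k"
proof -
  assume C: "C \<in> cstar_W b" and h: "h \<in> carrier H" and k: "k \<in> carrier H"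
  have Th: "adj H (T i) h \<in> carrier H" using T h by simp
  have "F (Qc N \<cdot> (C \<cdot> Bki i)) h k = F (Qc N \<cdot> C) (adj H (T i) h) k" for N
    using F_co[of "Qc N \<cdot> C" h k i] cstar_B[OF C] h k by (simp add: mult_assoc)
  then have "((\<lambda>N. F (Qc N \<cdot> C) (adj H (T i) h) k) \<longlongrightarrow> FK (C \<cdot> Bki i) h k) G"
    using FK_lim[OF FK.A_mult[OF C Bki_cstar[of i]] h k] by simp
  then show ?thesis by (rule tendsto_unique[OF G_bot _ FK_lim[OF C Th k]])
qed

text \<open>Asymptotic commutation lets \<open>Qc N\<close> pass C and meet \<open>P0\<close>, where
  the product is 0 because the empty word is never longer than N.\<close>

lemma FK_P0: "\<lbrakk>C \<in> cstar_W b; D \<in> cstar_W b; h \<in> carrier H; k \<in> carrier H\<rbrakk> \<Longrightarrow> FK (C \<cdot> (P0 \<cdot> D)) h k = 0"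
proof -
  assume C: "C \<in> cstar_W b" and D: "D \<in> cstar_W b" and h: "h \<in> carrier H" and k: "k \<in> carrier H"
  have PD: "P0 \<cdot> D \<in> cstar_W b" using D by simp
  have "{\<alpha> :: 'n list. N < length \<alpha>} \<inter> {[]} = {}" for N by auto
  then have "Qc N \<cdot> (P0 \<cdot> D) = dg {} \<cdot> D" for N
    using cstar_B[OF D] by (simp add: mult_assoc[symmetric] dg_compose)
  then have "F (C \<cdot> (Qc N \<cdot> (P0 \<cdot> D))) h k = 0" for N
    using F_dg_empty[OF cstar_B[OF C] cstar_B[OF D] h k] by simp
  then have "(\<lambda>N. F (Qc N \<cdot> (C \<cdot> (P0 \<cdot> D))) h k) \<longlonglongrightarrow> 0"
    using commD[OF cstar_comm[OF C] B.op_one_in cstar_B[OF PD] h k] cstar_B[OF C] cstar_B[OF D] by simp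
  then show ?thesis
    using tendsto_unique[OF G_bot FK_lim[OF FK.A_mult[OF C PD] h k] tendsto_mono[OF G_le]] by blast
qed

text \<open>The defect space \<open>D\<close> is the separated completion of \<open>H\<close> under \<open>F P\<^sub>0\<close>; vectors outside the
  carrier are sent to zero to obtain a kernel on the whole type.\<close>

definition inH :: "'h \<Rightarrow> 'h" where "inH h = (if h \<in> carrier H then h else \<zero>\<^bsub>H\<^esub>)"

definition kD :: "'h \<Rightarrow> 'h \<Rightarrow> complex" where "kD h k = F P0 (inH h) (inH k)"

lemma inH_in [simp]: "inH h \<in> carrier H" by (simp add: inH_def)

lemma kD_eq: "\<lbrakk>h \<in> carrier H; k \<in> carrier H\<rbrakk> \<Longrightarrow> kD h k = F P0 h k"
  by (simp add: kD_def inH_def)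

text \<open>Since \<open>P0\<close> is a projection it equals adj(\<open>P0\<close>)
  \<open>P0\<close>, and the Gram sum is complete positivity with all operators equal to
  \<open>P0\<close>.\<close>

lemma psd_kD: "psd_kernel kD"
  unfolding psd_kernel_def
proof (intro conjI allI)
  show "kD t s = cnj (kD s t)" for s t
    unfolding kD_def using F_herm[of P0 "inH s" "inH t"] by simp
  fix xs :: "(complex \<times> 'h) list"
  let ?g = "\<lambda>x. (P0, fst x \<odot>\<^bsub>H\<^esub> inH (snd x))"
  have "kform kD xs xs = (\<Sum>p\<leftarrow>map ?g xs. \<Sum>q\<leftarrow>map ?g xs. F (adj fock (fst q) \<otimes>\<^bsub>op_alg fock\<^esub> fst p) (snd p) (snd q))"
    unfolding kform_def by (simp add: o_def kD_def dg_compose F_smult1 F_smult2 mult.assoc mult.left_commute)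
  moreover have "0 \<le> Re (\<Sum>p\<leftarrow>map ?g xs. \<Sum>q\<leftarrow>map ?g xs. F (adj fock (fst q) \<otimes>\<^bsub>op_alg fock\<^esub> fst p) (snd p) (snd q))"
    by (rule F_cp) auto
  ultimately show "0 \<le> Re (kform kD xs xs)" by simp
qed

end

locale defect_space = cuntz_form b H F T FK G + D: realization D \<delta> "cuntz_form.kD H F"
  for b :: "'n::finite list \<Rightarrow> real" and H :: "'h hilbert" and F T FK G and D :: "'d hilbert" and \<delta> :: "'h \<Rightarrow> 'd"
begin

lemma \<delta>_ip: "\<lbrakk>h \<in> carrier H; k \<in> carrier H\<rbrakk> \<Longrightarrow> cinner D (\<delta> h) (\<delta> k) = F P0 h k"
  by (simp add: D.gram kD_eq)

lemma \<delta>_inH: "\<delta> (inH h) = \<delta> h"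
  by (rule D.total_eqI) (simp_all add: D.gram kD_def, simp add: inH_def)

lemma \<delta>_add: "\<lbrakk>h \<in> carrier H; k \<in> carrier H\<rbrakk> \<Longrightarrow> \<delta> (h \<oplus>\<^bsub>H\<^esub> k) = \<delta> h \<oplus>\<^bsub>D\<^esub> \<delta> k"
  by (rule D.total_eqI) (simp_all add: D.gram D.K.cinner_add_left kD_def F_add1 inH_def[of h] inH_def[of k] inH_def[of "h \<oplus>\<^bsub>H\<^esub> k"])

lemma \<delta>_smult: "h \<in> carrier H \<Longrightarrow> \<delta> (c \<odot>\<^bsub>H\<^esub> h) = c \<odot>\<^bsub>D\<^esub> \<delta> h"
  by (rule D.total_eqI) (simp_all add: D.gram D.K.cinner_smult_left kD_def F_smult1 inH_def[of h] inH_def[of "c \<odot>\<^bsub>H\<^esub> h"])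

lemma \<delta>_norm: "h \<in> carrier H \<Longrightarrow> hnorm D (\<delta> h) \<le> 1 * hnorm H h"
proof (rule power2_le_imp_le)
  assume h: "h \<in> carrier H"
  have "Re (F P0 h h) \<le> 1 * hnorm H h * hnorm H h"
    using F_bd[OF dg_in dg_props(2) h h, of "{[]}"] complex_Re_le_cmod order_trans by blast
  moreover have "(hnorm D (\<delta> h))\<^sup>2 = Re (F P0 h h)"
    using h by (simp add: D.K.hnorm_sq \<delta>_ip)
  ultimately show "(hnorm D (\<delta> h))\<^sup>2 \<le> (1 * hnorm H h)\<^sup>2"
    by (simp add: power2_eq_square)
qed simp

text \<open>A single map from H spans the defect space, so the family of spanning maps is
  constant.\<close>

lemma spanned_D: "spanned_by D H (\<lambda>_. \<delta>) (\<lambda>_. 1)"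
  by unfold_locales (simp_all add: \<delta>_add \<delta>_smult \<delta>_norm[simplified])

lemma realizes_kD: "\<exists>(D' :: (nat \<Rightarrow> 'h) hilbert) \<delta>'. realizes D' \<delta>' kD"
proof (rule D.realizes_functions[OF spanned_D])
  show "spanned_by.approximable D H (\<lambda>_. \<delta>) (\<delta> h)" for h
    using spanned_by.approximable_u[OF spanned_D, of "inH h"] by (simp add: \<delta>_inH)
qed

end

locale cuntz_dilation = defect_space b H F T FK G D \<delta> + Q: cstar_realization fock H "cstar_W b" FK K v "W b"
  for b :: "'n::finite list \<Rightarrow> real" and H :: "'h hilbert" and F T FK G and D :: "'d hilbert" and \<delta>
    and K :: "'k hilbert" and v
begin

text \<open>Coinvariance of \<open>FK\<close> read in the Stinespring space: the image of H under h
  \<mapsto> I \<otimes> h is invariant under the adjoints of the represented generators.\<close>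

lemma v_co: "h \<in> carrier H \<Longrightarrow> v (Bki i, h) = v (\<lambda>f\<in>carrier fock. f, adj H (T i) h)"
proof (rule Q.R.total_eqI)
  assume h: "h \<in> carrier H"
  have Th: "adj H (T i) h \<in> carrier H" using T h by simp
  fix t
  show "cinner K (v (Bki i, h)) (v t) = cinner K (v (\<lambda>f\<in>carrier fock. f, adj H (T i) h)) (v t)"
  proof (cases "t \<in> cstar_W b \<times> carrier H")
    case True
    then obtain C k where t: "t = (C, k)" and C: "C \<in> cstar_W b" and k: "k \<in> carrier H" by (metis SigmaE)
    have "FK (adj fock C \<cdot> Bki i) h k = FK (adj fock C \<cdot> (\<lambda>f\<in>carrier fock. f)) (adj H (T i) h) k"
      using FK_co[OF FK.A_adj[OF C] h k] FK.mult_one(1)[OF FK.A_adj[OF C]] by simp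
    then show ?thesis unfolding t Q.R.gram FK.kF_eq[OF Bki_cstar C h k] FK.kF_eq[OF one_cstar C Th k] .
  next
    case False
    then show ?thesis by (simp add: Q.v_zero)
  qed
qed auto

lemma v_P0: "\<lbrakk>C \<in> cstar_W b; h \<in> carrier H\<rbrakk> \<Longrightarrow> v (P0 \<cdot> C, h) = \<zero>\<^bsub>K\<^esub>"
proof (rule Q.R.total_eqI)
  assume C: "C \<in> cstar_W b" and h: "h \<in> carrier H"
  fix t
  show "cinner K (v (P0 \<cdot> C, h)) (v t) = cinner K \<zero>\<^bsub>K\<^esub> (v t)"
  proof (cases "t \<in> cstar_W b \<times> carrier H")
    case True
    then obtain A k where t: "t = (A, k)" and A: "A \<in> cstar_W b" and k: "k \<in> carrier H" by (metis SigmaE)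
    show ?thesis unfolding t using FK_P0[OF FK.A_adj[OF A] C h k] FK.kF_eq[OF FK.A_mult[OF P0_cstar C] A h k]
      by (simp add: Q.R.gram)
  next
    case False
    then show ?thesis by (simp add: Q.v_zero)
  qed
qed auto

lemma rep_P0: "x \<in> carrier K \<Longrightarrow> Q.rep P0 x = \<zero>\<^bsub>K\<^esub>"
proof (rule Q.R.total_eqI)
  assume x: "x \<in> carrier K"
  show "Q.rep P0 x \<in> carrier K" by (rule bounded_ops_in[OF Q.rep_in[OF P0_cstar] x])
  fix t
  show "cinner K (Q.rep P0 x) (v t) = cinner K \<zero>\<^bsub>K\<^esub> (v t)"
  proof (cases "t \<in> cstar_W b \<times> carrier H")
    case True
    then obtain A k where t: "t = (A, k)" and A: "A \<in> cstar_W b" and k: "k \<in> carrier H" by (metis SigmaE)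
    show ?thesis unfolding t Q.rep_ip[OF P0_cstar A k x] dg_adj v_P0[OF A k] using x by simp
  next
    case False
    then show ?thesis using bounded_ops_in[OF Q.rep_in[OF P0_cstar] x] by (simp add: Q.v_zero)
  qed
qed auto

text \<open>The representation carries the defect sums of W to those of the represented tuple. They
  converge in norm to \<open>P0\<close>, which is represented by 0, so contractivity makes them
  vanish.\<close>

lemma cuntz: "cuntz_type b K Q.rep"
  unfolding cuntz_type_def wot_tendsto_def
proof (intro conjI ballI)
  show "star_representation fock (cstar_W b) K Q.rep" by (rule Q.star_rep)
  show "\<zero>\<^bsub>op_alg K\<^esub> \<in> bounded_ops K K" by simp
  fix x y assume x: "x \<in> carrier K" and y: "y \<in> carrier K"
  note one = FK.A_one
  note ws = rep_word_sum[OF hilbert_fock Q.R.K.hilbert_space_axioms FK.alg Q.star_rep W_in_cstar one_cstar, of a]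
  have DN: "Delta_sum b fock (W b) N \<in> cstar_W b" for N
    unfolding Delta_sum_def op_alg_simps by (rule ws(1))
  have rN: "Delta_sum b K (\<lambda>i. Q.rep (W b i)) N = Q.rep (Delta_sum b fock (W b) N)" for N
    unfolding Delta_sum_def op_alg_simps ws(2) Q.rep_alg(1) ..
  have lim: "(\<lambda>N. op_norm fock (Delta_sum b fock (W b) N \<ominus>\<^bsub>op_alg fock\<^esub> P0)) \<longlonglongrightarrow> 0"
    using Delta_lim by (simp add: norm_tendsto_def)
  have "(\<lambda>N. cinner K (Delta_sum b K (\<lambda>i. Q.rep (W b i)) N x) y) \<longlonglongrightarrow> 0"
  proof (rule Lim_null_comparison)
    show "(\<lambda>N. op_norm fock (Delta_sum b fock (W b) N \<ominus>\<^bsub>op_alg fock\<^esub> P0) * (hnorm K x * hnorm K y)) \<longlonglongrightarrow> 0"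
      using tendsto_mult_left_zero[OF lim] .
    show "\<forall>\<^sub>F N in sequentially. norm (cinner K (Delta_sum b K (\<lambda>i. Q.rep (W b i)) N x) y) \<le>
       op_norm fock (Delta_sum b fock (W b) N \<ominus>\<^bsub>op_alg fock\<^esub> P0) * (hnorm K x * hnorm K y)"
    proof (intro always_eventually allI)
      fix N
      let ?z = "Q.rep (Delta_sum b fock (W b) N) x"
      have z: "?z \<in> carrier K" by (rule bounded_ops_in[OF Q.rep_in[OF DN] x])
      have "?z \<ominus>\<^bsub>K\<^esub> Q.rep P0 x = ?z"
        unfolding rep_P0[OF x] by (rule Q.R.K.vec_eqI) (use z in \<open>simp_all add: Q.R.K.ip_diff_left\<close>)
      then have "hnorm K ?z \<le> op_norm fock (Delta_sum b fock (W b) N \<ominus>\<^bsub>op_alg fock\<^esub> P0) * hnorm K x"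
        using Q.rep_diff_bound(1)[OF DN[of N] P0_cstar x] by simp
      then have "hnorm K ?z * hnorm K y \<le> op_norm fock (Delta_sum b fock (W b) N \<ominus>\<^bsub>op_alg fock\<^esub> P0) * hnorm K x * hnorm K y"
        using y by (intro mult_right_mono) auto
      then show "norm (cinner K (Delta_sum b K (\<lambda>i. Q.rep (W b i)) N x) y) \<le>
         op_norm fock (Delta_sum b fock (W b) N \<ominus>\<^bsub>op_alg fock\<^esub> P0) * (hnorm K x * hnorm K y)"
        using Q.R.K.Cauchy_Schwarz[OF z y] unfolding rN by (simp add: mult.assoc)
    qed
  qed
  then show "(\<lambda>N. cinner K (Delta_sum b K (\<lambda>i. Q.rep (W b i)) N x) y) \<longlonglongrightarrow> cinner K (\<zero>\<^bsub>op_alg K\<^esub> x) y"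
    using x y by simp
qed

text \<open>The Poisson kernel of T in coordinates, with the defect map \<delta> in place of the
  square root of the defect. By \<open>F_dg\<close> the squared norm of the coordinate at \<alpha>
  is the real part of \<open>F (dg {\<alpha>}) h h\<close>.\<close>

definition ff :: "'h \<Rightarrow> 'n list \<Rightarrow> 'd" where
  "ff h = (\<lambda>\<alpha>. complex_of_real (sqrt (b \<alpha>)) \<odot>\<^bsub>D\<^esub> \<delta> (wadj H T \<alpha> h))"

definition V :: "'h \<Rightarrow> ('n list \<Rightarrow> 'd) \<times> 'k" where
  "V = (\<lambda>h\<in>carrier H. (ff h, v (\<lambda>f\<in>carrier fock. f, h)))"

lemma Tw [simp]: "h \<in> carrier H \<Longrightarrow> wadj H T \<alpha> h \<in> carrier H"
  by (rule H.wadj_in[OF T])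

lemma ff_norm_sq: "h \<in> carrier H \<Longrightarrow> (hnorm D (ff h \<alpha>))\<^sup>2 = Re (of_real (b \<alpha>) * F P0 (wadj H T \<alpha> h) (wadj H T \<alpha> h))"
  by (simp add: ff_def D.K.hnorm_smult power_mult_distrib D.K.hnorm_sq \<delta>_ip)

lemma ff_partial: "h \<in> carrier H \<Longrightarrow> (\<Sum>\<alpha> | length \<alpha> \<le> N. (hnorm D (ff h \<alpha>))\<^sup>2) = (hnorm H h)\<^sup>2 - Re (F (Qc N) h h)"
  using arg_cong[OF F_words[of h h N], of Re] by (simp add: ff_norm_sq H.hnorm_sq)

lemma ff_summable: "h \<in> carrier H \<Longrightarrow> (\<lambda>\<alpha>. (hnorm D (ff h \<alpha>))\<^sup>2) summable_on UNIV"
proof (rule nonneg_bdd_above_summable_on)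
  assume h: "h \<in> carrier H"
  have "sum (\<lambda>\<alpha>. (hnorm D (ff h \<alpha>))\<^sup>2) Z \<le> (hnorm H h)\<^sup>2" if "finite Z" for Z
  proof -
    define N where "N = Max (length ` Z)"
    have "Z \<subseteq> {\<alpha>. length \<alpha> \<le> N}" using that by (auto simp: N_def)
    then have "sum (\<lambda>\<alpha>. (hnorm D (ff h \<alpha>))\<^sup>2) Z \<le> (\<Sum>\<alpha> | length \<alpha> \<le> N. (hnorm D (ff h \<alpha>))\<^sup>2)"
      by (intro sum_mono2) auto
    also have "\<dots> \<le> (hnorm H h)\<^sup>2"
      using F_nonneg[OF dg_in h, of "{\<alpha>. N < length \<alpha>}"] by (simp add: ff_partial[OF h] dg_compose)
    finally show ?thesis .
  qed
  then show "bdd_above (sum (\<lambda>\<alpha>. (hnorm D (ff h \<alpha>))\<^sup>2) ` {Z. Z \<subseteq> UNIV \<and> finite Z})" by (auto simp: bdd_above_def)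
qed simp

lemma ff_in: "h \<in> carrier H \<Longrightarrow> ff h \<in> carrier (l2_sum D)"
  unfolding l2_sum_carrier using ff_summable by (simp add: ff_def)

text \<open>The mass missing from the first N layers is the value of F at \<open>Qc N\<close>. Along
  G it tends to the value of \<open>FK\<close> at the identity, the squared norm of the component in
  K, while the partial sums converge outright; comparing both limits along G gives the
  identity.\<close>

lemma ff_hnorm: "h \<in> carrier H \<Longrightarrow> (hnorm (l2_sum D) (ff h))\<^sup>2 + (hnorm K (v (\<lambda>f\<in>carrier fock. f, h)))\<^sup>2 = (hnorm H h)\<^sup>2"
proof -
  assume h: "h \<in> carrier H"
  let ?s = "\<Sum>\<^sub>\<infinity>\<alpha>. (hnorm D (ff h \<alpha>))\<^sup>2"
  have 1: "(hnorm (l2_sum D) (ff h))\<^sup>2 = ?s"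
    unfolding D.K.hnorm_l2[OF ff_in[OF h]] by (simp add: infsum_nonneg)
  have 2: "(hnorm K (v (\<lambda>f\<in>carrier fock. f, h)))\<^sup>2 = Re (FK (\<lambda>f\<in>carrier fock. f) h h)"
    unfolding Q.R.K.hnorm_sq[OF Q.R.v_in] Q.R.gram FK.kF_eq[OF one_cstar one_cstar h h] B.adj_one
      FK.mult_one(1)[OF one_cstar] ..
  have "(\<lambda>N. (hnorm H h)\<^sup>2 - Re (F (Qc N) h h)) \<longlonglongrightarrow> ?s"
    using has_sum_words[OF has_sum_infsum[OF ff_summable[OF h]]] unfolding ff_partial[OF h] .
  then have l1: "((\<lambda>N. (hnorm H h)\<^sup>2 - Re (F (Qc N) h h)) \<longlongrightarrow> ?s) G" by (rule tendsto_mono[OF G_le])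
  have "((\<lambda>N. F (Qc N) h h) \<longlongrightarrow> FK (\<lambda>f\<in>carrier fock. f) h h) G" using FK_lim[OF one_cstar h h] by simp
  then have l2: "((\<lambda>N. (hnorm H h)\<^sup>2 - Re (F (Qc N) h h)) \<longlongrightarrow> (hnorm H h)\<^sup>2 - Re (FK (\<lambda>f\<in>carrier fock. f) h h)) G"
    by (intro tendsto_intros)
  show ?thesis using tendsto_unique[OF G_bot l1 l2] 1 2 by simp
qed

lemma V_isometry: "V \<in> isometries H (hdsum (fock_tensor D) K)"
proof -
  have L: "hilbert_space (l2_sum D :: ('n list \<Rightarrow> 'd) hilbert)" by (rule D.K.hilbert_l2_sum)
  have norm: "hnorm (hdsum (l2_sum D) K) (V h) = hnorm H h" if h: "h \<in> carrier H" for h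
    using hnorm_hdsum[OF L Q.R.K.hilbert_space_axioms ff_in[OF h] Q.R.v_in[of "(\<lambda>f\<in>carrier fock. f, h)"]] ff_hnorm[OF h] h
    by (simp add: V_def)
  have "V \<in> bounded_ops H (hdsum (l2_sum D) K)"
  proof (rule bounded_opsI[where M = 1])
    show "V \<in> carrier H \<rightarrow>\<^sub>E carrier (hdsum (l2_sum D) K)"
      unfolding V_def by (auto simp: ff_in simp del: restrict_apply)
    fix h assume h: "h \<in> carrier H"
    show "hnorm (hdsum (l2_sum D) K) (V h) \<le> 1 * hnorm H h" by (simp add: norm[OF h])
    fix k assume k: "k \<in> carrier H"
    have "ff (h \<oplus>\<^bsub>H\<^esub> k) = (\<lambda>\<alpha>. ff h \<alpha> \<oplus>\<^bsub>D\<^esub> ff k \<alpha>)"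
      unfolding ff_def using h k T by (auto simp: H.wadj_add \<delta>_add D.K.smult_r_distr)
    then show "V (h \<oplus>\<^bsub>H\<^esub> k) = V h \<oplus>\<^bsub>hdsum (l2_sum D) K\<^esub> V k"
      using h k Q.v_add1[OF one_cstar h k] by (simp add: V_def)
  next
    fix c h assume h: "h \<in> carrier H"
    have "ff (c \<odot>\<^bsub>H\<^esub> h) = (\<lambda>\<alpha>. c \<odot>\<^bsub>D\<^esub> ff h \<alpha>)"
    proof
      fix \<alpha>
      show "ff (c \<odot>\<^bsub>H\<^esub> h) \<alpha> = c \<odot>\<^bsub>D\<^esub> ff h \<alpha>"
        unfolding ff_def
        by (rule D.K.vec_eqI) (use h T in \<open>simp_all add: H.wadj_smult \<delta>_smult D.K.cinner_smult_left\<close>)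
    qed
    then show "V (c \<odot>\<^bsub>H\<^esub> h) = c \<odot>\<^bsub>hdsum (l2_sum D) K\<^esub> V h"
      using h Q.v_smult1[OF one_cstar h] by (simp add: V_def)
  qed
  then show ?thesis using norm by (simp add: isometries_def fock_tensor_def)
qed

text \<open>On the Fock side the weight of the backward shift turns the coefficient of i # \<alpha>
  into that of \<alpha>; on the side of K this is \<open>v_co\<close>.\<close>

lemma V_intertwines: "h \<in> carrier H \<Longrightarrow> V (adj H (T i) h) = model_op b D K Q.rep i (V h)"
proof -
  assume h: "h \<in> carrier H"
  have Th: "adj H (T i) h \<in> carrier H" using T h by simp
  have f: "Bk b D i (ff h) = ff (adj H (T i) h)"
  proof
    fix \<alpha>
    have "cinner D (ff (adj H (T i) h) \<alpha>) z = cinner D (bshift b D [i] (ff h) \<alpha>) z" if "z \<in> carrier D" for z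
    proof -
      have "complex_of_real (sqrt (b \<alpha>)) = of_real (sqrt (b \<alpha> / b (i # \<alpha>))) * of_real (sqrt (b (i # \<alpha>)))"
        unfolding of_real_mult[symmetric] real_sqrt_mult[symmetric] by simp
      then show ?thesis using that Th h by (simp add: ff_def bshift_def D.K.cinner_smult_left)
    qed
    then have "ff (adj H (T i) h) \<alpha> = bshift b D [i] (ff h) \<alpha>"
      by (intro D.K.vec_eqI) (simp_all add: ff_def bshift_def)
    then show "Bk b D i (ff h) \<alpha> = ff (adj H (T i) h) \<alpha>" using ff_in[OF h] by (simp add: Bk_def)
  qed
  have "adj K (Q.rep (W b i)) (v (\<lambda>f\<in>carrier fock. f, h)) = v (Bki i, h)"
    using Q.rep_alg(5)[OF W_in_cstar[of i]] Q.rep_v[OF Bki_cstar one_cstar h, of i] FK.mult_one(1)[OF Bki_cstar[of i]]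
    by (simp add: W_props(2))
  then show ?thesis
    using h Th ff_in[OF h] f v_co[OF h]
    by (simp add: V_def model_op_def op_dsum_def fock_tensor_def ampliation_adj_W[OF D.K.hilbert_space_axioms])
qed

end

text \<open>Each of D and K is built twice: first as a completion over a large type, where
  approximability by sequences in H is established, then as its copy with carrier in nat
  \<Rightarrow> 'h.\<close>

lemma (in admissible_series) cuntz_dilation_exists:
  fixes H :: "'h hilbert" and T :: "'n \<Rightarrow> 'h \<Rightarrow> 'h"
  assumes rp: "radially_pure TYPE('h) b" and lim: "norm_tendsto fock (Delta_sum b fock (W b)) L"
    and H: "hilbert_space H" and T: "T \<in> nc_domain b H"
  shows "\<exists>F FK G (D :: (nat \<Rightarrow> 'h) hilbert) \<delta> (K :: (nat \<Rightarrow> 'h) hilbert) v. cuntz_dilation b H F T FK G D \<delta> K v"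
proof -
  obtain F where F: "dilation_form b H T F" using dilation_form_exists[OF rp H T] by blast
  have Tops: "T i \<in> bounded_ops H H" for i using T by (auto simp: nc_domain_def domain_data_def)
  note F' = F[unfolded dilation_form_def]
  interpret dilation b H F T
  proof (intro dilation.intro dilation_axioms.intro)
    show "admissible_series b" by (rule admissible_series_axioms)
    show "cp_form fock H (bounded_ops fock fock) F" by (rule F'[THEN conjunct1])
  qed (rule Tops F'[THEN conjunct2, THEN conjunct1, rule_format]
      F'[THEN conjunct2, THEN conjunct2, THEN conjunct1, rule_format]
      F'[THEN conjunct2, THEN conjunct2, THEN conjunct2, rule_format]; assumption)+
  obtain FK G where G: "G \<le> sequentially" "G \<noteq> bot" "cp_form fock H (cstar_W b) FK"
    "\<forall>C\<in>cstar_W b. \<forall>h\<in>carrier H. \<forall>k\<in>carrier H. ((\<lambda>N. F (Qc N \<cdot> C) h k) \<longlongrightarrow> FK C h k) G"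
    "\<forall>C\<in>cstar_W b. \<forall>M. \<forall>h\<in>carrier H. \<forall>k\<in>carrier H. bounded_by fock C M \<longrightarrow>
      cmod (FK C h k) \<le> M * hnorm H h * hnorm H k"
    using cuntz_form_exists by (elim exE conjE) (rule that, assumption+)
  have lim': "norm_tendsto fock (Delta_sum b fock (W b)) P0" using lim dg_Nil_limit(1)[OF lim] by simp
  interpret C: cuntz_form b H F T FK G
    by (intro cuntz_form.intro cuntz_form_axioms.intro dilation_axioms G(1,2,3) lim')
      (rule G(4,5)[rule_format]; assumption)+
  obtain D0 \<delta>0 where "realizes (D0 :: ((complex \<times> 'h) list \<Rightarrow> complex) hilbert) \<delta>0 C.kD"
    using kernel_realization[OF C.psd_kD] by blast
  then interpret D0: defect_space b H F T FK G D0 \<delta>0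
    by (intro defect_space.intro realization.intro C.cuntz_form_axioms)
  obtain D \<delta> where D: "realizes (D :: (nat \<Rightarrow> 'h) hilbert) \<delta> C.kD" using D0.realizes_kD by blast
  \<comment> \<open>Stated for an arbitrary carrier type, because it is used for the completion
    \<open>K0\<close> and again for its small copy \<open>K\<close>.\<close>
  have cr: "cstar_realization fock H (cstar_W b) FK K v (W b)"
    if "realizes K v C.FK.kF" for K :: "'k hilbert" and v
    by (intro cstar_realization.intro cp_realization.intro realization.intro cstar_realization_axioms.intro
        G(3) unital_cstar_W W_in_cstar that) (rule cstar_W_least C.FK_bd; assumption)+
  obtain K0 v0 where K0: "realizes (K0 :: ((complex \<times> ((('n list \<Rightarrow> complex) \<Rightarrow> 'n list \<Rightarrow> complex) \<times> 'h)) list \<Rightarrow> complex) hilbert) v0 C.FK.kF"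
    using kernel_realization[OF C.FK.psd_kF] by blast
  obtain K v where K: "realizes (K :: (nat \<Rightarrow> 'h) hilbert) v C.FK.kF"
    using cstar_realization.realizes_kF[OF cr[OF K0]] by blast
  have "cuntz_dilation b H F T FK G D \<delta> K v"
    by (intro cuntz_dilation.intro cr[OF K] defect_space.intro realization.intro D C.cuntz_form_axioms)
  then show ?thesis by blast
qed

theorem corollary4p4:
  fixes b :: "'n::finite list \<Rightarrow> real"
    and H :: "'h hilbert"
    and T :: "'n \<Rightarrow> 'h \<Rightarrow> 'h"
  assumes "admissible b"
    and "radially_pure TYPE('h) b"
    and "\<exists>L. norm_tendsto fock (Delta_sum b fock (W b)) L"
    and "hilbert_space H"
    and "\<forall>i. T i \<in> bounded_ops H H"
  shows "T \<in> nc_domain b H \<longleftrightarrow>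
    (\<exists>(D :: (nat \<Rightarrow> 'h) hilbert) (K :: (nat \<Rightarrow> 'h) hilbert) \<pi> V.
       hilbert_space D \<and> hilbert_space K \<and>
       (separable_hilbert H \<longrightarrow> separable_hilbert K) \<and>
       cuntz_type b K \<pi> \<and>
       V \<in> isometries H (hdsum (fock_tensor D) K) \<and>
       (\<forall>i. model_op b D K \<pi> i ` (V ` carrier H) \<subseteq> V ` carrier H \<and>
            (\<forall>h\<in>carrier H. V (adj H (T i) h) = model_op b D K \<pi> i (V h))))"
  (is "_ \<longleftrightarrow> ?R")
proof
  interpret admissible_series b by (rule admissible_series.intro) fact
  have T: "T i \<in> bounded_ops H H" for i using assms(5) by (rule spec)
  {
    assume "?R"
    then obtain D K :: "(nat \<Rightarrow> 'h) hilbert" and \<pi> V where *: "hilbert_space D" "hilbert_space K" "cuntz_type b K \<pi>"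
      "V \<in> isometries H (hdsum (fock_tensor D) K)"
      "\<forall>i. model_op b D K \<pi> i ` (V ` carrier H) \<subseteq> V ` carrier H \<and>
            (\<forall>h\<in>carrier H. V (adj H (T i) h) = model_op b D K \<pi> i (V h))"
      by (elim exE conjE) (rule that, assumption+)
    show "T \<in> nc_domain b H"
      by (rule domain_if_dilation[OF assms(4) *(1,2) T *(3,4)]) (rule *(5)[THEN spec, THEN conjunct2, rule_format])
  }
  assume "T \<in> nc_domain b H"
  then have "\<exists>F FK G (D :: (nat \<Rightarrow> 'h) hilbert) \<delta> (K :: (nat \<Rightarrow> 'h) hilbert) v. cuntz_dilation b H F T FK G D \<delta> K v"
    using assms(3) by (elim exE) (rule cuntz_dilation_exists[OF assms(2) _ assms(4)])
  then obtain F FK G and D :: "(nat \<Rightarrow> 'h) hilbert" and \<delta> and K :: "(nat \<Rightarrow> 'h) hilbert" and v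
    where cd: "cuntz_dilation b H F T FK G D \<delta> K v"
    by (elim exE) (rule that)
  interpret C: cuntz_dilation b H F T FK G D \<delta> K v by (rule cd)
  \<comment> \<open>Invariance of the embedded space is intertwining: the image of V h is V of a
    vector of H.\<close>
  have "model_op b D K C.Q.rep i ` (C.V ` carrier H) \<subseteq> C.V ` carrier H" for i
    unfolding image_image
  proof (rule image_subsetI)
    fix h assume h: "h \<in> carrier H"
    show "model_op b D K C.Q.rep i (C.V h) \<in> C.V ` carrier H"
      unfolding C.V_intertwines[OF h, symmetric] by (intro imageI C.H.adj_app_in[OF T h])
  qed
  then show ?R
    by (intro exI[of _ D] exI[of _ K] exI[of _ C.Q.rep] exI[of _ C.V] conjI allI ballI impI
        C.D.K.hilbert_space_axioms C.Q.R.K.hilbert_space_axioms C.Q.separable C.cuntz C.V_isometry C.V_intertwines)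
qed

end
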